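(* Let $\Phi$ be a root system of type $\mathsf{E}_\ell$, $\ell=6,7,8$, and let $R$ be a commutative ring with $1$. An element $\alpha\in\mathrm{St}(\Phi,R[t],tR[t])$ is trivial if and only if its image in $\mathrm{St}(\Phi,R_M[t])$ is trivial for every maximal ideal $M\trianglelefteq R$.
   Context: All rings are commutative with $1$; $[x,y]=xyx^{-1}y^{-1}$. For simply laced $\Phi$ of rank $\ge 2$, fix a Chevalley base $\{e_\alpha\}$ of the simple complex Lie algebra of type $\Phi$ and let $N_{\alpha,\beta}=\pm1$ be its structure constants, $[e_\alpha,e_\beta]=N_{\alpha,\beta}e_{\alpha+\beta}$ for $\alpha,\beta,\alpha+\beta\in\Phi$. For a ring $A$, the Steinberg group $\mathrm{St}(\Phi,A)$ is the group with generators $x_\alpha(\xi)$ ($\alpha\in\Phi$, $\xi\in A$) and relations $x_\alpha(\xi)x_\alpha(\eta)=x_\alpha(\xi+\eta)$; $[x_\alpha(\xi),x_\beta(\eta)]=1$ if $\alpha+\beta\notin\Phi\cup\{0\}$; $[x_\alpha(\xi),x_\beta(\eta)]=x_{\alpha+\beta}(N_{\alpha,\beta}\xi\eta)$ if $\alpha+\beta\in\Phi$. A ring homomorphism $f\colon A\to B$ induces $f^*\colon\mathrm{St}(\Phi,A)\to\mathrm{St}(\Phi,B)$, $x_\alpha(\xi)\mapsto x_\alpha(f(\xi))$. Relative Steinberg group: for an ideal $I\trianglelefteq A$ let $D(A,I)=\{(a_1,a_2)\in A^2: a_1-a_2\in I\}$ with projections $p_1,p_2\colon D(A,I)\to A$.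 Put $G_i=\operatorname{Ker}(p_i^*\colon\mathrm{St}(\Phi,D(A,I))\to\mathrm{St}(\Phi,A))$, $C=[G_1,G_2]$ (mixed commutator subgroup), and $\mathrm{St}(\Phi,A,I)=G_1/C$. The map $p_2^*$ induces a homomorphism $\overline{p_2^*}\colon\mathrm{St}(\Phi,A,I)\to\mathrm{St}(\Phi,A)$. $R_M$ is the localization of $R$ at the maximal ideal $M$. The image of an element of $\mathrm{St}(\Phi,R[t],tR[t])$ in $\mathrm{St}(\Phi,R_M[t])$ is its image under the composite of $\overline{p_2^*}\colon\mathrm{St}(\Phi,R[t],tR[t])\to\mathrm{St}(\Phi,R[t])$ with the map $\mathrm{St}(\Phi,R[t])\to\mathrm{St}(\Phi,R_M[t])$ induced by localization. *)

theory Defs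
  imports
    "HOL-Analysis.Euclidean_Space"
    "HOL-Algebra.Generated_Groups"
    "HOL-Algebra.UnivPoly"
    "HOL-Algebra.Chinese_Remainder"
begin

section \<open>Root systems of type E\<close>

definition cartan_int :: "'e::euclidean_space \<Rightarrow> 'e \<Rightarrow> real" where
  "cartan_int \<beta> \<alpha> = 2 * inner \<beta> \<alpha> / inner \<alpha> \<alpha>"

definition root_system :: "'e::euclidean_space set \<Rightarrow> bool" where
  "root_system \<Phi> \<longleftrightarrow>
     finite \<Phi> \<and> 0 \<notin> \<Phi> \<and> span \<Phi> = UNIV \<and>
     (\<forall>\<alpha>\<in>\<Phi>. \<forall>c. c *\<^sub>R \<alpha> \<in> \<Phi> \<longrightarrow> c = 1 \<or> c = - 1) \<and>
     (\<forall>\<alpha>\<in>\<Phi>. \<forall>\<beta>\<in>\<Phi>. \<beta> - cartan_int \<beta> \<alpha> *\<^sub>R \<alpha> \<in> \<Phi> \<and> cartan_int \<beta> \<alpha> \<in> \<int>)"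

text \<open>Simple roots are presented as a numbered family \<open>b 1, \<dots>, b l\<close>.\<close>

definition simple_roots :: "'e::euclidean_space set \<Rightarrow> nat \<Rightarrow> (nat \<Rightarrow> 'e) \<Rightarrow> bool" where
  "simple_roots \<Phi> l b \<longleftrightarrow>
     inj_on b {1..l} \<and> b ` {1..l} \<subseteq> \<Phi> \<and>
     independent (b ` {1..l}) \<and> span (b ` {1..l}) = UNIV \<and>
     (\<forall>\<alpha>\<in>\<Phi>. \<exists>c::nat \<Rightarrow> nat.
        \<alpha> = (\<Sum>i=1..l. real (c i) *\<^sub>R b i) \<or> \<alpha> = - (\<Sum>i=1..l. real (c i) *\<^sub>R b i))"

text \<open>Dynkin diagram in Bourbaki's numbering: the chain 1-3-4-5-\<open>\<dots>\<close>-l together with the edge 2-4.\<close>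

definition E_edge :: "nat \<Rightarrow> nat \<Rightarrow> bool" where
  "E_edge i j \<longleftrightarrow> {i, j} \<in> {{1, 3}, {3, 4}, {2, 4}, {4, 5}, {5, 6}, {6, 7}, {7, 8}}"

definition root_system_E :: "nat \<Rightarrow> 'e::euclidean_space set \<Rightarrow> bool" where
  "root_system_E l \<Phi> \<longleftrightarrow>
     root_system \<Phi> \<and>
     (\<exists>b. simple_roots \<Phi> l b \<and>
       (\<forall>i\<in>{1..l}. \<forall>j\<in>{1..l}.
          cartan_int (b i) (b j) = (if i = j then 2 else if E_edge i j then - 1 else 0)))"


section \<open>Chevalley bases of simple complex Lie algebras\<close>

locale complex_lie_algebra = vector_space scale
  for scale :: "complex \<Rightarrow> 'g::ab_group_add \<Rightarrow> 'g" +
  fixes bracket :: "'g \<Rightarrow> 'g \<Rightarrow> 'g"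
  assumes bracket_linear_left: "Vector_Spaces.linear scale scale (\<lambda>x. bracket x y)"
    and bracket_linear_right: "Vector_Spaces.linear scale scale (bracket x)"
    and bracket_self: "bracket x x = 0"
    and jacobi: "bracket x (bracket y z) + bracket y (bracket z x) + bracket z (bracket x y) = 0"
begin

definition lie_subalgebra :: "'g set \<Rightarrow> bool" where
  "lie_subalgebra H \<longleftrightarrow> subspace H \<and> (\<forall>x\<in>H. \<forall>y\<in>H. bracket x y \<in> H)"

definition lie_ideal :: "'g set \<Rightarrow> bool" where
  "lie_ideal J \<longleftrightarrow> subspace J \<and> (\<forall>x. \<forall>y\<in>J. bracket x y \<in> J)"

definition simple_lie_algebra :: bool where
  "simple_lie_algebra \<longleftrightarrow>
     (\<exists>x y. bracket x y \<noteq> 0) \<and> (\<forall>J. lie_ideal J \<longrightarrow> J = {0} \<or> J = UNIV)"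

definition finite_dim :: bool where
  "finite_dim \<longleftrightarrow> (\<exists>B. finite B \<and> span B = UNIV)"

fun lower_central :: "'g set \<Rightarrow> nat \<Rightarrow> 'g set" where
  "lower_central H 0 = H"
| "lower_central H (Suc n) = span {bracket x y | x y. x \<in> H \<and> y \<in> lower_central H n}"

definition cartan_subalgebra :: "'g set \<Rightarrow> bool" where
  "cartan_subalgebra H \<longleftrightarrow>
     lie_subalgebra H \<and>
     (\<exists>n. lower_central H n = {0}) \<and>
     {x. \<forall>h\<in>H. bracket x h \<in> H} = H"

definition root_space :: "'g set \<Rightarrow> ('g \<Rightarrow> complex) \<Rightarrow> 'g set" where
  "root_space H \<mu> = {x. \<forall>h\<in>H. bracket h x = scale (\<mu> h) x}"

text \<open>A functional on \<open>H\<close> is a HOL function whose values outside \<open>H\<close> are irrelevant.\<close>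

definition is_root :: "'g set \<Rightarrow> ('g \<Rightarrow> complex) \<Rightarrow> bool" where
  "is_root H \<mu> \<longleftrightarrow>
     (\<forall>x\<in>H. \<forall>y\<in>H. \<mu> (x + y) = \<mu> x + \<mu> y) \<and>
     (\<forall>c. \<forall>x\<in>H. \<mu> (scale c x) = c * \<mu> x) \<and>
     (\<exists>h\<in>H. \<mu> h \<noteq> 0) \<and>
     root_space H \<mu> \<noteq> {0}"

end

text \<open>
  The map \<open>\<psi>\<close> identifies \<open>\<Phi>\<close> with the root system of \<open>(L, H)\<close>: it is the restriction of a real
  linear isomorphism onto the real span of the roots in the dual of \<open>H\<close>. As the roots span that
  dual, the assumptions on \<open>[e \<alpha>, e (-\<alpha>)]\<close> say that it is the coroot of \<open>\<alpha>\<close>.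
  By Chevalley's theorem the structure constants of a Chevalley base are integers, equal to 1 or -1
  in the simply laced case; \<open>structure_constant_unit\<close> records this.
\<close>

locale chevalley_base = complex_lie_algebra scale bracket
  for scale :: "complex \<Rightarrow> 'g::ab_group_add \<Rightarrow> 'g" and bracket +
  fixes \<Phi> :: "'e::euclidean_space set"
    and H :: "'g set"
    and \<psi> :: "'e \<Rightarrow> 'g \<Rightarrow> complex"
    and e :: "'e \<Rightarrow> 'g"
    and N :: "'e \<Rightarrow> 'e \<Rightarrow> int"
  assumes simple: "simple_lie_algebra"
    and finite_dimensional: "finite_dim"
    and cartan: "cartan_subalgebra H"
    and psi_linear: "h \<in> H \<Longrightarrow> Real_Vector_Spaces.linear (\<lambda>v. \<psi> v h)"
    and psi_injective: "(\<forall>h\<in>H. \<psi> v h = 0) \<Longrightarrow> v = 0"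
    and psi_root: "\<alpha> \<in> \<Phi> \<Longrightarrow> is_root H (\<psi> \<alpha>)"
    and psi_onto_roots: "is_root H \<mu> \<Longrightarrow> \<exists>\<alpha>\<in>\<Phi>. \<forall>h\<in>H. \<mu> h = \<psi> \<alpha> h"
    and root_vector: "\<alpha> \<in> \<Phi> \<Longrightarrow> e \<alpha> \<in> root_space H (\<psi> \<alpha>)"
    and coroot_in_cartan: "\<alpha> \<in> \<Phi> \<Longrightarrow> bracket (e \<alpha>) (e (- \<alpha>)) \<in> H"
    and coroot: "\<lbrakk>\<alpha> \<in> \<Phi>; \<beta> \<in> \<Phi>\<rbrakk> \<Longrightarrow>
      \<psi> \<beta> (bracket (e \<alpha>) (e (- \<alpha>))) = of_real (cartan_int \<beta> \<alpha>)"
    and structure_constant: "\<lbrakk>\<alpha> \<in> \<Phi>; \<beta> \<in> \<Phi>; \<alpha> + \<beta> \<in> \<Phi>\<rbrakk> \<Longrightarrow>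
      bracket (e \<alpha>) (e \<beta>) = scale (of_int (N \<alpha> \<beta>)) (e (\<alpha> + \<beta>))"
    and structure_constant_uminus: "\<lbrakk>\<alpha> \<in> \<Phi>; \<beta> \<in> \<Phi>; \<alpha> + \<beta> \<in> \<Phi>\<rbrakk> \<Longrightarrow>
      N (- \<alpha>) (- \<beta>) = - N \<alpha> \<beta>"
    and structure_constant_unit: "\<lbrakk>\<alpha> \<in> \<Phi>; \<beta> \<in> \<Phi>; \<alpha> + \<beta> \<in> \<Phi>\<rbrakk> \<Longrightarrow>
      N \<alpha> \<beta> \<in> {1, - 1}"


section \<open>Groups given by generators and relations\<close>

text \<open>The letter \<open>(x, True)\<close> is the generator \<open>x\<close>, and \<open>(x, False)\<close> is its formal inverse.\<close>

type_synonym 'x gword = "('x \<times> bool) list"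

definition gwords :: "'x set \<Rightarrow> 'x gword set" where
  "gwords X = lists (X \<times> UNIV)"

definition gword_inv :: "'x gword \<Rightarrow> 'x gword" where
  "gword_inv w = rev (map (apsnd Not) w)"

definition gword_comm :: "'x gword \<Rightarrow> 'x gword \<Rightarrow> 'x gword" where
  "gword_comm u v = u @ v @ gword_inv u @ gword_inv v"

inductive_set gword_rel :: "'x set \<Rightarrow> ('x gword \<times> 'x gword) set \<Rightarrow> ('x gword \<times> 'x gword) set"
  for X :: "'x set" and Rel :: "('x gword \<times> 'x gword) set" where
  refl: "w \<in> gwords X \<Longrightarrow> (w, w) \<in> gword_rel X Rel"
| sym: "(u, v) \<in> gword_rel X Rel \<Longrightarrow> (v, u) \<in> gword_rel X Rel"
| trans: "\<lbrakk>(u, v) \<in> gword_rel X Rel; (v, w) \<in> gword_rel X Rel\<rbrakk> \<Longrightarrow> (u, w) \<in> gword_rel X Rel"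
| cancel: "\<lbrakk>x \<in> X; u \<in> gwords X; v \<in> gwords X\<rbrakk> \<Longrightarrow>
    (u @ [(x, b), (x, \<not> b)] @ v, u @ v) \<in> gword_rel X Rel"
| relation: "\<lbrakk>(r, s) \<in> Rel; r \<in> gwords X; s \<in> gwords X; u \<in> gwords X; v \<in> gwords X\<rbrakk> \<Longrightarrow>
    (u @ r @ v, u @ s @ v) \<in> gword_rel X Rel"

definition presented_group :: "'x set \<Rightarrow> ('x gword \<times> 'x gword) set \<Rightarrow> 'x gword set monoid" where
  "presented_group X Rel =
     \<lparr> carrier = gwords X // gword_rel X Rel,
       mult = (\<lambda>U V. \<Union>u\<in>U. \<Union>v\<in>V. gword_rel X Rel `` {u @ v}),
       one = gword_rel X Rel `` {[]} \<rparr>"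


section \<open>Steinberg groups\<close>

definition steinberg_gens :: "'e set \<Rightarrow> ('a, 'm) ring_scheme \<Rightarrow> ('e \<times> 'a) set" where
  "steinberg_gens \<Phi> A = \<Phi> \<times> carrier A"

abbreviation root_elt :: "'e \<Rightarrow> 'a \<Rightarrow> ('e \<times> 'a) gword" where
  "root_elt \<alpha> \<xi> \<equiv> [((\<alpha>, \<xi>), True)]"

definition steinberg_rels ::
  "'e::euclidean_space set \<Rightarrow> ('e \<Rightarrow> 'e \<Rightarrow> int) \<Rightarrow> ('a, 'm) ring_scheme
    \<Rightarrow> (('e \<times> 'a) gword \<times> ('e \<times> 'a) gword) set" where
  "steinberg_rels \<Phi> N A =
     {(root_elt \<alpha> \<xi> @ root_elt \<alpha> \<eta>, root_elt \<alpha> (\<xi> \<oplus>\<^bsub>A\<^esub> \<eta>)) | \<alpha> \<xi> \<eta>.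
        \<alpha> \<in> \<Phi> \<and> \<xi> \<in> carrier A \<and> \<eta> \<in> carrier A} \<union>
     {(gword_comm (root_elt \<alpha> \<xi>) (root_elt \<beta> \<eta>), []) | \<alpha> \<beta> \<xi> \<eta>.
        \<alpha> \<in> \<Phi> \<and> \<beta> \<in> \<Phi> \<and> \<xi> \<in> carrier A \<and> \<eta> \<in> carrier A \<and> \<alpha> + \<beta> \<notin> \<Phi> \<union> {0}} \<union>
     {(gword_comm (root_elt \<alpha> \<xi>) (root_elt \<beta> \<eta>),
       root_elt (\<alpha> + \<beta>) (add_pow A (N \<alpha> \<beta>) (\<xi> \<otimes>\<^bsub>A\<^esub> \<eta>))) | \<alpha> \<beta> \<xi> \<eta>.
        \<alpha> \<in> \<Phi> \<and> \<beta> \<in> \<Phi> \<and> \<xi> \<in> carrier A \<and> \<eta> \<in> carrier A \<and> \<alpha> + \<beta> \<in> \<Phi>}"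

definition St ::
  "'e::euclidean_space set \<Rightarrow> ('e \<Rightarrow> 'e \<Rightarrow> int) \<Rightarrow> ('a, 'm) ring_scheme
    \<Rightarrow> ('e \<times> 'a) gword set monoid" where
  "St \<Phi> N A = presented_group (steinberg_gens \<Phi> A) (steinberg_rels \<Phi> N A)"

text \<open>
  \<open>St_map \<Phi> N B f\<close> is the homomorphism into the Steinberg group of \<open>B\<close> that sends the generator
  \<open>(\<alpha>, \<xi>)\<close> to \<open>(\<alpha>, f \<xi>)\<close>; it acts on classes of words letter by letter.
\<close>

definition St_map ::
  "'e::euclidean_space set \<Rightarrow> ('e \<Rightarrow> 'e \<Rightarrow> int) \<Rightarrow> ('b, 'n) ring_scheme \<Rightarrow> ('a \<Rightarrow> 'b)
    \<Rightarrow> ('e \<times> 'a) gword set \<Rightarrow> ('e \<times> 'b) gword set" where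
  "St_map \<Phi> N B f U =
     (\<Union>w\<in>U. gword_rel (steinberg_gens \<Phi> B) (steinberg_rels \<Phi> N B) `` {map (apfst (apsnd f)) w})"


section \<open>Relative Steinberg groups\<close>

definition double_ring :: "('a, 'm) ring_scheme \<Rightarrow> 'a set \<Rightarrow> ('a \<times> 'a) ring" where
  "double_ring A I =
     (RDirProd A A)\<lparr>carrier := {(a, b). a \<in> carrier A \<and> b \<in> carrier A \<and> a \<ominus>\<^bsub>A\<^esub> b \<in> I}\<rparr>"

definition mixed_commutator :: "('a, 'm) monoid_scheme \<Rightarrow> 'a set \<Rightarrow> 'a set \<Rightarrow> 'a set" where
  "mixed_commutator G H K =
     generate G {h \<otimes>\<^bsub>G\<^esub> k \<otimes>\<^bsub>G\<^esub> inv\<^bsub>G\<^esub> h \<otimes>\<^bsub>G\<^esub> inv\<^bsub>G\<^esub> k | h k. h \<in> H \<and> k \<in> K}"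

definition St_ker ::
  "'e::euclidean_space set \<Rightarrow> ('e \<Rightarrow> 'e \<Rightarrow> int) \<Rightarrow> ('a, 'm) ring_scheme \<Rightarrow> 'a set
    \<Rightarrow> ('a \<times> 'a \<Rightarrow> 'a) \<Rightarrow> ('e \<times> 'a \<times> 'a) gword set set" where
  "St_ker \<Phi> N A I p = kernel (St \<Phi> N (double_ring A I)) (St \<Phi> N A) (St_map \<Phi> N A p)"

definition St_rel ::
  "'e::euclidean_space set \<Rightarrow> ('e \<Rightarrow> 'e \<Rightarrow> int) \<Rightarrow> ('a, 'm) ring_scheme \<Rightarrow> 'a set
    \<Rightarrow> ('e \<times> 'a \<times> 'a) gword set set monoid" where
  "St_rel \<Phi> N A I =
     (St \<Phi> N (double_ring A I))\<lparr>carrier := St_ker \<Phi> N A I fst\<rparr> Mod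
       mixed_commutator (St \<Phi> N (double_ring A I)) (St_ker \<Phi> N A I fst) (St_ker \<Phi> N A I snd)"

text \<open>The homomorphism induced on cosets by the second projection, which is constant on each coset.\<close>

definition St_rel_map ::
  "'e::euclidean_space set \<Rightarrow> ('e \<Rightarrow> 'e \<Rightarrow> int) \<Rightarrow> ('a, 'm) ring_scheme
    \<Rightarrow> ('e \<times> 'a \<times> 'a) gword set set \<Rightarrow> ('e \<times> 'a) gword set" where
  "St_rel_map \<Phi> N A X = the_elem (St_map \<Phi> N A snd ` X)"


section \<open>Localization at a maximal ideal and polynomial rings\<close>

definition loc_rel :: "('a, 'm) ring_scheme \<Rightarrow> 'a set \<Rightarrow> (('a \<times> 'a) \<times> ('a \<times> 'a)) set" where
  "loc_rel R M =
     {((a, s), (b, t)).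
        a \<in> carrier R \<and> s \<in> carrier R - M \<and> b \<in> carrier R \<and> t \<in> carrier R - M \<and>
        (\<exists>u\<in>carrier R - M. u \<otimes>\<^bsub>R\<^esub> (a \<otimes>\<^bsub>R\<^esub> t \<ominus>\<^bsub>R\<^esub> b \<otimes>\<^bsub>R\<^esub> s) = \<zero>\<^bsub>R\<^esub>)}"

definition loc_frac :: "('a, 'm) ring_scheme \<Rightarrow> 'a set \<Rightarrow> 'a \<Rightarrow> 'a \<Rightarrow> ('a \<times> 'a) set" where
  "loc_frac R M a s = loc_rel R M `` {(a, s)}"

definition loc_ring :: "('a, 'm) ring_scheme \<Rightarrow> 'a set \<Rightarrow> ('a \<times> 'a) set ring" where
  "loc_ring R M =
     \<lparr> carrier = (carrier R \<times> (carrier R - M)) // loc_rel R M,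
       mult = (\<lambda>X Y. \<Union>(a, s)\<in>X. \<Union>(b, t)\<in>Y. loc_frac R M (a \<otimes>\<^bsub>R\<^esub> b) (s \<otimes>\<^bsub>R\<^esub> t)),
       one = loc_frac R M \<one>\<^bsub>R\<^esub> \<one>\<^bsub>R\<^esub>,
       zero = loc_frac R M \<zero>\<^bsub>R\<^esub> \<one>\<^bsub>R\<^esub>,
       add = (\<lambda>X Y. \<Union>(a, s)\<in>X. \<Union>(b, t)\<in>Y.
                loc_frac R M (a \<otimes>\<^bsub>R\<^esub> t \<oplus>\<^bsub>R\<^esub> b \<otimes>\<^bsub>R\<^esub> s) (s \<otimes>\<^bsub>R\<^esub> t)) \<rparr>"

definition loc_map :: "('a, 'm) ring_scheme \<Rightarrow> 'a set \<Rightarrow> 'a \<Rightarrow> ('a \<times> 'a) set" where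
  "loc_map R M a = loc_frac R M a \<one>\<^bsub>R\<^esub>"

definition loc_poly_map ::
  "('a, 'm) ring_scheme \<Rightarrow> 'a set \<Rightarrow> (nat \<Rightarrow> 'a) \<Rightarrow> nat \<Rightarrow> ('a \<times> 'a) set" where
  "loc_poly_map R M p = (\<lambda>n. loc_map R M (coeff (UP R) p n))"

definition t_ideal :: "('a, 'm) ring_scheme \<Rightarrow> (nat \<Rightarrow> 'a) set" where
  "t_ideal R = PIdl\<^bsub>UP R\<^esub> (monom (UP R) \<one>\<^bsub>R\<^esub> 1)"

end

theory Submission imports Defs begin

text \<open>
  For a word \<open>w\<close> over \<open>R[t]\<close> and \<open>a\<close> in \<open>R[t]\<close> let \<open>w(a)\<close> be the word obtained by substituting \<open>a\<close> for \<open>t\<close>.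
  The \<open>s\<close> in \<open>R\<close> with \<open>w(a + b s) = w(a)\<close> in the Steinberg group of \<open>R[t]\<close> for all \<open>a\<close>, \<open>b\<close> form an ideal.
  If every maximal ideal \<open>M\<close> misses such an \<open>s\<close>, the ideal contains 1 and \<open>w(t) = w(0)\<close>. So it suffices
  to find \<open>s\<close> outside \<open>M\<close> when \<open>w\<close> becomes trivial over \<open>R\<^sub>M[t]\<close>.

  Let \<open>J\<close> be an ideal of \<open>V\<close> in which any two elements have a common factor that is regular on \<open>J\<close>.
  Elements \<open>x\<^sub>\<gamma>(j)\<close>, \<open>j\<close> in \<open>J\<close>, satisfying the Steinberg relations that avoid one root can be completed
  uniquely at this root: the missing elements are commutators \<open>[x\<^sub>\<gamma>(q), x\<^sub>\<delta>(j')]\<close> with \<open>j = q j'\<close>. Hence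
  one may conjugate such a system by \<open>x\<^sub>\<beta>(c)\<close> for all \<open>c\<close> in \<open>V\<close>: the formula determines the result away
  from \<open>-\<beta>\<close>, although \<open>x\<^sub>\<beta>(c)\<close> itself need not exist. The conjugations satisfy the Steinberg relations
  over \<open>V\<close>, so the Steinberg group of a ring mapping to \<open>V\<close> acts, and a relation over \<open>R\<^sub>M[t]\<close> yields
  one in a Steinberg group with coefficients in \<open>J\<close>.

  Here \<open>V\<close> is a localization of a ring of families of polynomials in a new variable \<open>y\<close>, indexed by
  \<open>k\<close>, \<open>a\<close>, \<open>b\<close>, and \<open>J\<close> consists of the fractions whose numerators become divisible by arbitrarily high
  powers of \<open>y\<close> as \<open>k\<close> grows. The word is compared at \<open>a + b y\<^sup>k\<close> and at \<open>a\<close>. Replacing \<open>y\<close> by a multiple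
  of the denominators turns the fractions back into polynomials over \<open>R\<close>; finitely many relations
  survive for large \<open>k\<close>.

  In the relative group, an element \<open>g\<close> of the Steinberg group of the double ring is, modulo
  \<open>[G\<^sub>1, G\<^sub>2]\<close>, a product of the images of \<open>p\<^sub>1 g\<close> and \<open>p\<^sub>2 g\<close> under three sections that use the
  constant term \<open>t \<mapsto> 0\<close>. So \<open>g\<close> lies in \<open>[G\<^sub>1, G\<^sub>2]\<close> as soon as both projections are trivial.
\<close>

section \<open>Steinberg relations with a missing root\<close>

text \<open>A relation over R_M[t] involves denominators, and there is no ring map from R_M[t] back
  to R[t], so the relation itself cannot be carried over. What can be carried over is the quotient
  of the values of a word at two points that are congruent modulo \<open>J\<close>. If g0, g1 are
  the values of a prefix and x0, x1 those of the next letter, then g1 x1 (g0 x0)^-1 is (g1 g0^-1)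
  times the conjugate of x1 x0^-1 by g0, and x1 x0^-1 has its coefficient in \<open>J\<close>. So
  the prefixes need not exist as elements; only conjugation by them must make sense. For a single
  x_\<beta>(c) the commutator formula describes this conjugation at every root except -\<beta>,
  which is why exactly one root is missing. The missing element is a commutator whose coefficients
  multiply to the prescribed one. That only their product matters comes from rebracketing \<alpha> =
  \<gamma> + \<mu> + \<nu>, which requires rank at least three, and from cancelling common factors.
  Arbitrarily high powers of y can be halved, so every element of \<open>J\<close> splits into
  factors that are again in \<open>J\<close>; an ideal generated by a single power of y would not
  have this property.\<close>

no_notation Ideal_Product.ideal_prod (infixl "\<cdot>\<index>" 80)

text \<open>The facts about roots and structure constants on which everything before type E rests.
  \<open>ip\<close> is the inner product normalised to 2 on each root. \<open>ex_other\<close>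
  excludes type A2, where a root is a sum of two roots in only one way, and \<open>N_assoc\<close>
  is the Jacobi identity for three root vectors of which the first and the last commute.\<close>

locale simply_laced =
  fixes \<Phi> :: "'e::ab_group_add set" and ip :: "'e \<Rightarrow> 'e \<Rightarrow> real" and N :: "'e \<Rightarrow> 'e \<Rightarrow> int"
  assumes ip_add: "ip (\<alpha> + \<beta>) \<gamma> = ip \<alpha> \<gamma> + ip \<beta> \<gamma>"
    and ip_sym: "ip \<alpha> \<beta> = ip \<beta> \<alpha>"
    and ip_vals: "\<lbrakk>\<alpha> \<in> \<Phi>; \<beta> \<in> \<Phi>\<rbrakk> \<Longrightarrow> ip \<alpha> \<beta> \<in> {-2,-1,0,1,2}"
    and ip_self: "\<alpha> \<in> \<Phi> \<Longrightarrow> ip \<alpha> \<alpha> = 2"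
    and ip_2: "\<lbrakk>\<alpha> \<in> \<Phi>; \<beta> \<in> \<Phi>; ip \<alpha> \<beta> = 2\<rbrakk> \<Longrightarrow> \<alpha> = \<beta>"
    and root_neg: "\<alpha> \<in> \<Phi> \<Longrightarrow> - \<alpha> \<in> \<Phi>"
    and root_sum: "\<lbrakk>\<alpha> \<in> \<Phi>; \<beta> \<in> \<Phi>\<rbrakk> \<Longrightarrow> \<alpha> + \<beta> \<in> \<Phi> \<longleftrightarrow> ip \<alpha> \<beta> = -1"
    and ex_neighbour: "\<alpha> \<in> \<Phi> \<Longrightarrow> \<exists>\<gamma>\<in>\<Phi>. ip \<gamma> \<alpha> = 1"
    and ex_other: "\<lbrakk>\<alpha> \<in> \<Phi>; \<gamma> \<in> \<Phi>; ip \<gamma> \<alpha> = 1\<rbrakk> \<Longrightarrow> \<exists>\<gamma>'\<in>\<Phi>. ip \<gamma>' \<alpha> = 1 \<and> \<gamma>' \<noteq> \<gamma> \<and> \<gamma>' \<noteq> \<alpha> - \<gamma>"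
    and N_anti: "\<lbrakk>\<alpha> \<in> \<Phi>; \<beta> \<in> \<Phi>; \<alpha> + \<beta> \<in> \<Phi>\<rbrakk> \<Longrightarrow> N \<beta> \<alpha> = - N \<alpha> \<beta>"
    and N_unit: "\<lbrakk>\<alpha> \<in> \<Phi>; \<beta> \<in> \<Phi>; \<alpha> + \<beta> \<in> \<Phi>\<rbrakk> \<Longrightarrow> N \<alpha> \<beta> \<in> {1, -1}"
    and N_assoc: "\<lbrakk>\<alpha> \<in> \<Phi>; \<beta> \<in> \<Phi>; \<gamma> \<in> \<Phi>; ip \<alpha> \<beta> = -1; ip \<beta> \<gamma> = -1; ip \<alpha> \<gamma> = 0\<rbrakk> \<Longrightarrow>
       N \<alpha> \<beta> * N (\<alpha> + \<beta>) \<gamma> = N \<beta> \<gamma> * N \<alpha> (\<beta> + \<gamma>)"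
begin

lemma ip_add2: "ip \<gamma> (\<alpha> + \<beta>) = ip \<gamma> \<alpha> + ip \<gamma> \<beta>"
  by (metis ip_add ip_sym)

lemma ip_zero [simp]: "ip 0 \<gamma> = 0" "ip \<gamma> 0 = 0"
  using ip_add[of 0 0 \<gamma>] ip_sym[of \<gamma> 0] by simp_all

lemma ip_minus [simp]: "ip (- \<alpha>) \<gamma> = - ip \<alpha> \<gamma>" "ip \<gamma> (- \<alpha>) = - ip \<gamma> \<alpha>"
  using ip_add[of \<alpha> "-\<alpha>" \<gamma>] ip_add2[of \<gamma> \<alpha> "-\<alpha>"] by simp_all

lemma ip_diff: "ip (\<alpha> - \<beta>) \<gamma> = ip \<alpha> \<gamma> - ip \<beta> \<gamma>" "ip \<gamma> (\<alpha> - \<beta>) = ip \<gamma> \<alpha> - ip \<gamma> \<beta>"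
  using ip_add[of \<alpha> "-\<beta>" \<gamma>] ip_add2[of \<gamma> \<alpha> "-\<beta>"] by simp_all

lemmas ip_simps = ip_add ip_add2 ip_diff

lemma root_nz: "\<alpha> \<in> \<Phi> \<Longrightarrow> \<alpha> \<noteq> 0"
  using ip_self[of 0] by auto

lemma ip_neg2: "\<lbrakk>\<alpha> \<in> \<Phi>; \<beta> \<in> \<Phi>; ip \<alpha> \<beta> = -2\<rbrakk> \<Longrightarrow> \<alpha> = - \<beta>"
  using ip_2[of \<alpha> "-\<beta>"] root_neg by simp

lemma root_diff: "\<lbrakk>\<alpha> \<in> \<Phi>; \<beta> \<in> \<Phi>\<rbrakk> \<Longrightarrow> \<alpha> - \<beta> \<in> \<Phi> \<longleftrightarrow> ip \<alpha> \<beta> = 1"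
  using root_sum[of \<alpha> "-\<beta>"] root_neg by simp

lemma ip_int: "\<lbrakk>\<alpha> \<in> \<Phi>; \<beta> \<in> \<Phi>; \<alpha> \<noteq> \<beta>; \<alpha> \<noteq> -\<beta>\<rbrakk> \<Longrightarrow> ip \<alpha> \<beta> = -1 \<or> ip \<alpha> \<beta> = 0 \<or> ip \<alpha> \<beta> = 1"
  using ip_vals[of \<alpha> \<beta>] ip_2[of \<alpha> \<beta>] ip_neg2[of \<alpha> \<beta>] by auto

lemma ip_int': "\<lbrakk>\<alpha> \<in> \<Phi>; \<beta> \<in> \<Phi>; \<alpha> \<noteq> -\<beta>\<rbrakk> \<Longrightarrow> ip \<alpha> \<beta> = -1 \<or> ip \<alpha> \<beta> = 0 \<or> ip \<alpha> \<beta> = 1 \<or> ip \<alpha> \<beta> = 2"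
  using ip_vals[of \<alpha> \<beta>] ip_neg2[of \<alpha> \<beta>] by auto

text \<open>For a second decomposition \<alpha> = \<gamma>' + (\<alpha> - \<gamma>') the products of
  its two parts with \<gamma> add up to 1, and neither can be -1 or 2. So one of the parts has
  product 1 with \<gamma>, and its difference to \<gamma> is a root.\<close>

lemma ex_adjacent:
  assumes "\<alpha> \<in> \<Phi>" "\<gamma> \<in> \<Phi>" "ip \<gamma> \<alpha> = 1"
  shows "\<exists>\<gamma>'\<in>\<Phi>. ip \<gamma>' \<alpha> = 1 \<and> ip \<gamma>' \<gamma> = 1"
proof -
  obtain \<gamma>' where g: "\<gamma>' \<in> \<Phi>" "ip \<gamma>' \<alpha> = 1" "\<gamma>' \<noteq> \<gamma>" "\<gamma>' \<noteq> \<alpha> - \<gamma>"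
    using ex_other[OF assms] by auto
  have d: "\<alpha> - \<gamma> \<in> \<Phi>" "\<alpha> - \<gamma>' \<in> \<Phi>" using root_diff assms g ip_sym by metis+
  have "\<gamma>' \<noteq> - \<gamma>" using g assms by (metis ip_minus(1) neg_equal_iff_equal one_neq_neg_one)
  then have "ip \<gamma>' \<gamma> = -1 \<or> ip \<gamma>' \<gamma> = 0 \<or> ip \<gamma>' \<gamma> = 1" using ip_int g assms by blast
  moreover have "ip \<gamma>' \<gamma> \<noteq> -1"
  proof
    assume "ip \<gamma>' \<gamma> = -1"
    then have "ip \<gamma>' (\<alpha> - \<gamma>) = 2" using g by (simp add: ip_simps)
    then show False using ip_2 g d by blast
  qed
  moreover have "ip (\<alpha> - \<gamma>') \<gamma> = 1" "ip (\<alpha> - \<gamma>') \<alpha> = 1" if "ip \<gamma>' \<gamma> = 0"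
    using that assms g by (simp_all add: ip_simps ip_self ip_sym[of \<alpha> \<gamma>] ip_sym[of \<alpha> \<gamma>'])
  ultimately show ?thesis using g d by blast
qed

text \<open>There are two different decompositions of \<alpha>. All their parts have product 1 with
  \<alpha>, so no part of one is the negative of a part of the other, and \<epsilon> can interfere
  with only one of them.\<close>

lemma ex_decomposition:
  assumes "\<alpha> \<in> \<Phi>" "\<epsilon> \<noteq> \<alpha>" "\<epsilon> \<noteq> - \<alpha>"
  shows "\<exists>\<gamma>\<in>\<Phi>. ip \<gamma> \<alpha> = 1 \<and> \<epsilon> \<notin> {\<gamma>, - \<gamma>, \<alpha> - \<gamma>, - (\<alpha> - \<gamma>)}"
proof -
  obtain \<gamma> where g: "\<gamma> \<in> \<Phi>" "ip \<gamma> \<alpha> = 1" using ex_neighbour assms by blast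
  show ?thesis
  proof (cases "\<epsilon> \<in> {\<gamma>, - \<gamma>, \<alpha> - \<gamma>, - (\<alpha> - \<gamma>)}")
    case True
    obtain \<gamma>' where g': "\<gamma>' \<in> \<Phi>" "ip \<gamma>' \<alpha> = 1" "\<gamma>' \<noteq> \<gamma>" "\<gamma>' \<noteq> \<alpha> - \<gamma>"
      using ex_other[OF _ g] assms by auto
    have i: "ip (\<alpha> - \<gamma>) \<alpha> = 1" "ip (\<alpha> - \<gamma>') \<alpha> = 1" using g g' assms by (simp_all add: ip_simps ip_self)
    have n: "\<mu> \<noteq> - \<nu>" if "ip \<mu> \<alpha> = 1" "ip \<nu> \<alpha> = 1" for \<mu> \<nu>
      using that by auto
    have "\<epsilon> \<notin> {\<gamma>', - \<gamma>', \<alpha> - \<gamma>', - (\<alpha> - \<gamma>')}"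
      using True n[OF g(2) g'(2)] n[OF g(2) i(2)] n[OF i(1) g'(2)] n[OF i(1) i(2)] g' n[OF g'(2) g(2)]
         n[OF g'(2) i(1)] n[OF i(2) i(1)] n[OF i(2) g(2)]
      by (auto simp: algebra_simps)
    then show ?thesis using g' by blast
  qed (use g in blast)
qed

end

text \<open>Groups are written additively, without commutativity, because this is what the class
  \<open>group_add\<close> offers. As rewrite rules these equations bring a group word into the form
  of a right-nested sum without subtraction, in which adjacent inverse letters cancel.\<close>

lemma group_norm:
  fixes a b c :: "'g::group_add"
  shows "a - b = a + - b" "- (a + b) = - b + - a" "a + b + c = a + (b + c)" "- (- a) = a" "- 0 = (0::'g)"
    "0 + a = a" "a + 0 = a" "- a + a = 0" "a + - a = 0" "a + (- a + b) = b" "- a + (a + b) = b"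
  by (simp_all add: minus_add add.assoc del: minus_add_distrib)

definition cj :: "'g::group_add \<Rightarrow> 'g \<Rightarrow> 'g" where "cj g h = g + h - g"

lemma cj_add: "cj g (h + k) = cj g h + cj g k"
  by (simp add: cj_def diff_conv_add_uminus add.assoc del: add_uminus_conv_diff)

lemma cj_minus: "cj g (- h) = - cj g h"
  by (simp add: cj_def diff_conv_add_uminus add.assoc minus_add del: add_uminus_conv_diff)

lemma cj_diff: "cj g (h - k) = cj g h - cj g k"
  using cj_add[of g h "-k"] by (simp add: cj_minus)

lemma cj_cj: "cj (g + h) k = cj g (cj h k)"
  by (simp add: cj_def diff_conv_add_uminus add.assoc minus_add del: add_uminus_conv_diff)

lemma cj_nat: "cj g (cj h k) = cj (cj g h) (cj g k)"
  by (simp add: cj_def diff_conv_add_uminus add.assoc minus_add del: add_uminus_conv_diff)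

lemma cj_zero [simp]: "cj 0 h = h" "cj g 0 = 0"
  by (simp_all add: cj_def)

lemma cj_fix: "cj g h = h \<longleftrightarrow> g + h = h + g"
  by (simp add: cj_def diff_eq_eq)

text \<open>\<open>V\<close> may have zero divisors, so the common factor is cancellable only
  against elements of \<open>J\<close>. The case \<open>a = b\<close> says that every element of
  \<open>J\<close> is a product of two elements of \<open>J\<close>.\<close>

locale divisible_ideal = cring V + ideal J V for J and V (structure) +
  assumes common_factor: "\<lbrakk>a \<in> J; b \<in> J\<rbrakk> \<Longrightarrow>
    \<exists>q\<in>J. (\<forall>c\<in>J. q \<otimes> c = \<zero> \<longrightarrow> c = \<zero>) \<and> (\<exists>a'\<in>J. a = q \<otimes> a') \<and> (\<exists>b'\<in>J. b = q \<otimes> b')"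
begin

lemma J_carr [simp]: "a \<in> J \<Longrightarrow> a \<in> carrier V"
  using a_subset by blast

lemma J_add [simp]: "\<lbrakk>a \<in> J; b \<in> J\<rbrakk> \<Longrightarrow> a \<oplus> b \<in> J"
  by simp

lemma J_mult [simp]: "\<lbrakk>a \<in> carrier V; b \<in> J\<rbrakk> \<Longrightarrow> a \<otimes> b \<in> J" "\<lbrakk>a \<in> J; b \<in> carrier V\<rbrakk> \<Longrightarrow> a \<otimes> b \<in> J"
  using I_l_closed I_r_closed by blast+

lemma J_pow [simp]: "a \<in> J \<Longrightarrow> [(k::int)] \<cdot> a \<in> J"
proof -
  assume a: "a \<in> J"
  have "[k] \<cdot> \<one> \<otimes> a = [k] \<cdot> (\<one> \<otimes> a)" using a by (intro add_pow_ldistr_int) auto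
  then show ?thesis using a by (metis J_carr J_mult(1) add.int_pow_closed l_one one_closed)
qed

lemma pow_pow: "a \<in> carrier V \<Longrightarrow> [(k::int)] \<cdot> ([(m::int)] \<cdot> a) = [(k * m)] \<cdot> a"
  using add.int_pow_pow[of a k m] by (simp add: mult.commute)

lemmas coef_simps = add_pow_ldistr_int add_pow_rdistr_int pow_pow m_ac

lemma factor:
  assumes "a \<in> J" shows "\<exists>q\<in>J. \<exists>a'\<in>J. a = q \<otimes> a'"
  using common_factor[OF assms assms] by blast

end

text \<open>The value 0 at non-roots lets one formula cover both kinds of commutator relations: if
  \<gamma> + \<delta> is not a root, the first summand on the right vanishes and the two elements
  commute.\<close>

definition steinberg_rep :: "'e::ab_group_add set \<Rightarrow> ('e \<Rightarrow> 'e \<Rightarrow> int) \<Rightarrow> ('a, 'm) ring_scheme \<Rightarrow> 'a set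
    \<Rightarrow> ('e \<Rightarrow> 'a \<Rightarrow> 'g::group_add) \<Rightarrow> bool" where
  "steinberg_rep \<Phi> N V J x \<longleftrightarrow>
     (\<forall>\<gamma> a. \<gamma> \<notin> \<Phi> \<or> a \<notin> J \<longrightarrow> x \<gamma> a = 0) \<and>
     (\<forall>\<gamma>\<in>\<Phi>. \<forall>a\<in>J. \<forall>b\<in>J. x \<gamma> (a \<oplus>\<^bsub>V\<^esub> b) = x \<gamma> a + x \<gamma> b) \<and>
     (\<forall>\<gamma>\<in>\<Phi>. \<forall>\<delta>\<in>\<Phi>. \<forall>a\<in>J. \<forall>b\<in>J. \<gamma> + \<delta> \<noteq> 0 \<longrightarrow>
        cj (x \<gamma> a) (x \<delta> b) = x (\<gamma> + \<delta>) (add_pow V (N \<gamma> \<delta>) (a \<otimes>\<^bsub>V\<^esub> b)) + x \<delta> b)"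

locale steinberg_core = simply_laced \<Phi> ip N + divisible_ideal J V
  for \<Phi> :: "'e::ab_group_add set" and ip N and J :: "'a set" and V (structure)

text \<open>A relation is required only if \<alpha> occurs neither as one of the two roots nor as
  their sum. The values \<open>y \<alpha> a\<close> for \<open>a\<close> in \<open>J\<close> are
  arbitrary; the completion overrides them.\<close>

locale missing_root = steinberg_core \<Phi> ip N J V
  for \<Phi> :: "'e::ab_group_add set" and ip N and J :: "'a set" and V (structure) +
  fixes \<alpha> :: 'e and y :: "'e \<Rightarrow> 'a \<Rightarrow> 'g::group_add"
  assumes alpha: "\<alpha> \<in> \<Phi>"
    and y_outside: "\<gamma> \<notin> \<Phi> \<or> a \<notin> J \<Longrightarrow> y \<gamma> a = 0"
    and y_add: "\<lbrakk>\<gamma> \<in> \<Phi>; \<gamma> \<noteq> \<alpha>; a \<in> J; b \<in> J\<rbrakk> \<Longrightarrow> y \<gamma> (a \<oplus> b) = y \<gamma> a + y \<gamma> b"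
    and y_cj: "\<lbrakk>\<gamma> \<in> \<Phi>; \<delta> \<in> \<Phi>; \<gamma> \<noteq> \<alpha>; \<delta> \<noteq> \<alpha>; \<gamma> + \<delta> \<noteq> 0; \<gamma> + \<delta> \<noteq> \<alpha>; a \<in> J; b \<in> J\<rbrakk> \<Longrightarrow>
       cj (y \<gamma> a) (y \<delta> b) = y (\<gamma> + \<delta>) ([N \<gamma> \<delta>] \<cdot> (a \<otimes> b)) + y \<delta> b"
begin

lemma y_fix:
  assumes "\<gamma> \<in> \<Phi>" "\<delta> \<in> \<Phi>" "\<gamma> \<noteq> \<alpha>" "\<delta> \<noteq> \<alpha>" "ip \<gamma> \<delta> \<ge> 0" "a \<in> J" "b \<in> J"
  shows "cj (y \<gamma> a) (y \<delta> b) = y \<delta> b"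
proof -
  have n: "\<gamma> + \<delta> \<notin> \<Phi>" using assms root_sum by auto
  have "\<gamma> + \<delta> \<noteq> 0"
  proof
    assume "\<gamma> + \<delta> = 0"
    then have "\<delta> = - \<gamma>" by (simp add: add_eq_0_iff)
    then show False using assms ip_self by auto
  qed
  then show ?thesis using n assms alpha by (subst y_cj) (auto simp: y_outside)
qed

text \<open>The commutator of \<open>y \<gamma> a\<close> and
  \<open>y (\<alpha> - \<gamma>) b\<close>, which is what the missing element at \<alpha> with
  coefficient \<open>[N \<gamma> (\<alpha> - \<gamma>)] \<cdot> (a \<otimes> b)\<close> has to
  be.\<close>

definition Y :: "'e \<Rightarrow> 'a \<Rightarrow> 'a \<Rightarrow> 'g" where
  "Y \<gamma> a b = cj (y \<gamma> a) (y (\<alpha> - \<gamma>) b) - y (\<alpha> - \<gamma>) b"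

lemma partner:
  assumes "\<gamma> \<in> \<Phi>" "ip \<gamma> \<alpha> = 1"
  shows "\<alpha> - \<gamma> \<in> \<Phi>" "ip (\<alpha> - \<gamma>) \<alpha> = 1" "ip \<gamma> (\<alpha> - \<gamma>) = -1" "\<gamma> \<noteq> \<alpha>" "\<alpha> - \<gamma> \<noteq> \<alpha>" "\<gamma> \<noteq> - \<alpha>" "\<alpha> - \<gamma> \<noteq> - \<alpha>"
proof -
  show "\<alpha> - \<gamma> \<in> \<Phi>" using assms alpha root_diff ip_sym by metis
  show i: "ip (\<alpha> - \<gamma>) \<alpha> = 1" "ip \<gamma> (\<alpha> - \<gamma>) = -1" using assms alpha by (simp_all add: ip_simps ip_self)
  show "\<gamma> \<noteq> \<alpha>" "\<gamma> \<noteq> - \<alpha>" using assms alpha ip_self by auto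
  show "\<alpha> - \<gamma> \<noteq> \<alpha>" "\<alpha> - \<gamma> \<noteq> - \<alpha>" using i alpha ip_self[OF alpha] by (metis ip_minus(1) numeral_One numeral_eq_iff semiring_norm(85) neg_equal_iff_equal one_neq_neg_numeral)+
qed

text \<open>The candidate at \<alpha> already behaves under conjugation as the Steinberg relations
  prescribe, as long as \<epsilon> is not involved in its own construction. This is obtained by
  conjugating both entries of the commutator.\<close>

lemma Y_act:
  assumes g: "\<gamma> \<in> \<Phi>" "ip \<gamma> \<alpha> = 1" and e: "\<epsilon> \<in> \<Phi>" "\<epsilon> \<notin> {\<gamma>, - \<gamma>, \<alpha> - \<gamma>, - (\<alpha> - \<gamma>)}" "\<epsilon> \<noteq> \<alpha>" "\<epsilon> \<noteq> - \<alpha>"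
    and J: "a \<in> J" "b \<in> J" "d \<in> J"
  shows "cj (y \<epsilon> d) (Y \<gamma> a b) = y (\<epsilon> + \<alpha>) ([N \<epsilon> \<alpha>] \<cdot> (d \<otimes> ([N \<gamma> (\<alpha> - \<gamma>)] \<cdot> (a \<otimes> b)))) + Y \<gamma> a b"
proof -
  define \<delta> where "\<delta> = \<alpha> - \<gamma>"
  have alpha_eq: "\<alpha> = \<gamma> + \<delta>" by (simp add: \<delta>_def)
  note p = partner[OF g, folded \<delta>_def]
  have ig [simp]: "ip \<gamma> \<gamma> = 2" "ip \<delta> \<delta> = 2" "ip \<gamma> \<delta> = -1" "ip \<delta> \<gamma> = -1" "ip \<epsilon> \<epsilon> = 2"
    using ip_self g p e ip_sym[of \<delta> \<gamma>] by auto
  have e': "\<epsilon> \<noteq> \<gamma>" "\<epsilon> \<noteq> - \<gamma>" "\<epsilon> \<noteq> \<delta>" "\<epsilon> \<noteq> - \<delta>" using e \<delta>_def by auto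
  have s: "ip \<gamma> \<epsilon> = ip \<epsilon> \<gamma>" "ip \<delta> \<epsilon> = ip \<epsilon> \<delta>" by (rule ip_sym)+
  define G D E where "G = y \<gamma> a" and "D = y \<delta> b" and "E = y \<epsilon> d"
  have YD: "Y \<gamma> a b = cj G D - D" unfolding Y_def G_def D_def \<delta>_def by simp
  have cE: "cj E (cj G D - D) = cj (cj E G) (cj E D) - cj E D" by (simp only: cj_diff cj_nat[symmetric])
  have ipa: "ip \<epsilon> \<alpha> = ip \<epsilon> \<gamma> + ip \<epsilon> \<delta>" by (simp add: alpha_eq ip_simps)
  have i1: "ip \<epsilon> \<gamma> = -1 \<or> ip \<epsilon> \<gamma> = 0 \<or> ip \<epsilon> \<gamma> = 1" using ip_int e e' g by blast
  have i2: "ip \<epsilon> \<delta> = -1 \<or> ip \<epsilon> \<delta> = 0 \<or> ip \<epsilon> \<delta> = 1" using ip_int e e' p by blast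
  have i3: "ip \<epsilon> \<alpha> = -1 \<or> ip \<epsilon> \<alpha> = 0 \<or> ip \<epsilon> \<alpha> = 1" using ip_int e alpha by blast
  have nroot: "y (\<epsilon> + \<alpha>) c = 0" if "ip \<epsilon> \<alpha> \<noteq> -1" for c
    using that root_sum[OF e(1) alpha] by (simp add: y_outside)
  have nz: "\<epsilon> + \<gamma> \<noteq> 0" "\<epsilon> + \<delta> \<noteq> 0" "\<epsilon> + \<alpha> \<noteq> 0" using e e' by (simp_all add: eq_neg_iff_add_eq_0)
  have ng: "\<epsilon> + \<gamma> \<noteq> \<alpha>" "\<epsilon> + \<delta> \<noteq> \<alpha>" "\<epsilon> + \<alpha> \<noteq> \<alpha>" using e' e root_nz by (auto simp: alpha_eq add.commute)
  have sums: "\<gamma> + (\<epsilon> + \<delta>) = \<epsilon> + \<alpha>" "(\<epsilon> + \<gamma>) + \<delta> = \<epsilon> + \<alpha>"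
    by (simp_all add: alpha_eq ac_simps)
  have eg: "cj E G = y (\<epsilon> + \<gamma>) ([N \<epsilon> \<gamma>] \<cdot> (d \<otimes> a)) + G" "cj G E = y (\<gamma> + \<epsilon>) ([N \<gamma> \<epsilon>] \<cdot> (a \<otimes> d)) + E"
    unfolding E_def G_def using e e' g p J
    by (intro y_cj; use nz ng in \<open>auto simp: add.commute\<close>)+
  have ed: "cj E D = y (\<epsilon> + \<delta>) ([N \<epsilon> \<delta>] \<cdot> (d \<otimes> b)) + D"
    unfolding E_def D_def using e e' g p J
    by (intro y_cj; use nz ng in auto)
  have fG: "cj E G = G" if "ip \<epsilon> \<gamma> \<ge> 0"
    unfolding E_def G_def using that e g p J by (intro y_fix) auto
  have fD: "cj E D = D" if "ip \<epsilon> \<delta> \<ge> 0"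
    unfolding E_def D_def using that e g p J by (intro y_fix) auto
  \<comment> \<open>Both products cannot be -1 because \<epsilon> is not -\<alpha>, so
    \<open>E\<close> moves at most one of \<open>G\<close> and \<open>D\<close>. If the two products
    cancel, the additional factor commutes with the others and drops out; if they add up to -1, its
    commutator with the factor that is not moved is the desired \<open>Z\<close>.\<close>
  consider "ip \<epsilon> \<gamma> \<ge> 0" "ip \<epsilon> \<delta> \<ge> 0" | "ip \<epsilon> \<gamma> = 1" "ip \<epsilon> \<delta> = -1" | "ip \<epsilon> \<gamma> = -1" "ip \<epsilon> \<delta> = 1"
    | "ip \<epsilon> \<gamma> = 0" "ip \<epsilon> \<delta> = -1" | "ip \<epsilon> \<gamma> = -1" "ip \<epsilon> \<delta> = 0"
    using i1 i2 i3 ipa by fastforce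
  then show ?thesis
  proof cases
    case 1
    then show ?thesis using fG fD ipa cE nroot by (simp add: YD flip: E_def)
  next
    case 2
    define D' where "D' = y (\<epsilon> + \<delta>) ([N \<epsilon> \<delta>] \<cdot> (d \<otimes> b))"
    have r: "\<epsilon> + \<delta> \<in> \<Phi>" using 2 e p root_sum by blast
    have 3: "cj G D' = D'"
      unfolding G_def D'_def using 2 r g p J ng by (intro y_fix) (auto simp: ip_simps s)
    have 4: "cj D D' = D'"
      unfolding D_def D'_def using 2 r g p J ng by (intro y_fix) (auto simp: ip_simps s)
    have "cj E D = D + D'" using ed 4 by (simp add: D'_def[symmetric] cj_fix)
    then have "cj E (cj G D - D) = cj G (D + D') - (D + D')" using fG 2 cE by simp
    also have "\<dots> = cj G D - D" by (simp only: cj_add 3 group_norm)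
    finally show ?thesis using 2 nroot ipa by (simp add: YD flip: E_def)
  next
    case 3
    define G' where "G' = y (\<epsilon> + \<gamma>) ([N \<epsilon> \<gamma>] \<cdot> (d \<otimes> a))"
    have r: "\<epsilon> + \<gamma> \<in> \<Phi>" using 3 e g root_sum by blast
    have 4: "cj G' D = D"
      unfolding D_def G'_def using 3 r g p J ng by (intro y_fix) (auto simp: ip_simps s)
    have 5: "cj G G' = G'"
      unfolding G_def G'_def using 3 r g p J ng by (intro y_fix) (auto simp: ip_simps s)
    have "cj E G = G + G'" using eg 5 by (simp add: G'_def[symmetric] cj_fix)
    then have "cj E (cj G D - D) = cj G (cj G' D) - D" using fD 3 cE by (simp add: cj_cj)
    then show ?thesis using 3 4 nroot ipa by (simp add: YD flip: E_def)
  next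
    case 4
    define D' where "D' = y (\<epsilon> + \<delta>) ([N \<epsilon> \<delta>] \<cdot> (d \<otimes> b))"
    define Z where "Z = y (\<epsilon> + \<alpha>) ([N \<epsilon> \<alpha>] \<cdot> (d \<otimes> ([N \<gamma> \<delta>] \<cdot> (a \<otimes> b))))"
    have r: "\<epsilon> + \<delta> \<in> \<Phi>" "\<epsilon> + \<alpha> \<in> \<Phi>" using 4 e p root_sum alpha ipa by (metis, metis add_0)
    have "N \<epsilon> \<delta> * N (\<epsilon> + \<delta>) \<gamma> = N \<delta> \<gamma> * N \<epsilon> (\<delta> + \<gamma>)"
      using 4 e p g by (intro N_assoc) auto
    moreover have "N (\<epsilon> + \<delta>) \<gamma> = - N \<gamma> (\<epsilon> + \<delta>)" "N \<delta> \<gamma> = - N \<gamma> \<delta>"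
      using r p g alpha by (auto intro!: N_anti simp: alpha_eq algebra_simps)
    ultimately have N: "N \<gamma> (\<epsilon> + \<delta>) * N \<epsilon> \<delta> = N \<epsilon> \<alpha> * N \<gamma> \<delta>" by (simp add: alpha_eq algebra_simps)
    have "cj G D' = y (\<gamma> + (\<epsilon> + \<delta>)) ([N \<gamma> (\<epsilon> + \<delta>)] \<cdot> (a \<otimes> ([N \<epsilon> \<delta>] \<cdot> (d \<otimes> b)))) + D'"
      unfolding G_def D'_def using 4 r g p J ng e by (intro y_cj) (auto simp: sums nz)
    also have "y (\<gamma> + (\<epsilon> + \<delta>)) ([N \<gamma> (\<epsilon> + \<delta>)] \<cdot> (a \<otimes> ([N \<epsilon> \<delta>] \<cdot> (d \<otimes> b)))) = Z"
      unfolding Z_def using J N by (simp add: coef_simps sums)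
    finally have 3: "cj G D' = Z + D'" .
    have 5: "cj D D' = D'"
      unfolding D_def D'_def using 4 r g p J ng by (intro y_fix) (auto simp: ip_simps s)
    have 6: "cj Z D = D" "cj Z G = G"
      unfolding Z_def D_def G_def using 4 r g p J ng by (auto intro!: y_fix simp: ip_simps s) (auto simp: alpha_eq ip_simps)
    have zd: "D + (Z + k) = Z + (D + k)" "G + (Z + k) = Z + (G + k)" for k
      using 6 by (simp_all add: cj_fix flip: add.assoc)
    have zd': "- D + (Z + k) = Z + (- D + k)" "- G + (Z + k) = Z + (- G + k)" for k
      using zd(1)[of "- D + k"] zd(2)[of "- G + k"] by (metis add.assoc add.left_inverse add_0 minus_add_cancel)+
    have "cj E D = D + D'" using ed 5 by (simp add: D'_def[symmetric] cj_fix)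
    then have "cj E (cj G D - D) = cj G (D + D') - (D + D')" using fG 4 cE by simp
    also have "\<dots> = cj G D + (Z + (D' - D' - D))" by (simp only: cj_add 3 group_norm)
    also have "\<dots> = Z + (cj G D - D)"
      by (simp only: cj_def group_norm zd zd')
    finally show ?thesis by (simp add: YD E_def[symmetric] Z_def[symmetric] flip: \<delta>_def)
  next
    case 5
    define G' where "G' = y (\<epsilon> + \<gamma>) ([N \<epsilon> \<gamma>] \<cdot> (d \<otimes> a))"
    define Z where "Z = y (\<epsilon> + \<alpha>) ([N \<epsilon> \<alpha>] \<cdot> (d \<otimes> ([N \<gamma> \<delta>] \<cdot> (a \<otimes> b))))"
    have r: "\<epsilon> + \<gamma> \<in> \<Phi>" "\<epsilon> + \<alpha> \<in> \<Phi>" using 5 e g root_sum alpha ipa by (metis, metis add.right_neutral)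
    have "N \<epsilon> \<gamma> * N (\<epsilon> + \<gamma>) \<delta> = N \<gamma> \<delta> * N \<epsilon> (\<gamma> + \<delta>)"
      using 5 e p g by (intro N_assoc) auto
    then have N: "N (\<epsilon> + \<gamma>) \<delta> * N \<epsilon> \<gamma> = N \<epsilon> \<alpha> * N \<gamma> \<delta>" by (simp add: alpha_eq algebra_simps)
    have "cj G' D = y ((\<epsilon> + \<gamma>) + \<delta>) ([N (\<epsilon> + \<gamma>) \<delta>] \<cdot> (([N \<epsilon> \<gamma>] \<cdot> (d \<otimes> a)) \<otimes> b)) + D"
      unfolding D_def G'_def using 5 r g p J ng e by (intro y_cj) (auto simp: sums nz)
    also have "y ((\<epsilon> + \<gamma>) + \<delta>) ([N (\<epsilon> + \<gamma>) \<delta>] \<cdot> (([N \<epsilon> \<gamma>] \<cdot> (d \<otimes> a)) \<otimes> b)) = Z"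
      unfolding Z_def using J N by (simp add: coef_simps sums)
    finally have 3: "cj G' D = Z + D" .
    have 4: "cj G G' = G'"
      unfolding G_def G'_def using 5 r g p J ng by (intro y_fix) (auto simp: ip_simps s)
    have 6: "cj G Z = Z"
      unfolding Z_def G_def using 5 r g p J ng by (intro y_fix) (auto simp: ip_simps s alpha_eq)
    have "cj E G = G + G'" using eg 4 by (simp add: G'_def[symmetric] cj_fix)
    then have "cj E (cj G D - D) = cj G (cj G' D) - D" using fD 5 cE by (simp add: cj_cj)
    also have "\<dots> = Z + (cj G D - D)" by (simp only: 3 cj_add 6 group_norm)
    finally show ?thesis by (simp add: YD E_def[symmetric] Z_def[symmetric] flip: \<delta>_def)
  qed
qed

end

lemma double_eq: "g + g = g \<Longrightarrow> g = 0" for g :: "'g::group_add"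
  by (metis add.right_neutral add_left_imp_eq)

lemma fix_commutator: "\<lbrakk>cj g z = z; cj h z = z\<rbrakk> \<Longrightarrow> cj (cj g h - h) z = z" for g h z :: "'x::group_add"
proof -
  assume a: "cj g z = z" "cj h z = z"
  have m: "cj (- k) z = z" if "cj k z = z" for k using that by (metis cj_cj cj_zero(1) add.left_inverse)
  have "cj g h - h = g + (h + (- g + - h))" by (simp only: cj_def group_norm)
  then show ?thesis by (simp only: cj_cj a m)
qed

context missing_root begin

lemma y_minus:
  assumes "\<gamma> \<noteq> \<alpha>" "a \<in> J"
  shows "y \<gamma> (\<ominus> a) = - y \<gamma> a"
proof (cases "\<gamma> \<in> \<Phi>")
  case True
  have "y \<gamma> \<zero> + y \<gamma> \<zero> = y \<gamma> \<zero>" using y_add[of \<gamma> \<zero> \<zero>] True assms by simp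
  then have z: "y \<gamma> \<zero> = 0" by (rule double_eq)
  have "y \<gamma> (\<ominus> a) + y \<gamma> a = y \<gamma> (\<ominus> a \<oplus> a)" using True assms by (simp add: y_add)
  also have "\<dots> = 0" using assms z by (simp add: l_neg)
  finally show ?thesis by (simp add: eq_neg_iff_add_eq_0)
qed (use y_outside in simp)

lemma ip_ne: "\<lbrakk>\<gamma> \<in> \<Phi>; ip \<epsilon> \<gamma> = -1 \<or> ip \<epsilon> \<gamma> = 0 \<or> ip \<epsilon> \<gamma> = 1\<rbrakk> \<Longrightarrow> \<epsilon> \<noteq> \<gamma> \<and> \<epsilon> \<noteq> - \<gamma>"
  using ip_self by fastforce

text \<open>The exclusions of \<open>Y_act\<close> in arithmetic form, for \<epsilon> such that
  \<epsilon> + \<alpha> is not a root. The inequality with -2 says that \<epsilon> differs from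
  \<open>\<alpha> - \<gamma>\<close>.\<close>

lemma Y_fix:
  assumes g: "\<gamma> \<in> \<Phi>" "ip \<gamma> \<alpha> = 1" and e: "\<epsilon> \<in> \<Phi>"
    "ip \<epsilon> \<gamma> = -1 \<or> ip \<epsilon> \<gamma> = 0 \<or> ip \<epsilon> \<gamma> = 1" "ip \<epsilon> \<alpha> = 0 \<or> ip \<epsilon> \<alpha> = 1" "ip \<epsilon> \<gamma> - ip \<epsilon> \<alpha> \<noteq> -2"
    and J: "a \<in> J" "b \<in> J" "d \<in> J"
  shows "cj (y \<epsilon> d) (Y \<gamma> a b) = Y \<gamma> a b"
proof -
  have "ip \<epsilon> (\<alpha> - \<gamma>) = -1 \<or> ip \<epsilon> (\<alpha> - \<gamma>) = 0 \<or> ip \<epsilon> (\<alpha> - \<gamma>) = 1"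
    using e(2-4) ip_vals[OF e(1) partner(1)[OF g]] by (auto simp: ip_simps)
  then have "\<epsilon> \<notin> {\<gamma>, - \<gamma>, \<alpha> - \<gamma>, - (\<alpha> - \<gamma>)}"
    using ip_ne[OF g(1), of \<epsilon>] ip_ne[OF partner(1)[OF g], of \<epsilon>] e(2) by blast
  moreover have "\<epsilon> \<noteq> \<alpha> \<and> \<epsilon> \<noteq> - \<alpha>" using ip_ne[OF alpha, of \<epsilon>] e by blast
  moreover have "y (\<epsilon> + \<alpha>) c = 0" for c
    using root_sum[OF e(1) alpha] e(3) by (auto simp: y_outside)
  ultimately show ?thesis using Y_act[OF g e(1)] J by simp
qed

text \<open>A Hall-Witt argument for \<alpha> = \<gamma> + \<mu> + \<nu> with orthogonal \<gamma>
  and \<nu>: the nested commutators with brackets \<gamma> + (\<mu> + \<nu>) and (\<gamma> + \<mu>)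
  + \<nu> agree. Thus a factor of the coefficient passes from one entry of the commutator to the
  other while the decomposition of \<alpha> changes.\<close>

lemma Y_shift:
  assumes g: "\<gamma> \<in> \<Phi>" "ip \<gamma> \<alpha> = 1" and g': "\<gamma>' \<in> \<Phi>" "ip \<gamma>' \<alpha> = 1" "ip \<gamma> \<gamma>' = 1"
    and J: "a \<in> J" "u \<in> J" "v \<in> J"
  shows "Y \<gamma> a ([N (\<gamma>' - \<gamma>) (\<alpha> - \<gamma>')] \<cdot> (u \<otimes> v)) = Y \<gamma>' ([N \<gamma> (\<gamma>' - \<gamma>)] \<cdot> (a \<otimes> u)) v"
proof -
  define \<mu> \<nu> \<delta> where "\<mu> = \<gamma>' - \<gamma>" and "\<nu> = \<alpha> - \<gamma>'" and "\<delta> = \<alpha> - \<gamma>"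
  note p = partner[OF g, folded \<delta>_def] and p' = partner[OF g'(1,2), folded \<nu>_def]
  have sums: "\<mu> + \<nu> = \<delta>" "\<gamma> + \<mu> = \<gamma>'" by (simp_all add: \<mu>_def \<nu>_def \<delta>_def)
  have mu: "\<mu> \<in> \<Phi>" using root_diff g g' by (simp add: \<mu>_def ip_sym)
  have ips: "ip \<gamma> \<mu> = -1" "ip \<mu> \<nu> = -1" "ip \<gamma> \<nu> = 0" "ip \<gamma>' \<delta> = 0" "ip \<mu> \<alpha> = 0" "ip \<delta> \<gamma>' = 0" "ip \<delta> \<alpha> = 1"
    using g g' alpha by (simp_all add: \<mu>_def \<nu>_def \<delta>_def ip_simps ip_self ip_sym[of \<gamma>' \<gamma>] ip_sym[of \<alpha> \<gamma>'])
  have mua: "\<mu> \<noteq> \<alpha>" using ips alpha ip_self by auto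
  define G M W D X where "G = y \<gamma> a" and "M = y \<mu> u" and "W = y \<nu> v" and "D = y \<delta> ([N \<mu> \<nu>] \<cdot> (u \<otimes> v))"
    and "X = y \<gamma>' ([N \<gamma> \<mu>] \<cdot> (a \<otimes> u))"
  have nz: "\<mu> + \<nu> \<noteq> 0" "\<gamma> + \<mu> \<noteq> 0" using p g' root_nz sums by auto
  have MW: "cj M W = D + W" unfolding M_def W_def D_def
    using mu mua p' p J nz by (subst y_cj) (auto simp: sums)
  have GM: "cj G M = X + M" unfolding G_def M_def X_def
    using mu mua p' p J nz g g' by (subst y_cj) (auto simp: sums)
  have GW: "cj G W = W" unfolding G_def W_def
    using p p' g ips J by (intro y_fix) auto
  have XD: "cj X D = D" unfolding X_def D_def
    using p p' g' ips J by (intro y_fix) auto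
  have Y': "Y \<gamma>' ([N \<gamma> \<mu>] \<cdot> (a \<otimes> u)) v = cj X W - W" by (simp add: Y_def X_def W_def \<nu>_def)
  \<comment> \<open>\<open>D\<close> is the commutator of \<open>M\<close> and \<open>W\<close>.
    Conjugation by \<open>G\<close> fixes \<open>W\<close> and turns \<open>M\<close> into
    \<open>X + M\<close>, so it produces the commutator of \<open>X\<close> and
    \<open>W\<close>.\<close>
  have "D = cj M W - W" using MW by simp
  then have "cj G D = cj (X + M) W - W" by (simp add: cj_diff cj_nat GM GW)
  also have "\<dots> = cj X (D + W) - W" by (simp add: cj_cj MW)
  also have "\<dots> = D + (cj X W - W)" by (simp add: cj_add XD add_diff_eq)
  finally have "cj G D - D = cj D (cj X W - W)" by (simp add: cj_def[of D])
  also have "\<dots> = cj X W - W" unfolding Y'[symmetric] D_def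
    using p g' ips J by (intro Y_fix) auto
  finally show ?thesis using Y' by (simp add: Y_def G_def D_def \<mu>_def \<nu>_def \<delta>_def)
qed

lemma N_N: "\<lbrakk>\<gamma> \<in> \<Phi>; \<delta> \<in> \<Phi>; \<gamma> + \<delta> \<in> \<Phi>\<rbrakk> \<Longrightarrow> N \<gamma> \<delta> * N \<gamma> \<delta> = 1"
  using N_unit[of \<gamma> \<delta>] by auto

lemma partner_N:
  assumes "\<gamma> \<in> \<Phi>" "ip \<gamma> \<alpha> = 1"
  shows "N \<gamma> (\<alpha> - \<gamma>) * N \<gamma> (\<alpha> - \<gamma>) = 1" "N (\<alpha> - \<gamma>) \<gamma> = - N \<gamma> (\<alpha> - \<gamma>)"
    "N \<gamma> (\<alpha> - \<gamma>) = 1 \<or> N \<gamma> (\<alpha> - \<gamma>) = -1"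
  using N_N[of \<gamma> "\<alpha> - \<gamma>"] N_anti[of \<gamma> "\<alpha> - \<gamma>"] N_unit[of \<gamma> "\<alpha> - \<gamma>"] partner[OF assms] assms alpha by auto

text \<open>These are the roots that \<open>Y_act\<close> leaves out. Along \<epsilon> = \<mu> +
  \<nu> with \<mu> adjacent to \<epsilon>, the element \<open>y \<epsilon> d\<close> is a commutator
  of two elements to which \<open>Y_fix\<close> applies.\<close>

lemma y_fix_Y:
  assumes g: "\<gamma> \<in> \<Phi>" "ip \<gamma> \<alpha> = 1" and e: "\<epsilon> = \<gamma> \<or> \<epsilon> = \<alpha> - \<gamma>" and J: "a \<in> J" "b \<in> J" "d \<in> J"
  shows "cj (y \<epsilon> d) (Y \<gamma> a b) = Y \<gamma> a b"
proof -
  note p = partner[OF g]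
  have eP: "\<epsilon> \<in> \<Phi>" "ip \<epsilon> \<alpha> = 1" "\<epsilon> \<noteq> \<alpha>" using e g p by auto
  obtain \<mu> where mu: "\<mu> \<in> \<Phi>" "ip \<mu> \<alpha> = 1" "ip \<mu> \<epsilon> = 1" using ex_adjacent[OF alpha eP(1,2)] by auto
  define \<nu> where "\<nu> = \<epsilon> - \<mu>"
  have nu: "\<nu> \<in> \<Phi>" "ip \<nu> \<alpha> = 0" using root_diff[OF eP(1) mu(1)] mu eP by (simp_all add: \<nu>_def ip_sym ip_simps)
  have mug: "ip \<mu> \<gamma> = 0 \<or> ip \<mu> \<gamma> = 1" using e mu by (auto simp: ip_simps)
  have nug: "ip \<nu> \<gamma> = -1 \<or> ip \<nu> \<gamma> = 1"
    using e mu g p ip_self[OF g(1)] ip_sym[of "\<alpha> - \<gamma>" \<gamma>] by (auto simp: ip_simps \<nu>_def)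
  have sum: "\<mu> + \<nu> = \<epsilon>" by (simp add: \<nu>_def)
  have nn: "\<mu> \<noteq> \<alpha>" "\<nu> \<noteq> \<alpha>" "\<epsilon> \<noteq> 0" using mu nu alpha ip_self eP root_nz by auto
  obtain q d' where q: "q \<in> J" "d' \<in> J" "d = q \<otimes> d'" using factor[OF J(3)] by blast
  define n where "n = N \<mu> \<nu>"
  have "n * n = 1" unfolding n_def using N_N[OF mu(1) nu(1)] eP sum by simp
  then have d: "d = [n] \<cdot> (q \<otimes> ([n] \<cdot> d'))" using q by (simp add: coef_simps)
  have "cj (y \<mu> q) (y \<nu> ([n] \<cdot> d')) = y \<epsilon> d + y \<nu> ([n] \<cdot> d')"
    using y_cj[of \<mu> \<nu> q "[n] \<cdot> d'"] mu nu nn q eP unfolding sum n_def[symmetric] by (simp flip: d)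
  then have "y \<epsilon> d = cj (y \<mu> q) (y \<nu> ([n] \<cdot> d')) - y \<nu> ([n] \<cdot> d')" by simp
  moreover have "cj (y \<mu> q) (Y \<gamma> a b) = Y \<gamma> a b" "cj (y \<nu> ([n] \<cdot> d')) (Y \<gamma> a b) = Y \<gamma> a b"
    using g mu nu mug nug J q by (auto intro!: Y_fix)
  ultimately show ?thesis by (simp add: fix_commutator)
qed

text \<open>The commutator of g with hk is that of g with h times the conjugate by h of that of g
  with k, and by \<open>y_fix_Y\<close> this conjugation is trivial.\<close>

lemma Y_add_right:
  assumes g: "\<gamma> \<in> \<Phi>" "ip \<gamma> \<alpha> = 1" and J: "a \<in> J" "b \<in> J" "b' \<in> J"
  shows "Y \<gamma> a (b \<oplus> b') = Y \<gamma> a b + Y \<gamma> a b'"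
proof -
  define \<delta> where "\<delta> = \<alpha> - \<gamma>"
  have Yd: "Y \<gamma> a b = cj (y \<gamma> a) (y \<delta> b) - y \<delta> b" for a b by (simp add: Y_def \<delta>_def)
  have "Y \<gamma> a (b \<oplus> b') = cj (y \<gamma> a) (y \<delta> b) + cj (y \<gamma> a) (y \<delta> b') - (y \<delta> b + y \<delta> b')"
    using g J partner[OF g] by (simp add: Y_def y_add cj_add \<delta>_def)
  also have "\<dots> = Y \<gamma> a b + cj (y \<delta> b) (Y \<gamma> a b')"
    by (simp only: Yd cj_def group_norm)
  also have "\<dots> = Y \<gamma> a b + Y \<gamma> a b'"
    using y_fix_Y[OF g, of \<delta> a b' b] J by (simp add: \<delta>_def)
  finally show ?thesis .
qed

lemma Y_minus:
  assumes g: "\<gamma> \<in> \<Phi>" "ip \<gamma> \<alpha> = 1" and J: "a \<in> J" "b \<in> J"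
  shows "Y \<gamma> a (\<ominus> b) = - Y \<gamma> a b"
proof -
  have "y (\<alpha> - \<gamma>) \<zero> + y (\<alpha> - \<gamma>) \<zero> = y (\<alpha> - \<gamma>) \<zero>"
    using y_add[of "\<alpha> - \<gamma>" \<zero> \<zero>] partner[OF g] by simp
  then have "y (\<alpha> - \<gamma>) \<zero> = 0" by (rule double_eq)
  then have "Y \<gamma> a \<zero> = 0" by (simp add: Y_def)
  then have "Y \<gamma> a (\<ominus> b) + Y \<gamma> a b = 0"
    using Y_add_right[OF g, of a "\<ominus> b" b] J by (simp add: l_neg)
  then show ?thesis by (simp add: eq_neg_iff_add_eq_0)
qed

section \<open>Independence of the element at the missing root from its factorisation\<close>

definition Z :: "'e \<Rightarrow> 'a \<Rightarrow> 'a \<Rightarrow> 'g" where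
  "Z \<gamma> a b = Y \<gamma> ([N \<gamma> (\<alpha> - \<gamma>)] \<cdot> a) b"

lemma Y_eq_Z:
  assumes g: "\<gamma> \<in> \<Phi>" "ip \<gamma> \<alpha> = 1" and J: "a \<in> J" "b \<in> J"
  shows "Y \<gamma> a b = Z \<gamma> ([N \<gamma> (\<alpha> - \<gamma>)] \<cdot> a) b"
  using partner_N[OF g] J by (simp add: Z_def coef_simps)

text \<open>The normalisation by \<open>N \<gamma> (\<alpha> - \<gamma>)\<close> makes
  \<open>a \<otimes> b\<close> the intended coefficient of \<open>Z \<gamma> a b\<close>. By
  \<open>N_assoc\<close> this removes all signs from \<open>Y_shift\<close>.\<close>

lemma Z_shift:
  assumes g: "\<gamma> \<in> \<Phi>" "ip \<gamma> \<alpha> = 1" and g': "\<gamma>' \<in> \<Phi>" "ip \<gamma>' \<alpha> = 1" "ip \<gamma> \<gamma>' = 1"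
    and J: "a \<in> J" "u \<in> J" "v \<in> J"
  shows "Z \<gamma> a (u \<otimes> v) = Z \<gamma>' (a \<otimes> u) v"
proof -
  define \<mu> \<nu> \<delta> where "\<mu> = \<gamma>' - \<gamma>" and "\<nu> = \<alpha> - \<gamma>'" and "\<delta> = \<alpha> - \<gamma>"
  note p = partner[OF g, folded \<delta>_def] and p' = partner[OF g'(1,2), folded \<nu>_def]
  have sums: "\<mu> + \<nu> = \<delta>" "\<gamma> + \<mu> = \<gamma>'" by (simp_all add: \<mu>_def \<nu>_def \<delta>_def)
  have mu: "\<mu> \<in> \<Phi>" using root_diff g g' by (simp add: \<mu>_def ip_sym)
  have ips: "ip \<gamma> \<mu> = -1" "ip \<mu> \<nu> = -1" "ip \<gamma> \<nu> = 0"
    using g g' alpha by (simp_all add: \<mu>_def \<nu>_def \<delta>_def ip_simps ip_self ip_sym[of \<gamma>' \<gamma>] ip_sym[of \<alpha> \<gamma>'])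
  have mn: "N \<mu> \<nu> * N \<mu> \<nu> = 1" "N \<gamma> \<mu> * N \<gamma> \<mu> = 1"
    using N_N mu p p' g g' sums by auto
  have "N \<gamma> \<mu> * N \<gamma>' \<nu> = N \<mu> \<nu> * N \<gamma> \<delta>"
    using N_assoc[of \<gamma> \<mu> \<nu>] g mu p' ips sums by simp
  then have "N \<gamma> \<mu> * (N \<gamma> \<mu> * N \<gamma>' \<nu>) = N \<gamma> \<mu> * (N \<mu> \<nu> * N \<gamma> \<delta>)" by simp
  then have N': "N \<gamma>' \<nu> = N \<gamma> \<mu> * (N \<mu> \<nu> * N \<gamma> \<delta>)" using mn by (simp flip: mult.assoc)
  have "Z \<gamma> a (u \<otimes> v) = Y \<gamma> ([N \<gamma> \<delta>] \<cdot> a) ([N \<mu> \<nu>] \<cdot> (([N \<mu> \<nu>] \<cdot> u) \<otimes> v))"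
    using J mn by (simp add: Z_def \<delta>_def coef_simps)
  also have "\<dots> = Y \<gamma>' ([N \<gamma> \<mu>] \<cdot> (([N \<gamma> \<delta>] \<cdot> a) \<otimes> ([N \<mu> \<nu>] \<cdot> u))) v"
    unfolding \<mu>_def \<nu>_def using Y_shift[OF g g'] J by simp
  also have "[N \<gamma> \<mu>] \<cdot> (([N \<gamma> \<delta>] \<cdot> a) \<otimes> ([N \<mu> \<nu>] \<cdot> u)) = [N \<gamma>' \<nu>] \<cdot> (a \<otimes> u)"
    using J by (simp add: N' coef_simps mult.commute)
  finally show ?thesis by (simp add: Z_def \<nu>_def)
qed

text \<open>Going to an adjacent decomposition and back moves two factors across without changing
  \<gamma>. Common factors of \<open>b\<close> and \<open>b'\<close> are therefore moved to the left
  entry, and what remains to be compared is made equal by cancellation.\<close>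

lemma Z_cong:
  assumes g: "\<gamma> \<in> \<Phi>" "ip \<gamma> \<alpha> = 1" and J: "a \<in> J" "b \<in> J" "a' \<in> J" "b' \<in> J" and eq: "a \<otimes> b = a' \<otimes> b'"
  shows "Z \<gamma> a b = Z \<gamma> a' b'"
proof -
  obtain \<gamma>' where g': "\<gamma>' \<in> \<Phi>" "ip \<gamma>' \<alpha> = 1" "ip \<gamma>' \<gamma> = 1" using ex_adjacent[OF alpha g] by blast
  then have g'': "ip \<gamma> \<gamma>' = 1" by (simp add: ip_sym)
  have shift: "Z \<gamma> s (t \<otimes> (u \<otimes> v)) = Z \<gamma> (s \<otimes> t \<otimes> u) v" if "s \<in> J" "t \<in> J" "u \<in> J" "v \<in> J" for s t u v
    using Z_shift[OF g g'(1,2) g'', of s t "u \<otimes> v"] Z_shift[OF g'(1,2) g g'(3), of "s \<otimes> t" u v] that by simp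
  \<comment> \<open>Two common factors are split off because the shift there and back moves two
    factors at a time. Both are regular on \<open>J\<close>, so
    \<open>a \<otimes> b = a' \<otimes> b'\<close> implies
    \<open>a \<otimes> d = a' \<otimes> d'\<close>.\<close>
  obtain p c c' where p: "p \<in> J" "\<forall>c\<in>J. p \<otimes> c = \<zero> \<longrightarrow> c = \<zero>" "c \<in> J" "b = p \<otimes> c" "c' \<in> J" "b' = p \<otimes> c'"
    using common_factor[OF J(2,4)] by blast
  obtain r d d' where r: "r \<in> J" "\<forall>c\<in>J. r \<otimes> c = \<zero> \<longrightarrow> c = \<zero>" "d \<in> J" "c = r \<otimes> d" "d' \<in> J" "c' = r \<otimes> d'"
    using common_factor[OF p(3,5)] by blast
  define s t where "s = a \<otimes> d" and "t = a' \<otimes> d'"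
  have st: "s \<in> J" "t \<in> J" using J r by (simp_all add: s_def t_def)
  have "p \<otimes> (r \<otimes> s) = a \<otimes> b" "p \<otimes> (r \<otimes> t) = a' \<otimes> b'"
    unfolding s_def t_def p(4,6) r(4,6) using J p(1) r(1,3,5) by (simp_all add: m_ac)
  then have "p \<otimes> (r \<otimes> (s \<ominus> t)) = \<zero>"
    using eq st p(1) r(1) J by (simp add: minus_eq r_distr r_minus r_neg)
  moreover have "s \<ominus> t \<in> J" using st by (simp add: minus_eq)
  ultimately have "s \<ominus> t = \<zero>" using p(1,2) r(1,2) by (meson J_carr J_mult(1))
  then have "s = t" using st minus_equality[of s "\<ominus> t"] by (simp add: minus_eq)
  then have e: "a \<otimes> d = a' \<otimes> d'" by (simp add: s_def t_def)
  have "Z \<gamma> a b = Z \<gamma> p (r \<otimes> (a \<otimes> d))"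
    unfolding p(4) r(4) using shift[of a p r d] shift[of p r a d] J p(1) r(1,3) by (simp add: m_ac)
  also have "\<dots> = Z \<gamma> p (r \<otimes> (a' \<otimes> d'))" by (simp add: e)
  also have "\<dots> = Z \<gamma> a' b'"
    unfolding p(6) r(6) using shift[of a' p r d'] shift[of p r a' d'] J p(1) r(1,5) by (simp add: m_ac)
  finally show ?thesis .
qed

text \<open>Exchanging the entries inverts the commutator, and \<open>N\<close> changes sign as
  well, so the two effects cancel. The exchanged coefficients have the same product, which is enough
  by \<open>Z_cong\<close>.\<close>

lemma Z_partner:
  assumes g: "\<gamma> \<in> \<Phi>" "ip \<gamma> \<alpha> = 1" and J: "a \<in> J" "b \<in> J"
  shows "Z (\<alpha> - \<gamma>) a b = Z \<gamma> a b"
proof -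
  define \<delta> n where "\<delta> = \<alpha> - \<gamma>" and "n = N \<gamma> (\<alpha> - \<gamma>)"
  note n = partner_N[OF g, folded n_def \<delta>_def]
  have sw: "Y \<delta> c d = - Y \<gamma> d c" for c d
    unfolding Y_def \<delta>_def by (simp add: cj_def) (simp only: group_norm)
  have "Z \<delta> a b = - Y \<gamma> b ([(- n)] \<cdot> a)" using n by (simp add: Z_def sw) (simp add: \<delta>_def)
  also have "[(- n)] \<cdot> a = \<ominus> ([n] \<cdot> a)" using J by (simp add: add.int_pow_neg)
  also have "- Y \<gamma> b (\<ominus> ([n] \<cdot> a)) = Y \<gamma> b ([n] \<cdot> a)" using Y_minus[OF g, of b "[n] \<cdot> a"] J by simp
  also have "\<dots> = Z \<gamma> ([n] \<cdot> b) ([n] \<cdot> a)" using Y_eq_Z[OF g] J by (simp add: n_def)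
  also have "\<dots> = Z \<gamma> a b" using J n by (intro Z_cong[OF g]) (auto simp: coef_simps)
  finally show ?thesis by (simp add: \<delta>_def)
qed

text \<open>For adjacent \<gamma>, \<gamma>' a factor is moved by \<open>Z_shift\<close> and the
  coefficients are then rearranged by \<open>Z_cong\<close>. Every other pair becomes adjacent or
  equal after replacing \<gamma>' by \<open>\<alpha> - \<gamma>'\<close>.\<close>

lemma Z_indep:
  assumes g: "\<gamma> \<in> \<Phi>" "ip \<gamma> \<alpha> = 1" and g': "\<gamma>' \<in> \<Phi>" "ip \<gamma>' \<alpha> = 1" and J: "a \<in> J" "b \<in> J"
  shows "Z \<gamma> a b = Z \<gamma>' a b"
proof -
  have adj: "Z \<gamma> a b = Z \<gamma>' a b" if "ip \<gamma> \<gamma>' = 1" "\<gamma>' \<in> \<Phi>" "ip \<gamma>' \<alpha> = 1" for \<gamma>'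
  proof -
    obtain q b' where q: "q \<in> J" "b' \<in> J" "b = q \<otimes> b'" using factor J by blast
    have "Z \<gamma> a b = Z \<gamma>' (a \<otimes> q) b'" unfolding q(3) using Z_shift[OF g that(2,3,1)] J q by simp
    also have "\<dots> = Z \<gamma>' a b" using that J q by (intro Z_cong) (auto simp: m_ac)
    finally show ?thesis .
  qed
  have "\<gamma> \<noteq> - \<gamma>'" using g g' by auto
  then consider "ip \<gamma> \<gamma>' = -1" | "ip \<gamma> \<gamma>' = 0" | "ip \<gamma> \<gamma>' = 1" | "\<gamma> = \<gamma>'"
    using ip_int g g' by blast
  then show ?thesis
  proof cases
    case 1
    then have "ip \<gamma> (\<alpha> - \<gamma>') = 2" using g by (simp add: ip_simps)
    then have "\<gamma> = \<alpha> - \<gamma>'" using ip_2 g partner[OF g'] by blast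
    then show ?thesis using Z_partner[OF g' J] by simp
  next
    case 2
    then have "ip \<gamma> (\<alpha> - \<gamma>') = 1" using g by (simp add: ip_simps)
    then show ?thesis using adj[of "\<alpha> - \<gamma>'"] partner[OF g'] Z_partner[OF g' J] by simp
  qed (use adj g' in auto)
qed

text \<open>The choice does not matter, by \<open>Z_cong\<close> (regular common factors) and \<open>Z_indep\<close>.\<close>

definition completion :: "'e \<Rightarrow> 'a \<Rightarrow> 'g" where
  "completion \<gamma> c = (if \<gamma> = \<alpha> then
     (if c \<in> J then (SOME z. \<exists>\<gamma>\<in>\<Phi>. \<exists>a\<in>J. \<exists>b\<in>J. ip \<gamma> \<alpha> = 1 \<and> c = a \<otimes> b \<and> z = Z \<gamma> a b) else 0)
     else y \<gamma> c)"

lemma completion_other: "\<gamma> \<noteq> \<alpha> \<Longrightarrow> completion \<gamma> = y \<gamma>"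
  by (auto simp: completion_def)

lemma completion_prod:
  assumes g: "\<gamma> \<in> \<Phi>" "ip \<gamma> \<alpha> = 1" and J: "a \<in> J" "b \<in> J"
  shows "completion \<alpha> (a \<otimes> b) = Z \<gamma> a b"
proof -
  define P where "P z \<longleftrightarrow> (\<exists>\<gamma>'\<in>\<Phi>. \<exists>a'\<in>J. \<exists>b'\<in>J. ip \<gamma>' \<alpha> = 1 \<and> a \<otimes> b = a' \<otimes> b' \<and> z = Z \<gamma>' a' b')" for z
  have "P (Z \<gamma> a b)" unfolding P_def using g J by blast
  then have "P (SOME z. P z)" by (rule someI)
  moreover have "completion \<alpha> (a \<otimes> b) = (SOME z. P z)" using J by (simp add: completion_def P_def)
  ultimately have "P (completion \<alpha> (a \<otimes> b))" by simp
  then obtain \<gamma>' a' b' where "\<gamma>' \<in> \<Phi>" "ip \<gamma>' \<alpha> = 1" "a' \<in> J" "b' \<in> J" "a \<otimes> b = a' \<otimes> b'"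
    "completion \<alpha> (a \<otimes> b) = Z \<gamma>' a' b'"
    unfolding P_def by blast
  then show ?thesis using Z_cong[of \<gamma>' a b a' b'] Z_indep[OF g, of \<gamma>' a b] J by simp
qed

lemma completion_act:
  assumes e: "\<epsilon> \<in> \<Phi>" "\<epsilon> \<noteq> \<alpha>" "\<epsilon> \<noteq> - \<alpha>" and J: "d \<in> J" "c \<in> J"
  shows "cj (y \<epsilon> d) (completion \<alpha> c) = y (\<epsilon> + \<alpha>) ([N \<epsilon> \<alpha>] \<cdot> (d \<otimes> c)) + completion \<alpha> c"
proof -
  \<comment> \<open>Since \<gamma> may be chosen freely, a decomposition of \<alpha> that avoids
    \<epsilon> up to sign is taken; \<open>Y_act\<close> then applies.\<close>
  obtain \<gamma> where g: "\<gamma> \<in> \<Phi>" "ip \<gamma> \<alpha> = 1" "\<epsilon> \<notin> {\<gamma>, - \<gamma>, \<alpha> - \<gamma>, - (\<alpha> - \<gamma>)}"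
    using ex_decomposition[OF alpha e(2,3)] by auto
  obtain a b where ab: "a \<in> J" "b \<in> J" "c = a \<otimes> b" using factor J by blast
  then show ?thesis using Y_act[OF g(1,2) e(1) g(3) e(2,3), of "[N \<gamma> (\<alpha> - \<gamma>)] \<cdot> a" b d] J
      completion_prod[OF g(1,2) ab(1,2)] partner_N[OF g(1,2)]
    by (simp add: Z_def coef_simps)
qed

theorem completion_rep: "steinberg_rep \<Phi> N V J completion"
  unfolding steinberg_rep_def
proof (intro conjI ballI allI impI)
  fix \<gamma> a assume "\<gamma> \<notin> \<Phi> \<or> a \<notin> J"
  then show "completion \<gamma> a = 0" using alpha y_outside by (auto simp: completion_def)
next
  fix \<gamma> a b assume g: "\<gamma> \<in> \<Phi>" and J: "a \<in> J" "b \<in> J"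
  obtain \<gamma>0 where g0: "\<gamma>0 \<in> \<Phi>" "ip \<gamma>0 \<alpha> = 1" using ex_neighbour alpha by blast
  show "completion \<gamma> (a \<oplus> b) = completion \<gamma> a + completion \<gamma> b"
  proof (cases "\<gamma> = \<alpha>")
    case True
    \<comment> \<open>With a common left factor, additivity in the coefficient becomes additivity of
      \<open>Z\<close> in its right entry.\<close>
    obtain q a' b' where q: "q \<in> J" "a' \<in> J" "a = q \<otimes> a'" "b' \<in> J" "b = q \<otimes> b'"
      using common_factor[OF J] by blast
    then have "a \<oplus> b = q \<otimes> (a' \<oplus> b')" by (simp add: r_distr)
    then show ?thesis using q Y_add_right[OF g0, of _ a' b']
      by (simp add: True completion_prod[OF g0]) (simp add: Z_def)
  qed (use y_add g J in \<open>simp add: completion_other\<close>)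
next
  fix \<gamma> \<delta> a b assume g: "\<gamma> \<in> \<Phi>" "\<delta> \<in> \<Phi>" and J: "a \<in> J" "b \<in> J" and nz: "\<gamma> + \<delta> \<noteq> 0"
  obtain \<gamma>0 where g0: "\<gamma>0 \<in> \<Phi>" "ip \<gamma>0 \<alpha> = 1" using ex_neighbour alpha by blast
  \<comment> \<open>The relation with \<alpha> as the first root follows from
    \<open>completion_act\<close>, where it is the second, by solving for the other conjugate and
    using the antisymmetry of \<open>N\<close>.\<close>
  have act': "cj (completion \<alpha> c) (y \<epsilon> d) = y (\<alpha> + \<epsilon>) ([N \<alpha> \<epsilon>] \<cdot> (c \<otimes> d)) + y \<epsilon> d"
    if e: "\<epsilon> \<in> \<Phi>" "\<epsilon> \<noteq> \<alpha>" "\<epsilon> \<noteq> - \<alpha>" and J: "d \<in> J" "c \<in> J" for \<epsilon> c d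
  proof -
    define A D T where "A = completion \<alpha> c" and "D = y \<epsilon> d" and "T = y (\<epsilon> + \<alpha>) ([N \<epsilon> \<alpha>] \<cdot> (d \<otimes> c))"
    have "cj D A = T + A" using completion_act[OF e J] by (simp add: A_def D_def T_def)
    then have "D + A = T + A + D" by (simp add: cj_def diff_eq_eq)
    then have "A + D = - T + (D + A)" by (simp only: group_norm)
    then have "cj A D = - T + D" by (simp add: cj_def diff_eq_eq add.assoc)
    moreover have "- T = y (\<alpha> + \<epsilon>) ([N \<alpha> \<epsilon>] \<cdot> (c \<otimes> d))"
    proof (cases "\<epsilon> + \<alpha> \<in> \<Phi>")
      case True
      have "N \<alpha> \<epsilon> = - N \<epsilon> \<alpha>" using N_anti e alpha True by auto
      then have "[N \<alpha> \<epsilon>] \<cdot> (c \<otimes> d) = \<ominus> ([N \<epsilon> \<alpha>] \<cdot> (d \<otimes> c))" using J by (simp add: add.int_pow_neg m_comm)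
      moreover have "\<epsilon> + \<alpha> \<noteq> \<alpha>" using e root_nz by auto
      ultimately show ?thesis using y_minus[of "\<epsilon> + \<alpha>"] J by (simp add: T_def add.commute)
    next
      case False
      then have "\<alpha> + \<epsilon> \<notin> \<Phi>" by (simp add: add.commute)
      with False show ?thesis by (simp add: T_def y_outside)
    qed
    ultimately show ?thesis by (simp add: A_def D_def)
  qed
  have neq: "\<epsilon> \<noteq> - \<alpha> \<and> \<alpha> + \<epsilon> \<noteq> \<alpha> \<and> \<epsilon> + \<alpha> \<noteq> \<alpha>" if "\<epsilon> \<in> \<Phi>" "\<epsilon> + \<alpha> \<noteq> 0" for \<epsilon>
    using that root_nz by auto
  consider "\<gamma> \<noteq> \<alpha>" "\<delta> \<noteq> \<alpha>" "\<gamma> + \<delta> \<noteq> \<alpha>" | "\<gamma> \<noteq> \<alpha>" "\<delta> \<noteq> \<alpha>" "\<gamma> + \<delta> = \<alpha>"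
    | "\<gamma> \<noteq> \<alpha>" "\<delta> = \<alpha>" | "\<gamma> = \<alpha>" "\<delta> \<noteq> \<alpha>" | "\<gamma> = \<alpha>" "\<delta> = \<alpha>" by blast
  then show "cj (completion \<gamma> a) (completion \<delta> b) = completion (\<gamma> + \<delta>) ([N \<gamma> \<delta>] \<cdot> (a \<otimes> b)) + completion \<delta> b"
  proof cases
    case 1
    then show ?thesis using y_cj g J nz by (simp add: completion_other)
  next
    case 2
    have "ip \<gamma> \<delta> = -1" using root_sum g alpha 2 by auto
    then have i: "ip \<gamma> \<alpha> = 1" using 2(3) ip_self g by (auto simp: ip_simps simp flip: 2(3))
    have d: "\<delta> = \<alpha> - \<gamma>" using 2 by auto
    have "completion \<alpha> ([N \<gamma> \<delta>] \<cdot> (a \<otimes> b)) = Y \<gamma> a b"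
      using completion_prod[OF g(1) i, of "[N \<gamma> \<delta>] \<cdot> a" b] Y_eq_Z[OF g(1) i J] J
      by (simp add: coef_simps d)
    then show ?thesis using 2 by (simp add: completion_other) (simp add: Y_def d)
  next
    case 3
    then show ?thesis using completion_act[of \<gamma> a b] g J nz neq[of \<gamma>] by (simp add: completion_other)
  next
    case 4
    then show ?thesis using act'[of \<delta> b a] g J nz neq[of \<delta>] by (simp add: completion_other add.commute)
  next
    case 5
    have "\<alpha> + \<alpha> \<notin> \<Phi>" using root_sum[OF alpha alpha] ip_self[OF alpha] by simp
    moreover have "\<alpha> + \<alpha> \<noteq> \<alpha>" using root_nz alpha by simp
    moreover have "cj (completion \<alpha> a) (completion \<alpha> b) = completion \<alpha> b"
    proof -
      \<comment> \<open>The second element at \<alpha> is a commutator of elements at \<gamma>0 and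
        \<alpha> - \<gamma>0, and the first one commutes with both of these because neither root
        gives a root when added to \<alpha>.\<close>
      obtain u v where uv: "u \<in> J" "v \<in> J" "b = u \<otimes> v" using factor J by blast
      have f: "cj (completion \<alpha> a) (y \<mu> d) = y \<mu> d" if "\<mu> \<in> \<Phi>" "ip \<mu> \<alpha> = 1" "d \<in> J" for \<mu> d
      proof -
        have "\<alpha> + \<mu> \<notin> \<Phi>" using root_sum[OF alpha that(1)] that(2) by (simp add: ip_sym)
        then show ?thesis using act'[of \<mu> d a] that J partner[OF that(1,2)] by (simp add: y_outside)
      qed
      show ?thesis using uv g0 partner[OF g0]
        by (simp add: completion_prod[OF g0]) (simp add: Z_def Y_def cj_diff cj_nat f)
    qed
    ultimately show ?thesis using 5 by (simp add: completion_other y_outside)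
  qed
qed

end

section \<open>Conjugation by elements with coefficients outside the ideal\<close>

context steinberg_core begin

abbreviation rep :: "('e \<Rightarrow> 'a \<Rightarrow> 'g::group_add) \<Rightarrow> bool" where
  "rep \<equiv> steinberg_rep \<Phi> N V J"

lemma rep_outside: "rep x \<Longrightarrow> \<gamma> \<notin> \<Phi> \<or> a \<notin> J \<Longrightarrow> x \<gamma> a = 0"
  unfolding steinberg_rep_def by blast

lemma rep_add: "\<lbrakk>rep x; \<gamma> \<in> \<Phi>; a \<in> J; b \<in> J\<rbrakk> \<Longrightarrow> x \<gamma> (a \<oplus> b) = x \<gamma> a + x \<gamma> b"
  unfolding steinberg_rep_def by blast

lemma rep_cj: "\<lbrakk>rep x; \<gamma> \<in> \<Phi>; \<delta> \<in> \<Phi>; \<gamma> + \<delta> \<noteq> 0; a \<in> J; b \<in> J\<rbrakk> \<Longrightarrow>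
   cj (x \<gamma> a) (x \<delta> b) = x (\<gamma> + \<delta>) ([N \<gamma> \<delta>] \<cdot> (a \<otimes> b)) + x \<delta> b"
  unfolding steinberg_rep_def by blast

lemma sum_nz: "\<lbrakk>\<gamma> \<in> \<Phi>; \<delta> \<in> \<Phi>; ip \<gamma> \<delta> \<noteq> -2\<rbrakk> \<Longrightarrow> \<gamma> + \<delta> \<noteq> 0"
  using ip_self by (auto simp: add_eq_0_iff)

lemma rep_fix: "\<lbrakk>rep x; \<gamma> \<in> \<Phi>; \<delta> \<in> \<Phi>; ip \<gamma> \<delta> \<ge> 0; a \<in> J; b \<in> J\<rbrakk> \<Longrightarrow> cj (x \<gamma> a) (x \<delta> b) = x \<delta> b"
  using rep_cj[of x \<gamma> \<delta> a b] sum_nz[of \<gamma> \<delta>] root_sum[of \<gamma> \<delta>] by (simp add: rep_outside)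

lemma rep_zero: "rep x \<Longrightarrow> x \<gamma> \<zero> = 0"
  using rep_add[of x \<gamma> \<zero> \<zero>] double_eq[of "x \<gamma> \<zero>"] rep_outside[of x \<gamma>] by fastforce

lemma rep_minus: "\<lbrakk>rep x; a \<in> J\<rbrakk> \<Longrightarrow> x \<gamma> (\<ominus> a) = - x \<gamma> a"
proof (cases "\<gamma> \<in> \<Phi>")
  case True
  assume x: "rep x" and a: "a \<in> J"
  have "x \<gamma> (\<ominus> a) + x \<gamma> a = x \<gamma> (\<ominus> a \<oplus> a)" using True x a by (simp add: rep_add)
  also have "\<dots> = 0" using a x by (simp add: l_neg rep_zero)
  finally show ?thesis by (simp add: eq_neg_iff_add_eq_0)
qed (simp add: rep_outside)

text \<open>Every coefficient in \<open>J\<close> is a product of two others, so the element at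
  \<tau> is a commutator of elements at \<mu> and \<tau> - \<mu>. Values outside \<open>T\<close>
  thus determine those inside.\<close>

lemma rep_cong:
  fixes y y' :: "'e \<Rightarrow> 'a \<Rightarrow> 'g::group_add"
  assumes y: "rep y" "rep y'" and agree: "\<And>\<gamma> a. \<lbrakk>\<gamma> \<in> \<Phi>; \<gamma> \<notin> T; a \<in> J\<rbrakk> \<Longrightarrow> y \<gamma> a = y' \<gamma> a"
    and T: "\<And>\<tau>. \<lbrakk>\<tau> \<in> \<Phi>; \<tau> \<in> T\<rbrakk> \<Longrightarrow> \<exists>\<mu>\<in>\<Phi>. ip \<mu> \<tau> = 1 \<and> \<mu> \<notin> T \<and> \<tau> - \<mu> \<notin> T"
  shows "y = y'"
proof (intro ext)
  fix \<tau> a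
  consider "\<tau> \<notin> \<Phi> \<or> a \<notin> J" | "\<tau> \<in> \<Phi>" "\<tau> \<notin> T" "a \<in> J" | "\<tau> \<in> \<Phi>" "\<tau> \<in> T" "a \<in> J" by blast
  then show "y \<tau> a = y' \<tau> a"
  proof cases
    case 3
    then obtain \<mu> where mu: "\<mu> \<in> \<Phi>" "ip \<mu> \<tau> = 1" "\<mu> \<notin> T" "\<tau> - \<mu> \<notin> T" using T by blast
    define \<nu> n where "\<nu> = \<tau> - \<mu>" and "n = N \<mu> \<nu>"
    have nu: "\<nu> \<in> \<Phi>" "\<nu> \<notin> T" using root_diff[OF 3(1) mu(1)] mu by (simp_all add: \<nu>_def ip_sym)
    have sum: "\<mu> + \<nu> = \<tau>" by (simp add: \<nu>_def)
    have "n = 1 \<or> n = -1" using N_unit[OF mu(1) nu(1)] 3 sum by (simp add: n_def)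
    then have n: "n * n = 1" by auto
    obtain q a' where q: "q \<in> J" "a' \<in> J" "a = q \<otimes> a'" using factor[OF 3(3)] by blast
    then have a: "a = [n] \<cdot> (q \<otimes> ([n] \<cdot> a'))" using n by (simp add: coef_simps)
    have *: "z \<tau> a = cj (z \<mu> q) (z \<nu> ([n] \<cdot> a')) - z \<nu> ([n] \<cdot> a')" if "rep z" for z :: "'e \<Rightarrow> 'a \<Rightarrow> 'g"
      using rep_cj[OF that mu(1) nu(1), of q "[n] \<cdot> a'"] root_nz[OF 3(1)] q
      unfolding sum n_def[symmetric] by (simp flip: a)
    have "y \<mu> q = y' \<mu> q" "y \<nu> ([n] \<cdot> a') = y' \<nu> ([n] \<cdot> a')" using agree mu nu q by auto
    then show ?thesis unfolding *[OF y(1)] *[OF y(2)] by simp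
  qed (use agree rep_outside[OF y(1)] rep_outside[OF y(2)] in auto)
qed

lemma rep_conj:
  assumes "rep x" shows "rep (\<lambda>\<gamma> a. cj g (x \<gamma> a))"
  unfolding steinberg_rep_def
  using rep_outside[OF assms] rep_add[OF assms] rep_cj[OF assms]
  by (simp add: cj_add flip: cj_nat)

text \<open>Since \<open>x \<beta> c\<close> is not at hand as a group element, the relations among
  the would-be conjugates are verified by computation with structure constants, for all pairs that
  avoid -\<beta>.\<close>

lemma ex_shift:
  assumes x: "rep x" and b: "\<beta> \<in> \<Phi>" and c: "c \<in> carrier V"
  shows "\<exists>y. rep y \<and> (\<forall>\<gamma>\<in>\<Phi>. \<gamma> \<noteq> - \<beta> \<longrightarrow> (\<forall>a\<in>J. y \<gamma> a = x \<gamma> a + x (\<gamma> + \<beta>) ([N \<beta> \<gamma>] \<cdot> (c \<otimes> a))))"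
proof -
  define y where "y \<gamma> a = (if \<gamma> \<in> \<Phi> \<and> \<gamma> \<noteq> - \<beta> \<and> a \<in> J then x \<gamma> a + x (\<gamma> + \<beta>) ([N \<beta> \<gamma>] \<cdot> (c \<otimes> a)) else 0)" for \<gamma> a
  note fix_x = rep_fix[OF x] and cj_x = rep_cj[OF x]
  have y0: "y \<gamma> a = x \<gamma> a" if "\<gamma> \<in> \<Phi>" "ip \<gamma> \<beta> \<ge> 0" "a \<in> J" for \<gamma> a
  proof -
    have "\<gamma> \<noteq> - \<beta>" using that b ip_self by auto
    then show ?thesis using that root_sum[OF that(1) b] x by (simp add: y_def rep_outside)
  qed
  have y1: "y \<gamma> a = x \<gamma> a + x (\<gamma> + \<beta>) ([N \<beta> \<gamma>] \<cdot> (c \<otimes> a))" if "\<gamma> \<in> \<Phi>" "ip \<gamma> \<beta> = -1" "a \<in> J" for \<gamma> a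
  proof -
    have "\<gamma> \<noteq> - \<beta>" using that b ip_self by auto
    then show ?thesis using that by (simp add: y_def)
  qed
  have yout: "y \<gamma> a = 0" if "\<gamma> \<notin> \<Phi>" for \<gamma> a using that by (simp add: y_def)
  have yrel: "cj (y \<gamma> a) (y \<delta> b) = y (\<gamma> + \<delta>) ([N \<gamma> \<delta>] \<cdot> (a \<otimes> b)) + y \<delta> b"
    if g: "\<gamma> \<in> \<Phi>" "\<delta> \<in> \<Phi>" "\<gamma> \<noteq> - \<beta>" "\<delta> \<noteq> - \<beta>" "\<gamma> + \<delta> \<noteq> 0" "\<gamma> + \<delta> \<noteq> - \<beta>" and J: "a \<in> J" "b \<in> J" for \<gamma> \<delta> a b
  proof -
    define G G' D D' where "G = x \<gamma> a" and "G' = x (\<gamma> + \<beta>) ([N \<beta> \<gamma>] \<cdot> (c \<otimes> a))"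
      and "D = x \<delta> b" and "D' = x (\<delta> + \<beta>) ([N \<beta> \<delta>] \<cdot> (c \<otimes> b))"
    have self: "ip \<gamma> \<gamma> = 2" "ip \<delta> \<delta> = 2" "ip \<beta> \<beta> = 2" using g assms ip_self by auto
    have sy: "ip \<delta> \<gamma> = ip \<gamma> \<delta>" "ip \<beta> \<gamma> = ip \<gamma> \<beta>" "ip \<beta> \<delta> = ip \<delta> \<beta>" by (simp_all add: ip_sym)
    note ips = ip_simps self sy
    have nd: "\<gamma> \<noteq> - \<delta>" using g by (auto simp: add_eq_0_iff)
    have p: "ip \<gamma> \<beta> = -1 \<or> ip \<gamma> \<beta> = 0 \<or> ip \<gamma> \<beta> = 1 \<or> ip \<gamma> \<beta> = 2"
      and r: "ip \<delta> \<beta> = -1 \<or> ip \<delta> \<beta> = 0 \<or> ip \<delta> \<beta> = 1 \<or> ip \<delta> \<beta> = 2"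
      and s: "ip \<gamma> \<delta> = -1 \<or> ip \<gamma> \<delta> = 0 \<or> ip \<gamma> \<delta> = 1 \<or> ip \<gamma> \<delta> = 2"
      using ip_int'[OF g(1) assms(2)] ip_int'[OF g(2) assms(2)] ip_int'[OF g(1,2) nd] g by blast+
    have gb: "\<gamma> + \<beta> \<in> \<Phi>" if "ip \<gamma> \<beta> = -1" using root_sum g assms that by blast
    have db: "\<delta> + \<beta> \<in> \<Phi>" if "ip \<delta> \<beta> = -1" using root_sum g assms that by blast
    have gd: "\<gamma> + \<delta> \<in> \<Phi> \<longleftrightarrow> ip \<gamma> \<delta> = -1" using root_sum g by blast
    have GD: "cj G D = x (\<gamma> + \<delta>) ([N \<gamma> \<delta>] \<cdot> (a \<otimes> b)) + D" unfolding G_def D_def using g J by (intro cj_x) auto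
    have GD0: "cj G D = D" if "ip \<gamma> \<delta> \<ge> 0" unfolding G_def D_def using g J that by (intro fix_x) auto
    have GG': "cj G G' = G'" if "ip \<gamma> \<beta> = -1"
      unfolding G_def G'_def using g J c gb[OF that] that by (intro fix_x) (auto simp: ips)
    have yG: "y \<gamma> a = G + G'" if "ip \<gamma> \<beta> = -1" using y1[OF g(1) that] J by (simp add: G_def G'_def)
    have yG': "y \<gamma> a = G' + G" if "ip \<gamma> \<beta> = -1" using yG[OF that] GG'[OF that] by (simp add: cj_fix)
    have yD: "y \<delta> b = D + D'" if "ip \<delta> \<beta> = -1" using y1[OF g(2) that] J by (simp add: D_def D'_def)
    have G'D: "cj G' D = D" if "ip \<gamma> \<beta> = -1" "ip \<gamma> \<delta> + ip \<delta> \<beta> \<ge> 0"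
      unfolding G'_def D_def using g J c gb[OF that(1)] that by (intro fix_x) (auto simp: ips)
    have GD': "cj G D' = D'" if "ip \<delta> \<beta> = -1" "ip \<gamma> \<delta> + ip \<gamma> \<beta> \<ge> 0"
      unfolding D'_def G_def using g J c db[OF that(1)] that by (intro fix_x) (auto simp: ips)
    have G'D': "cj G' D' = D'" if "ip \<gamma> \<beta> = -1" "ip \<delta> \<beta> = -1" "ip \<gamma> \<delta> \<ge> 0"
      unfolding D'_def G'_def using g J c db[OF that(2)] gb[OF that(1)] that by (intro fix_x) (auto simp: ips)
    have ysum0: "y (\<gamma> + \<delta>) e = 0" if "ip \<gamma> \<delta> \<noteq> -1" for e using gd that yout by blast
    have ysum1: "y (\<gamma> + \<delta>) e = x (\<gamma> + \<delta>) e" if "ip \<gamma> \<delta> = -1" "ip \<gamma> \<beta> + ip \<delta> \<beta> \<ge> 0" "e \<in> J" for e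
      using gd that y0 by (simp add: ip_simps)
    define Z Z' X where "Z = x (\<gamma> + \<beta> + \<delta>) ([N (\<gamma> + \<beta>) \<delta>] \<cdot> (([N \<beta> \<gamma>] \<cdot> (c \<otimes> a)) \<otimes> b))"
      and "Z' = x (\<gamma> + (\<delta> + \<beta>)) ([N \<gamma> (\<delta> + \<beta>)] \<cdot> (a \<otimes> ([N \<beta> \<delta>] \<cdot> (c \<otimes> b))))"
      and "X = x (\<gamma> + \<delta>) ([N \<gamma> \<delta>] \<cdot> (a \<otimes> b))"
    have G'DZ: "cj G' D = Z + D" if "ip \<gamma> \<beta> = -1" "ip \<gamma> \<delta> + ip \<delta> \<beta> = -1"
      unfolding G'_def D_def Z_def using g J c gb[OF that(1)] that by (intro cj_x sum_nz) (auto simp: ips)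
    have GD'Z: "cj G D' = Z' + D'" if "ip \<delta> \<beta> = -1" "ip \<gamma> \<delta> + ip \<gamma> \<beta> = -1"
      unfolding D'_def G_def Z'_def using g J c db[OF that(1)] that by (intro cj_x sum_nz) (auto simp: ips)
    \<comment> \<open>Product -1 with \<beta> means that the element acquires an additional factor;
      the cases say which of the two elements do.\<close>
    consider "ip \<gamma> \<beta> \<ge> 0" "ip \<delta> \<beta> \<ge> 0" | "ip \<gamma> \<beta> = -1" "ip \<delta> \<beta> \<ge> 0" | "ip \<gamma> \<beta> \<ge> 0" "ip \<delta> \<beta> = -1"
      | "ip \<gamma> \<beta> = -1" "ip \<delta> \<beta> = -1" using p r by fastforce
    then show ?thesis
    proof cases
      case 1
      have yy: "y \<gamma> a = G" "y \<delta> b = D" using y0[OF g(1)] y0[OF g(2)] 1 J by (simp_all add: G_def D_def)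
      consider "ip \<gamma> \<delta> = -1" | "ip \<gamma> \<delta> \<ge> 0" using s by fastforce
      then show ?thesis
      proof cases
        case a: 1
        then show ?thesis unfolding yy using GD 1 J by (subst ysum1) auto
      next
        case a: 2
        then show ?thesis unfolding yy using GD0 by (subst ysum0) auto
      qed
    next
      case 2
      have D: "y \<delta> b = D" using y0[OF g(2)] 2 J by (simp add: D_def)
      consider "ip \<gamma> \<delta> = -1" "ip \<delta> \<beta> = 0" | "ip \<gamma> \<delta> = -1" "ip \<delta> \<beta> \<ge> 1" | "ip \<gamma> \<delta> \<ge> 0" using s r 2 by fastforce
      then show ?thesis
      proof cases
        case a: 1
        have r3: "\<gamma> + \<beta> + \<delta> \<in> \<Phi>" using root_sum[OF gb[OF 2(1)] g(2)] a 2 by (simp add: ips)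
        have "cj (y \<gamma> a) (y \<delta> b) = cj G' (X + D)" using GD unfolding yG'[OF 2(1)] D cj_cj X_def by simp
        also have "cj G' X = X" unfolding G'_def X_def
          using g J c gb[OF 2(1)] gd a 2 by (intro fix_x) (auto simp: ips)
        then have "cj G' (X + D) = X + Z + D" using G'DZ[OF 2(1)] a by (simp add: cj_add add.assoc)
        also have "X + Z = y (\<gamma> + \<delta>) ([N \<gamma> \<delta>] \<cdot> (a \<otimes> b))"
        proof -
          have "N \<beta> \<gamma> * N (\<beta> + \<gamma>) \<delta> = N \<gamma> \<delta> * N \<beta> (\<gamma> + \<delta>)" using g assms a 2 by (intro N_assoc) (auto simp: ips)
          then have "N (\<gamma> + \<beta>) \<delta> * N \<beta> \<gamma> = N \<beta> (\<gamma> + \<delta>) * N \<gamma> \<delta>" by (simp add: ac_simps)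
          moreover have e: "\<gamma> + \<beta> + \<delta> = \<gamma> + \<delta> + \<beta>" by (simp add: ac_simps)
          ultimately have "Z = x (\<gamma> + \<delta> + \<beta>) ([N \<beta> (\<gamma> + \<delta>)] \<cdot> (c \<otimes> ([N \<gamma> \<delta>] \<cdot> (a \<otimes> b))))"
            unfolding Z_def e using J c by (simp add: coef_simps)
          then show ?thesis using y1[of "\<gamma> + \<delta>"] gd a 2 J by (simp add: X_def ip_simps)
        qed
        finally show ?thesis by (simp add: D)
      next
        case a: 2
        then have "cj G' D = D" using G'D 2 by simp
        then show ?thesis unfolding yG[OF 2(1)] D cj_cj using a 2 GD J by (subst ysum1) auto
      next
        case a: 3
        then have "cj G' D = D" using G'D 2 by simp
        then show ?thesis unfolding yG[OF 2(1)] D cj_cj using a GD0 by (subst ysum0) auto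
      qed
    next
      case 3
      have G: "y \<gamma> a = G" using y0[OF g(1)] 3 J by (simp add: G_def)
      consider "ip \<gamma> \<delta> = -1" "ip \<gamma> \<beta> = 0" | "ip \<gamma> \<delta> = -1" "ip \<gamma> \<beta> \<ge> 1" | "ip \<gamma> \<delta> \<ge> 0" using s p 3 by fastforce
      then show ?thesis
      proof cases
        case a: 1
        have r3: "\<gamma> + (\<delta> + \<beta>) \<in> \<Phi>" using root_sum[OF g(1) db[OF 3(2)]] a 3 by (simp add: ips)
        have "cj D Z' = Z'" unfolding D_def Z'_def
          using g J c r3 a 3 by (intro fix_x) (auto simp: ips)
        then have DZ: "D + Z' = Z' + D" by (simp add: cj_fix)
        have "cj (y \<gamma> a) (y \<delta> b) = X + D + (Z' + D')"
          unfolding G yD[OF 3(2)] cj_add X_def using GD GD'Z[OF 3(2)] a by simp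
        also have "\<dots> = X + Z' + (D + D')" using DZ by (metis add.assoc)
        also have "X + Z' = y (\<gamma> + \<delta>) ([N \<gamma> \<delta>] \<cdot> (a \<otimes> b))"
        proof -
          have "N \<beta> \<delta> * N (\<beta> + \<delta>) \<gamma> = N \<delta> \<gamma> * N \<beta> (\<delta> + \<gamma>)" using g assms a 3 by (intro N_assoc) (auto simp: ips)
          moreover have "N (\<beta> + \<delta>) \<gamma> = - N \<gamma> (\<delta> + \<beta>)" using N_anti[OF g(1) db[OF 3(2)] r3] by (simp add: add.commute)
          moreover have "N \<delta> \<gamma> = - N \<gamma> \<delta>" using N_anti[OF g(1,2)] gd a by simp
          ultimately have "N \<gamma> (\<delta> + \<beta>) * N \<beta> \<delta> = N \<beta> (\<gamma> + \<delta>) * N \<gamma> \<delta>" by (simp add: ac_simps)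
          moreover have e: "\<gamma> + (\<delta> + \<beta>) = \<gamma> + \<delta> + \<beta>" by (simp add: ac_simps)
          ultimately have "Z' = x (\<gamma> + \<delta> + \<beta>) ([N \<beta> (\<gamma> + \<delta>)] \<cdot> (c \<otimes> ([N \<gamma> \<delta>] \<cdot> (a \<otimes> b))))"
            unfolding Z'_def e using J c by (simp add: coef_simps)
          then show ?thesis using y1[of "\<gamma> + \<delta>"] gd a 3 J by (simp add: X_def ip_simps)
        qed
        finally show ?thesis by (simp add: yD[OF 3(2)])
      next
        case a: 2
        then have "cj G D' = D'" using GD' 3 by simp
        then show ?thesis unfolding yD[OF 3(2)] G cj_add using a 3 GD J by (subst ysum1) (auto simp: add.assoc)
      next
        case a: 3
        then have "cj G D' = D'" using GD' 3 by simp
        then show ?thesis unfolding yD[OF 3(2)] G cj_add using a GD0 by (subst ysum0) auto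
      qed
    next
      case 4
      have "ip \<gamma> \<delta> \<noteq> -1"
      proof
        assume "ip \<gamma> \<delta> = -1"
        then have "\<gamma> + \<delta> \<in> \<Phi>" "ip (\<gamma> + \<delta>) \<beta> = -2" using gd 4 by (auto simp: ip_simps)
        then show False using ip_neg2 assms g by blast
      qed
      then consider "ip \<gamma> \<delta> = 0" | "ip \<gamma> \<delta> \<ge> 1" using s by fastforce
      then show ?thesis
      proof cases
        case a: 1
        have r3: "\<gamma> + \<beta> + \<delta> \<in> \<Phi>" using root_sum[OF gb[OF 4(1)] g(2)] a 4 by (simp add: ips)
        have r3': "\<gamma> + (\<delta> + \<beta>) \<in> \<Phi>" using root_sum[OF g(1) db[OF 4(2)]] a 4 by (simp add: ips)
        have "cj D Z = Z" "cj G Z = Z" unfolding D_def G_def Z_def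
          using g J c r3 a 4 by (auto intro!: fix_x simp: ips)
        then have DZ: "D + Z = Z + D" and GZ: "cj G Z = Z" by (simp_all add: cj_fix)
        \<comment> \<open>The root \<gamma> + \<beta> + \<delta> arises from moving either element.
          As \<gamma> + \<delta> is not a root, the two contributions have to cancel, and
          \<open>N_assoc\<close> together with antisymmetry provides the opposite signs.\<close>
        have ZZ: "Z' = - Z"
        proof -
          have "N \<gamma> \<beta> * N (\<gamma> + \<beta>) \<delta> = N \<beta> \<delta> * N \<gamma> (\<beta> + \<delta>)" using g assms a 4 by (intro N_assoc) (auto simp: ips)
          moreover have "N \<gamma> \<beta> = - N \<beta> \<gamma>" using N_anti[OF assms(2) g(1)] gb[OF 4(1)] by (simp add: add.commute)
          ultimately have n: "N \<gamma> (\<delta> + \<beta>) * N \<beta> \<delta> = - (N (\<gamma> + \<beta>) \<delta> * N \<beta> \<gamma>)" by (simp add: ac_simps)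
          have e: "\<gamma> + (\<delta> + \<beta>) = \<gamma> + \<beta> + \<delta>" by (simp add: ac_simps)
          have "Z' = x (\<gamma> + \<beta> + \<delta>) (\<ominus> ([(N (\<gamma> + \<beta>) \<delta> * N \<beta> \<gamma>)] \<cdot> (a \<otimes> (b \<otimes> c))))"
            unfolding Z'_def e using J c n by (simp add: coef_simps add.int_pow_neg)
          also have "\<dots> = - Z" unfolding Z_def using J c by (subst rep_minus[OF x]) (auto simp: coef_simps)
          finally show ?thesis .
        qed
        have "cj (y \<gamma> a) (y \<delta> b) = cj G (Z + D + D')"
          unfolding yG[OF 4(1)] yD[OF 4(2)] cj_cj cj_add using G'DZ[OF 4(1)] G'D'[OF 4] a 4 by (simp add: cj_add)
        also have "\<dots> = Z + D + (- Z + D')" unfolding cj_add using GZ GD0 GD'Z[OF 4(2)] a 4 ZZ by simp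
        also have "\<dots> = D + D'" by (simp only: DZ[symmetric] group_norm)
        finally show ?thesis unfolding yD[OF 4(2)] using a by (subst ysum0) auto
      next
        case a: 2
        then have "cj G D' = D'" "cj G D = D" "cj G' D = D" "cj G' D' = D'" using GD' GD0 G'D G'D' 4 by simp_all
        then show ?thesis unfolding yD[OF 4(2)] yG[OF 4(1)] cj_add cj_cj using a by (subst ysum0) auto
      qed
    qed
  qed
  \<comment> \<open>The one root at which no formula is available is -\<beta>; completing there
    yields the whole conjugated representation.\<close>
  interpret missing_root \<Phi> ip N J V "- \<beta>" y
  proof unfold_locales
    show "- \<beta> \<in> \<Phi>" using b root_neg by blast
  next
    fix \<gamma> a b assume a: "\<gamma> \<in> \<Phi>" "\<gamma> \<noteq> - \<beta>" "a \<in> J" "b \<in> J"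
    consider "ip \<gamma> \<beta> = -1" | "ip \<gamma> \<beta> \<ge> 0" using ip_int'[OF a(1) assms(2) a(2)] by auto
    then show "y \<gamma> (a \<oplus> b) = y \<gamma> a + y \<gamma> b"
    proof cases
      case 1
      have r: "\<gamma> + \<beta> \<in> \<Phi>" using root_sum a assms 1 by blast
      define G' where "G' e = x (\<gamma> + \<beta>) ([N \<beta> \<gamma>] \<cdot> (c \<otimes> e))" for e
      have "cj (G' a) (x \<gamma> b) = x \<gamma> b" unfolding G'_def
        using a c r 1 ip_self[OF a(1)] by (intro fix_x) (auto simp: ip_simps ip_sym[of \<beta> \<gamma>])
      then have cm: "G' a + x \<gamma> b = x \<gamma> b + G' a" by (simp add: cj_fix)
      have "G' (a \<oplus> b) = G' a + G' b" unfolding G'_def using a c r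
        by (subst rep_add[OF x r, symmetric]) (auto simp: r_distr add.int_pow_distrib)
      then have "y \<gamma> (a \<oplus> b) = x \<gamma> a + x \<gamma> b + (G' a + G' b)"
        using y1[OF a(1) 1] a rep_add[OF x] by (simp add: G'_def)
      also have "\<dots> = (x \<gamma> a + G' a) + (x \<gamma> b + G' b)" using cm by (metis add.assoc)
      finally show ?thesis using y1[OF a(1) 1] a by (simp add: G'_def)
    qed (use y0[OF a(1)] a rep_add[OF x] in simp)
  qed (use yrel in \<open>auto simp: y_def\<close>)
  have "rep completion" by (rule completion_rep)
  moreover have "completion \<gamma> a = x \<gamma> a + x (\<gamma> + \<beta>) ([N \<beta> \<gamma>] \<cdot> (c \<otimes> a))" if "\<gamma> \<in> \<Phi>" "\<gamma> \<noteq> - \<beta>" "a \<in> J" for \<gamma> a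
    using that by (simp add: completion_other y_def)
  ultimately show ?thesis by blast
qed

lemma ex_neighbour':
  assumes "\<alpha> \<in> \<Phi>"
  shows "\<exists>\<mu>\<in>\<Phi>. ip \<mu> \<alpha> = 1 \<and> \<mu> \<noteq> \<alpha> \<and> \<alpha> - \<mu> \<noteq> \<alpha>"
proof -
  obtain \<mu> where m: "\<mu> \<in> \<Phi>" "ip \<mu> \<alpha> = 1" using ex_neighbour assms by blast
  moreover have "\<mu> \<noteq> \<alpha>" "\<mu> \<noteq> 0" using m ip_self[OF assms] root_nz by auto
  ultimately show ?thesis by auto
qed

text \<open>Conjugation by the possibly non-existent element \<open>x \<beta> c\<close>.\<close>

definition shift :: "'e \<Rightarrow> 'a \<Rightarrow> ('e \<Rightarrow> 'a \<Rightarrow> 'g::group_add) \<Rightarrow> 'e \<Rightarrow> 'a \<Rightarrow> 'g" where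
  "shift \<beta> c x = (SOME y. rep y \<and>
     (\<forall>\<gamma>\<in>\<Phi>. \<gamma> \<noteq> - \<beta> \<longrightarrow> (\<forall>a\<in>J. y \<gamma> a = x \<gamma> a + x (\<gamma> + \<beta>) ([N \<beta> \<gamma>] \<cdot> (c \<otimes> a)))))"

lemma shift_spec:
  assumes "rep x" "\<beta> \<in> \<Phi>" "c \<in> carrier V"
  shows "rep (shift \<beta> c x)"
    "\<lbrakk>\<gamma> \<in> \<Phi>; \<gamma> \<noteq> - \<beta>; a \<in> J\<rbrakk> \<Longrightarrow> shift \<beta> c x \<gamma> a = x \<gamma> a + x (\<gamma> + \<beta>) ([N \<beta> \<gamma>] \<cdot> (c \<otimes> a))"
  using someI_ex[OF ex_shift[OF assms], folded shift_def] by blast+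

lemma shift_unique:
  assumes x: "rep x" and b: "\<beta> \<in> \<Phi>" and c: "c \<in> carrier V" and y: "rep y"
    and eq: "\<And>\<gamma> a. \<lbrakk>\<gamma> \<in> \<Phi>; \<gamma> \<noteq> - \<beta>; a \<in> J\<rbrakk> \<Longrightarrow> y \<gamma> a = x \<gamma> a + x (\<gamma> + \<beta>) ([N \<beta> \<gamma>] \<cdot> (c \<otimes> a))"
  shows "shift \<beta> c x = y"
proof (rule rep_cong[where T = "{- \<beta>}"])
  fix \<tau> assume t: "\<tau> \<in> \<Phi>" "\<tau> \<in> {- \<beta>}"
  then show "\<exists>\<mu>\<in>\<Phi>. ip \<mu> \<tau> = 1 \<and> \<mu> \<notin> {- \<beta>} \<and> \<tau> - \<mu> \<notin> {- \<beta>}" using ex_neighbour'[OF t(1)] by auto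
qed (use shift_spec[OF x b c] y eq in auto)

lemma shift_fixes:
  assumes "rep x" "\<beta> \<in> \<Phi>" "c \<in> carrier V" "\<gamma> \<in> \<Phi>" "ip \<gamma> \<beta> \<ge> 0" "a \<in> J"
  shows "shift \<beta> c x \<gamma> a = x \<gamma> a"
proof -
  have "\<gamma> \<noteq> - \<beta>" using assms ip_self by auto
  moreover have "\<gamma> + \<beta> \<notin> \<Phi>" using assms root_sum by auto
  ultimately show ?thesis using assms shift_spec(2)[OF assms(1-4)] rep_outside[OF assms(1)] by simp
qed

lemma shift_moves:
  assumes "rep x" "\<beta> \<in> \<Phi>" "c \<in> carrier V" "\<gamma> \<in> \<Phi>" "ip \<gamma> \<beta> = -1" "a \<in> J"
  shows "shift \<beta> c x \<gamma> a = x \<gamma> a + x (\<gamma> + \<beta>) ([N \<beta> \<gamma>] \<cdot> (c \<otimes> a))" "\<gamma> + \<beta> \<in> \<Phi>"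
proof -
  have "\<gamma> \<noteq> - \<beta>" using assms ip_self by auto
  then show "shift \<beta> c x \<gamma> a = x \<gamma> a + x (\<gamma> + \<beta>) ([N \<beta> \<gamma>] \<cdot> (c \<otimes> a))"
    using assms shift_spec(2)[OF assms(1-4)] by simp
  show "\<gamma> + \<beta> \<in> \<Phi>" using assms root_sum by auto
qed

lemma shift_zero:
  assumes "rep x" "\<beta> \<in> \<Phi>"
  shows "shift \<beta> \<zero> x = x"
  using assms by (intro shift_unique) (auto simp: rep_zero)

text \<open>A later shift multiplies on the right:
  \<open>shift \<delta> d (shift \<gamma> c x)\<close> stands for conjugation by the product of
  x_\<gamma>(c) and x_\<delta>(d) in this order, because the second shift uses root elements already
  conjugated by the first. For equal roots this order does not show.\<close>

lemma shift_add:
  assumes x: "rep x" and b: "\<beta> \<in> \<Phi>" and c: "c \<in> carrier V" "d \<in> carrier V"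
  shows "shift \<beta> d (shift \<beta> c x) = shift \<beta> (c \<oplus> d) x"
proof -
  have "shift \<beta> (c \<oplus> d) x = shift \<beta> d (shift \<beta> c x)"
  proof (rule shift_unique[OF x b])
  note s = shift_spec[OF x b c(1)]
  show "rep (shift \<beta> d (shift \<beta> c x))" using shift_spec[OF s(1) b c(2)] by blast
  fix \<gamma> a assume g: "\<gamma> \<in> \<Phi>" "\<gamma> \<noteq> - \<beta>" "a \<in> J"
  consider "ip \<gamma> \<beta> = -1" | "ip \<gamma> \<beta> \<ge> 0" using ip_int'[OF g(1) b g(2)] by auto
  then show "shift \<beta> d (shift \<beta> c x) \<gamma> a = x \<gamma> a + x (\<gamma> + \<beta>) ([N \<beta> \<gamma>] \<cdot> ((c \<oplus> d) \<otimes> a))"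
  proof cases
    case 1
    have r: "\<gamma> + \<beta> \<in> \<Phi>" using root_sum g b 1 by blast
    have "ip (\<gamma> + \<beta>) \<beta> \<ge> 0" using 1 ip_self[OF b] by (simp add: ip_simps)
    then have "shift \<beta> d (shift \<beta> c x) \<gamma> a
        = x \<gamma> a + (x (\<gamma> + \<beta>) ([N \<beta> \<gamma>] \<cdot> (c \<otimes> a)) + x (\<gamma> + \<beta>) ([N \<beta> \<gamma>] \<cdot> (d \<otimes> a)))"
      using shift_moves[OF s(1) b c(2) g(1) 1 g(3)] shift_moves[OF x b c(1) g(1) 1 g(3)]
        shift_fixes[OF x b c(1) r] c g by (simp add: add.assoc)
    also have "x (\<gamma> + \<beta>) ([N \<beta> \<gamma>] \<cdot> (c \<otimes> a)) + x (\<gamma> + \<beta>) ([N \<beta> \<gamma>] \<cdot> (d \<otimes> a))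
       = x (\<gamma> + \<beta>) ([N \<beta> \<gamma>] \<cdot> ((c \<oplus> d) \<otimes> a))"
      using c g by (subst rep_add[OF x r, symmetric]) (auto simp: l_distr add.int_pow_distrib)
    finally show ?thesis .
  next
    case 2
    then have "\<gamma> + \<beta> \<notin> \<Phi>" using root_sum g b by auto
    then show ?thesis using shift_fixes[OF s(1) b c(2) g(1) 2 g(3)] shift_fixes[OF x b c(1) g(1) 2 g(3)] rep_outside[OF x] by simp
  qed
  qed (use c in auto)
  then show ?thesis by simp
qed

text \<open>The exceptional sets of the next two lemmas consist of \<tau>, another root \<epsilon>
  and possibly \<tau> - \<epsilon>, up to one root that is excluded by its product with \<tau>. A
  decomposition of \<tau> avoiding them is what \<open>rep_cong\<close> asks for.\<close>

lemma ex_decomposition':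
  assumes "\<tau> \<in> \<Phi>" "\<epsilon> \<noteq> \<tau>" "\<epsilon> \<noteq> - \<tau>"
  shows "\<exists>\<mu>\<in>\<Phi>. ip \<mu> \<tau> = 1 \<and> ip (\<tau> - \<mu>) \<tau> = 1 \<and> \<mu> \<notin> {\<tau>, \<epsilon>, \<tau> - \<epsilon>} \<and> \<tau> - \<mu> \<notin> {\<tau>, \<epsilon>, \<tau> - \<epsilon>}"
proof -
  obtain \<mu> where m: "\<mu> \<in> \<Phi>" "ip \<mu> \<tau> = 1" "\<epsilon> \<notin> {\<mu>, - \<mu>, \<tau> - \<mu>, - (\<tau> - \<mu>)}"
    using ex_decomposition[OF assms] by blast
  have "ip (\<tau> - \<mu>) \<tau> = 1" using m ip_self[OF assms(1)] by (simp add: ip_simps)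
  moreover have "\<mu> \<noteq> \<tau>" "\<tau> - \<mu> \<noteq> \<tau>" using m assms ip_self root_nz by auto
  ultimately show ?thesis using m by (intro bexI[of _ \<mu>]) auto
qed

text \<open>Only at -\<gamma> and -\<delta> are the shifts not given by a formula, so by
  \<open>rep_cong\<close> it suffices to compare the two sides at all other roots.\<close>

lemma shift_comm:
  assumes x: "rep x" and g: "\<gamma> \<in> \<Phi>" "\<delta> \<in> \<Phi>" "ip \<gamma> \<delta> \<ge> 0" and c: "c \<in> carrier V" "d \<in> carrier V"
  shows "shift \<delta> d (shift \<gamma> c x) = shift \<gamma> c (shift \<delta> d x)"
proof (rule rep_cong[where T = "{- \<gamma>, - \<delta>}"])
  define u v where "u = shift \<gamma> c x" and "v = shift \<delta> d x"
  have u: "rep u" and v: "rep v" using shift_spec x g c by (auto simp: u_def v_def)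
  show "rep (shift \<delta> d (shift \<gamma> c x))" "rep (shift \<gamma> c (shift \<delta> d x))"
    using shift_spec u v x g c by (auto simp: u_def v_def)
  have self: "ip \<gamma> \<gamma> = 2" "ip \<delta> \<delta> = 2" using g ip_self by auto
  have sy: "ip \<delta> \<gamma> = ip \<gamma> \<delta>" by (rule ip_sym)
  {
    fix \<tau> assume t: "\<tau> \<in> \<Phi>" "\<tau> \<in> {- \<gamma>, - \<delta>}"
    \<comment> \<open>The exceptional root other than \<tau>; it coincides with \<tau> exactly when
      \<gamma> = \<delta>.\<close>
    define \<epsilon> where "\<epsilon> = (if \<tau> = - \<gamma> then - \<delta> else - \<gamma>)"
    have n: "\<gamma> \<noteq> - \<delta>" using g self by auto
    show "\<exists>\<mu>\<in>\<Phi>. ip \<mu> \<tau> = 1 \<and> \<mu> \<notin> {- \<gamma>, - \<delta>} \<and> \<tau> - \<mu> \<notin> {- \<gamma>, - \<delta>}"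
    proof (cases "\<epsilon> = \<tau>")
      case True
      then have e: "- \<gamma> = \<tau>" "- \<delta> = \<tau>" using t by (auto simp: \<epsilon>_def split: if_splits)
      show ?thesis using ex_neighbour'[OF t(1)] e by auto
    next
      case False
      have n': "\<delta> \<noteq> - \<gamma>" "- \<delta> \<noteq> \<gamma>" "- \<gamma> \<noteq> \<delta>" using n by auto
      have "\<epsilon> \<noteq> - \<tau>"
        using t n n' unfolding \<epsilon>_def by auto
      moreover have "{- \<gamma>, - \<delta>} = {\<tau>, \<epsilon>}" using t by (auto simp: \<epsilon>_def)
      ultimately show ?thesis using ex_decomposition'[OF t(1) False] by auto
    qed
  next
    fix \<epsilon> a assume e: "\<epsilon> \<in> \<Phi>" "\<epsilon> \<notin> {- \<gamma>, - \<delta>}" "a \<in> J"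
    have se: "ip \<epsilon> \<epsilon> = 2" "ip \<gamma> \<epsilon> = ip \<epsilon> \<gamma>" "ip \<delta> \<epsilon> = ip \<epsilon> \<delta>" using e ip_self ip_sym by auto
    note ips = self sy se ip_simps
    have p: "ip \<epsilon> \<gamma> = -1 \<or> ip \<epsilon> \<gamma> = 0 \<or> ip \<epsilon> \<gamma> = 1 \<or> ip \<epsilon> \<gamma> = 2"
      and r: "ip \<epsilon> \<delta> = -1 \<or> ip \<epsilon> \<delta> = 0 \<or> ip \<epsilon> \<delta> = 1 \<or> ip \<epsilon> \<delta> = 2"
      using ip_int'[OF e(1) g(1)] ip_int'[OF e(1) g(2)] e(2) by blast+
    consider "ip \<epsilon> \<gamma> \<ge> 0" "ip \<epsilon> \<delta> \<ge> 0" | "ip \<epsilon> \<gamma> = -1" "ip \<epsilon> \<delta> \<ge> 0" | "ip \<epsilon> \<gamma> \<ge> 0" "ip \<epsilon> \<delta> = -1"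
      | "ip \<epsilon> \<gamma> = -1" "ip \<epsilon> \<delta> = -1" using p r by fastforce
    then have "shift \<delta> d u \<epsilon> a = shift \<gamma> c v \<epsilon> a"
    proof cases
      case 1
      have "shift \<delta> d u \<epsilon> a = x \<epsilon> a" using shift_fixes[OF u g(2) c(2) e(1) 1(2) e(3)] shift_fixes[OF x g(1) c(1) e(1) 1(1) e(3)] by (simp add: u_def)
      moreover have "shift \<gamma> c v \<epsilon> a = x \<epsilon> a" using shift_fixes[OF v g(1) c(1) e(1) 1(1) e(3)] shift_fixes[OF x g(2) c(2) e(1) 1(2) e(3)] by (simp add: v_def)
      ultimately show ?thesis by simp
    next
      case 2
      note m = shift_moves[OF v g(1) c(1) e(1) 2(1) e(3)]
      have "shift \<delta> d u \<epsilon> a = u \<epsilon> a" using shift_fixes[OF u g(2) c(2) e(1) 2(2) e(3)] .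
      moreover have "v (\<epsilon> + \<gamma>) ([N \<gamma> \<epsilon>] \<cdot> (c \<otimes> a)) = x (\<epsilon> + \<gamma>) ([N \<gamma> \<epsilon>] \<cdot> (c \<otimes> a))" unfolding v_def
        using g 2 c e by (intro shift_fixes[OF x g(2) c(2) m(2)]) (auto simp: ips)
      ultimately show ?thesis unfolding m(1) using shift_fixes[OF x g(2) c(2) e(1) 2(2) e(3)]
        shift_moves[OF x g(1) c(1) e(1) 2(1) e(3)] by (simp add: u_def v_def)
    next
      case 3
      note m = shift_moves[OF u g(2) c(2) e(1) 3(2) e(3)]
      have "shift \<gamma> c v \<epsilon> a = v \<epsilon> a" using shift_fixes[OF v g(1) c(1) e(1) 3(1) e(3)] .
      moreover have "u (\<epsilon> + \<delta>) ([N \<delta> \<epsilon>] \<cdot> (d \<otimes> a)) = x (\<epsilon> + \<delta>) ([N \<delta> \<epsilon>] \<cdot> (d \<otimes> a))" unfolding u_def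
        using g 3 c e by (intro shift_fixes[OF x g(1) c(1) m(2)]) (auto simp: ips)
      ultimately show ?thesis unfolding m(1) using shift_fixes[OF x g(1) c(1) e(1) 3(1) e(3)]
        shift_moves[OF x g(2) c(2) e(1) 3(2) e(3)] by (simp add: u_def v_def)
    next
      case 4
      define e1 e2 where "e1 = [N \<gamma> \<epsilon>] \<cdot> (c \<otimes> a)" and "e2 = [N \<delta> \<epsilon>] \<cdot> (d \<otimes> a)"
      have eJ: "e1 \<in> J" "e2 \<in> J" using e c by (auto simp: e1_def e2_def)
      note mu = shift_moves[OF u g(2) c(2) e(1) 4(2) e(3), folded e2_def]
      note mv = shift_moves[OF v g(1) c(1) e(1) 4(1) e(3), folded e1_def]
      have ue: "u \<epsilon> a = x \<epsilon> a + x (\<epsilon> + \<gamma>) e1" using shift_moves[OF x g(1) c(1) e(1) 4(1) e(3)] by (simp add: u_def e1_def)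
      have ve: "v \<epsilon> a = x \<epsilon> a + x (\<epsilon> + \<delta>) e2" using shift_moves[OF x g(2) c(2) e(1) 4(2) e(3)] by (simp add: v_def e2_def)
      have "cj (x (\<epsilon> + \<gamma>) e1) (x (\<epsilon> + \<delta>) e2) = x (\<epsilon> + \<delta>) e2"
        using 4 g by (intro rep_fix[OF x mv(2) mu(2) _ eJ]) (auto simp: ips)
      then have cm: "x (\<epsilon> + \<gamma>) e1 + x (\<epsilon> + \<delta>) e2 = x (\<epsilon> + \<delta>) e2 + x (\<epsilon> + \<gamma>) e1" by (simp add: cj_fix)
      consider "ip \<gamma> \<delta> = 0" | "ip \<gamma> \<delta> \<ge> 1" using ip_vals[OF g(1,2)] g by auto
      then show ?thesis
      proof cases
        case 1
        have ip1: "ip (\<epsilon> + \<delta>) \<gamma> = -1" "ip (\<epsilon> + \<gamma>) \<delta> = -1" using 1 4 by (simp_all add: ips)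
        note mm = shift_moves[OF x g(1) c(1) mu(2) ip1(1) eJ(2)] and mm' = shift_moves[OF x g(2) c(2) mv(2) ip1(2) eJ(1)]
        have N: "N \<gamma> (\<epsilon> + \<delta>) * N \<delta> \<epsilon> = N \<delta> (\<epsilon> + \<gamma>) * N \<gamma> \<epsilon>"
        proof -
          have "N \<gamma> \<epsilon> * N (\<gamma> + \<epsilon>) \<delta> = N \<epsilon> \<delta> * N \<gamma> (\<epsilon> + \<delta>)" using 1 4 g e by (intro N_assoc) (auto simp: ips)
          moreover have "N (\<gamma> + \<epsilon>) \<delta> = - N \<delta> (\<epsilon> + \<gamma>)" using N_anti[OF mv(2) g(2) mm'(2)] by (simp add: add.commute)
          moreover have "N \<epsilon> \<delta> = - N \<delta> \<epsilon>" using N_anti[OF e(1) g(2) mu(2)] by simp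
          ultimately show ?thesis by (simp add: mult.commute)
        qed
        have s: "\<epsilon> + \<delta> + \<gamma> = \<epsilon> + \<gamma> + \<delta>" by (simp add: ac_simps)
        have "x (\<epsilon> + \<delta> + \<gamma>) ([N \<gamma> (\<epsilon> + \<delta>)] \<cdot> (c \<otimes> e2)) = x (\<epsilon> + \<gamma> + \<delta>) ([N \<delta> (\<epsilon> + \<gamma>)] \<cdot> (d \<otimes> e1))"
          unfolding e1_def e2_def s using N c e by (simp add: coef_simps)
        then show ?thesis unfolding mu(1) mv(1) ue ve unfolding u_def v_def mm(1) mm'(1)
          by (simp add: add.assoc) (metis cm add.assoc)
      next
        case 2
        have "u (\<epsilon> + \<delta>) e2 = x (\<epsilon> + \<delta>) e2" unfolding u_def using 2 4
          by (intro shift_fixes[OF x g(1) c(1) mu(2) _ eJ(2)]) (auto simp: ips)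
        moreover have "v (\<epsilon> + \<gamma>) e1 = x (\<epsilon> + \<gamma>) e1" unfolding v_def using 2 4
          by (intro shift_fixes[OF x g(2) c(2) mv(2) _ eJ(1)]) (auto simp: ips)
        ultimately show ?thesis unfolding mu(1) mv(1) ue ve using cm by (simp add: add.assoc)
      qed
    qed
    then show "shift \<delta> d (shift \<gamma> c x) \<epsilon> a = shift \<gamma> c (shift \<delta> d x) \<epsilon> a" by (simp add: u_def v_def)
  }
qed

text \<open>Read from the inside outwards, this is the relation x_\<gamma>(c) x_\<delta>(d) =
  x_{\<gamma>+\<delta>}(N c d) x_\<delta>(d) x_\<gamma>(c) for the conjugations. It is checked at
  the roots where all three shifts are given by formulas.\<close>

lemma shift_rel:
  fixes x :: "'e \<Rightarrow> 'a \<Rightarrow> 'g::group_add"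
  assumes x: "rep x" and g: "\<gamma> \<in> \<Phi>" "\<delta> \<in> \<Phi>" "ip \<gamma> \<delta> = -1" and c: "c \<in> carrier V" "d \<in> carrier V"
  shows "shift \<delta> d (shift \<gamma> c x) = shift \<gamma> c (shift \<delta> d (shift (\<gamma> + \<delta>) ([N \<gamma> \<delta>] \<cdot> (c \<otimes> d)) x))"
proof (rule rep_cong[where T = "{- \<gamma>, - \<delta>, - (\<gamma> + \<delta>)}"])
  define z where "z = [N \<gamma> \<delta>] \<cdot> (c \<otimes> d)"
  have z: "z \<in> carrier V" using c by (simp add: z_def)
  have gd: "\<gamma> + \<delta> \<in> \<Phi>" using root_sum g by blast
  define u w v where "u = shift \<gamma> c x" and "w = shift (\<gamma> + \<delta>) z x" and "v = shift \<delta> d w"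
  have u: "rep u" and w: "rep w" using shift_spec x g c gd z by (auto simp: u_def w_def)
  have v: "rep v" using shift_spec w g c by (auto simp: v_def)
  show "rep (shift \<delta> d (shift \<gamma> c x))" "rep (shift \<gamma> c (shift \<delta> d (shift (\<gamma> + \<delta>) ([N \<gamma> \<delta>] \<cdot> (c \<otimes> d)) x)))"
    using shift_spec u v w x g c gd z by (auto simp: u_def v_def w_def simp flip: z_def)
  have self: "ip \<gamma> \<gamma> = 2" "ip \<delta> \<delta> = 2" using g ip_self by auto
  have sy: "ip \<delta> \<gamma> = -1" using ip_sym g by metis
  {
    fix \<tau> assume t: "\<tau> \<in> \<Phi>" "\<tau> \<in> {- \<gamma>, - \<delta>, - (\<gamma> + \<delta>)}"
    \<comment> \<open>For \<tau> = -(\<gamma> + \<delta>) the exceptional roots are \<tau>,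
      \<epsilon> and \<tau> - \<epsilon>. For \<tau> = -\<gamma> or -\<delta> the third exceptional
      root is not of this form, but its product with \<tau> is -1, whereas the parts of a
      decomposition of \<tau> have product 1 with it.\<close>
    define \<epsilon> where "\<epsilon> = (if \<tau> = - (\<gamma> + \<delta>) then - \<gamma> else - (\<gamma> + \<delta>))"
    have nz: "\<gamma> \<noteq> 0" "\<delta> \<noteq> 0" "\<gamma> + \<delta> \<noteq> 0" using root_nz g gd by auto
    have "ip (\<gamma> + \<delta>) \<gamma> \<noteq> ip (- \<gamma>) \<gamma>" "ip (\<gamma> + \<delta>) \<delta> \<noteq> ip (- \<delta>) \<delta>" using g self sy by (simp_all add: ip_simps)
    then have n2: "\<gamma> + \<delta> \<noteq> - \<gamma>" "\<gamma> + \<delta> \<noteq> - \<delta>" by metis+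
    have "ip (- (\<gamma> + \<delta>)) \<gamma> \<noteq> ip \<gamma> \<gamma>" "ip (- (\<gamma> + \<delta>)) \<delta> \<noteq> ip \<delta> \<delta>" using g self sy by (simp_all add: ip_simps)
    then have n3: "- (\<gamma> + \<delta>) \<noteq> \<gamma>" "- (\<gamma> + \<delta>) \<noteq> \<delta>" by metis+
    have n4: "- \<gamma> \<noteq> - (\<gamma> + \<delta>)" "- \<delta> \<noteq> - (\<gamma> + \<delta>)" using nz by simp_all
    consider "\<tau> = - (\<gamma> + \<delta>)" "\<epsilon> = - \<gamma>" | "\<tau> = - \<gamma>" "\<epsilon> = - (\<gamma> + \<delta>)" | "\<tau> = - \<delta>" "\<epsilon> = - (\<gamma> + \<delta>)"
      using t(2) n4 unfolding \<epsilon>_def by (metis insertE singletonD)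
    then have "\<epsilon> \<noteq> \<tau> \<and> \<epsilon> \<noteq> - \<tau>"
    proof cases
      case 1
      show ?thesis unfolding 1 unfolding group_add_class.minus_minus using n2(1) n4(1) by metis
    next
      case 2
      show ?thesis unfolding 2 unfolding group_add_class.minus_minus using n3(1) n4(1) by metis
    next
      case 3
      show ?thesis unfolding 3 unfolding group_add_class.minus_minus using n3(2) n4(2) by metis
    qed
    then obtain \<mu> where mu: "\<mu> \<in> \<Phi>" "ip \<mu> \<tau> = 1" "ip (\<tau> - \<mu>) \<tau> = 1" "\<mu> \<notin> {\<tau>, \<epsilon>, \<tau> - \<epsilon>}" "\<tau> - \<mu> \<notin> {\<tau>, \<epsilon>, \<tau> - \<epsilon>}"
      using ex_decomposition'[OF t(1), of \<epsilon>] by blast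
    have "\<mu>' \<notin> {- \<gamma>, - \<delta>, - (\<gamma> + \<delta>)}" if m: "ip \<mu>' \<tau> = 1" "\<mu>' \<notin> {\<tau>, \<epsilon>, \<tau> - \<epsilon>}" for \<mu>'
    proof (cases "\<tau> = - (\<gamma> + \<delta>)")
      case True
      then show ?thesis using m by (auto simp: \<epsilon>_def)
    next
      case False
      then have "\<tau> = - \<gamma> \<or> \<tau> = - \<delta>" "\<epsilon> = - (\<gamma> + \<delta>)" using t by (auto simp: \<epsilon>_def)
      then show ?thesis using m g sy by auto
    qed
    then show "\<exists>\<mu>\<in>\<Phi>. ip \<mu> \<tau> = 1 \<and> \<mu> \<notin> {- \<gamma>, - \<delta>, - (\<gamma> + \<delta>)} \<and> \<tau> - \<mu> \<notin> {- \<gamma>, - \<delta>, - (\<gamma> + \<delta>)}"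
      using mu by blast
  next
    fix \<epsilon> a assume e: "\<epsilon> \<in> \<Phi>" "\<epsilon> \<notin> {- \<gamma>, - \<delta>, - (\<gamma> + \<delta>)}" "a \<in> J"
    have se: "ip \<epsilon> \<epsilon> = 2" "ip \<gamma> \<epsilon> = ip \<epsilon> \<gamma>" "ip \<delta> \<epsilon> = ip \<epsilon> \<delta>" using e ip_self ip_sym by auto
    note ips = self sy se ip_simps g(3)
    have p: "ip \<epsilon> \<gamma> = -1 \<or> ip \<epsilon> \<gamma> = 0 \<or> ip \<epsilon> \<gamma> = 1 \<or> ip \<epsilon> \<gamma> = 2"
      and r: "ip \<epsilon> \<delta> = -1 \<or> ip \<epsilon> \<delta> = 0 \<or> ip \<epsilon> \<delta> = 1 \<or> ip \<epsilon> \<delta> = 2"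
      and pr: "ip \<epsilon> \<gamma> + ip \<epsilon> \<delta> \<noteq> -2"
      using ip_int'[OF e(1) g(1)] ip_int'[OF e(1) g(2)] ip_neg2[OF e(1) gd] e(2) by (auto simp: ip_simps)
    define e1 e2 e3 where "e1 = [N \<gamma> \<epsilon>] \<cdot> (c \<otimes> a)" and "e2 = [N \<delta> \<epsilon>] \<cdot> (d \<otimes> a)" and "e3 = [N (\<gamma> + \<delta>) \<epsilon>] \<cdot> (z \<otimes> a)"
    have eJ: "e1 \<in> J" "e2 \<in> J" "e3 \<in> J" using e c z by (auto simp: e1_def e2_def e3_def)
    consider "ip \<epsilon> \<gamma> \<ge> 0" "ip \<epsilon> \<delta> \<ge> 0" | "ip \<epsilon> \<gamma> = -1" "ip \<epsilon> \<delta> = 0" | "ip \<epsilon> \<gamma> = 0" "ip \<epsilon> \<delta> = -1"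
      | "ip \<epsilon> \<gamma> = -1" "ip \<epsilon> \<delta> \<ge> 1" | "ip \<epsilon> \<gamma> \<ge> 1" "ip \<epsilon> \<delta> = -1" using p r pr by fastforce
    then have "shift \<delta> d u \<epsilon> a = shift \<gamma> c v \<epsilon> a"
    proof cases
      case 1
      have 2: "ip \<epsilon> (\<gamma> + \<delta>) \<ge> 0" using 1 by (simp add: ip_simps)
      have "shift \<delta> d u \<epsilon> a = x \<epsilon> a" using shift_fixes[OF u g(2) c(2) e(1) 1(2) e(3)] shift_fixes[OF x g(1) c(1) e(1) 1(1) e(3)] by (simp add: u_def)
      moreover have "shift \<gamma> c v \<epsilon> a = x \<epsilon> a"
        using shift_fixes[OF v g(1) c(1) e(1) 1(1) e(3)] shift_fixes[OF w g(2) c(2) e(1) 1(2) e(3)] shift_fixes[OF x gd z e(1) 2 e(3)]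
        by (simp add: v_def w_def)
      ultimately show ?thesis by simp
    next
      case 2
      have r0: "ip \<epsilon> \<delta> \<ge> 0" and ig: "ip \<epsilon> (\<gamma> + \<delta>) = -1" using 2 by (auto simp: ips)
      note ux = shift_moves[OF x g(1) c(1) e(1) 2(1) e(3), folded e1_def u_def]
      note wx = shift_moves[OF x gd z e(1) ig e(3), folded e3_def w_def]
      have ig2: "ip (\<epsilon> + \<gamma>) \<delta> = -1" using 2 by (simp add: ips)
      note vw = shift_moves[OF w g(2) c(2) ux(2) ig2 eJ(1), folded v_def]
      have L: "shift \<delta> d u \<epsilon> a = x \<epsilon> a + x (\<epsilon> + \<gamma>) e1"
        using shift_fixes[OF u g(2) c(2) e(1) r0 e(3)] ux(1) by simp
      have R: "shift \<gamma> c v \<epsilon> a = v \<epsilon> a + v (\<epsilon> + \<gamma>) e1"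
        using shift_moves[OF v g(1) c(1) e(1) 2(1) e(3)] by (simp add: e1_def)
      have V1: "v \<epsilon> a = x \<epsilon> a + x (\<epsilon> + (\<gamma> + \<delta>)) e3"
        using shift_fixes[OF w g(2) c(2) e(1) r0 e(3)] wx by (simp add: v_def)
      have V2: "v (\<epsilon> + \<gamma>) e1 = x (\<epsilon> + \<gamma>) e1 + x (\<epsilon> + \<gamma> + \<delta>) ([N \<delta> (\<epsilon> + \<gamma>)] \<cdot> (d \<otimes> e1))"
      proof -
        have "w (\<epsilon> + \<gamma>) e1 = x (\<epsilon> + \<gamma>) e1" unfolding w_def using 2
          by (intro shift_fixes[OF x gd z ux(2) _ eJ(1)]) (auto simp: ips)
        moreover have "w (\<epsilon> + \<gamma> + \<delta>) ([N \<delta> (\<epsilon> + \<gamma>)] \<cdot> (d \<otimes> e1)) = x (\<epsilon> + \<gamma> + \<delta>) ([N \<delta> (\<epsilon> + \<gamma>)] \<cdot> (d \<otimes> e1))"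
          unfolding w_def using 2 c eJ by (intro shift_fixes[OF x gd z vw(2)]) (auto simp: ips)
        ultimately show ?thesis unfolding vw(1) by simp
      qed
      \<comment> \<open>Passing through \<gamma> and then \<delta> contributes the inverse of what
        the shift along \<gamma> + \<delta> contributes directly; only the factor at \<epsilon> +
        \<gamma> survives.\<close>
      have B: "x (\<epsilon> + \<gamma> + \<delta>) ([N \<delta> (\<epsilon> + \<gamma>)] \<cdot> (d \<otimes> e1)) = - x (\<epsilon> + (\<gamma> + \<delta>)) e3"
      proof -
        have "N \<epsilon> \<gamma> * N (\<epsilon> + \<gamma>) \<delta> = N \<gamma> \<delta> * N \<epsilon> (\<gamma> + \<delta>)" using 2 g e by (intro N_assoc) (auto simp: ips)
        moreover have "N \<epsilon> \<gamma> = - N \<gamma> \<epsilon>" using N_anti[OF e(1) g(1) ux(2)] by simp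
        moreover have "N (\<epsilon> + \<gamma>) \<delta> = - N \<delta> (\<epsilon> + \<gamma>)" using N_anti[OF ux(2) g(2) vw(2)] by simp
        moreover have "N \<epsilon> (\<gamma> + \<delta>) = - N (\<gamma> + \<delta>) \<epsilon>" using N_anti[OF e(1) gd wx(2)] by simp
        ultimately have n: "N \<delta> (\<epsilon> + \<gamma>) * N \<gamma> \<epsilon> = - (N (\<gamma> + \<delta>) \<epsilon> * N \<gamma> \<delta>)" by (simp add: mult.commute)
        have "[N \<delta> (\<epsilon> + \<gamma>)] \<cdot> (d \<otimes> e1) = \<ominus> e3"
          unfolding e1_def e3_def z_def using n c e by (simp add: coef_simps add.int_pow_neg)
        then show ?thesis using rep_minus[OF x eJ(3)] by (simp add: add.assoc)
      qed
      have CM: "x (\<epsilon> + (\<gamma> + \<delta>)) e3 + x (\<epsilon> + \<gamma>) e1 = x (\<epsilon> + \<gamma>) e1 + x (\<epsilon> + (\<gamma> + \<delta>)) e3"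
      proof -
        have "cj (x (\<epsilon> + (\<gamma> + \<delta>)) e3) (x (\<epsilon> + \<gamma>) e1) = x (\<epsilon> + \<gamma>) e1"
          using 2 by (intro rep_fix[OF x wx(2) ux(2) _ eJ(3,1)]) (auto simp: ips)
        then show ?thesis by (simp add: cj_fix)
      qed
      have "g + h = g + a + (h + - a)" if "a + h = h + a" for g h a :: 'g
        by (metis that add.assoc add.right_inverse add.right_neutral)
      then show ?thesis unfolding L R V1 V2 B using CM by blast
    next
      case 3
      have r0: "ip \<epsilon> \<gamma> \<ge> 0" and ig: "ip \<epsilon> (\<gamma> + \<delta>) = -1" using 3 by (auto simp: ips)
      note ux = shift_moves[OF u g(2) c(2) e(1) 3(2) e(3), folded e2_def]
      note wx = shift_moves[OF x gd z e(1) ig e(3), folded e3_def w_def]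
      have ig2: "ip (\<epsilon> + \<delta>) \<gamma> = -1" using 3 by (simp add: ips)
      note uu = shift_moves[OF x g(1) c(1) ux(2) ig2 eJ(2), folded u_def]
      have "u \<epsilon> a = x \<epsilon> a" using shift_fixes[OF x g(1) c(1) e(1) r0 e(3)] by (simp add: u_def)
      then have "shift \<delta> d u \<epsilon> a = x \<epsilon> a + (x (\<epsilon> + \<delta>) e2 + x (\<epsilon> + \<delta> + \<gamma>) ([N \<gamma> (\<epsilon> + \<delta>)] \<cdot> (c \<otimes> e2)))"
        using ux(1) uu(1) by simp
      moreover have "shift \<gamma> c v \<epsilon> a = w \<epsilon> a + w (\<epsilon> + \<delta>) e2"
        using shift_fixes[OF v g(1) c(1) e(1) r0 e(3)] shift_moves[OF w g(2) c(2) e(1) 3(2) e(3)] by (simp add: v_def e2_def)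
      moreover have "w (\<epsilon> + \<delta>) e2 = x (\<epsilon> + \<delta>) e2" unfolding w_def using 3
        by (intro shift_fixes[OF x gd z ux(2) _ eJ(2)]) (auto simp: ips)
      moreover have "x (\<epsilon> + \<delta> + \<gamma>) ([N \<gamma> (\<epsilon> + \<delta>)] \<cdot> (c \<otimes> e2)) = x (\<epsilon> + (\<gamma> + \<delta>)) e3"
      proof -
        have "N \<gamma> \<delta> * N (\<gamma> + \<delta>) \<epsilon> = N \<delta> \<epsilon> * N \<gamma> (\<delta> + \<epsilon>)" using 3 g e by (intro N_assoc) (auto simp: ips)
        then have n: "N \<gamma> (\<epsilon> + \<delta>) * N \<delta> \<epsilon> = N (\<gamma> + \<delta>) \<epsilon> * N \<gamma> \<delta>" by (simp add: mult.commute add.commute)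
        have s: "\<epsilon> + \<delta> + \<gamma> = \<epsilon> + (\<gamma> + \<delta>)" by (simp add: ac_simps)
        show ?thesis unfolding e2_def e3_def z_def s using n c e by (simp add: coef_simps)
      qed
      moreover have "x (\<epsilon> + (\<gamma> + \<delta>)) e3 + x (\<epsilon> + \<delta>) e2 = x (\<epsilon> + \<delta>) e2 + x (\<epsilon> + (\<gamma> + \<delta>)) e3"
      proof -
        have "cj (x (\<epsilon> + (\<gamma> + \<delta>)) e3) (x (\<epsilon> + \<delta>) e2) = x (\<epsilon> + \<delta>) e2"
          using 3 by (intro rep_fix[OF x wx(2) ux(2) _ eJ(3,2)]) (auto simp: ips)
        then show ?thesis by (simp add: cj_fix)
      qed
      ultimately show ?thesis using wx(1) by (simp add: add.assoc)
    next
      case 4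
      have r0: "ip \<epsilon> \<delta> \<ge> 0" and ig: "ip \<epsilon> (\<gamma> + \<delta>) \<ge> 0" using 4 by (auto simp: ips)
      note ux = shift_moves[OF x g(1) c(1) e(1) 4(1) e(3), folded e1_def u_def]
      have "shift \<delta> d u \<epsilon> a = x \<epsilon> a + x (\<epsilon> + \<gamma>) e1"
        using shift_fixes[OF u g(2) c(2) e(1) r0 e(3)] ux(1) by simp
      moreover have "shift \<gamma> c v \<epsilon> a = v \<epsilon> a + v (\<epsilon> + \<gamma>) e1"
        using shift_moves[OF v g(1) c(1) e(1) 4(1) e(3)] by (simp add: e1_def)
      moreover have "v \<epsilon> a = x \<epsilon> a"
        using shift_fixes[OF w g(2) c(2) e(1) r0 e(3)] shift_fixes[OF x gd z e(1) ig e(3)] by (simp add: v_def w_def)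
      moreover have "v (\<epsilon> + \<gamma>) e1 = w (\<epsilon> + \<gamma>) e1" unfolding v_def using 4
        by (intro shift_fixes[OF w g(2) c(2) ux(2) _ eJ(1)]) (auto simp: ips)
      moreover have "w (\<epsilon> + \<gamma>) e1 = x (\<epsilon> + \<gamma>) e1" unfolding w_def using 4
        by (intro shift_fixes[OF x gd z ux(2) _ eJ(1)]) (auto simp: ips)
      ultimately show ?thesis by simp
    next
      case 5
      have r0: "ip \<epsilon> \<gamma> \<ge> 0" and ig: "ip \<epsilon> (\<gamma> + \<delta>) \<ge> 0" using 5 by (auto simp: ips)
      note ux = shift_moves[OF u g(2) c(2) e(1) 5(2) e(3), folded e2_def]
      have "u \<epsilon> a = x \<epsilon> a" using shift_fixes[OF x g(1) c(1) e(1) r0 e(3)] by (simp add: u_def)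
      moreover have "u (\<epsilon> + \<delta>) e2 = x (\<epsilon> + \<delta>) e2" unfolding u_def using 5
        by (intro shift_fixes[OF x g(1) c(1) ux(2) _ eJ(2)]) (auto simp: ips)
      moreover have "shift \<gamma> c v \<epsilon> a = w \<epsilon> a + w (\<epsilon> + \<delta>) e2"
        using shift_fixes[OF v g(1) c(1) e(1) r0 e(3)] shift_moves[OF w g(2) c(2) e(1) 5(2) e(3)] by (simp add: v_def e2_def)
      moreover have "w \<epsilon> a = x \<epsilon> a" using shift_fixes[OF x gd z e(1) ig e(3)] by (simp add: w_def)
      moreover have "w (\<epsilon> + \<delta>) e2 = x (\<epsilon> + \<delta>) e2" unfolding w_def using 5
        by (intro shift_fixes[OF x gd z ux(2) _ eJ(2)]) (auto simp: ips)
      ultimately show ?thesis using ux(1) by simp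
    qed
    then show "shift \<delta> d (shift \<gamma> c x) \<epsilon> a = shift \<gamma> c (shift \<delta> d (shift (\<gamma> + \<delta>) ([N \<gamma> \<delta>] \<cdot> (c \<otimes> d)) x)) \<epsilon> a"
      by (simp add: u_def v_def w_def z_def)
  }
qed

end

section \<open>Words acting on representations by two congruent homomorphisms\<close>

lemma (in ring) add_pow_unit:
  assumes "a \<in> carrier R" shows "[(1::int)] \<cdot> a = a" "[(- 1::int)] \<cdot> a = \<ominus> a"
  using assms by (simp_all add: add.int_pow_neg add.int_pow_1)

lemma ring_hom_add_pow_unit:
  assumes "ring Q" "ring V" "h \<in> ring_hom Q V" "a \<in> carrier Q" "(k::int) \<in> {1, -1}"
  shows "h (add_pow Q k a) = add_pow V k (h a)"
proof -
  interpret ring_hom_ring Q V h using assms by (intro ring_hom_ringI2)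
  show ?thesis using assms R.add_pow_unit[of a] S.add_pow_unit[of "h a"] by auto
qed

lemma (in abelian_group) add_diff_cancel_carrier:
  assumes "a \<in> carrier G" "b \<in> carrier G" shows "a \<oplus> (b \<ominus> a) = b"
proof -
  have "a \<oplus> (b \<ominus> a) = b \<oplus> (\<ominus> a \<oplus> a)" using assms by (simp add: minus_eq a_ac)
  then show ?thesis using assms by (simp add: l_neg)
qed

lemma (in abelian_group) diff_cancel_left_carrier:
  assumes "a \<in> carrier G" "b \<in> carrier G" shows "(a \<oplus> b) \<ominus> a = b"
proof -
  have "(a \<oplus> b) \<ominus> a = b \<oplus> (a \<oplus> \<ominus> a)" using assms by (simp add: minus_eq a_ac)
  then show ?thesis using assms by (simp add: r_neg)
qed

definition word_eval :: "('x \<Rightarrow> 'g::group_add) \<Rightarrow> 'x gword \<Rightarrow> 'g" where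
  "word_eval f w = sum_list (map (\<lambda>(x, b). if b then f x else - f x) w)"

lemma word_eval_simps [simp]:
  "word_eval f [] = 0"
  "word_eval f (u @ v) = word_eval f u + word_eval f v"
  "word_eval f [(x, b)] = (if b then f x else - f x)"
  "word_eval f ((x, b) # w) = (if b then f x else - f x) + word_eval f w"
  by (auto simp: word_eval_def)

lemma word_eval_map: "word_eval f (map (apfst h) w) = word_eval (f \<circ> h) w"
  by (induction w) auto

definition map_coef :: "('a \<Rightarrow> 'b) \<Rightarrow> ('e \<times> 'a) gword \<Rightarrow> ('e \<times> 'b) gword" where
  "map_coef h = map (apfst (apsnd h))"

lemma map_coef_simps [simp]: "map_coef h [] = []" "map_coef h (u @ v) = map_coef h u @ map_coef h v"
  "map_coef h (((\<gamma>, f), b) # w) = ((\<gamma>, h f), b) # map_coef h w"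
  by (simp_all add: map_coef_def)

lemma gwords_simps [simp]: "[] \<in> gwords X" "u @ v \<in> gwords X \<longleftrightarrow> u \<in> gwords X \<and> v \<in> gwords X"
  "(x, b) # w \<in> gwords X \<longleftrightarrow> x \<in> X \<and> w \<in> gwords X"
  by (auto simp: gwords_def)

context steinberg_core begin

text \<open>
  A letter acts on the first component of a state by conjugation along \<open>\<rho>0\<close>, while the second
  component collects the effect of replacing \<open>\<rho>0\<close> by \<open>\<rho>1\<close>.
\<close>

definition step :: "('q \<Rightarrow> 'a) \<Rightarrow> ('q \<Rightarrow> 'a) \<Rightarrow> 'e \<Rightarrow> 'q \<Rightarrow> ('e \<Rightarrow> 'a \<Rightarrow> 'g::group_add) \<times> 'g \<Rightarrow> ('e \<Rightarrow> 'a \<Rightarrow> 'g) \<times> 'g" where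
  "step \<rho>0 \<rho>1 \<gamma> f s = (shift \<gamma> (\<rho>0 f) (fst s), snd s + fst s \<gamma> (\<rho>1 f \<ominus> \<rho>0 f))"

end

text \<open>In the application \<open>\<rho>0\<close> and \<open>\<rho>1\<close> are evaluations of
  R_M[t] at two elements of \<open>V\<close> that differ by an element of \<open>J\<close>.\<close>

locale core_action = steinberg_core \<Phi> ip N J V + Q: cring Q
  for \<Phi> :: "'e::euclidean_space set" and ip N and J :: "'a set" and V (structure) and Q :: "('q, 'n) ring_scheme" +
  fixes \<rho>0 \<rho>1 :: "'q \<Rightarrow> 'a"
  assumes hom0: "\<rho>0 \<in> ring_hom Q V" and hom1: "\<rho>1 \<in> ring_hom Q V"
    and diff: "f \<in> carrier Q \<Longrightarrow> \<rho>1 f \<ominus> \<rho>0 f \<in> J"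
begin

abbreviation stp :: "'e \<Rightarrow> 'q \<Rightarrow> ('e \<Rightarrow> 'a \<Rightarrow> 'g::group_add) \<times> 'g \<Rightarrow> ('e \<Rightarrow> 'a \<Rightarrow> 'g) \<times> 'g" where
  "stp \<equiv> step \<rho>0 \<rho>1"

sublocale h0: ring_hom_ring Q V \<rho>0
  using hom0 by (intro ring_hom_ringI2) (auto intro: Q.ring_axioms ring_axioms)

sublocale h1: ring_hom_ring Q V \<rho>1
  using hom1 by (intro ring_hom_ringI2) (auto intro: Q.ring_axioms ring_axioms)

lemma rho_closed [simp]: "f \<in> carrier Q \<Longrightarrow> \<rho>0 f \<in> carrier V" "f \<in> carrier Q \<Longrightarrow> \<rho>1 f \<in> carrier V"
  using ring_hom_closed hom0 hom1 by fast+

lemma stp_rep: "\<lbrakk>rep (fst s); \<gamma> \<in> \<Phi>; f \<in> carrier Q\<rbrakk> \<Longrightarrow> rep (fst (stp \<gamma> f s))"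
  by (simp add: step_def shift_spec(1))

lemma stp_add:
  assumes s: "rep (fst s)" and g: "\<gamma> \<in> \<Phi>" and f: "\<xi> \<in> carrier Q" "\<eta> \<in> carrier Q"
  shows "stp \<gamma> \<eta> (stp \<gamma> \<xi> s) = stp \<gamma> (\<xi> \<oplus>\<^bsub>Q\<^esub> \<eta>) s"
proof -
  define j k where "j = \<rho>1 \<xi> \<ominus> \<rho>0 \<xi>" and "k = \<rho>1 \<eta> \<ominus> \<rho>0 \<eta>"
  have J: "j \<in> J" "k \<in> J" using diff f by (auto simp: j_def k_def)
  have "\<rho>1 (\<xi> \<oplus>\<^bsub>Q\<^esub> \<eta>) \<ominus> \<rho>0 (\<xi> \<oplus>\<^bsub>Q\<^esub> \<eta>) = j \<oplus> k"
    using f by (simp add: j_def k_def minus_eq minus_add a_ac)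
  moreover have "shift \<gamma> (\<rho>0 \<xi>) (fst s) \<gamma> k = fst s \<gamma> k"
    using s g f J ip_self by (intro shift_fixes) auto
  ultimately show ?thesis using s g f J rep_add[OF s g J] shift_add[OF s g, of "\<rho>0 \<xi>" "\<rho>0 \<eta>"]
    by (simp add: step_def add.assoc flip: j_def k_def)
qed

lemma stp_zero: "\<lbrakk>rep (fst s); \<gamma> \<in> \<Phi>\<rbrakk> \<Longrightarrow> stp \<gamma> \<zero>\<^bsub>Q\<^esub> s = s"
  by (simp add: step_def minus_eq shift_zero rep_zero)

lemma stp_cancel:
  assumes "rep (fst s)" "\<gamma> \<in> \<Phi>" "f \<in> carrier Q"
  shows "stp \<gamma> (\<ominus>\<^bsub>Q\<^esub> f) (stp \<gamma> f s) = s" "stp \<gamma> f (stp \<gamma> (\<ominus>\<^bsub>Q\<^esub> f) s) = s"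
  using assms by (simp_all add: stp_add stp_zero Q.r_neg Q.l_neg)

lemma stp_comm:
  assumes s: "rep (fst s)" and g: "\<gamma> \<in> \<Phi>" "\<delta> \<in> \<Phi>" "\<gamma> + \<delta> \<notin> \<Phi> \<union> {0}" and f: "\<xi> \<in> carrier Q" "\<eta> \<in> carrier Q"
  shows "stp \<delta> \<eta> (stp \<gamma> \<xi> s) = stp \<gamma> \<xi> (stp \<delta> \<eta> s)"
proof -
  define j k where "j = \<rho>1 \<xi> \<ominus> \<rho>0 \<xi>" and "k = \<rho>1 \<eta> \<ominus> \<rho>0 \<eta>"
  have J: "j \<in> J" "k \<in> J" using diff f by (auto simp: j_def k_def)
  have "\<gamma> \<noteq> - \<delta>" using g by auto
  then have i: "ip \<gamma> \<delta> \<ge> 0" using ip_int'[OF g(1,2)] root_sum[OF g(1,2)] g(3) by auto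
  then have i': "ip \<delta> \<gamma> \<ge> 0" by (simp add: ip_sym)
  have "shift \<gamma> (\<rho>0 \<xi>) (fst s) \<delta> k = fst s \<delta> k" "shift \<delta> (\<rho>0 \<eta>) (fst s) \<gamma> j = fst s \<gamma> j"
    using s g f J i i' by (auto intro!: shift_fixes)
  moreover have "fst s \<gamma> j + fst s \<delta> k = fst s \<delta> k + fst s \<gamma> j"
    using rep_fix[OF s g(1,2) i J] by (simp add: cj_fix)
  ultimately show ?thesis using shift_comm[OF s g(1,2) i, of "\<rho>0 \<xi>" "\<rho>0 \<eta>"] f
    by (simp add: step_def add.assoc flip: j_def k_def)
qed

text \<open>The coefficient N(c + j)(d + k) over \<gamma> + \<delta> exceeds N c d by three terms.
  \<open>P\<close> also arises when the shift along \<gamma> moves the increment at \<delta>, the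
  inverse of \<open>M\<close> when the shift along \<delta> moves the increment at \<gamma>, and
  \<open>R\<close> is the commutator of the two increments.\<close>

lemma stp_rel:
  assumes s: "rep (fst s)" and g: "\<gamma> \<in> \<Phi>" "\<delta> \<in> \<Phi>" "\<gamma> + \<delta> \<in> \<Phi>" and f: "\<xi> \<in> carrier Q" "\<eta> \<in> carrier Q"
  shows "stp \<delta> \<eta> (stp \<gamma> \<xi> s) = stp \<gamma> \<xi> (stp \<delta> \<eta> (stp (\<gamma> + \<delta>) (add_pow Q (N \<gamma> \<delta>) (\<xi> \<otimes>\<^bsub>Q\<^esub> \<eta>)) s))"
proof -
  define c d j k where "c = \<rho>0 \<xi>" and "d = \<rho>0 \<eta>" and "j = \<rho>1 \<xi> \<ominus> \<rho>0 \<xi>" and "k = \<rho>1 \<eta> \<ominus> \<rho>0 \<eta>"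
  define n where "n = N \<gamma> \<delta>"
  obtain y p where sp: "s = (y, p)" by fastforce
  have y: "rep y" using s sp by simp
  have J: "j \<in> J" "k \<in> J" using diff f by (auto simp: j_def k_def)
  have c: "c \<in> carrier V" "d \<in> carrier V" using f by (auto simp: c_def d_def)
  have nu: "n \<in> {1, -1}" using N_unit g by (simp add: n_def)
  have i: "ip \<gamma> \<delta> = -1" using root_sum g by blast
  then have i': "ip \<delta> \<gamma> = -1" by (simp add: ip_sym)
  have self: "ip \<gamma> \<gamma> = 2" "ip \<delta> \<delta> = 2" using g ip_self by auto
  have r1: "\<rho>1 \<xi> = c \<oplus> j" "\<rho>1 \<eta> = d \<oplus> k"
    using f by (simp_all add: c_def d_def j_def k_def add_diff_cancel_carrier)
  define \<zeta> z where "\<zeta> = add_pow Q n (\<xi> \<otimes>\<^bsub>Q\<^esub> \<eta>)" and "z = [n] \<cdot> (c \<otimes> d)"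
  have z0: "\<rho>0 \<zeta> = z" unfolding \<zeta>_def z_def c_def d_def
    using f nu by (subst ring_hom_add_pow_unit[OF Q.ring_axioms ring_axioms hom0]) auto
  have z1: "\<rho>1 \<zeta> = [n] \<cdot> ((c \<oplus> j) \<otimes> (d \<oplus> k))" unfolding \<zeta>_def
    using f nu by (subst ring_hom_add_pow_unit[OF Q.ring_axioms ring_axioms hom1]) (auto simp: r1)
  have "(c \<oplus> j) \<otimes> (d \<oplus> k) = c \<otimes> d \<oplus> (c \<otimes> k \<oplus> j \<otimes> d \<oplus> j \<otimes> k)"
    using c J by (simp add: l_distr r_distr a_ac)
  then have zd: "\<rho>1 \<zeta> \<ominus> \<rho>0 \<zeta> = [n] \<cdot> (c \<otimes> k) \<oplus> [n] \<cdot> (j \<otimes> d) \<oplus> [n] \<cdot> (j \<otimes> k)"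
    using c J by (simp add: z0 z1 z_def add.int_pow_distrib diff_cancel_left_carrier)
  define P M R where "P = y (\<gamma> + \<delta>) ([n] \<cdot> (c \<otimes> k))" and "M = y (\<gamma> + \<delta>) ([n] \<cdot> (j \<otimes> d))"
    and "R = y (\<gamma> + \<delta>) ([n] \<cdot> (j \<otimes> k))"
  have Z: "y (\<gamma> + \<delta>) (\<rho>1 \<zeta> \<ominus> \<rho>0 \<zeta>) = P + M + R"
    unfolding zd P_def M_def R_def using c J by (simp add: rep_add[OF y g(3)])
  define w v where "w = shift (\<gamma> + \<delta>) z y" and "v = shift \<delta> d w"
  have zV: "z \<in> carrier V" using c by (simp add: z_def)
  have w: "rep w" using shift_spec y g zV by (simp add: w_def)
  have 1: "shift \<gamma> c y \<delta> k = y \<delta> k + P"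
    using shift_moves(1)[OF y g(1) c(1) g(2) i' J(2)] by (simp add: P_def n_def add.commute)
  have 2: "w \<delta> k = y \<delta> k" unfolding w_def
    using self i i' by (intro shift_fixes[OF y g(3) zV g(2) _ J(2)]) (simp add: ip_simps)
  have 3: "v \<gamma> j = y \<gamma> j + - M"
  proof -
    have "w \<gamma> j = y \<gamma> j" unfolding w_def
      using self i i' by (intro shift_fixes[OF y g(3) zV g(1) _ J(1)]) (simp add: ip_simps)
    moreover have "w (\<gamma> + \<delta>) ([N \<delta> \<gamma>] \<cdot> (d \<otimes> j)) = y (\<gamma> + \<delta>) ([N \<delta> \<gamma>] \<cdot> (d \<otimes> j))" unfolding w_def
      using c J ip_self[OF g(3)] by (intro shift_fixes[OF y g(3) zV g(3)]) auto
    moreover have "[N \<delta> \<gamma>] \<cdot> (d \<otimes> j) = \<ominus> ([n] \<cdot> (j \<otimes> d))"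
      using N_anti[OF g] c J by (simp add: n_def add.int_pow_neg m_comm)
    ultimately show ?thesis using shift_moves(1)[OF w g(2) c(2) g(1) i J(1)] rep_minus[OF y] c J
      by (simp add: v_def M_def)
  qed
  have fx: "cj (y (\<gamma> + \<delta>) e) (y \<gamma> j) = y \<gamma> j" "cj (y (\<gamma> + \<delta>) e) (y \<delta> k) = y \<delta> k" if "e \<in> J" for e
    using that J self i i' g by (auto intro!: rep_fix[OF y] simp: ip_simps)
  have cP: "P + (y \<gamma> j + h) = y \<gamma> j + (P + h)" "P + (y \<delta> k + h) = y \<delta> k + (P + h)"
    and cM: "M + (y \<gamma> j + h) = y \<gamma> j + (M + h)" "M + (y \<delta> k + h) = y \<delta> k + (M + h)" for h
    using fx[of "[n] \<cdot> (c \<otimes> k)"] fx[of "[n] \<cdot> (j \<otimes> d)"] c J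
    by (simp_all add: P_def M_def cj_fix flip: add.assoc)
  have cR: "M + (R + h) = R + (M + h)" "P + (R + h) = R + (P + h)" for h
    using rep_fix[OF y g(3) g(3), of "[n] \<cdot> (j \<otimes> d)" "[n] \<cdot> (j \<otimes> k)"]
      rep_fix[OF y g(3) g(3), of "[n] \<cdot> (c \<otimes> k)" "[n] \<cdot> (j \<otimes> k)"] c J ip_self[OF g(3)]
    by (simp_all add: P_def M_def R_def cj_fix flip: add.assoc)
  have cPM: "P + (M + h) = M + (P + h)" for h
    using rep_fix[OF y g(3) g(3), of "[n] \<cdot> (c \<otimes> k)" "[n] \<cdot> (j \<otimes> d)"] c J ip_self[OF g(3)]
    by (simp add: P_def M_def cj_fix flip: add.assoc)
  have "cj (y \<gamma> j) (y \<delta> k) = R + y \<delta> k"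
    using rep_cj[OF y g(1,2) root_nz[OF g(3)] J] by (simp add: R_def n_def)
  then have K: "y \<gamma> j + y \<delta> k = R + y \<delta> k + y \<gamma> j" by (simp add: cj_def diff_eq_eq)
  have "p + y \<gamma> j + (y \<delta> k + P) = p + (P + M + R) + y \<delta> k + (y \<gamma> j + - M)"
  proof -
    have "y \<gamma> j + (y \<delta> k + P) = R + (y \<delta> k + (y \<gamma> j + P))" using arg_cong[OF K, of "\<lambda>z. z + P"] by (simp only: add.assoc)
    moreover have "P + M + R + y \<delta> k + (y \<gamma> j + - M) = R + (y \<delta> k + (y \<gamma> j + (P + (M + - M))))"
      unfolding add.assoc cR cPM cP cM by (simp only: cR cPM cP cM)
    ultimately show ?thesis by (simp add: add.assoc)
  qed
  moreover have "shift \<delta> d (shift \<gamma> c y) = shift \<gamma> c v"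
    using shift_rel[OF y g(1,2) i c] by (simp add: v_def w_def z_def n_def)
  moreover have "\<rho>1 \<xi> \<ominus> c = j" "\<rho>1 \<eta> \<ominus> d = k" by (simp_all add: c_def d_def j_def k_def)
  ultimately show ?thesis
    unfolding sp step_def n_def[symmetric] \<zeta>_def[symmetric] c_def[symmetric] d_def[symmetric]
    by (simp add: z0 1 Z[unfolded z0] w_def[symmetric] v_def[symmetric] 2 3)
qed

fun run :: "('e \<times> 'q) gword \<Rightarrow> ('e \<Rightarrow> 'a \<Rightarrow> 'g::group_add) \<times> 'g \<Rightarrow> ('e \<Rightarrow> 'a \<Rightarrow> 'g) \<times> 'g" where
  "run [] s = s"
| "run (((\<gamma>, f), b) # w) s = run w (stp \<gamma> (if b then f else \<ominus>\<^bsub>Q\<^esub> f) s)"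

lemma run_append: "run (u @ v) s = run v (run u s)"
  by (induction u s rule: run.induct) auto

lemma run_rep: "\<lbrakk>w \<in> gwords (steinberg_gens \<Phi> Q); rep (fst s)\<rbrakk> \<Longrightarrow> rep (fst (run w s))"
proof (induction w s rule: run.induct)
  case (2 \<gamma> f b w s)
  then show ?case using stp_rep[OF 2(3), of \<gamma> "if b then f else \<ominus>\<^bsub>Q\<^esub> f"] by (simp add: steinberg_gens_def)
qed simp

text \<open>By the preceding lemmas the Steinberg group of \<open>Q\<close> acts from the right on
  the states whose first component satisfies the relations over \<open>J\<close>.\<close>

lemma run_rel:
  assumes "(u, v) \<in> gword_rel (steinberg_gens \<Phi> Q) (steinberg_rels \<Phi> N Q)"
  shows "\<forall>s :: ('e \<Rightarrow> 'a \<Rightarrow> 'g::group_add) \<times> 'g. rep (fst s) \<longrightarrow> run u s = run v s"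
  using assms
proof (induction rule: gword_rel.induct)
  case (cancel x u v b)
  obtain \<gamma> f where x: "x = (\<gamma>, f)" by fastforce
  show ?case
  proof (intro allI impI)
    fix t :: "('e \<Rightarrow> 'a \<Rightarrow> 'g) \<times> 'g" assume t: "rep (fst t)"
    have g: "\<gamma> \<in> \<Phi>" "f \<in> carrier Q" using cancel x by (auto simp: steinberg_gens_def)
    show "run (u @ [(x, b), (x, \<not> b)] @ v) t = run (u @ v) t"
      using stp_cancel[OF run_rep[OF cancel(2) t] g] by (simp add: x run_append)
  qed
next
  case (relation r s u v)
  have "run r t = run s t" if t: "rep (fst t)" for t :: "('e \<Rightarrow> 'a \<Rightarrow> 'g) \<times> 'g"
  proof -
    consider (1) \<gamma> \<xi> \<eta> where "r = root_elt \<gamma> \<xi> @ root_elt \<gamma> \<eta>" "s = root_elt \<gamma> (\<xi> \<oplus>\<^bsub>Q\<^esub> \<eta>)"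
        "\<gamma> \<in> \<Phi>" "\<xi> \<in> carrier Q" "\<eta> \<in> carrier Q"
      | (2) \<gamma> \<delta> \<xi> \<eta> where "r = gword_comm (root_elt \<gamma> \<xi>) (root_elt \<delta> \<eta>)" "s = []"
        "\<gamma> \<in> \<Phi>" "\<delta> \<in> \<Phi>" "\<xi> \<in> carrier Q" "\<eta> \<in> carrier Q" "\<gamma> + \<delta> \<notin> \<Phi> \<union> {0}"
      | (3) \<gamma> \<delta> \<xi> \<eta> where "r = gword_comm (root_elt \<gamma> \<xi>) (root_elt \<delta> \<eta>)"
        "s = root_elt (\<gamma> + \<delta>) (add_pow Q (N \<gamma> \<delta>) (\<xi> \<otimes>\<^bsub>Q\<^esub> \<eta>))"
        "\<gamma> \<in> \<Phi>" "\<delta> \<in> \<Phi>" "\<xi> \<in> carrier Q" "\<eta> \<in> carrier Q" "\<gamma> + \<delta> \<in> \<Phi>"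
      using relation(1) unfolding steinberg_rels_def by blast
    then show ?thesis
    proof cases
      case 1
      then show ?thesis using stp_add[OF t] by simp
    next
      case 2
      have "run r t = stp \<delta> (\<ominus>\<^bsub>Q\<^esub> \<eta>) (stp \<gamma> (\<ominus>\<^bsub>Q\<^esub> \<xi>) (stp \<delta> \<eta> (stp \<gamma> \<xi> t)))"
        by (simp add: 2 gword_comm_def gword_inv_def)
      also have "\<dots> = t" using 2 t stp_comm[OF t 2(3,4,7,5,6)] by (simp add: stp_rep stp_cancel)
      finally show ?thesis by (simp add: 2)
    next
      case 3
      define t' where "t' = stp (\<gamma> + \<delta>) (add_pow Q (N \<gamma> \<delta>) (\<xi> \<otimes>\<^bsub>Q\<^esub> \<eta>)) t"
      have t': "rep (fst t')" unfolding t'_def using 3 t by (intro stp_rep) auto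
      have "run r t = stp \<delta> (\<ominus>\<^bsub>Q\<^esub> \<eta>) (stp \<gamma> (\<ominus>\<^bsub>Q\<^esub> \<xi>) (stp \<delta> \<eta> (stp \<gamma> \<xi> t)))"
        by (simp add: 3 gword_comm_def gword_inv_def)
      also have "\<dots> = t'" using 3 t' stp_rel[OF t 3(3,4,7,5,6), folded t'_def] by (simp add: stp_rep stp_cancel)
      finally show ?thesis by (simp add: 3 t'_def)
    qed
  qed
  note same = this
  show ?case
  proof (intro allI impI)
    fix t :: "('e \<Rightarrow> 'a \<Rightarrow> 'g) \<times> 'g" assume t: "rep (fst t)"
    show "run (u @ r @ v) t = run (u @ s @ v) t"
      using same[OF run_rep[OF relation(4) t]] by (simp add: run_append)
  qed
qed auto

end

text \<open>
  Under the \<open>\<rho>\<close>-action the prefixes of \<open>map_coef \<iota> w\<close> lead from the representation \<open>E \<gamma> (\<pi> j)\<close>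
  to its conjugates by the \<open>\<tau>0\<close>-values of these prefixes; the second component of the state is the
  quotient of the \<open>\<tau>1\<close>-value by the \<open>\<tau>0\<close>-value. If \<open>map_coef \<iota> w\<close> is trivial, so is this quotient.
\<close>

theorem (in core_action) word_eval_eq:
  fixes E :: "'e \<Rightarrow> 'r \<Rightarrow> 'g::group_add"
  assumes A: "cring A" and E: "steinberg_rep \<Phi> N A (carrier A) E"
    and Q': "cring Q'" and iota: "\<iota> \<in> ring_hom Q' Q"
    and tau: "\<tau>0 \<in> ring_hom Q' A" "\<tau>1 \<in> ring_hom Q' A"
    and pi_closed: "\<And>j. j \<in> J \<Longrightarrow> \<pi> j \<in> carrier A"
    and pi_add: "\<And>j k. \<lbrakk>j \<in> J; k \<in> J\<rbrakk> \<Longrightarrow> \<pi> (j \<oplus> k) = \<pi> j \<oplus>\<^bsub>A\<^esub> \<pi> k"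
    and pi_mult: "\<And>j k. \<lbrakk>j \<in> J; k \<in> J\<rbrakk> \<Longrightarrow> \<pi> (j \<otimes> k) = \<pi> j \<otimes>\<^bsub>A\<^esub> \<pi> k"
    and pi_diff: "\<And>f. f \<in> carrier Q' \<Longrightarrow> \<pi> (\<rho>1 (\<iota> f) \<ominus> \<rho>0 (\<iota> f)) = \<tau>1 f \<ominus>\<^bsub>A\<^esub> \<tau>0 f"
    and pi_act: "\<And>f j. \<lbrakk>f \<in> carrier Q'; j \<in> J\<rbrakk> \<Longrightarrow> \<pi> (\<rho>0 (\<iota> f) \<otimes> j) = \<tau>0 f \<otimes>\<^bsub>A\<^esub> \<pi> j"
    and w: "w \<in> gwords (steinberg_gens \<Phi> Q')"
    and rel: "(map_coef \<iota> w, []) \<in> gword_rel (steinberg_gens \<Phi> Q) (steinberg_rels \<Phi> N Q)"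
  shows "word_eval (\<lambda>(\<gamma>, f). E \<gamma> (\<tau>1 f)) w = word_eval (\<lambda>(\<gamma>, f). E \<gamma> (\<tau>0 f)) w"
proof -
  interpret A: cring A by fact
  interpret Q': cring Q' by fact
  interpret i: ring_hom_ring Q' Q \<iota> using iota by (intro ring_hom_ringI2) (auto intro: Q'.ring_axioms Q.ring_axioms)
  interpret t0: ring_hom_ring Q' A \<tau>0 using tau by (intro ring_hom_ringI2) (auto intro: Q'.ring_axioms A.ring_axioms)
  interpret t1: ring_hom_ring Q' A \<tau>1 using tau by (intro ring_hom_ringI2) (auto intro: Q'.ring_axioms A.ring_axioms)
  have E_add: "E \<gamma> (a \<oplus>\<^bsub>A\<^esub> b) = E \<gamma> a + E \<gamma> b" if "\<gamma> \<in> \<Phi>" "a \<in> carrier A" "b \<in> carrier A" for \<gamma> a b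
    using E that by (simp add: steinberg_rep_def)
  have E_cj: "cj (E \<gamma> a) (E \<delta> b) = E (\<gamma> + \<delta>) (add_pow A (N \<gamma> \<delta>) (a \<otimes>\<^bsub>A\<^esub> b)) + E \<delta> b"
    if "\<gamma> \<in> \<Phi>" "\<delta> \<in> \<Phi>" "a \<in> carrier A" "b \<in> carrier A" "\<gamma> + \<delta> \<noteq> 0" for \<gamma> \<delta> a b
    using E that by (simp add: steinberg_rep_def)
  have E_out: "E \<gamma> a = 0" if "\<gamma> \<notin> \<Phi>" for \<gamma> a using E that by (simp add: steinberg_rep_def)
  have E_zero: "E \<gamma> \<zero>\<^bsub>A\<^esub> = 0" if "\<gamma> \<in> \<Phi>" for \<gamma>
    using E_add[OF that, of "\<zero>\<^bsub>A\<^esub>" "\<zero>\<^bsub>A\<^esub>"] double_eq[of "E \<gamma> \<zero>\<^bsub>A\<^esub>"] by simp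
  have E_minus: "E \<gamma> (\<ominus>\<^bsub>A\<^esub> a) = - E \<gamma> a" if "\<gamma> \<in> \<Phi>" "a \<in> carrier A" for \<gamma> a
    using E_add[OF that(1), of "\<ominus>\<^bsub>A\<^esub> a" a] that E_zero by (simp add: A.l_neg eq_neg_iff_add_eq_0)
  have pi_zero: "\<pi> \<zero> = \<zero>\<^bsub>A\<^esub>"
    using pi_add[of \<zero> \<zero>] pi_closed[of \<zero>] by (simp add: A.add.l_cancel_one')
  have pi_minus: "\<pi> (\<ominus> j) = \<ominus>\<^bsub>A\<^esub> \<pi> j" if "j \<in> J" for j
    using pi_add[of "\<ominus> j" j] that pi_zero pi_closed A.minus_equality[of "\<pi> (\<ominus> j)" "\<pi> j"] by (simp add: l_neg)
  have pi_pow: "\<pi> ([k] \<cdot> j) = add_pow A k (\<pi> j)" if "j \<in> J" "(k::int) \<in> {1, -1}" for j k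
    using that pi_minus pi_closed by (auto simp: add_pow_unit A.add_pow_unit)
  \<comment> \<open>The representation with coefficients in \<open>J\<close> from which the action
    starts: \<open>E\<close> pulled back along \<open>\<pi>\<close>, which is additive and
    multiplicative on \<open>J\<close>.\<close>
  define x where "x \<gamma> j = (if j \<in> J then E \<gamma> (\<pi> j) else 0)" for \<gamma> j
  have x: "rep x"
    unfolding steinberg_rep_def
  proof (intro conjI ballI allI impI)
    fix \<gamma> \<delta> a b assume a: "\<gamma> \<in> \<Phi>" "\<delta> \<in> \<Phi>" "a \<in> J" "b \<in> J" "\<gamma> + \<delta> \<noteq> 0"
    then have "cj (x \<gamma> a) (x \<delta> b) = E (\<gamma> + \<delta>) (add_pow A (N \<gamma> \<delta>) (\<pi> a \<otimes>\<^bsub>A\<^esub> \<pi> b)) + x \<delta> b"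
      by (simp add: x_def E_cj pi_closed)
    also have "E (\<gamma> + \<delta>) (add_pow A (N \<gamma> \<delta>) (\<pi> a \<otimes>\<^bsub>A\<^esub> \<pi> b)) = x (\<gamma> + \<delta>) ([N \<gamma> \<delta>] \<cdot> (a \<otimes> b))"
      using a N_unit[of \<gamma> \<delta>] E_out by (cases "\<gamma> + \<delta> \<in> \<Phi>") (simp_all add: x_def pi_pow pi_mult)
    finally show "cj (x \<gamma> a) (x \<delta> b) = x (\<gamma> + \<delta>) ([N \<gamma> \<delta>] \<cdot> (a \<otimes> b)) + x \<delta> b" .
  qed (auto simp: x_def pi_add E_add pi_closed E_out)
  define e0 e1 where "e0 = word_eval (\<lambda>(\<gamma>, f). E \<gamma> (\<tau>0 f))" and "e1 = word_eval (\<lambda>(\<gamma>, f). E \<gamma> (\<tau>1 f))"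
  have main: "run (map_coef \<iota> w) (x, 0) = (\<lambda>\<gamma> a. cj (e0 w) (x \<gamma> a), e1 w - e0 w)"
    if "w \<in> gwords (steinberg_gens \<Phi> Q')" for w
    using that
  proof (induction w rule: rev_induct)
    case Nil
    then show ?case by (simp add: e0_def e1_def)
  next
    case (snoc l w)
    obtain \<gamma> f b where l: "l = ((\<gamma>, f), b)" by (metis prod.collapse)
    define f' where "f' = (if b then f else \<ominus>\<^bsub>Q'\<^esub> f)"
    have g: "\<gamma> \<in> \<Phi>" and f: "f \<in> carrier Q'" "f' \<in> carrier Q'" and wf: "w \<in> gwords (steinberg_gens \<Phi> Q')"
      using snoc.prems by (auto simp: l steinberg_gens_def f'_def)
    have e: "e0 (w @ [l]) = e0 w + E \<gamma> (\<tau>0 f')" "e1 (w @ [l]) = e1 w + E \<gamma> (\<tau>1 f')"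
      using g f by (auto simp: l e0_def e1_def f'_def E_minus)
    have "run (map_coef \<iota> (w @ [l])) (x, 0) = stp \<gamma> (\<iota> f') (run (map_coef \<iota> w) (x, 0))"
      using f by (simp add: l run_append f'_def)
    also have "\<dots> = stp \<gamma> (\<iota> f') (\<lambda>\<gamma> a. cj (e0 w) (x \<gamma> a), e1 w - e0 w)" using snoc.IH[OF wf] by simp
    also have "\<dots> = (shift \<gamma> (\<rho>0 (\<iota> f')) (\<lambda>\<gamma> a. cj (e0 w) (x \<gamma> a)),
        e1 w - e0 w + cj (e0 w) (x \<gamma> (\<rho>1 (\<iota> f') \<ominus> \<rho>0 (\<iota> f'))))" by (simp add: step_def)
    also have "shift \<gamma> (\<rho>0 (\<iota> f')) (\<lambda>\<gamma> a. cj (e0 w) (x \<gamma> a)) = (\<lambda>\<gamma> a. cj (e0 (w @ [l])) (x \<gamma> a))"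
    proof (rule shift_unique)
      show "rep (\<lambda>\<gamma> a. cj (e0 w) (x \<gamma> a))" "rep (\<lambda>\<gamma> a. cj (e0 (w @ [l])) (x \<gamma> a))" by (rule rep_conj[OF x])+
      show "\<gamma> \<in> \<Phi>" "\<rho>0 (\<iota> f') \<in> carrier V" using g f by auto
      fix \<delta> a assume d: "\<delta> \<in> \<Phi>" "\<delta> \<noteq> - \<gamma>" "a \<in> J"
      then have nz: "\<gamma> + \<delta> \<noteq> 0" by (auto simp: add_eq_0_iff)
      have D: "cj (E \<gamma> (\<tau>0 f')) (x \<delta> a) = x (\<delta> + \<gamma>) ([N \<gamma> \<delta>] \<cdot> (\<rho>0 (\<iota> f') \<otimes> a)) + x \<delta> a"
        using d g f nz E_cj[of \<gamma> \<delta> "\<tau>0 f'" "\<pi> a"] E_out[of "\<gamma> + \<delta>"] N_unit[of \<gamma> \<delta>]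
        by (cases "\<gamma> + \<delta> \<in> \<Phi>") (simp_all add: x_def pi_closed pi_act pi_pow add.commute)
      have cm: "x (\<delta> + \<gamma>) ([N \<gamma> \<delta>] \<cdot> (\<rho>0 (\<iota> f') \<otimes> a)) + x \<delta> a = x \<delta> a + x (\<delta> + \<gamma>) ([N \<gamma> \<delta>] \<cdot> (\<rho>0 (\<iota> f') \<otimes> a))"
      proof (cases "\<delta> + \<gamma> \<in> \<Phi>")
        case True
        then have "ip \<delta> \<gamma> = -1" using root_sum d g by blast
        then have "cj (x (\<delta> + \<gamma>) ([N \<gamma> \<delta>] \<cdot> (\<rho>0 (\<iota> f') \<otimes> a))) (x \<delta> a) = x \<delta> a"
          using d g f True ip_self[OF d(1)] ip_sym[of \<gamma> \<delta>] by (intro rep_fix[OF x]) (auto simp: ip_simps)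
        then show ?thesis by (simp add: cj_fix)
      qed (simp add: rep_outside[OF x])
      show "cj (e0 (w @ [l])) (x \<delta> a) = cj (e0 w) (x \<delta> a) + cj (e0 w) (x (\<delta> + \<gamma>) ([N \<gamma> \<delta>] \<cdot> (\<rho>0 (\<iota> f') \<otimes> a)))"
        unfolding e(1) cj_cj D cm by (rule cj_add)
    qed
    also have "e1 w - e0 w + cj (e0 w) (x \<gamma> (\<rho>1 (\<iota> f') \<ominus> \<rho>0 (\<iota> f'))) = e1 (w @ [l]) - e0 (w @ [l])"
    proof -
      have "x \<gamma> (\<rho>1 (\<iota> f') \<ominus> \<rho>0 (\<iota> f')) = E \<gamma> (\<tau>1 f' \<ominus>\<^bsub>A\<^esub> \<tau>0 f')"
        using f diff[of "\<iota> f'"] by (simp add: x_def pi_diff)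
      also have "\<dots> = E \<gamma> (\<tau>1 f') + - E \<gamma> (\<tau>0 f')"
        using g f by (simp add: A.minus_eq E_add E_minus)
      finally show ?thesis unfolding e by (simp only: cj_def group_norm)
    qed
    finally show ?case .
  qed
  have "run (map_coef \<iota> w) (x, 0) = (x, 0)" using run_rel[OF rel, THEN spec, of "(x, 0)"] x by simp
  then have "e1 w - e0 w = 0" using main[OF w] by simp
  then show ?thesis by (simp add: e0_def e1_def)
qed

section \<open>Presented groups and Steinberg groups\<close>

text \<open>
  Actions on states require a type of class \<open>group_add\<close>; a presented group is embedded into such a
  type by its regular representation.
\<close>

typedef 'a bijection = "{f :: 'a \<Rightarrow> 'a. bij f}"
  by (rule exI[of _ id]) simp

setup_lifting type_definition_bijection

instantiation bijection :: (type) group_add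
begin

lift_definition zero_bijection :: "'a bijection" is id by simp
lift_definition plus_bijection :: "'a bijection \<Rightarrow> 'a bijection \<Rightarrow> 'a bijection" is "(\<circ>)" by (rule bij_comp)
lift_definition uminus_bijection :: "'a bijection \<Rightarrow> 'a bijection" is "inv_into UNIV" by (rule bij_imp_bij_inv)
definition "minus_bijection f g = f + - (g :: 'a bijection)"

instance
proof
  fix a b c :: "'a bijection"
  show "a + b + c = a + (b + c)" by transfer auto
  show "0 + a = a" "a + 0 = a" by (transfer, simp)+
  show "- a + a = 0" by transfer (simp add: bij_is_inj)
qed (simp add: minus_bijection_def)

end

text \<open>The identity off the carrier, so that left translation is a bijection of the whole
  type.\<close>

definition left_mult :: "('a, 'm) monoid_scheme \<Rightarrow> 'a \<Rightarrow> 'a bijection" where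
  "left_mult G g = Abs_bijection (\<lambda>h. if h \<in> carrier G then g \<otimes>\<^bsub>G\<^esub> h else h)"

context group begin

lemma Rep_left_mult:
  assumes g: "g \<in> carrier G"
  shows "Rep_bijection (left_mult G g) = (\<lambda>h. if h \<in> carrier G then g \<otimes> h else h)"
proof -
  have "bij (\<lambda>h. if h \<in> carrier G then g \<otimes> h else h)"
    using g by (intro o_bij[where g = "\<lambda>h. if h \<in> carrier G then inv g \<otimes> h else h"]) (auto simp: fun_eq_iff simp flip: m_assoc)
  then show ?thesis by (simp add: left_mult_def Abs_bijection_inverse)
qed

lemma left_mult_mult: "\<lbrakk>g \<in> carrier G; h \<in> carrier G\<rbrakk> \<Longrightarrow> left_mult G (g \<otimes> h) = left_mult G g + left_mult G h"
  by (rule Rep_bijection_inject[THEN iffD1]) (auto simp: Rep_left_mult plus_bijection.rep_eq fun_eq_iff m_assoc)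

lemma left_mult_one: "left_mult G \<one> = 0"
  by (rule Rep_bijection_inject[THEN iffD1]) (auto simp: Rep_left_mult zero_bijection.rep_eq fun_eq_iff)

lemma left_mult_inj: "\<lbrakk>g \<in> carrier G; h \<in> carrier G; left_mult G g = left_mult G h\<rbrakk> \<Longrightarrow> g = h"
proof -
  assume a: "g \<in> carrier G" "h \<in> carrier G" "left_mult G g = left_mult G h"
  have "g = Rep_bijection (left_mult G g) \<one>" "h = Rep_bijection (left_mult G h) \<one>"
    using a(1,2) by (simp_all add: Rep_left_mult)
  then show ?thesis using a(3) by simp
qed

end

section \<open>Groups given by generators and relations, embedded into a type of class
  \<open>group_add\<close>\<close>

lemma gword_rel_gwords: "(u, v) \<in> gword_rel X Rel \<Longrightarrow> u \<in> gwords X \<and> v \<in> gwords X"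
  by (induction rule: gword_rel.induct) auto

lemma gword_inv_gwords: "gword_inv w \<in> gwords X \<longleftrightarrow> w \<in> gwords X"
  by (induction w) (auto simp: gword_inv_def)

lemma gword_rel_append1:
  assumes "(u, v) \<in> gword_rel X Rel" "w \<in> gwords X"
  shows "(u @ w, v @ w) \<in> gword_rel X Rel"
  using assms
proof (induction rule: gword_rel.induct)
  case (cancel x u v b)
  then show ?case using gword_rel.cancel[of x X u "v @ w" b] by simp
next
  case (relation r s u v)
  then show ?case using gword_rel.relation[of r s Rel X u "v @ w"] by simp
qed (auto intro: gword_rel.refl gword_rel.sym elim: gword_rel.trans)

lemma gword_rel_append2:
  assumes "(u, v) \<in> gword_rel X Rel" "w \<in> gwords X"
  shows "(w @ u, w @ v) \<in> gword_rel X Rel"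
  using assms
proof (induction rule: gword_rel.induct)
  case (cancel x u v b)
  then show ?case using gword_rel.cancel[of x X "w @ u" v b] by simp
next
  case (relation r s u v)
  then show ?case using gword_rel.relation[of r s Rel X "w @ u" v] by simp
qed (auto intro: gword_rel.refl gword_rel.sym elim: gword_rel.trans)

lemma gword_rel_append:
  assumes "(u, v) \<in> gword_rel X Rel" "(u', v') \<in> gword_rel X Rel"
  shows "(u @ u', v @ v') \<in> gword_rel X Rel"
proof (rule gword_rel.trans)
  show "(u @ u', v @ u') \<in> gword_rel X Rel" using gword_rel_append1[OF assms(1)] gword_rel_gwords[OF assms(2)] by blast
  show "(v @ u', v @ v') \<in> gword_rel X Rel" using gword_rel_append2[OF assms(2)] gword_rel_gwords[OF assms(1)] by blast
qed

lemma gword_rel_inv: "w \<in> gwords X \<Longrightarrow> (gword_inv w @ w, []) \<in> gword_rel X Rel"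
proof (induction w)
  case Nil
  then show ?case by (auto simp: gword_inv_def intro: gword_rel.refl)
next
  case (Cons l w)
  obtain x b where l: "l = (x, b)" by fastforce
  have x: "x \<in> X" "w \<in> gwords X" using Cons.prems l by auto
  have "(gword_inv w @ [(x, \<not> b), (x, \<not> \<not> b)] @ w, gword_inv w @ w) \<in> gword_rel X Rel"
    using x by (intro gword_rel.cancel) (auto simp: gword_inv_gwords)
  then show ?case using gword_rel.trans[OF _ Cons.IH[OF x(2)]] l by (simp add: gword_inv_def)
qed

definition word_class :: "'x set \<Rightarrow> ('x gword \<times> 'x gword) set \<Rightarrow> 'x gword \<Rightarrow> 'x gword set" where
  "word_class X Rel w = gword_rel X Rel `` {w}"

lemma equiv_gword_rel: "equiv (gwords X) (gword_rel X Rel)"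
proof (intro equivI refl_onI symI transI subsetI)
  fix p assume "p \<in> gword_rel X Rel"
  then show "p \<in> gwords X \<times> gwords X" using gword_rel_gwords by (cases p) auto
next
  fix w assume "w \<in> gwords X" then show "(w, w) \<in> gword_rel X Rel" by (rule gword_rel.refl)
next
  fix u v assume "(u, v) \<in> gword_rel X Rel" then show "(v, u) \<in> gword_rel X Rel" by (rule gword_rel.sym)
next
  fix u v w assume "(u, v) \<in> gword_rel X Rel" "(v, w) \<in> gword_rel X Rel"
  then show "(u, w) \<in> gword_rel X Rel" by (rule gword_rel.trans)
qed

lemma word_class_eq_iff:
  "\<lbrakk>u \<in> gwords X; v \<in> gwords X\<rbrakk> \<Longrightarrow> word_class X Rel u = word_class X Rel v \<longleftrightarrow> (u, v) \<in> gword_rel X Rel"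
  unfolding word_class_def by (rule eq_equiv_class_iff[OF equiv_gword_rel])

lemma presented_group_carrier: "carrier (presented_group X Rel) = word_class X Rel ` gwords X"
  by (auto simp: presented_group_def word_class_def quotient_def)

lemma presented_group_one: "\<one>\<^bsub>presented_group X Rel\<^esub> = word_class X Rel []"
  by (simp add: presented_group_def word_class_def)

lemma presented_group_mult:
  assumes "u \<in> gwords X" "v \<in> gwords X"
  shows "word_class X Rel u \<otimes>\<^bsub>presented_group X Rel\<^esub> word_class X Rel v = word_class X Rel (u @ v)"
proof -
  have "word_class X Rel (u' @ v') = word_class X Rel (u @ v)"
    if "(u, u') \<in> gword_rel X Rel" "(v, v') \<in> gword_rel X Rel" for u' v'
    using gword_rel_append[OF that] that gword_rel_gwords[OF that(1)] gword_rel_gwords[OF that(2)]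
    by (subst word_class_eq_iff) (auto intro: gword_rel.sym)
  then have "(\<Union>u'\<in>word_class X Rel u. \<Union>v'\<in>word_class X Rel v. word_class X Rel (u' @ v'))
      = (\<Union>u'\<in>word_class X Rel u. \<Union>v'\<in>word_class X Rel v. word_class X Rel (u @ v))"
    by (intro SUP_cong refl) (simp_all add: word_class_def)
  moreover have "u \<in> word_class X Rel u" "v \<in> word_class X Rel v"
    using assms by (simp_all add: word_class_def gword_rel.refl)
  ultimately have "(\<Union>u'\<in>word_class X Rel u. \<Union>v'\<in>word_class X Rel v. word_class X Rel (u' @ v')) = word_class X Rel (u @ v)"
    by auto
  then show ?thesis by (simp add: presented_group_def word_class_def)
qed

lemma group_presented_group: "group (presented_group X Rel)"
proof (rule groupI)
  fix x assume "x \<in> carrier (presented_group X Rel)"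
  then obtain w where w: "w \<in> gwords X" "x = word_class X Rel w" by (auto simp: presented_group_carrier)
  then have "word_class X Rel (gword_inv w) \<otimes>\<^bsub>presented_group X Rel\<^esub> x = \<one>\<^bsub>presented_group X Rel\<^esub>"
    using gword_rel_inv[OF w(1), of Rel]
    by (simp add: presented_group_mult presented_group_one gword_inv_gwords word_class_eq_iff)
  then show "\<exists>y\<in>carrier (presented_group X Rel). y \<otimes>\<^bsub>presented_group X Rel\<^esub> x = \<one>\<^bsub>presented_group X Rel\<^esub>"
    using w by (auto simp: presented_group_carrier gword_inv_gwords)
qed (auto simp: presented_group_carrier presented_group_one presented_group_mult)

definition gel :: "'x set \<Rightarrow> ('x gword \<times> 'x gword) set \<Rightarrow> 'x gword \<Rightarrow> 'x gword set bijection" where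
  "gel X Rel w = left_mult (presented_group X Rel) (word_class X Rel w)"

lemma gel_eq_iff: "\<lbrakk>u \<in> gwords X; v \<in> gwords X\<rbrakk> \<Longrightarrow> gel X Rel u = gel X Rel v \<longleftrightarrow> (u, v) \<in> gword_rel X Rel"
proof -
  assume w: "u \<in> gwords X" "v \<in> gwords X"
  have "gel X Rel u = gel X Rel v \<longleftrightarrow> word_class X Rel u = word_class X Rel v"
    using group.left_mult_inj[OF group_presented_group, of "word_class X Rel u" X Rel "word_class X Rel v"] w
    by (auto simp: gel_def presented_group_carrier)
  then show ?thesis by (simp only: word_class_eq_iff[OF w])
qed

lemma gel_append: "\<lbrakk>u \<in> gwords X; v \<in> gwords X\<rbrakk> \<Longrightarrow> gel X Rel (u @ v) = gel X Rel u + gel X Rel v"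
  unfolding gel_def by (simp add: group.left_mult_mult[OF group_presented_group, symmetric] presented_group_carrier presented_group_mult)

lemma gel_Nil: "gel X Rel [] = 0"
  unfolding gel_def using group.left_mult_one[OF group_presented_group] by (simp add: presented_group_one)

lemma gel_word_eval: "w \<in> gwords X \<Longrightarrow> gel X Rel w = word_eval (\<lambda>x. gel X Rel [(x, True)]) w"
proof (induction w)
  case Nil
  then show ?case by (simp add: gel_Nil)
next
  case (Cons l w)
  obtain x b where l: "l = (x, b)" by fastforce
  have x: "x \<in> X" "w \<in> gwords X" using Cons.prems l by auto
  have "gel X Rel [(x, False)] + gel X Rel [(x, True)] = gel X Rel ([(x, False)] @ [(x, True)])"
    using x by (intro gel_append[symmetric]) auto
  also have "\<dots> = 0" using gword_rel.cancel[of x X "[]" "[]" False Rel] x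
    by (simp add: gel_eq_iff flip: gel_Nil[of X Rel])
  finally have "gel X Rel [(x, False)] = - gel X Rel [(x, True)]" by (simp add: eq_neg_iff_add_eq_0)
  moreover have "gel X Rel (l # w) = gel X Rel [l] + gel X Rel w" using gel_append[of "[l]" X w Rel] x l by simp
  ultimately show ?case using Cons.IH[OF x(2)] l by (cases b) auto
qed

text \<open>The values 0 at non-roots and outside the ring are those that
  \<open>steinberg_rep\<close> prescribes.\<close>

definition St_elt :: "'e::euclidean_space set \<Rightarrow> ('e \<Rightarrow> 'e \<Rightarrow> int) \<Rightarrow> ('a, 'm) ring_scheme \<Rightarrow> 'e \<Rightarrow> 'a \<Rightarrow> ('e \<times> 'a) gword set bijection" where
  "St_elt \<Phi> N A \<gamma> a = (if \<gamma> \<in> \<Phi> \<and> a \<in> carrier A then gel (steinberg_gens \<Phi> A) (steinberg_rels \<Phi> N A) (root_elt \<gamma> a) else 0)"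

abbreviation St_word :: "'e::euclidean_space set \<Rightarrow> ('e \<Rightarrow> 'e \<Rightarrow> int) \<Rightarrow> ('a, 'm) ring_scheme \<Rightarrow> ('e \<times> 'a) gword \<Rightarrow> ('e \<times> 'a) gword set bijection" where
  "St_word \<Phi> N A w \<equiv> gel (steinberg_gens \<Phi> A) (steinberg_rels \<Phi> N A) w"

abbreviation St_words :: "'e set \<Rightarrow> ('a, 'm) ring_scheme \<Rightarrow> ('e \<times> 'a) gword set" where
  "St_words \<Phi> A \<equiv> gwords (steinberg_gens \<Phi> A)"

abbreviation St_eq :: "'e::euclidean_space set \<Rightarrow> ('e \<Rightarrow> 'e \<Rightarrow> int) \<Rightarrow> ('a, 'm) ring_scheme \<Rightarrow> (('e \<times> 'a) gword \<times> ('e \<times> 'a) gword) set" where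
  "St_eq \<Phi> N A \<equiv> gword_rel (steinberg_gens \<Phi> A) (steinberg_rels \<Phi> N A)"

lemma St_word_eval: "w \<in> St_words \<Phi> A \<Longrightarrow> St_word \<Phi> N A w = word_eval (\<lambda>(\<gamma>, a). St_elt \<Phi> N A \<gamma> a) w"
proof (induction w)
  case Nil
  then show ?case by (simp add: gel_Nil)
next
  case (Cons l w)
  then show ?case using gel_word_eval[of "l # w" "steinberg_gens \<Phi> A" "steinberg_rels \<Phi> N A"]
      gel_word_eval[of w "steinberg_gens \<Phi> A" "steinberg_rels \<Phi> N A"]
    by (cases l) (auto simp: St_elt_def steinberg_gens_def)
qed

lemma gel_relation:
  assumes "(r, s) \<in> Rel" "r \<in> gwords X" "s \<in> gwords X"
  shows "gel X Rel r = gel X Rel s"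
  using gword_rel.relation[OF assms, of "[]" "[]"] assms by (simp add: gel_eq_iff)

lemma steinberg_gens_iff: "(\<gamma>, a) \<in> steinberg_gens \<Phi> A \<longleftrightarrow> \<gamma> \<in> \<Phi> \<and> a \<in> carrier A"
  by (simp add: steinberg_gens_def)

lemma St_elt_rep:
  assumes "ring A"
  shows "steinberg_rep \<Phi> N A (carrier A) (St_elt \<Phi> N A)"
proof -
  interpret A: ring A by fact
  let ?X = "steinberg_gens \<Phi> A" and ?R = "steinberg_rels \<Phi> N A"
  have elt: "word_eval (\<lambda>(\<gamma>, a). St_elt \<Phi> N A \<gamma> a) (root_elt \<gamma> a) = St_elt \<Phi> N A \<gamma> a" for \<gamma> a by simp
  show ?thesis
    unfolding steinberg_rep_def
  proof (intro conjI ballI allI impI)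
    fix \<gamma> a assume "\<gamma> \<notin> \<Phi> \<or> a \<notin> carrier A"
    then show "St_elt \<Phi> N A \<gamma> a = 0" by (auto simp: St_elt_def)
  next
    fix \<gamma> a b assume g: "\<gamma> \<in> \<Phi>" "a \<in> carrier A" "b \<in> carrier A"
    have "St_word \<Phi> N A (root_elt \<gamma> a @ root_elt \<gamma> b) = St_word \<Phi> N A (root_elt \<gamma> (a \<oplus>\<^bsub>A\<^esub> b))"
      using g by (intro gel_relation) (auto simp: steinberg_rels_def steinberg_gens_iff)
    then show "St_elt \<Phi> N A \<gamma> (a \<oplus>\<^bsub>A\<^esub> b) = St_elt \<Phi> N A \<gamma> a + St_elt \<Phi> N A \<gamma> b"
      using g by (simp add: St_word_eval steinberg_gens_iff)
  next
    fix \<gamma> \<delta> a b assume g: "\<gamma> \<in> \<Phi>" "\<delta> \<in> \<Phi>" "a \<in> carrier A" "b \<in> carrier A" "\<gamma> + \<delta> \<noteq> 0"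
    let ?x = "St_elt \<Phi> N A \<gamma> a" and ?y = "St_elt \<Phi> N A \<delta> b"
    let ?w = "gword_comm (root_elt \<gamma> a) (root_elt \<delta> b)"
    have w: "?w \<in> St_words \<Phi> A" using g by (simp add: gword_comm_def gword_inv_def steinberg_gens_iff)
    have "St_word \<Phi> N A ?w = ?x + (?y + (- ?x + - ?y))"
      using w by (simp only: St_word_eval) (simp add: gword_comm_def gword_inv_def add.assoc)
    moreover have "St_word \<Phi> N A ?w = St_elt \<Phi> N A (\<gamma> + \<delta>) (add_pow A (N \<gamma> \<delta>) (a \<otimes>\<^bsub>A\<^esub> b))"
    proof (cases "\<gamma> + \<delta> \<in> \<Phi>")
      case True
      have "St_word \<Phi> N A ?w = St_word \<Phi> N A (root_elt (\<gamma> + \<delta>) (add_pow A (N \<gamma> \<delta>) (a \<otimes>\<^bsub>A\<^esub> b)))"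
        using g w True by (intro gel_relation) (auto simp: steinberg_rels_def steinberg_gens_iff)
      then show ?thesis using g True by (simp add: St_word_eval steinberg_gens_iff)
    next
      case False
      have "St_word \<Phi> N A ?w = St_word \<Phi> N A []"
        using g w False by (intro gel_relation) (auto simp: steinberg_rels_def)
      then show ?thesis using False by (simp add: gel_Nil St_elt_def)
    qed
    ultimately have "St_elt \<Phi> N A (\<gamma> + \<delta>) (add_pow A (N \<gamma> \<delta>) (a \<otimes>\<^bsub>A\<^esub> b)) = ?x + (?y + (- ?x + - ?y))" by simp
    then show "cj ?x ?y = St_elt \<Phi> N A (\<gamma> + \<delta>) (add_pow A (N \<gamma> \<delta>) (a \<otimes>\<^bsub>A\<^esub> b)) + ?y"
      by (simp only: cj_def group_norm)
  qed
qed

lemma map_coef_words: "\<lbrakk>w \<in> St_words \<Phi> A; h \<in> carrier A \<rightarrow> carrier B\<rbrakk> \<Longrightarrow> map_coef h w \<in> St_words \<Phi> B"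
  by (induction w) (auto simp: steinberg_gens_iff)

text \<open>\<open>E\<close> is taken to be the family of root elements of the Steinberg group of
  \<open>A\<close> itself. The regular representation is faithful, so equality of values is equality
  of the words in the group.\<close>

theorem (in core_action) St_lift:
  assumes A: "cring A"
    and Q': "cring Q'" and iota: "\<iota> \<in> ring_hom Q' Q"
    and tau: "\<tau>0 \<in> ring_hom Q' A" "\<tau>1 \<in> ring_hom Q' A"
    and pi_closed: "\<And>j. j \<in> J \<Longrightarrow> \<pi> j \<in> carrier A"
    and pi_add: "\<And>j k. \<lbrakk>j \<in> J; k \<in> J\<rbrakk> \<Longrightarrow> \<pi> (j \<oplus> k) = \<pi> j \<oplus>\<^bsub>A\<^esub> \<pi> k"
    and pi_mult: "\<And>j k. \<lbrakk>j \<in> J; k \<in> J\<rbrakk> \<Longrightarrow> \<pi> (j \<otimes> k) = \<pi> j \<otimes>\<^bsub>A\<^esub> \<pi> k"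
    and pi_diff: "\<And>f. f \<in> carrier Q' \<Longrightarrow> \<pi> (\<rho>1 (\<iota> f) \<ominus> \<rho>0 (\<iota> f)) = \<tau>1 f \<ominus>\<^bsub>A\<^esub> \<tau>0 f"
    and pi_act: "\<And>f j. \<lbrakk>f \<in> carrier Q'; j \<in> J\<rbrakk> \<Longrightarrow> \<pi> (\<rho>0 (\<iota> f) \<otimes> j) = \<tau>0 f \<otimes>\<^bsub>A\<^esub> \<pi> j"
    and w: "w \<in> St_words \<Phi> Q'" and rel: "(map_coef \<iota> w, []) \<in> St_eq \<Phi> N Q"
  shows "(map_coef \<tau>1 w, map_coef \<tau>0 w) \<in> St_eq \<Phi> N A"
proof -
  have r: "ring A" using A by (rule cring.axioms)
  have wt: "map_coef \<tau>0 w \<in> St_words \<Phi> A" "map_coef \<tau>1 w \<in> St_words \<Phi> A"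
    using w tau by (auto intro!: map_coef_words simp: ring_hom_def)
  have ev: "word_eval (\<lambda>(\<gamma>, f). St_elt \<Phi> N A \<gamma> (\<tau> f)) w = word_eval (\<lambda>(\<gamma>, a). St_elt \<Phi> N A \<gamma> a) (map_coef \<tau> w)" for \<tau>
    by (simp add: map_coef_def word_eval_map comp_def split_def)
  have "word_eval (\<lambda>(\<gamma>, f). St_elt \<Phi> N A \<gamma> (\<tau>1 f)) w = word_eval (\<lambda>(\<gamma>, f). St_elt \<Phi> N A \<gamma> (\<tau>0 f)) w"
    by (rule word_eval_eq[OF A St_elt_rep[OF r] Q' iota tau, where \<pi> = \<pi>]) (fact pi_closed pi_add pi_mult pi_diff pi_act w rel)+
  then have "St_word \<Phi> N A (map_coef \<tau>1 w) = St_word \<Phi> N A (map_coef \<tau>0 w)"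
    using wt by (simp add: St_word_eval ev)
  then show ?thesis using wt by (simp add: gel_eq_iff)
qed

lemma (in abelian_group) diff_eq_zero_iff:
  assumes "a \<in> carrier G" "b \<in> carrier G" shows "a \<ominus> b = \<zero> \<longleftrightarrow> a = b"
proof
  assume "a \<ominus> b = \<zero>"
  then show "a = b" using assms minus_equality[of a "\<ominus> b"] by (simp add: minus_eq)
qed (use assms in \<open>simp add: minus_eq r_neg\<close>)

section \<open>Rings of functions with pointwise operations\<close>

definition fun_ring :: "('a, 'm) ring_scheme \<Rightarrow> ('i \<Rightarrow> 'a) ring" where
  "fun_ring A = \<lparr>carrier = {f. \<forall>i. f i \<in> carrier A}, mult = (\<lambda>f g i. f i \<otimes>\<^bsub>A\<^esub> g i), one = (\<lambda>i. \<one>\<^bsub>A\<^esub>),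
     zero = (\<lambda>i. \<zero>\<^bsub>A\<^esub>), add = (\<lambda>f g i. f i \<oplus>\<^bsub>A\<^esub> g i)\<rparr>"

lemma fun_ring_simps [simp]:
  "f \<in> carrier (fun_ring A) \<longleftrightarrow> (\<forall>i. f i \<in> carrier A)"
  "f \<otimes>\<^bsub>fun_ring A\<^esub> g = (\<lambda>i. f i \<otimes>\<^bsub>A\<^esub> g i)"
  "\<one>\<^bsub>fun_ring A\<^esub> = (\<lambda>i. \<one>\<^bsub>A\<^esub>)"
  "\<zero>\<^bsub>fun_ring A\<^esub> = (\<lambda>i. \<zero>\<^bsub>A\<^esub>)"
  "f \<oplus>\<^bsub>fun_ring A\<^esub> g = (\<lambda>i. f i \<oplus>\<^bsub>A\<^esub> g i)"
  by (simp_all add: fun_ring_def)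

lemma cring_fun_ring:
  assumes "cring A" shows "cring (fun_ring A)"
proof -
  interpret cring A by fact
  show ?thesis
  proof (intro cringI abelian_groupI comm_monoidI)
    fix f assume "f \<in> carrier (fun_ring A)"
    then show "\<exists>g\<in>carrier (fun_ring A). g \<oplus>\<^bsub>fun_ring A\<^esub> f = \<zero>\<^bsub>fun_ring A\<^esub>"
      by (intro bexI[of _ "\<lambda>i. \<ominus>\<^bsub>A\<^esub> f i"]) (auto simp: l_neg)
  qed (auto simp: fun_eq_iff a_ac m_ac l_distr r_distr)
qed

lemma fun_ring_minus:
  assumes "cring A" "f \<in> carrier (fun_ring A)" "g \<in> carrier (fun_ring A)"
  shows "\<ominus>\<^bsub>fun_ring A\<^esub> f = (\<lambda>i. \<ominus>\<^bsub>A\<^esub> f i)" "f \<ominus>\<^bsub>fun_ring A\<^esub> g = (\<lambda>i. f i \<ominus>\<^bsub>A\<^esub> g i)"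
proof -
  interpret A: cring A by fact
  interpret F: cring "fun_ring A" using assms(1) by (rule cring_fun_ring)
  have m: "\<ominus>\<^bsub>fun_ring A\<^esub> f = (\<lambda>i. \<ominus>\<^bsub>A\<^esub> f i)" if "f \<in> carrier (fun_ring A)" for f
    using that by (intro F.minus_equality) (auto simp: A.l_neg)
  show "\<ominus>\<^bsub>fun_ring A\<^esub> f = (\<lambda>i. \<ominus>\<^bsub>A\<^esub> f i)" using m assms(2) .
  show "f \<ominus>\<^bsub>fun_ring A\<^esub> g = (\<lambda>i. f i \<ominus>\<^bsub>A\<^esub> g i)"
    using assms m[of g] by (simp add: F.minus_eq A.minus_eq)
qed

section \<open>Localization\<close>

text \<open>The axioms concern only the multiplicative set \<open>carrier R - M\<close>. They cover
  the complement of a maximal ideal as well as the set of constant denominators in a ring of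
  families.\<close>

locale localization = cring R for R (structure) +
  fixes M
  assumes one_notin: "\<one> \<in> carrier R - M"
    and mult_notin: "\<lbrakk>s \<in> carrier R - M; t \<in> carrier R - M\<rbrakk> \<Longrightarrow> s \<otimes> t \<in> carrier R - M"
begin

abbreviation S where "S \<equiv> carrier R - M"
abbreviation L where "L \<equiv> loc_ring R M"

lemma loc_rel_iff: "((a, s), (b, t)) \<in> loc_rel R M \<longleftrightarrow>
    a \<in> carrier R \<and> s \<in> S \<and> b \<in> carrier R \<and> t \<in> S \<and> (\<exists>u\<in>S. u \<otimes> a \<otimes> t = u \<otimes> b \<otimes> s)"
proof -
  have "u \<otimes> (a \<otimes> t \<ominus> b \<otimes> s) = \<zero> \<longleftrightarrow> u \<otimes> a \<otimes> t = u \<otimes> b \<otimes> s"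
    if "a \<in> carrier R" "s \<in> carrier R" "b \<in> carrier R" "t \<in> carrier R" "u \<in> carrier R" for u
  proof -
    have "u \<otimes> (a \<otimes> t \<ominus> b \<otimes> s) = u \<otimes> a \<otimes> t \<ominus> u \<otimes> b \<otimes> s"
      using that by (simp add: minus_eq r_distr r_minus m_assoc)
    then show ?thesis using that by (simp add: diff_eq_zero_iff)
  qed
  then show ?thesis by (auto simp: loc_rel_def)
qed

lemma loc_rel_trans:
  assumes "((a, s), (b, t)) \<in> loc_rel R M" "((b, t), (c, w)) \<in> loc_rel R M"
  shows "((a, s), (c, w)) \<in> loc_rel R M"
proof -
  obtain u v where uv: "u \<in> S" "v \<in> S" "u \<otimes> a \<otimes> t = u \<otimes> b \<otimes> s" "v \<otimes> b \<otimes> w = v \<otimes> c \<otimes> t"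
    and C: "a \<in> carrier R" "b \<in> carrier R" "c \<in> carrier R" "s \<in> S" "t \<in> S" "w \<in> S"
    using assms by (auto simp: loc_rel_iff)
  have "(u \<otimes> v \<otimes> t) \<otimes> a \<otimes> w = (v \<otimes> w) \<otimes> (u \<otimes> a \<otimes> t)" using uv(1,2) C by (simp add: m_ac)
  also have "\<dots> = (u \<otimes> s) \<otimes> (v \<otimes> b \<otimes> w)" unfolding uv(3) using uv(1,2) C by (simp add: m_ac)
  also have "\<dots> = (u \<otimes> v \<otimes> t) \<otimes> c \<otimes> s" unfolding uv(4) using uv(1,2) C by (simp add: m_ac)
  finally show ?thesis using uv C mult_notin unfolding loc_rel_iff by blast
qed

lemma equiv_loc_rel: "equiv (carrier R \<times> S) (loc_rel R M)"
proof (intro equivI refl_onI symI transI)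
  show "loc_rel R M \<subseteq> (carrier R \<times> S) \<times> (carrier R \<times> S)" by (auto simp: loc_rel_def)
next
  fix p assume "p \<in> carrier R \<times> S"
  then show "(p, p) \<in> loc_rel R M" using one_notin by (cases p) (auto simp: loc_rel_iff)
next
  fix p q assume "(p, q) \<in> loc_rel R M"
  then show "(q, p) \<in> loc_rel R M" by (cases p, cases q) (force simp: loc_rel_iff)
next
  fix p q r assume "(p, q) \<in> loc_rel R M" "(q, r) \<in> loc_rel R M"
  then show "(p, r) \<in> loc_rel R M" using loc_rel_trans by (cases p, cases q, cases r) blast
qed

lemma frac_eq_iff:
  assumes "a \<in> carrier R" "s \<in> S" "b \<in> carrier R" "t \<in> S"
  shows "loc_frac R M a s = loc_frac R M b t \<longleftrightarrow> (\<exists>u\<in>S. u \<otimes> a \<otimes> t = u \<otimes> b \<otimes> s)"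
  unfolding loc_frac_def using eq_equiv_class_iff[OF equiv_loc_rel, of "(a, s)" "(b, t)"] assms by (simp add: loc_rel_iff)

lemma L_carrier: "carrier L = {loc_frac R M a s | a s. a \<in> carrier R \<and> s \<in> S}"
  by (auto simp: loc_ring_def loc_frac_def quotient_def)

lemma frac_closed [simp]: "\<lbrakk>a \<in> carrier R; s \<in> S\<rbrakk> \<Longrightarrow> loc_frac R M a s \<in> carrier L"
  by (auto simp: L_carrier)

text \<open>The operations of \<open>loc_ring\<close> are unions over all representatives. Once the
  result is seen to be the same class for all of them, the union is this class.\<close>

lemma union_const:
  assumes "a \<in> carrier R" "s \<in> S" "b \<in> carrier R" "t \<in> S"
    and F: "\<And>a' s' b' t'. \<lbrakk>((a, s), (a', s')) \<in> loc_rel R M; ((b, t), (b', t')) \<in> loc_rel R M\<rbrakk> \<Longrightarrow> F a' s' b' t' = F a s b t"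
  shows "(\<Union>(a', s')\<in>loc_frac R M a s. \<Union>(b', t')\<in>loc_frac R M b t. F a' s' b' t') = F a s b t"
proof -
  have "(a, s) \<in> loc_frac R M a s" "(b, t) \<in> loc_frac R M b t"
    using assms equiv_class_self[OF equiv_loc_rel] by (auto simp: loc_frac_def)
  moreover have "\<forall>p\<in>loc_frac R M a s. \<forall>q\<in>loc_frac R M b t. F (fst p) (snd p) (fst q) (snd q) = F a s b t"
    using F by (auto simp: loc_frac_def)
  ultimately show ?thesis by (auto simp: split_def)
qed

lemma frac_mult [simp]:
  assumes C: "a \<in> carrier R" "s \<in> S" "b \<in> carrier R" "t \<in> S"
  shows "loc_frac R M a s \<otimes>\<^bsub>L\<^esub> loc_frac R M b t = loc_frac R M (a \<otimes> b) (s \<otimes> t)"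
  unfolding loc_ring_def using C
proof (simp, intro union_const)
  fix a' s' b' t' assume r: "((a, s), (a', s')) \<in> loc_rel R M" "((b, t), (b', t')) \<in> loc_rel R M"
  then obtain u v where uv: "u \<in> S" "v \<in> S" "u \<otimes> a \<otimes> s' = u \<otimes> a' \<otimes> s" "v \<otimes> b \<otimes> t' = v \<otimes> b' \<otimes> t"
    and C': "a' \<in> carrier R" "b' \<in> carrier R" "s' \<in> S" "t' \<in> S"
    by (auto simp: loc_rel_iff)
  have "(u \<otimes> v) \<otimes> (a' \<otimes> b') \<otimes> (s \<otimes> t) = (u \<otimes> a' \<otimes> s) \<otimes> (v \<otimes> b' \<otimes> t)" using uv(1,2) C C' by (simp add: m_ac)
  also have "\<dots> = (u \<otimes> v) \<otimes> (a \<otimes> b) \<otimes> (s' \<otimes> t')"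
    unfolding uv(3,4)[symmetric] using uv(1,2) C C' by (simp add: m_ac)
  finally show "loc_frac R M (a' \<otimes> b') (s' \<otimes> t') = loc_frac R M (a \<otimes> b) (s \<otimes> t)"
    using C C' uv mult_notin by (subst frac_eq_iff) auto
qed auto

lemma frac_add [simp]:
  assumes C: "a \<in> carrier R" "s \<in> S" "b \<in> carrier R" "t \<in> S"
  shows "loc_frac R M a s \<oplus>\<^bsub>L\<^esub> loc_frac R M b t = loc_frac R M (a \<otimes> t \<oplus> b \<otimes> s) (s \<otimes> t)"
  unfolding loc_ring_def using C
proof (simp, intro union_const)
  fix a' s' b' t' assume r: "((a, s), (a', s')) \<in> loc_rel R M" "((b, t), (b', t')) \<in> loc_rel R M"
  then obtain u v where uv: "u \<in> S" "v \<in> S" "u \<otimes> a \<otimes> s' = u \<otimes> a' \<otimes> s" "v \<otimes> b \<otimes> t' = v \<otimes> b' \<otimes> t"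
    and C': "a' \<in> carrier R" "b' \<in> carrier R" "s' \<in> S" "t' \<in> S"
    by (auto simp: loc_rel_iff)
  have "(u \<otimes> v) \<otimes> (a' \<otimes> t' \<oplus> b' \<otimes> s') \<otimes> (s \<otimes> t)
      = (u \<otimes> a' \<otimes> s) \<otimes> (v \<otimes> t \<otimes> t') \<oplus> (v \<otimes> b' \<otimes> t) \<otimes> (u \<otimes> s \<otimes> s')"
    using uv(1,2) C C' by (simp add: m_ac l_distr r_distr)
  also have "\<dots> = (u \<otimes> v) \<otimes> (a \<otimes> t \<oplus> b \<otimes> s) \<otimes> (s' \<otimes> t')"
    unfolding uv(3,4)[symmetric] using uv(1,2) C C' by (simp add: m_ac l_distr r_distr)
  finally show "loc_frac R M (a' \<otimes> t' \<oplus> b' \<otimes> s') (s' \<otimes> t') = loc_frac R M (a \<otimes> t \<oplus> b \<otimes> s) (s \<otimes> t)"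
    using C C' uv mult_notin by (subst frac_eq_iff) auto
qed auto

lemma L_one: "\<one>\<^bsub>L\<^esub> = loc_frac R M \<one> \<one>" and L_zero: "\<zero>\<^bsub>L\<^esub> = loc_frac R M \<zero> \<one>"
  by (simp_all add: loc_ring_def)

lemma frac_eqI: "\<lbrakk>a \<in> carrier R; s \<in> S; b \<in> carrier R; t \<in> S; a \<otimes> t = b \<otimes> s\<rbrakk> \<Longrightarrow> loc_frac R M a s = loc_frac R M b t"
  using one_notin by (subst frac_eq_iff) (auto simp: m_assoc)

lemma cring_loc_ring: "cring L"
proof (intro cringI abelian_groupI comm_monoidI)
  note closed = one_notin mult_notin
  have ex: "\<exists>a s. X = loc_frac R M a s \<and> a \<in> carrier R \<and> s \<in> carrier R \<and> s \<notin> M" if "X \<in> carrier L" for X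
    using that by (auto simp: L_carrier)
  have S: "s \<otimes> t \<notin> M" if "s \<in> carrier R" "s \<notin> M" "t \<in> carrier R" "t \<notin> M" for s t using that mult_notin by blast
  have one: "\<one> \<notin> M" using one_notin by blast
  {
    fix X Y Z assume "X \<in> carrier L" "Y \<in> carrier L" "Z \<in> carrier L"
    then obtain a s b t c w where X: "X = loc_frac R M a s" "a \<in> carrier R" "s \<in> carrier R" "s \<notin> M"
      and Y: "Y = loc_frac R M b t" "b \<in> carrier R" "t \<in> carrier R" "t \<notin> M"
      and Z: "Z = loc_frac R M c w" "c \<in> carrier R" "w \<in> carrier R" "w \<notin> M" by (metis ex)
    show "X \<oplus>\<^bsub>L\<^esub> Y \<oplus>\<^bsub>L\<^esub> Z = X \<oplus>\<^bsub>L\<^esub> (Y \<oplus>\<^bsub>L\<^esub> Z)"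
      using X Y Z by (simp add: S) (rule frac_eqI; simp add: S m_ac l_distr r_distr a_ac)
    show "X \<otimes>\<^bsub>L\<^esub> Y \<otimes>\<^bsub>L\<^esub> Z = X \<otimes>\<^bsub>L\<^esub> (Y \<otimes>\<^bsub>L\<^esub> Z)"
      using X Y Z by (simp add: S) (rule frac_eqI; simp add: S m_ac)
    show "(X \<oplus>\<^bsub>L\<^esub> Y) \<otimes>\<^bsub>L\<^esub> Z = X \<otimes>\<^bsub>L\<^esub> Z \<oplus>\<^bsub>L\<^esub> Y \<otimes>\<^bsub>L\<^esub> Z"
      using X Y Z by (simp add: S) (rule frac_eqI; simp add: S m_ac l_distr r_distr)
  next
    fix X Y assume "X \<in> carrier L" "Y \<in> carrier L"
    then obtain a s b t where X: "X = loc_frac R M a s" "a \<in> carrier R" "s \<in> carrier R" "s \<notin> M"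
      and Y: "Y = loc_frac R M b t" "b \<in> carrier R" "t \<in> carrier R" "t \<notin> M" by (metis ex)
    show "X \<oplus>\<^bsub>L\<^esub> Y \<in> carrier L" "X \<otimes>\<^bsub>L\<^esub> Y \<in> carrier L" using X Y by (simp_all add: S)
    show "X \<oplus>\<^bsub>L\<^esub> Y = Y \<oplus>\<^bsub>L\<^esub> X" using X Y by (simp add: S) (rule frac_eqI; simp add: S m_ac l_distr r_distr a_ac)
    show "X \<otimes>\<^bsub>L\<^esub> Y = Y \<otimes>\<^bsub>L\<^esub> X" using X Y by (simp add: S m_comm)
  next
    fix X assume "X \<in> carrier L"
    then obtain a s where X: "X = loc_frac R M a s" "a \<in> carrier R" "s \<in> carrier R" "s \<notin> M" by (metis ex)
    show "\<zero>\<^bsub>L\<^esub> \<oplus>\<^bsub>L\<^esub> X = X" "\<one>\<^bsub>L\<^esub> \<otimes>\<^bsub>L\<^esub> X = X" using X by (simp_all add: L_zero L_one one)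
    have "loc_frac R M (\<ominus> a) s \<oplus>\<^bsub>L\<^esub> X = \<zero>\<^bsub>L\<^esub>" unfolding X(1) L_zero using X(2-)
      by (simp add: L_zero S) (rule frac_eqI; simp add: S one l_minus l_neg)
    then show "\<exists>Y\<in>carrier L. Y \<oplus>\<^bsub>L\<^esub> X = \<zero>\<^bsub>L\<^esub>" using X by (intro bexI[of _ "loc_frac R M (\<ominus> a) s"]) auto
  }
qed (simp_all add: L_one L_zero one_notin[simplified])

lemma loc_map_hom: "loc_map R M \<in> ring_hom R L"
  using one_notin by (intro ring_hom_memI) (auto simp: loc_map_def L_one)

lemma loc_map_closed [simp]: "a \<in> carrier R \<Longrightarrow> loc_map R M a \<in> carrier L"
  using one_notin by (simp add: loc_map_def)

lemma loc_map_minus: 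
  assumes "a \<in> carrier R" "b \<in> carrier R"
  shows "loc_map R M a \<ominus>\<^bsub>L\<^esub> loc_map R M b = loc_map R M (a \<ominus> b)"
proof -
  interpret L: cring L by (rule cring_loc_ring)
  interpret h: ring_hom_ring R L "loc_map R M" using loc_map_hom by (intro ring_hom_ringI2) (auto intro: ring_axioms L.ring_axioms)
  show ?thesis using assms by (simp add: minus_eq L.minus_eq)
qed

end

text \<open>Functoriality of localization: a homomorphism respecting the denominators acts on
  numerator and denominator, and the common multiplier in an equality of fractions is mapped
  along.\<close>

lemma localization_map:
  assumes "localization R M" "localization R' M'" and h: "h \<in> ring_hom R R'" and S: "\<And>s. s \<in> carrier R - M \<Longrightarrow> h s \<in> carrier R' - M'"
  shows "\<exists>k\<in>ring_hom (loc_ring R M) (loc_ring R' M'). \<forall>a\<in>carrier R. k (loc_map R M a) = loc_map R' M' (h a)"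
proof -
  interpret A: localization R M by fact
  interpret B: localization R' M' by fact
  interpret h: ring_hom_ring R R' h using h by (intro ring_hom_ringI2) (auto intro: A.ring_axioms B.ring_axioms)
  define k where "k X = (THE Y. \<exists>a s. a \<in> carrier R \<and> s \<in> carrier R - M \<and> X = loc_frac R M a s \<and> Y = loc_frac R' M' (h a) (h s))" for X
  have k: "k (loc_frac R M a s) = loc_frac R' M' (h a) (h s)" if as: "a \<in> carrier R" "s \<in> carrier R - M" for a s
    unfolding k_def
  proof (rule the_equality)
    fix Y assume "\<exists>b t. b \<in> carrier R \<and> t \<in> carrier R - M \<and> loc_frac R M a s = loc_frac R M b t \<and> Y = loc_frac R' M' (h b) (h t)"
    then obtain b t u where b: "b \<in> carrier R" "t \<in> carrier R - M" "Y = loc_frac R' M' (h b) (h t)"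
      and u: "u \<in> carrier R - M" "u \<otimes>\<^bsub>R\<^esub> a \<otimes>\<^bsub>R\<^esub> t = u \<otimes>\<^bsub>R\<^esub> b \<otimes>\<^bsub>R\<^esub> s"
      using as A.frac_eq_iff by auto
    have "h (u \<otimes>\<^bsub>R\<^esub> a \<otimes>\<^bsub>R\<^esub> t) = h (u \<otimes>\<^bsub>R\<^esub> b \<otimes>\<^bsub>R\<^esub> s)" using u by simp
    then have "h u \<otimes>\<^bsub>R'\<^esub> h b \<otimes>\<^bsub>R'\<^esub> h s = h u \<otimes>\<^bsub>R'\<^esub> h a \<otimes>\<^bsub>R'\<^esub> h t" using as b u(1) by simp
    then show "Y = loc_frac R' M' (h a) (h s)"
      unfolding b(3) using as b S u(1) by (subst B.frac_eq_iff) auto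
  qed (use as in blast)
  have "k \<in> ring_hom (loc_ring R M) (loc_ring R' M')"
  proof (rule ring_hom_memI)
    fix X Y assume "X \<in> carrier (loc_ring R M)" "Y \<in> carrier (loc_ring R M)"
    then obtain a s b t where X: "X = loc_frac R M a s" "a \<in> carrier R" "s \<in> carrier R - M"
      and Y: "Y = loc_frac R M b t" "b \<in> carrier R" "t \<in> carrier R - M" by (auto simp: A.L_carrier)
    have st: "s \<otimes>\<^bsub>R\<^esub> t \<in> carrier R - M" using X Y A.mult_notin by blast
    have hs: "h s \<in> carrier R' - M'" "h t \<in> carrier R' - M'" using X Y S by blast+
    have c: "s \<in> carrier R" "t \<in> carrier R" using X Y by auto
    show "k (X \<otimes>\<^bsub>loc_ring R M\<^esub> Y) = k X \<otimes>\<^bsub>loc_ring R' M'\<^esub> k Y"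
      unfolding X(1) Y(1) A.frac_mult[OF X(2,3) Y(2,3)] using X(2,3) Y(2,3) st hs c by (simp only: k A.m_closed B.frac_mult h.hom_closed h.hom_mult)
    show "k (X \<oplus>\<^bsub>loc_ring R M\<^esub> Y) = k X \<oplus>\<^bsub>loc_ring R' M'\<^esub> k Y"
      unfolding X(1) Y(1) A.frac_add[OF X(2,3) Y(2,3)] using X(2,3) Y(2,3) st hs c
      by (simp only: k A.m_closed A.a_closed B.frac_add h.hom_closed h.hom_mult h.hom_add)
  next
    fix X assume "X \<in> carrier (loc_ring R M)"
    then obtain a s where X: "X = loc_frac R M a s" "a \<in> carrier R" "s \<in> carrier R - M" by (auto simp: A.L_carrier)
    then show "k X \<in> carrier (loc_ring R' M')" using S[OF X(3)] by (simp only: k h.hom_closed B.frac_closed)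
  qed (use k[of "\<one>\<^bsub>R\<^esub>" "\<one>\<^bsub>R\<^esub>"] A.one_notin in \<open>simp add: A.L_one B.L_one\<close>)
  moreover have "k (loc_map R M a) = loc_map R' M' (h a)" if "a \<in> carrier R" for a
    using k[OF that A.one_notin] by (simp add: loc_map_def)
  ultimately show ?thesis by blast
qed

section \<open>Dilation\<close>

lemma steinberg_relsI:
  "\<lbrakk>\<gamma> \<in> \<Phi>; \<xi> \<in> carrier A; \<eta> \<in> carrier A\<rbrakk> \<Longrightarrow>
     (root_elt \<gamma> \<xi> @ root_elt \<gamma> \<eta>, root_elt \<gamma> (\<xi> \<oplus>\<^bsub>A\<^esub> \<eta>)) \<in> steinberg_rels \<Phi> N A"
  "\<lbrakk>\<gamma> \<in> \<Phi>; \<delta> \<in> \<Phi>; \<xi> \<in> carrier A; \<eta> \<in> carrier A; \<gamma> + \<delta> \<notin> \<Phi> \<union> {0}\<rbrakk> \<Longrightarrow>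
     (gword_comm (root_elt \<gamma> \<xi>) (root_elt \<delta> \<eta>), []) \<in> steinberg_rels \<Phi> N A"
  "\<lbrakk>\<gamma> \<in> \<Phi>; \<delta> \<in> \<Phi>; \<xi> \<in> carrier A; \<eta> \<in> carrier A; \<gamma> + \<delta> \<in> \<Phi>\<rbrakk> \<Longrightarrow>
     (gword_comm (root_elt \<gamma> \<xi>) (root_elt \<delta> \<eta>), root_elt (\<gamma> + \<delta>) (add_pow A (N \<gamma> \<delta>) (\<xi> \<otimes>\<^bsub>A\<^esub> \<eta>)))
       \<in> steinberg_rels \<Phi> N A"
  unfolding steinberg_rels_def by blast+

lemma map_coef_comm:
  "map_coef h (gword_comm (root_elt \<gamma> \<xi>) (root_elt \<delta> \<eta>)) = gword_comm (root_elt \<gamma> (h \<xi>)) (root_elt \<delta> (h \<eta>))"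
  by (simp add: gword_comm_def gword_inv_def)

text \<open>A derivation of a relation uses finitely many sums and products of coefficients. So a
  family of maps transports it eventually, even if no single \<open>\<phi> p\<close> is a
  homomorphism and each sum and product is respected only from some point on. As the structure
  constants are 1 or -1, integer multiples reduce to negation.\<close>

lemma gword_rel_St_transfer:
  fixes \<phi> :: "'p \<Rightarrow> 'a \<Rightarrow> 'b" and F :: "'p filter"
  assumes A: "ring A" and T: "ring T" and N: "\<And>\<gamma> \<delta>. \<lbrakk>\<gamma> \<in> \<Phi>; \<delta> \<in> \<Phi>; \<gamma> + \<delta> \<in> \<Phi>\<rbrakk> \<Longrightarrow> N \<gamma> \<delta> \<in> {1, -1}"
    and closed: "\<And>a. a \<in> carrier A \<Longrightarrow> \<forall>\<^sub>F p in F. \<phi> p a \<in> carrier T"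
    and add: "\<And>a b. \<lbrakk>a \<in> carrier A; b \<in> carrier A\<rbrakk> \<Longrightarrow> \<forall>\<^sub>F p in F. \<phi> p (a \<oplus>\<^bsub>A\<^esub> b) = \<phi> p a \<oplus>\<^bsub>T\<^esub> \<phi> p b"
    and mult: "\<And>a b. \<lbrakk>a \<in> carrier A; b \<in> carrier A\<rbrakk> \<Longrightarrow> \<forall>\<^sub>F p in F. \<phi> p (a \<otimes>\<^bsub>A\<^esub> b) = \<phi> p a \<otimes>\<^bsub>T\<^esub> \<phi> p b"
    and rel: "(u, v) \<in> St_eq \<Phi> N A"
  shows "\<forall>\<^sub>F p in F. (map_coef (\<phi> p) u, map_coef (\<phi> p) v) \<in> St_eq \<Phi> N T"
proof -
  interpret A: ring A by fact
  interpret T: ring T by fact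
  have words: "\<forall>\<^sub>F p in F. map_coef (\<phi> p) w \<in> St_words \<Phi> T" if "w \<in> St_words \<Phi> A" for w
    using that
  proof (induction w)
    case (Cons l w)
    obtain \<gamma> a b where l: "l = ((\<gamma>, a), b)" by (metis prod.collapse)
    then have "\<gamma> \<in> \<Phi>" "a \<in> carrier A" "w \<in> St_words \<Phi> A" using Cons.prems by (auto simp: steinberg_gens_iff)
    then show ?case using eventually_conj[OF closed[of a] Cons.IH] by (simp add: l steinberg_gens_iff)
  qed simp
  have zero: "\<forall>\<^sub>F p in F. \<phi> p \<zero>\<^bsub>A\<^esub> = \<zero>\<^bsub>T\<^esub>"
    using add[OF A.zero_closed A.zero_closed] closed[OF A.zero_closed]
    by eventually_elim (simp add: T.add.l_cancel_one')
  have minus: "\<forall>\<^sub>F p in F. \<phi> p (\<ominus>\<^bsub>A\<^esub> a) = \<ominus>\<^bsub>T\<^esub> \<phi> p a" if a: "a \<in> carrier A" for a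
    using add[of "\<ominus>\<^bsub>A\<^esub> a" a, OF A.a_inv_closed[OF a] a] zero closed[OF a] closed[OF A.a_inv_closed[OF a]]
    by eventually_elim (use a in \<open>simp add: A.l_neg T.minus_equality\<close>)
  have pow: "\<forall>\<^sub>F p in F. \<phi> p (add_pow A k a) = add_pow T k (\<phi> p a)" if a: "a \<in> carrier A" "(k::int) \<in> {1, -1}" for a k
    using minus[OF a(1)] closed[OF a(1)]
    by eventually_elim (use a in \<open>auto simp: A.add_pow_unit T.add_pow_unit\<close>)
  show ?thesis
    using rel
  proof (induction rule: gword_rel.induct)
    case (refl w)
    show ?case using words[OF refl] by eventually_elim (rule gword_rel.refl)
  next
    case (sym u v)
    show ?case using sym.IH by eventually_elim (rule gword_rel.sym)
  next
    case (trans u v w)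
    show ?case using trans.IH by eventually_elim (rule gword_rel.trans)
  next
    case (cancel x u v b)
    obtain \<gamma> a where x: "x = (\<gamma>, a)" by fastforce
    have g: "\<gamma> \<in> \<Phi>" "a \<in> carrier A" using cancel x by (auto simp: steinberg_gens_iff)
    show ?case using closed[OF g(2)] words[OF cancel(2)] words[OF cancel(3)]
    proof eventually_elim
      case (elim p)
      have "(\<gamma>, \<phi> p a) \<in> steinberg_gens \<Phi> T" using elim g by (simp add: steinberg_gens_iff)
      then show ?case using gword_rel.cancel[OF _ elim(2,3)] by (simp add: x)
    qed
  next
    case (relation r s u v)
    have "\<forall>\<^sub>F p in F. (map_coef (\<phi> p) r, map_coef (\<phi> p) s) \<in> steinberg_rels \<Phi> N T"
    proof -
      consider (1) \<gamma> \<xi> \<eta> where "r = root_elt \<gamma> \<xi> @ root_elt \<gamma> \<eta>" "s = root_elt \<gamma> (\<xi> \<oplus>\<^bsub>A\<^esub> \<eta>)"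
        "\<gamma> \<in> \<Phi>" "\<xi> \<in> carrier A" "\<eta> \<in> carrier A"
      | (2) \<gamma> \<delta> \<xi> \<eta> where "r = gword_comm (root_elt \<gamma> \<xi>) (root_elt \<delta> \<eta>)" "s = []"
        "\<gamma> \<in> \<Phi>" "\<delta> \<in> \<Phi>" "\<xi> \<in> carrier A" "\<eta> \<in> carrier A" "\<gamma> + \<delta> \<notin> \<Phi> \<union> {0}"
      | (3) \<gamma> \<delta> \<xi> \<eta> where "r = gword_comm (root_elt \<gamma> \<xi>) (root_elt \<delta> \<eta>)"
        "s = root_elt (\<gamma> + \<delta>) (add_pow A (N \<gamma> \<delta>) (\<xi> \<otimes>\<^bsub>A\<^esub> \<eta>))"
        "\<gamma> \<in> \<Phi>" "\<delta> \<in> \<Phi>" "\<xi> \<in> carrier A" "\<eta> \<in> carrier A" "\<gamma> + \<delta> \<in> \<Phi>"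
      using relation(1) unfolding steinberg_rels_def by blast
      then show ?thesis
      proof cases
        case 1
        show ?thesis using add[OF 1(4,5)] closed[OF 1(4)] closed[OF 1(5)]
        proof eventually_elim
          case (elim p)
          show ?case using steinberg_relsI(1)[OF 1(3) elim(2,3)] elim(1) by (simp add: 1)
        qed
      next
        case 2
        show ?thesis using closed[OF 2(5)] closed[OF 2(6)]
        proof eventually_elim
          case (elim p)
          show ?case using steinberg_relsI(2)[OF 2(3,4) elim 2(7)] by (simp add: 2 map_coef_comm)
        qed
      next
        case 3
        show ?thesis using closed[OF 3(5)] closed[OF 3(6)] mult[OF 3(5,6)] pow[OF A.m_closed[OF 3(5,6)] N[OF 3(3,4,7)]]
        proof eventually_elim
          case (elim p)
          show ?case using steinberg_relsI(3)[OF 3(3,4) elim(1,2) 3(7)] elim(3,4) by (simp add: 3 map_coef_comm)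
        qed
      qed
    qed
    then show ?case using words[OF relation(2)] words[OF relation(3)] words[OF relation(4)] words[OF relation(5)]
      by eventually_elim (auto intro: gword_rel.relation)
  qed
qed

lemma RDirProd_simps [simp]:
  "(a, b) \<otimes>\<^bsub>RDirProd A B\<^esub> (c, d) = (a \<otimes>\<^bsub>A\<^esub> c, b \<otimes>\<^bsub>B\<^esub> d)"
  "(a, b) \<oplus>\<^bsub>RDirProd A B\<^esub> (c, d) = (a \<oplus>\<^bsub>A\<^esub> c, b \<oplus>\<^bsub>B\<^esub> d)"
  "\<one>\<^bsub>RDirProd A B\<^esub> = (\<one>\<^bsub>A\<^esub>, \<one>\<^bsub>B\<^esub>)" "\<zero>\<^bsub>RDirProd A B\<^esub> = (\<zero>\<^bsub>A\<^esub>, \<zero>\<^bsub>B\<^esub>)"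
  by (simp_all add: RDirProd_def DirProd_def monoid.defs)

text \<open>Serves for both rings of congruent pairs that occur, \<open>thick\<close> and
  \<open>double_ring\<close>.\<close>

lemma cring_subproduct:
  assumes A: "cring A" and B: "cring B" and H: "H \<subseteq> carrier A \<times> carrier B"
    and one: "(\<one>\<^bsub>A\<^esub>, \<one>\<^bsub>B\<^esub>) \<in> H"
    and minus: "\<And>a b. (a, b) \<in> H \<Longrightarrow> (\<ominus>\<^bsub>A\<^esub> a, \<ominus>\<^bsub>B\<^esub> b) \<in> H"
    and add: "\<And>a b c d. \<lbrakk>(a, b) \<in> H; (c, d) \<in> H\<rbrakk> \<Longrightarrow> (a \<oplus>\<^bsub>A\<^esub> c, b \<oplus>\<^bsub>B\<^esub> d) \<in> H"
    and mult: "\<And>a b c d. \<lbrakk>(a, b) \<in> H; (c, d) \<in> H\<rbrakk> \<Longrightarrow> (a \<otimes>\<^bsub>A\<^esub> c, b \<otimes>\<^bsub>B\<^esub> d) \<in> H"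
  shows "cring ((RDirProd A B)\<lparr>carrier := H\<rparr>)" (is "cring ?R")
    and "(a, b) \<in> H \<Longrightarrow> \<ominus>\<^bsub>(RDirProd A B)\<lparr>carrier := H\<rparr>\<^esub> (a, b) = (\<ominus>\<^bsub>A\<^esub> a, \<ominus>\<^bsub>B\<^esub> b)"
proof -
  interpret A: cring A by fact
  interpret B: cring B by fact
  have C: "(a, b) \<in> H \<Longrightarrow> a \<in> carrier A \<and> b \<in> carrier B" for a b using H by auto
  have zero: "(\<zero>\<^bsub>A\<^esub>, \<zero>\<^bsub>B\<^esub>) \<in> H" using add[OF one minus[OF one]] by (simp add: A.r_neg B.r_neg)
  show R: "cring ?R"
  proof (intro cringI abelian_groupI comm_monoidI)
    {
      fix x z w assume "x \<in> carrier ?R" "z \<in> carrier ?R" "w \<in> carrier ?R"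
      then obtain a b c d e f where x: "x = (a, b)" "z = (c, d)" "w = (e, f)" "(a, b) \<in> H" "(c, d) \<in> H" "(e, f) \<in> H"
        by (cases x, cases z, cases w) auto
      note c = C[OF x(4)] C[OF x(5)] C[OF x(6)]
      show "x \<oplus>\<^bsub>?R\<^esub> z \<in> carrier ?R" "x \<otimes>\<^bsub>?R\<^esub> z \<in> carrier ?R" using x add mult by auto
      show "x \<oplus>\<^bsub>?R\<^esub> z \<oplus>\<^bsub>?R\<^esub> w = x \<oplus>\<^bsub>?R\<^esub> (z \<oplus>\<^bsub>?R\<^esub> w)" "x \<oplus>\<^bsub>?R\<^esub> z = z \<oplus>\<^bsub>?R\<^esub> x" "\<zero>\<^bsub>?R\<^esub> \<oplus>\<^bsub>?R\<^esub> x = x"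
        "x \<otimes>\<^bsub>?R\<^esub> z \<otimes>\<^bsub>?R\<^esub> w = x \<otimes>\<^bsub>?R\<^esub> (z \<otimes>\<^bsub>?R\<^esub> w)" "x \<otimes>\<^bsub>?R\<^esub> z = z \<otimes>\<^bsub>?R\<^esub> x" "\<one>\<^bsub>?R\<^esub> \<otimes>\<^bsub>?R\<^esub> x = x"
        "(x \<oplus>\<^bsub>?R\<^esub> z) \<otimes>\<^bsub>?R\<^esub> w = x \<otimes>\<^bsub>?R\<^esub> w \<oplus>\<^bsub>?R\<^esub> z \<otimes>\<^bsub>?R\<^esub> w"
        using c by (simp_all add: x(1-3) A.a_ac B.a_ac A.m_ac B.m_ac A.l_distr B.l_distr A.r_distr B.r_distr)
      show "\<exists>z\<in>carrier ?R. z \<oplus>\<^bsub>?R\<^esub> x = \<zero>\<^bsub>?R\<^esub>"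
        using minus[OF x(4)] c by (intro bexI[of _ "(\<ominus>\<^bsub>A\<^esub> a, \<ominus>\<^bsub>B\<^esub> b)"]) (auto simp: x(1) A.l_neg B.l_neg)
    }
  qed (use one zero in simp_all)
  interpret R: cring ?R by fact
  show "\<ominus>\<^bsub>?R\<^esub> (a, b) = (\<ominus>\<^bsub>A\<^esub> a, \<ominus>\<^bsub>B\<^esub> b)" if "(a, b) \<in> H"
    using that minus[OF that] C[OF that] by (intro R.minus_equality) (auto simp: A.l_neg B.l_neg)
qed

text \<open>
  \<open>y\<close> is a variable over \<open>T\<close>, to be specialised by \<open>ev\<close> to elements of \<open>S\<close>; the type \<open>'q\<close> only carries
  additional parameters, over which everything is uniform.
\<close>

locale dilation = T: cring T + P: cring P
  for T :: "('a, 'm) ring_scheme" and P :: "('b, 'n) ring_scheme" +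
  fixes S :: "'a set" and emb :: "'a \<Rightarrow> 'b" and ev :: "'a \<Rightarrow> 'b \<Rightarrow> 'a" and y :: 'b and index :: "'q itself"
  assumes S_subset: "S \<subseteq> carrier T" and S_one: "\<one>\<^bsub>T\<^esub> \<in> S" and S_mult: "\<lbrakk>s \<in> S; t \<in> S\<rbrakk> \<Longrightarrow> s \<otimes>\<^bsub>T\<^esub> t \<in> S"
    and emb_hom: "emb \<in> ring_hom T P"
    and ev_hom: "\<sigma> \<in> S \<Longrightarrow> ev \<sigma> \<in> ring_hom P T"
    and ev_emb: "\<lbrakk>\<sigma> \<in> S; a \<in> carrier T\<rbrakk> \<Longrightarrow> ev \<sigma> (emb a) = a"
    and ev_y: "\<sigma> \<in> S \<Longrightarrow> ev \<sigma> y = \<sigma>"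
    and y_closed [simp]: "y \<in> carrier P"
    and y_regular: "\<lbrakk>g \<in> carrier P; y \<otimes>\<^bsub>P\<^esub> g = \<zero>\<^bsub>P\<^esub>\<rbrakk> \<Longrightarrow> g = \<zero>\<^bsub>P\<^esub>"
begin

definition \<Omega> :: "(nat \<times> 'q \<Rightarrow> 'b) ring" where "\<Omega> = fun_ring P"
definition cst :: "'a \<Rightarrow> nat \<times> 'q \<Rightarrow> 'b" where "cst a = (\<lambda>_. emb a)"
text \<open>\<open>loc_ring\<close> inverts the complement of its second argument; this choice makes
  \<open>V\<close> the ring of fractions with constant denominators from \<open>S\<close>.\<close>

definition M :: "(nat \<times> 'q \<Rightarrow> 'b) set" where "M = carrier \<Omega> - cst ` S"
abbreviation V where "V \<equiv> loc_ring \<Omega> M"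

definition ydvd :: "nat \<Rightarrow> 'b \<Rightarrow> bool" where "ydvd n f \<longleftrightarrow> (\<exists>g\<in>carrier P. f = y [^]\<^bsub>P\<^esub> n \<otimes>\<^bsub>P\<^esub> g)"
text \<open>The bound \<open>K\<close> must not depend on \<open>q\<close>: in the end one and the
  same dilation factor has to serve all substitutions, and these are indexed by
  \<open>q\<close>.\<close>

definition vanishing :: "(nat \<times> 'q \<Rightarrow> 'b) \<Rightarrow> bool" where
  "vanishing F \<longleftrightarrow> (\<forall>n. \<exists>K. \<forall>k\<ge>K. \<forall>q. ydvd n (F (k, q)))"
definition J where "J = {loc_frac \<Omega> M F (cst d) | F d. F \<in> carrier \<Omega> \<and> vanishing F \<and> d \<in> S}"

lemma S_carr [simp]: "s \<in> S \<Longrightarrow> s \<in> carrier T" using S_subset by blast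

lemma emb_closed [simp]: "a \<in> carrier T \<Longrightarrow> emb a \<in> carrier P"
  using emb_hom by (simp add: ring_hom_closed)

lemma Omega_simps [simp]:
  "F \<in> carrier \<Omega> \<longleftrightarrow> (\<forall>i. F i \<in> carrier P)" "F \<otimes>\<^bsub>\<Omega>\<^esub> G = (\<lambda>i. F i \<otimes>\<^bsub>P\<^esub> G i)"
  "F \<oplus>\<^bsub>\<Omega>\<^esub> G = (\<lambda>i. F i \<oplus>\<^bsub>P\<^esub> G i)" "\<one>\<^bsub>\<Omega>\<^esub> = (\<lambda>i. \<one>\<^bsub>P\<^esub>)" "\<zero>\<^bsub>\<Omega>\<^esub> = (\<lambda>i. \<zero>\<^bsub>P\<^esub>)"
  by (simp_all add: \<Omega>_def)

lemma cst_apply [simp]: "cst a i = emb a" by (simp add: cst_def)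

lemma complement_M: "carrier \<Omega> - M = cst ` S"
  by (auto simp: M_def)

lemma cst_mult: "\<lbrakk>a \<in> carrier T; b \<in> carrier T\<rbrakk> \<Longrightarrow> cst a \<otimes>\<^bsub>\<Omega>\<^esub> cst b = cst (a \<otimes>\<^bsub>T\<^esub> b)"
  using emb_hom by (auto simp: fun_eq_iff ring_hom_mult)

lemma cst_one: "cst \<one>\<^bsub>T\<^esub> = \<one>\<^bsub>\<Omega>\<^esub>"
  using emb_hom by (auto simp: fun_eq_iff ring_hom_one)

lemma cst_in: "s \<in> S \<Longrightarrow> cst s \<in> carrier \<Omega> - M" by (simp add: complement_M)

sublocale Omega: cring \<Omega>
  unfolding \<Omega>_def by (rule cring_fun_ring) (rule P.is_cring)

sublocale loc: localization \<Omega> M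
proof
  show "\<one>\<^bsub>\<Omega>\<^esub> \<in> carrier \<Omega> - M" using cst_in[OF S_one] cst_one by simp
  show "s \<otimes>\<^bsub>\<Omega>\<^esub> t \<in> carrier \<Omega> - M" if "s \<in> carrier \<Omega> - M" "t \<in> carrier \<Omega> - M" for s t
    using that S_mult unfolding complement_M by (auto simp: cst_mult simp del: Omega_simps)
qed

sublocale V: cring V by (rule loc.cring_loc_ring)

abbreviation fr where "fr F d \<equiv> loc_frac \<Omega> M F (cst d)"

lemma fr_eq_iff:
  assumes "F \<in> carrier \<Omega>" "G \<in> carrier \<Omega>" "d \<in> S" "e \<in> S"
  shows "fr F d = fr G e \<longleftrightarrow> (\<exists>u\<in>S. \<forall>i. emb u \<otimes>\<^bsub>P\<^esub> F i \<otimes>\<^bsub>P\<^esub> emb e = emb u \<otimes>\<^bsub>P\<^esub> G i \<otimes>\<^bsub>P\<^esub> emb d)"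
  using loc.frac_eq_iff[OF assms(1) cst_in[OF assms(3)] assms(2) cst_in[OF assms(4)]]
  unfolding complement_M by (auto simp: fun_eq_iff)

lemma fr_mult: "\<lbrakk>F \<in> carrier \<Omega>; G \<in> carrier \<Omega>; d \<in> S; e \<in> S\<rbrakk> \<Longrightarrow> fr F d \<otimes>\<^bsub>V\<^esub> fr G e = fr (F \<otimes>\<^bsub>\<Omega>\<^esub> G) (d \<otimes>\<^bsub>T\<^esub> e)"
  using loc.frac_mult[of F "cst d" G "cst e"] cst_in cst_mult[of d e] by (simp del: Omega_simps)

lemma fr_add: "\<lbrakk>F \<in> carrier \<Omega>; G \<in> carrier \<Omega>; d \<in> S; e \<in> S\<rbrakk> \<Longrightarrow>
   fr F d \<oplus>\<^bsub>V\<^esub> fr G e = fr (F \<otimes>\<^bsub>\<Omega>\<^esub> cst e \<oplus>\<^bsub>\<Omega>\<^esub> G \<otimes>\<^bsub>\<Omega>\<^esub> cst d) (d \<otimes>\<^bsub>T\<^esub> e)"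
  using loc.frac_add[of F "cst d" G "cst e"] cst_in cst_mult[of d e] by (simp del: Omega_simps)

lemma loc_map_fr: "loc_map \<Omega> M F = fr F \<one>\<^bsub>T\<^esub>"
  by (simp add: loc_map_def cst_one)

lemma fr_closed: "\<lbrakk>F \<in> carrier \<Omega>; d \<in> S\<rbrakk> \<Longrightarrow> fr F d \<in> carrier V"
  using cst_in by (intro loc.frac_closed) auto

lemma V_cases: "v \<in> carrier V \<Longrightarrow> \<exists>F d. v = fr F d \<and> F \<in> carrier \<Omega> \<and> d \<in> S"
  unfolding loc.L_carrier complement_M by blast

lemma y_pow_regular: "\<lbrakk>g \<in> carrier P; h \<in> carrier P; y [^]\<^bsub>P\<^esub> (n::nat) \<otimes>\<^bsub>P\<^esub> g = y [^]\<^bsub>P\<^esub> n \<otimes>\<^bsub>P\<^esub> h\<rbrakk> \<Longrightarrow> g = h"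
proof (induction n)
  case (Suc n)
  define a b where "a = y [^]\<^bsub>P\<^esub> n \<otimes>\<^bsub>P\<^esub> g" and "b = y [^]\<^bsub>P\<^esub> n \<otimes>\<^bsub>P\<^esub> h"
  have ab: "a \<in> carrier P" "b \<in> carrier P" using Suc by (auto simp: a_def b_def)
  have "y \<otimes>\<^bsub>P\<^esub> a = y \<otimes>\<^bsub>P\<^esub> b" using Suc by (simp add: a_def b_def P.m_ac)
  then have "y \<otimes>\<^bsub>P\<^esub> (a \<ominus>\<^bsub>P\<^esub> b) = \<zero>\<^bsub>P\<^esub>" using ab by (simp add: P.minus_eq P.r_distr P.r_minus P.r_neg)
  then have "a = b" using y_regular[of "a \<ominus>\<^bsub>P\<^esub> b"] ab by (simp add: P.diff_eq_zero_iff)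
  then show ?case using Suc by (simp add: a_def b_def)
qed simp

lemma ydvd_0: "f \<in> carrier P \<Longrightarrow> ydvd 0 f" by (auto simp: ydvd_def)

lemma ydvd_add: "\<lbrakk>ydvd n f; ydvd n g\<rbrakk> \<Longrightarrow> ydvd n (f \<oplus>\<^bsub>P\<^esub> g)"
  unfolding ydvd_def by (metis P.a_closed P.nat_pow_closed P.r_distr y_closed)

lemma ydvd_mult_left: "\<lbrakk>f \<in> carrier P; ydvd n g\<rbrakk> \<Longrightarrow> ydvd n (f \<otimes>\<^bsub>P\<^esub> g)"
  unfolding ydvd_def by (metis P.m_closed P.m_lcomm P.nat_pow_closed y_closed)

lemma ydvd_mult_right: "\<lbrakk>f \<in> carrier P; ydvd n g\<rbrakk> \<Longrightarrow> ydvd n (g \<otimes>\<^bsub>P\<^esub> f)"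
  unfolding ydvd_def by (metis P.m_closed P.m_assoc P.nat_pow_closed y_closed)

lemma ydvd_mono: "\<lbrakk>ydvd n f; m \<le> n\<rbrakk> \<Longrightarrow> ydvd m f"
  unfolding ydvd_def
proof (elim bexE)
  fix g assume g: "g \<in> carrier P" "f = y [^]\<^bsub>P\<^esub> n \<otimes>\<^bsub>P\<^esub> g" "m \<le> n"
  then have "f = y [^]\<^bsub>P\<^esub> m \<otimes>\<^bsub>P\<^esub> (y [^]\<^bsub>P\<^esub> (n - m) \<otimes>\<^bsub>P\<^esub> g)"
    by (simp add: P.nat_pow_mult flip: P.m_assoc)
  moreover have "y [^]\<^bsub>P\<^esub> (n - m) \<otimes>\<^bsub>P\<^esub> g \<in> carrier P" using g(1) by simp
  ultimately show "\<exists>g\<in>carrier P. f = y [^]\<^bsub>P\<^esub> m \<otimes>\<^bsub>P\<^esub> g" by (rule bexI)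
qed

lemma vanishing_add: "\<lbrakk>vanishing F; vanishing G\<rbrakk> \<Longrightarrow> vanishing (F \<oplus>\<^bsub>\<Omega>\<^esub> G)"
  unfolding vanishing_def Omega_simps
proof
  fix n assume F: "\<forall>n. \<exists>K. \<forall>k\<ge>K. \<forall>q. ydvd n (F (k, q))" and G: "\<forall>n. \<exists>K. \<forall>k\<ge>K. \<forall>q. ydvd n (G (k, q))"
  obtain K where "\<forall>k\<ge>K. \<forall>q. ydvd n (F (k, q))" using F by blast
  moreover obtain K' where "\<forall>k\<ge>K'. \<forall>q. ydvd n (G (k, q))" using G by blast
  ultimately have "\<forall>k\<ge>max K K'. \<forall>q. ydvd n (F (k, q) \<oplus>\<^bsub>P\<^esub> G (k, q))" using ydvd_add by simp
  then show "\<exists>K. \<forall>k\<ge>K. \<forall>q. ydvd n (F (k, q) \<oplus>\<^bsub>P\<^esub> G (k, q))" by blast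
qed

lemma vanishing_mult: "\<lbrakk>F \<in> carrier \<Omega>; vanishing G\<rbrakk> \<Longrightarrow> vanishing (F \<otimes>\<^bsub>\<Omega>\<^esub> G)"
  "\<lbrakk>F \<in> carrier \<Omega>; vanishing G\<rbrakk> \<Longrightarrow> vanishing (G \<otimes>\<^bsub>\<Omega>\<^esub> F)"
proof -
  assume F: "F \<in> carrier \<Omega>" and G: "vanishing G"
  have "\<exists>K. \<forall>k\<ge>K. \<forall>q. ydvd n (F (k, q) \<otimes>\<^bsub>P\<^esub> G (k, q)) \<and> ydvd n (G (k, q) \<otimes>\<^bsub>P\<^esub> F (k, q))" for n
  proof -
    obtain K where "\<forall>k\<ge>K. \<forall>q. ydvd n (G (k, q))" using G unfolding vanishing_def by blast
    then show ?thesis using F ydvd_mult_left ydvd_mult_right by (intro exI[of _ K]) simp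
  qed
  then show "vanishing (F \<otimes>\<^bsub>\<Omega>\<^esub> G)" "vanishing (G \<otimes>\<^bsub>\<Omega>\<^esub> F)" unfolding vanishing_def Omega_simps by blast+
qed

lemma J_I: "\<lbrakk>F \<in> carrier \<Omega>; vanishing F; d \<in> S\<rbrakk> \<Longrightarrow> fr F d \<in> J"
  unfolding J_def by blast

lemma J_cases: "j \<in> J \<Longrightarrow> \<exists>F d. j = fr F d \<and> F \<in> carrier \<Omega> \<and> vanishing F \<and> d \<in> S"
  unfolding J_def by blast

lemma cst_carrier: "d \<in> S \<Longrightarrow> cst d \<in> carrier \<Omega>" by simp

lemma ideal_J: "ideal J V"
proof (rule idealI)
  show "ring V" by (rule V.ring_axioms)
  have sub: "J \<subseteq> carrier V" unfolding J_def using fr_closed by blast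
  have l: "x \<otimes>\<^bsub>V\<^esub> j \<in> J" if j: "j \<in> J" and x: "x \<in> carrier V" for j x
  proof -
    obtain F d G e where F: "j = fr F d" "F \<in> carrier \<Omega>" "vanishing F" "d \<in> S" and G: "x = fr G e" "G \<in> carrier \<Omega>" "e \<in> S"
      using J_cases[OF j] V_cases[OF x] by blast
    show ?thesis unfolding F(1) G(1) fr_mult[OF G(2) F(2) G(3) F(4)]
      by (rule J_I[OF Omega.m_closed[OF G(2) F(2)] vanishing_mult(1)[OF G(2) F(3)] S_mult[OF G(3) F(4)]])
  qed
  then show "\<And>a x. a \<in> J \<Longrightarrow> x \<in> carrier V \<Longrightarrow> x \<otimes>\<^bsub>V\<^esub> a \<in> J" by blast
  show "a \<otimes>\<^bsub>V\<^esub> x \<in> J" if "a \<in> J" "x \<in> carrier V" for a x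
    using l[OF that] V.m_comm[of a x] that sub by auto
  have neg: "\<ominus>\<^bsub>V\<^esub> j \<in> J" if "j \<in> J" for j
    using l[OF that, of "\<ominus>\<^bsub>V\<^esub> \<one>\<^bsub>V\<^esub>"] that sub by (simp add: V.l_minus subsetD)
  have add: "j \<oplus>\<^bsub>V\<^esub> k \<in> J" if j: "j \<in> J" and k: "k \<in> J" for j k
  proof -
    obtain F d G e where F: "j = fr F d" "F \<in> carrier \<Omega>" "vanishing F" "d \<in> S" and G: "k = fr G e" "G \<in> carrier \<Omega>" "vanishing G" "e \<in> S"
      using J_cases[OF j] J_cases[OF k] by blast
    show ?thesis unfolding F(1) G(1) fr_add[OF F(2) G(2) F(4) G(4)]
      by (rule J_I[OF _ vanishing_add[OF vanishing_mult(2)[OF cst_carrier[OF G(4)] F(3)] vanishing_mult(2)[OF cst_carrier[OF F(4)] G(3)]] S_mult[OF F(4) G(4)]])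
        (use F G in simp)
  qed
  have "fr \<zero>\<^bsub>\<Omega>\<^esub> \<one>\<^bsub>T\<^esub> \<in> J"
    using S_one by (intro J_I) (auto simp: vanishing_def ydvd_def intro!: bexI[of _ "\<zero>\<^bsub>P\<^esub>"])
  then show "subgroup J (add_monoid V)"
    using sub neg add by (intro V.add.subgroupI) (auto simp: a_inv_def)
qed

text \<open>The factor is a power of y depending on \<open>k\<close>. It cancels pointwise since y
  is regular, and its exponent is half of the power of y available in both numerators, so that the
  factor and the quotients still vanish to arbitrarily high order.\<close>

lemma J_common_factor:
  assumes j: "j \<in> J" and k: "k \<in> J"
  shows "\<exists>q\<in>J. (\<forall>c\<in>J. q \<otimes>\<^bsub>V\<^esub> c = \<zero>\<^bsub>V\<^esub> \<longrightarrow> c = \<zero>\<^bsub>V\<^esub>) \<and> (\<exists>j'\<in>J. j = q \<otimes>\<^bsub>V\<^esub> j') \<and> (\<exists>k'\<in>J. k = q \<otimes>\<^bsub>V\<^esub> k')"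
proof -
  obtain F d G e where F: "j = fr F d" "F \<in> carrier \<Omega>" "vanishing F" "d \<in> S" and G: "k = fr G e" "G \<in> carrier \<Omega>" "vanishing G" "e \<in> S"
    using J_cases[OF j] J_cases[OF k] by blast
  \<comment> \<open>The bound \<open>n \<le> k\<close> makes the maximum exist even where the
    numerators are divisible by every power of y, for instance where they are zero, and it does not
    prevent the maximum from tending to infinity.\<close>
  define I where "I k = {n. n \<le> k \<and> (\<forall>q. ydvd n (F (k, q)) \<and> ydvd n (G (k, q)))}" for k
  define o' where "o' k = Max (I k)" for k
  have I: "finite (I k)" "0 \<in> I k" for k
    using F(2) G(2) finite_subset[of "I k" "{..k}"] by (auto simp: I_def ydvd_0)
  have oI: "o' k \<in> I k" for k unfolding o'_def using Max_in[OF I(1)] I(2) by blast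
  have o_lim: "\<exists>K. \<forall>k\<ge>K. n \<le> o' k" for n
  proof -
    obtain K where "\<forall>k\<ge>K. \<forall>q. ydvd n (F (k, q))" using F(3) unfolding vanishing_def by blast
    moreover obtain K' where "\<forall>k\<ge>K'. \<forall>q. ydvd n (G (k, q))" using G(3) unfolding vanishing_def by blast
    ultimately have "\<forall>k\<ge>max n (max K K'). n \<in> I k" by (simp add: I_def)
    then show ?thesis using Max_ge[OF I(1)] unfolding o'_def by blast
  qed
  \<comment> \<open>Both \<open>m k\<close> and \<open>o' k - m k\<close> tend to infinity.\<close>
  define m where "m k = o' k div 2" for k
  define q where "q = (\<lambda>(k, _::'q). y [^]\<^bsub>P\<^esub> m k)"
  have q: "q \<in> carrier \<Omega>" by (auto simp: q_def)
  have m_lim: "\<exists>K. \<forall>k\<ge>K. n \<le> m k \<and> n \<le> o' k - m k" for n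
  proof -
    obtain K where K: "\<forall>k\<ge>K. 2 * n \<le> o' k" using o_lim by blast
    have "n \<le> m k \<and> n \<le> o' k - m k" if "2 * n \<le> o' k" for k using that unfolding m_def by linarith
    then show ?thesis using K by blast
  qed
  have vq: "vanishing q" unfolding vanishing_def
  proof
    fix n
    obtain K where K: "\<forall>k\<ge>K. n \<le> m k \<and> n \<le> o' k - m k" using m_lim by blast
    have "ydvd n (q (k, x))" if "k \<ge> K" for k x
    proof -
      have "ydvd (m k) (q (k, x))" by (auto simp: q_def ydvd_def intro!: bexI[of _ "\<one>\<^bsub>P\<^esub>"])
      then show ?thesis using ydvd_mono K that by blast
    qed
    then show "\<exists>K. \<forall>k\<ge>K. \<forall>x. ydvd n (q (k, x))" by blast
  qed
  have quot: "\<exists>H\<in>carrier \<Omega>. vanishing H \<and> F' = q \<otimes>\<^bsub>\<Omega>\<^esub> H"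
    if F': "\<And>k x. ydvd (o' k) (F' (k, x))" for F' :: "nat \<times> 'q \<Rightarrow> 'b"
  proof -
    have "\<forall>i. \<exists>g. g \<in> carrier P \<and> F' i = y [^]\<^bsub>P\<^esub> o' (fst i) \<otimes>\<^bsub>P\<^esub> g"
      using F' unfolding ydvd_def by (metis prod.collapse)
    then obtain g where g: "\<And>i. g i \<in> carrier P" "\<And>i. F' i = y [^]\<^bsub>P\<^esub> o' (fst i) \<otimes>\<^bsub>P\<^esub> g i" by metis
    define H where "H = (\<lambda>i :: nat \<times> 'q. y [^]\<^bsub>P\<^esub> (o' (fst i) - m (fst i)) \<otimes>\<^bsub>P\<^esub> g i)"
    have "H \<in> carrier \<Omega>" using g by (simp add: H_def)
    moreover have "vanishing H" unfolding vanishing_def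
    proof
      fix n
      obtain K where K: "\<forall>k\<ge>K. n \<le> m k \<and> n \<le> o' k - m k" using m_lim by blast
      have "ydvd n (H (k, x))" if "k \<ge> K" for k x
      proof -
        have "ydvd (o' k - m k) (H (k, x))" using g by (auto simp: H_def ydvd_def)
        then show ?thesis using ydvd_mono K that by blast
      qed
      then show "\<exists>K. \<forall>k\<ge>K. \<forall>x. ydvd n (H (k, x))" by blast
    qed
    moreover have "F' = q \<otimes>\<^bsub>\<Omega>\<^esub> H"
    proof
      fix i :: "nat \<times> 'q"
      have "m (fst i) \<le> o' (fst i)" by (simp add: m_def)
      then show "F' i = (q \<otimes>\<^bsub>\<Omega>\<^esub> H) i" using g
        by (cases i) (simp add: q_def H_def P.nat_pow_mult flip: P.m_assoc)
    qed
    ultimately show ?thesis by blast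
  qed
  obtain H where H: "H \<in> carrier \<Omega>" "vanishing H" "F = q \<otimes>\<^bsub>\<Omega>\<^esub> H" using quot[of F] oI unfolding I_def by blast
  obtain H' where H': "H' \<in> carrier \<Omega>" "vanishing H'" "G = q \<otimes>\<^bsub>\<Omega>\<^esub> H'" using quot[of G] oI unfolding I_def by blast
  have "fr q \<one>\<^bsub>T\<^esub> \<in> J" using q vq S_one by (rule J_I)
  moreover have "c = \<zero>\<^bsub>V\<^esub>" if c: "c \<in> J" "fr q \<one>\<^bsub>T\<^esub> \<otimes>\<^bsub>V\<^esub> c = \<zero>\<^bsub>V\<^esub>" for c
  proof -
    obtain C d where C: "c = fr C d" "C \<in> carrier \<Omega>" "d \<in> S" using J_cases[OF c(1)] by blast
    have z: "\<zero>\<^bsub>V\<^esub> = fr \<zero>\<^bsub>\<Omega>\<^esub> \<one>\<^bsub>T\<^esub>" by (simp add: loc.L_zero cst_one)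
    have "fr (q \<otimes>\<^bsub>\<Omega>\<^esub> C) d = fr \<zero>\<^bsub>\<Omega>\<^esub> \<one>\<^bsub>T\<^esub>"
      using c(2) fr_mult[OF q C(2) S_one C(3)] C by (simp add: z del: Omega_simps)
    then obtain u where u: "u \<in> S" "\<And>i. emb u \<otimes>\<^bsub>P\<^esub> (q i \<otimes>\<^bsub>P\<^esub> C i) \<otimes>\<^bsub>P\<^esub> emb \<one>\<^bsub>T\<^esub> = emb u \<otimes>\<^bsub>P\<^esub> \<zero>\<^bsub>P\<^esub> \<otimes>\<^bsub>P\<^esub> emb d"
      using fr_eq_iff[of "q \<otimes>\<^bsub>\<Omega>\<^esub> C" "\<zero>\<^bsub>\<Omega>\<^esub>" d "\<one>\<^bsub>T\<^esub>"] q C S_one by auto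
    have "emb u \<otimes>\<^bsub>P\<^esub> C i = \<zero>\<^bsub>P\<^esub>" for i
    proof -
      have e1: "emb \<one>\<^bsub>T\<^esub> = \<one>\<^bsub>P\<^esub>" using emb_hom by (rule ring_hom_one)
      have cl: "C i \<in> carrier P" "q i \<in> carrier P" "emb u \<in> carrier P" "emb d \<in> carrier P" using C(2,3) q u(1) by (simp_all del: split_paired_All)
      have "q i \<otimes>\<^bsub>P\<^esub> (emb u \<otimes>\<^bsub>P\<^esub> C i) = emb u \<otimes>\<^bsub>P\<^esub> (q i \<otimes>\<^bsub>P\<^esub> C i)" using cl by (simp add: P.m_lcomm)
      also have "\<dots> = \<zero>\<^bsub>P\<^esub>" using u(2)[of i] cl unfolding e1 by simp
      finally have "y [^]\<^bsub>P\<^esub> m (fst i) \<otimes>\<^bsub>P\<^esub> (emb u \<otimes>\<^bsub>P\<^esub> C i) = y [^]\<^bsub>P\<^esub> m (fst i) \<otimes>\<^bsub>P\<^esub> \<zero>\<^bsub>P\<^esub>"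
        by (simp add: q_def split_def)
      then show ?thesis by (rule y_pow_regular[rotated 2]) (use cl in simp_all)
    qed
    then have "\<exists>u\<in>S. \<forall>i. emb u \<otimes>\<^bsub>P\<^esub> C i \<otimes>\<^bsub>P\<^esub> emb \<one>\<^bsub>T\<^esub> = emb u \<otimes>\<^bsub>P\<^esub> \<zero>\<^bsub>\<Omega>\<^esub> i \<otimes>\<^bsub>P\<^esub> emb d"
      using u(1) C(3) S_one by (intro bexI[of _ u]) (simp_all del: split_paired_All)
    then have "fr C d = fr \<zero>\<^bsub>\<Omega>\<^esub> \<one>\<^bsub>T\<^esub>" unfolding fr_eq_iff[OF C(2) Omega.zero_closed C(3) S_one] .
    then show ?thesis using C z by simp
  qed
  moreover have "j = fr q \<one>\<^bsub>T\<^esub> \<otimes>\<^bsub>V\<^esub> fr H d" "k = fr q \<one>\<^bsub>T\<^esub> \<otimes>\<^bsub>V\<^esub> fr H' e"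
    unfolding F(1) G(1) fr_mult[OF q H(1) S_one F(4)] fr_mult[OF q H'(1) S_one G(4)] H(3)[symmetric] H'(3)[symmetric]
    using F(4) G(4) by simp_all
  moreover have "fr H d \<in> J" "fr H' e \<in> J" using J_I H H' F(4) G(4) by blast+
  ultimately show ?thesis by blast
qed

sublocale divisible_ideal J V
  using ideal_J J_common_factor by (auto simp: divisible_ideal_def divisible_ideal_axioms_def V.is_cring)

end

lemma map_coef_comp: "map_coef g (map_coef h w) = map_coef (g \<circ> h) w"
  by (simp add: map_coef_def apfst_def apsnd_def map_prod_def split_def)

lemma eventually_map_coef_eq:
  assumes "w \<in> St_words \<Phi> A" "\<And>a. a \<in> carrier A \<Longrightarrow> \<forall>\<^sub>F p in F. g p a = h p a"
  shows "\<forall>\<^sub>F p in F. map_coef (g p) w = map_coef (h p) w"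
  using assms(1)
proof (induction w)
  case (Cons l w)
  obtain \<gamma> a b where l: "l = ((\<gamma>, a), b)" by (metis prod.collapse)
  then have "a \<in> carrier A" "w \<in> St_words \<Phi> A" using Cons.prems by (auto simp: steinberg_gens_iff)
  then show ?case using eventually_conj[OF assms(2)[of a] Cons.IH] by (simp add: l)
qed simp

section \<open>Specialising the variable y at multiples of all denominators\<close>

context dilation begin

text \<open>An index consists of \<open>k\<close>, the value \<sigma> substituted for y, and the
  parameter \<open>q\<close>. Eventually means for all large \<open>k\<close>, for all \<sigma> in u
  S with some u in \<open>S\<close>, and uniformly in \<open>q\<close>. Divisibility plays the role
  of size here: finitely many required divisors are met at once by their product.\<close>

definition dil_at_top :: "(nat \<times> 'a \<times> 'q) filter" where
  "dil_at_top = Abs_filter (\<lambda>Q. \<exists>K. \<exists>u\<in>S. \<forall>k\<ge>K. \<forall>s\<in>S. \<forall>q. Q (k, u \<otimes>\<^bsub>T\<^esub> s, q))"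

lemma eventually_dil_at_top: "eventually Q dil_at_top \<longleftrightarrow> (\<exists>K. \<exists>u\<in>S. \<forall>k\<ge>K. \<forall>s\<in>S. \<forall>q. Q (k, u \<otimes>\<^bsub>T\<^esub> s, q))"
  unfolding dil_at_top_def
proof (rule eventually_Abs_filter, rule is_filter.intro)
  show "\<exists>K. \<exists>u\<in>S. \<forall>k\<ge>K. \<forall>s\<in>S. \<forall>q. True" using S_one by blast
next
  fix Q Q' :: "nat \<times> 'a \<times> 'q \<Rightarrow> bool"
  assume "\<exists>K. \<exists>u\<in>S. \<forall>k\<ge>K. \<forall>s\<in>S. \<forall>q. Q (k, u \<otimes>\<^bsub>T\<^esub> s, q)" "\<exists>K. \<exists>u\<in>S. \<forall>k\<ge>K. \<forall>s\<in>S. \<forall>q. Q' (k, u \<otimes>\<^bsub>T\<^esub> s, q)"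
  then obtain K u K' u' where u: "u \<in> S" "\<And>k s q. \<lbrakk>k \<ge> K; s \<in> S\<rbrakk> \<Longrightarrow> Q (k, u \<otimes>\<^bsub>T\<^esub> s, q)"
    and u': "u' \<in> S" "\<And>k s q. \<lbrakk>k \<ge> K'; s \<in> S\<rbrakk> \<Longrightarrow> Q' (k, u' \<otimes>\<^bsub>T\<^esub> s, q)" by blast
  have "Q (k, (u \<otimes>\<^bsub>T\<^esub> u') \<otimes>\<^bsub>T\<^esub> s, q) \<and> Q' (k, (u \<otimes>\<^bsub>T\<^esub> u') \<otimes>\<^bsub>T\<^esub> s, q)" if k: "k \<ge> max K K'" and s: "s \<in> S" for k s q
  proof -
    have e: "(u \<otimes>\<^bsub>T\<^esub> u') \<otimes>\<^bsub>T\<^esub> s = u \<otimes>\<^bsub>T\<^esub> (u' \<otimes>\<^bsub>T\<^esub> s)" "(u \<otimes>\<^bsub>T\<^esub> u') \<otimes>\<^bsub>T\<^esub> s = u' \<otimes>\<^bsub>T\<^esub> (u \<otimes>\<^bsub>T\<^esub> s)"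
      using u(1) u'(1) s by (simp_all add: T.m_ac)
    show ?thesis using u(2)[OF _ S_mult[OF u'(1) s]] u'(2)[OF _ S_mult[OF u(1) s]] k unfolding e(1)[symmetric] e(2)[symmetric] by simp
  qed
  then show "\<exists>K. \<exists>u\<in>S. \<forall>k\<ge>K. \<forall>s\<in>S. \<forall>q. Q (k, u \<otimes>\<^bsub>T\<^esub> s, q) \<and> Q' (k, u \<otimes>\<^bsub>T\<^esub> s, q)"
    using S_mult[OF u(1) u'(1)] by blast
next
  fix Q Q' :: "nat \<times> 'a \<times> 'q \<Rightarrow> bool"
  assume "\<forall>p. Q p \<longrightarrow> Q' p" "\<exists>K. \<exists>u\<in>S. \<forall>k\<ge>K. \<forall>s\<in>S. \<forall>q. Q (k, u \<otimes>\<^bsub>T\<^esub> s, q)"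
  then show "\<exists>K. \<exists>u\<in>S. \<forall>k\<ge>K. \<forall>s\<in>S. \<forall>q. Q' (k, u \<otimes>\<^bsub>T\<^esub> s, q)" by meson
qed

abbreviation scl :: "nat \<times> 'a \<times> 'q \<Rightarrow> 'a" where "scl p \<equiv> fst (snd p)"
abbreviation pt :: "nat \<times> 'a \<times> 'q \<Rightarrow> nat \<times> 'q" where "pt p \<equiv> (fst p, snd (snd p))"

lemma eventually_scl: "\<forall>\<^sub>F p in dil_at_top. scl p \<in> S"
  unfolding eventually_dil_at_top using S_one S_mult by (intro exI[of _ 0] bexI[of _ "\<one>\<^bsub>T\<^esub>"]) simp_all

lemma eventually_factor: "d \<in> S \<Longrightarrow> \<forall>\<^sub>F p in dil_at_top. \<exists>w\<in>S. scl p = d \<otimes>\<^bsub>T\<^esub> w"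
  unfolding eventually_dil_at_top by (intro exI[of _ 0] bexI[of _ d]) auto

lemma eventually_ydvd: "vanishing F \<Longrightarrow> \<forall>\<^sub>F p in dil_at_top. ydvd n (F (pt p))"
proof -
  assume "vanishing F"
  then obtain K where "\<forall>k\<ge>K. \<forall>q. ydvd n (F (k, q))" unfolding vanishing_def by blast
  then show ?thesis unfolding eventually_dil_at_top using S_one by (intro exI[of _ K] bexI[of _ "\<one>\<^bsub>T\<^esub>"]) simp_all
qed

text \<open>
  For \<open>\<sigma> = d w\<close> this is the value of \<open>y ^ 4 G / d\<close> at \<open>y = \<sigma>\<close>. The spare powers of \<open>\<sigma>\<close> absorb the
  denominators and multipliers in which two representations of a fraction may differ.
\<close>

definition scaled :: "'a \<Rightarrow> 'a \<Rightarrow> 'b \<Rightarrow> 'a" where "scaled \<sigma> w G = w \<otimes>\<^bsub>T\<^esub> \<sigma> [^]\<^bsub>T\<^esub> (3::nat) \<otimes>\<^bsub>T\<^esub> ev \<sigma> G"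

text \<open>The value at y = \<sigma> of the fraction with numerator F and denominator d: if
  \<sigma> = d w and F = y^4 G, then F(\<sigma>) divided by d is w \<sigma>^3 G(\<sigma>). This is
  meaningful as soon as d divides \<sigma> and \<open>k\<close> is large, and by
  \<open>lift_eq\<close> the choices then do not matter.\<close>

definition lift :: "nat \<times> 'a \<times> 'q \<Rightarrow> ((nat \<times> 'q \<Rightarrow> 'b) \<times> (nat \<times> 'q \<Rightarrow> 'b)) set \<Rightarrow> 'a" where
  "lift p j = (let (F, d) = SOME (F, d). j = fr F d \<and> F \<in> carrier \<Omega> \<and> vanishing F \<and> d \<in> S in
     scaled (scl p) (SOME w. w \<in> S \<and> scl p = d \<otimes>\<^bsub>T\<^esub> w)
       (SOME G. G \<in> carrier P \<and> F (pt p) = y [^]\<^bsub>P\<^esub> (4::nat) \<otimes>\<^bsub>P\<^esub> G))"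

lemma ev_closed [simp]: "\<lbrakk>\<sigma> \<in> S; f \<in> carrier P\<rbrakk> \<Longrightarrow> ev \<sigma> f \<in> carrier T"
  by (rule ring_hom_closed[OF ev_hom])

text \<open>Two names of a fraction agree only after multiplication by \<open>u\<close> and by each
  other's denominators. After cancelling y^4 and evaluating, two of the three spare factors \<sigma>
  are written as \<open>d' \<otimes> w'\<close> and \<open>u \<otimes> x\<close>, which supplies
  these multipliers.\<close>

lemma scaled_unique:
  assumes C: "X \<in> carrier P" "X' \<in> carrier P" "d \<in> S" "d' \<in> S" "u \<in> S" "x \<in> S" "w \<in> S" "w' \<in> S" "G \<in> carrier P" "G' \<in> carrier P"
    and eq: "emb u \<otimes>\<^bsub>P\<^esub> X \<otimes>\<^bsub>P\<^esub> emb d' = emb u \<otimes>\<^bsub>P\<^esub> X' \<otimes>\<^bsub>P\<^esub> emb d"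
    and \<sigma>: "\<sigma> = u \<otimes>\<^bsub>T\<^esub> x" "\<sigma> = d \<otimes>\<^bsub>T\<^esub> w" "\<sigma> = d' \<otimes>\<^bsub>T\<^esub> w'"
    and G: "X = y [^]\<^bsub>P\<^esub> (4::nat) \<otimes>\<^bsub>P\<^esub> G" "X' = y [^]\<^bsub>P\<^esub> (4::nat) \<otimes>\<^bsub>P\<^esub> G'"
  shows "scaled \<sigma> w G = scaled \<sigma> w' G'"
proof -
  have s: "\<sigma> \<in> S" using \<sigma>(1) S_mult C by blast
  interpret ev: ring_hom_ring P T "ev \<sigma>"
    using ev_hom[OF s] by (intro ring_hom_ringI2) (auto intro: P.ring_axioms T.ring_axioms)
  have "y [^]\<^bsub>P\<^esub> (4::nat) \<otimes>\<^bsub>P\<^esub> (emb u \<otimes>\<^bsub>P\<^esub> G \<otimes>\<^bsub>P\<^esub> emb d') = y [^]\<^bsub>P\<^esub> (4::nat) \<otimes>\<^bsub>P\<^esub> (emb u \<otimes>\<^bsub>P\<^esub> G' \<otimes>\<^bsub>P\<^esub> emb d)"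
    using eq C unfolding G by (simp add: P.m_ac)
  then have "emb u \<otimes>\<^bsub>P\<^esub> G \<otimes>\<^bsub>P\<^esub> emb d' = emb u \<otimes>\<^bsub>P\<^esub> G' \<otimes>\<^bsub>P\<^esub> emb d"
    by (rule y_pow_regular[rotated 2]) (use C in simp_all)
  then have "ev \<sigma> (emb u \<otimes>\<^bsub>P\<^esub> G \<otimes>\<^bsub>P\<^esub> emb d') = ev \<sigma> (emb u \<otimes>\<^bsub>P\<^esub> G' \<otimes>\<^bsub>P\<^esub> emb d)" by simp
  then have e: "u \<otimes>\<^bsub>T\<^esub> ev \<sigma> G \<otimes>\<^bsub>T\<^esub> d' = u \<otimes>\<^bsub>T\<^esub> ev \<sigma> G' \<otimes>\<^bsub>T\<^esub> d" using C s by (simp add: ev_emb)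
  have c: "ev \<sigma> G \<in> carrier T" "ev \<sigma> G' \<in> carrier T" "\<sigma> \<in> carrier T" using C s by auto
  have p: "\<sigma> [^]\<^bsub>T\<^esub> (3::nat) = \<sigma> \<otimes>\<^bsub>T\<^esub> \<sigma> \<otimes>\<^bsub>T\<^esub> \<sigma>" using c by (simp add: numeral_eq_Suc)
  have "scaled \<sigma> w G = w \<otimes>\<^bsub>T\<^esub> ((d' \<otimes>\<^bsub>T\<^esub> w') \<otimes>\<^bsub>T\<^esub> (u \<otimes>\<^bsub>T\<^esub> x) \<otimes>\<^bsub>T\<^esub> \<sigma>) \<otimes>\<^bsub>T\<^esub> ev \<sigma> G"
    unfolding scaled_def p \<sigma>(1)[symmetric] \<sigma>(3)[symmetric] ..
  also have "\<dots> = w \<otimes>\<^bsub>T\<^esub> w' \<otimes>\<^bsub>T\<^esub> x \<otimes>\<^bsub>T\<^esub> \<sigma> \<otimes>\<^bsub>T\<^esub> (u \<otimes>\<^bsub>T\<^esub> ev \<sigma> G \<otimes>\<^bsub>T\<^esub> d')" using C c by (simp add: T.m_ac)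
  also have "\<dots> = w' \<otimes>\<^bsub>T\<^esub> ((d \<otimes>\<^bsub>T\<^esub> w) \<otimes>\<^bsub>T\<^esub> (u \<otimes>\<^bsub>T\<^esub> x) \<otimes>\<^bsub>T\<^esub> \<sigma>) \<otimes>\<^bsub>T\<^esub> ev \<sigma> G'" unfolding e using C c by (simp add: T.m_ac)
  also have "\<dots> = scaled \<sigma> w' G'" unfolding scaled_def p \<sigma>(1)[symmetric] \<sigma>(2)[symmetric] ..
  finally show ?thesis .
qed

text \<open>The numerator and denominator chosen inside \<open>lift\<close> depend on the fraction
  but not on the index \<open>p\<close>. Hence comparing them with \<open>F\<close> and
  \<open>d\<close> imposes only finitely many divisibility conditions on \<sigma> and one lower
  bound on \<open>k\<close>.\<close>

lemma lift_eq:
  assumes F: "F \<in> carrier \<Omega>" "vanishing F" and d: "d \<in> S"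
  shows "\<forall>\<^sub>F p in dil_at_top. \<forall>w\<in>S. \<forall>G\<in>carrier P. scl p = d \<otimes>\<^bsub>T\<^esub> w \<longrightarrow> F (pt p) = y [^]\<^bsub>P\<^esub> (4::nat) \<otimes>\<^bsub>P\<^esub> G \<longrightarrow>
    lift p (fr F d) = scaled (scl p) w G"
proof -
  define rep where "rep = (SOME (F', d'). fr F d = fr F' d' \<and> F' \<in> carrier \<Omega> \<and> vanishing F' \<and> d' \<in> S)"
  obtain F' d' where r: "rep = (F', d')" by fastforce
  have "case rep of (F', d') \<Rightarrow> fr F d = fr F' d' \<and> F' \<in> carrier \<Omega> \<and> vanishing F' \<and> d' \<in> S"
    unfolding rep_def by (rule someI[of _ "(F, d)"]) (use assms in simp)
  then have F': "fr F d = fr F' d'" "F' \<in> carrier \<Omega>" "vanishing F'" "d' \<in> S" by (simp_all add: r)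
  obtain u where u: "u \<in> S" "\<And>i. emb u \<otimes>\<^bsub>P\<^esub> F i \<otimes>\<^bsub>P\<^esub> emb d' = emb u \<otimes>\<^bsub>P\<^esub> F' i \<otimes>\<^bsub>P\<^esub> emb d"
    using F'(1) unfolding fr_eq_iff[OF F(1) F'(2) d F'(4)] by blast
  show ?thesis using eventually_factor[OF u(1)] eventually_factor[OF F'(4)] eventually_ydvd[OF F'(3), of 4]
  proof eventually_elim
    case (elim p)
    define w' where "w' = (SOME w. w \<in> S \<and> scl p = d' \<otimes>\<^bsub>T\<^esub> w)"
    define G' where "G' = (SOME G. G \<in> carrier P \<and> F' (pt p) = y [^]\<^bsub>P\<^esub> (4::nat) \<otimes>\<^bsub>P\<^esub> G)"
    have w': "w' \<in> S \<and> scl p = d' \<otimes>\<^bsub>T\<^esub> w'" unfolding w'_def by (rule someI_ex) (use elim(2) in blast)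
    have G': "G' \<in> carrier P \<and> F' (pt p) = y [^]\<^bsub>P\<^esub> (4::nat) \<otimes>\<^bsub>P\<^esub> G'"
      unfolding G'_def by (rule someI_ex) (use elim(3) in \<open>unfold ydvd_def, blast\<close>)
    have l: "lift p (fr F d) = scaled (scl p) w' G'"
      unfolding lift_def rep_def[symmetric] r w'_def G'_def by simp
    obtain x where x: "x \<in> S" "scl p = u \<otimes>\<^bsub>T\<^esub> x" using elim(1) by blast
    have FP: "F (pt p) \<in> carrier P" "F' (pt p) \<in> carrier P" using F(1) F'(2) by (simp_all del: split_paired_All)
    show ?case
    proof (intro ballI impI)
      fix w G assume w: "w \<in> S" "G \<in> carrier P" "scl p = d \<otimes>\<^bsub>T\<^esub> w" "F (pt p) = y [^]\<^bsub>P\<^esub> (4::nat) \<otimes>\<^bsub>P\<^esub> G"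
      have "scaled (scl p) w G = scaled (scl p) w' G'"
        by (rule scaled_unique[OF FP d F'(4) u(1) x(1) w(1) _ w(2) _ u(2) x(2) w(3) _ w(4)]) (use w' G' in simp_all)
      then show "lift p (fr F d) = scaled (scl p) w G" unfolding l ..
    qed
  qed
qed

lemma lift_closed: "j \<in> J \<Longrightarrow> \<forall>\<^sub>F p in dil_at_top. lift p j \<in> carrier T"
proof -
  assume "j \<in> J"
  then obtain F d where F: "j = fr F d" "F \<in> carrier \<Omega>" "vanishing F" "d \<in> S" using J_cases by blast
  show ?thesis using lift_eq[OF F(2-4)] eventually_factor[OF F(4)] eventually_ydvd[OF F(3), of 4] eventually_scl
  proof eventually_elim
    case (elim p)
    obtain w G where "w \<in> S" "scl p = d \<otimes>\<^bsub>T\<^esub> w" "G \<in> carrier P" "F (pt p) = y [^]\<^bsub>P\<^esub> (4::nat) \<otimes>\<^bsub>P\<^esub> G"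
      using elim(2,3) unfolding ydvd_def by blast
    moreover from this have "lift p j = scaled (scl p) w G" using elim(1) unfolding F(1) by blast
    ultimately show ?case using elim(4) by (simp add: scaled_def del: split_paired_All)
  qed
qed

lemma lift_add_mult:
  assumes j: "j \<in> J" and k: "k \<in> J"
  shows "\<forall>\<^sub>F p in dil_at_top. lift p (j \<oplus>\<^bsub>V\<^esub> k) = lift p j \<oplus>\<^bsub>T\<^esub> lift p k"
    and "\<forall>\<^sub>F p in dil_at_top. lift p (j \<otimes>\<^bsub>V\<^esub> k) = lift p j \<otimes>\<^bsub>T\<^esub> lift p k"
proof -
  obtain F d G e where F: "j = fr F d" "F \<in> carrier \<Omega>" "vanishing F" "d \<in> S" and G: "k = fr G e" "G \<in> carrier \<Omega>" "vanishing G" "e \<in> S"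
    using J_cases[OF j] J_cases[OF k] by blast
  define A where "A = F \<otimes>\<^bsub>\<Omega>\<^esub> cst e \<oplus>\<^bsub>\<Omega>\<^esub> G \<otimes>\<^bsub>\<Omega>\<^esub> cst d"
  define B where "B = F \<otimes>\<^bsub>\<Omega>\<^esub> G"
  have A: "A \<in> carrier \<Omega>" "vanishing A" unfolding A_def
    using Omega.a_closed[OF Omega.m_closed[OF F(2) cst_carrier[OF G(4)]] Omega.m_closed[OF G(2) cst_carrier[OF F(4)]]]
      vanishing_add[OF vanishing_mult(2)[OF cst_carrier[OF G(4)] F(3)] vanishing_mult(2)[OF cst_carrier[OF F(4)] G(3)]] by blast+
  have B: "B \<in> carrier \<Omega>" "vanishing B" unfolding B_def using Omega.m_closed[OF F(2) G(2)] vanishing_mult(1)[OF F(2) G(3)] by blast+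
  have de: "d \<otimes>\<^bsub>T\<^esub> e \<in> S" using F G S_mult by blast
  have sum: "j \<oplus>\<^bsub>V\<^esub> k = fr A (d \<otimes>\<^bsub>T\<^esub> e)" and prod: "j \<otimes>\<^bsub>V\<^esub> k = fr B (d \<otimes>\<^bsub>T\<^esub> e)"
    unfolding F(1) G(1) A_def B_def by (rule fr_add fr_mult; fact F G)+
  have "\<forall>\<^sub>F p in dil_at_top. lift p (j \<oplus>\<^bsub>V\<^esub> k) = lift p j \<oplus>\<^bsub>T\<^esub> lift p k \<and> lift p (j \<otimes>\<^bsub>V\<^esub> k) = lift p j \<otimes>\<^bsub>T\<^esub> lift p k"
    using lift_eq[OF F(2-4)] lift_eq[OF G(2-4)] lift_eq[OF A de] lift_eq[OF B de] eventually_factor[OF de]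
      eventually_ydvd[OF F(3), of 4] eventually_ydvd[OF G(3), of 4] eventually_scl
  proof eventually_elim
    case (elim p)
    obtain w where w: "w \<in> S" "scl p = d \<otimes>\<^bsub>T\<^esub> e \<otimes>\<^bsub>T\<^esub> w" using elim(5) by blast
    obtain f g where f: "f \<in> carrier P" "F (pt p) = y [^]\<^bsub>P\<^esub> (4::nat) \<otimes>\<^bsub>P\<^esub> f" and g: "g \<in> carrier P" "G (pt p) = y [^]\<^bsub>P\<^esub> (4::nat) \<otimes>\<^bsub>P\<^esub> g"
      using elim(6,7) unfolding ydvd_def by blast
    interpret ev: ring_hom_ring P T "ev (scl p)"
      using ev_hom[OF elim(8)] by (intro ring_hom_ringI2) (auto intro: P.ring_axioms T.ring_axioms)
    define \<sigma> where "\<sigma> = scl p"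
    have c: "\<sigma> \<in> carrier T" "d \<in> carrier T" "e \<in> carrier T" "w \<in> carrier T" "ev \<sigma> f \<in> carrier T" "ev \<sigma> g \<in> carrier T"
      using elim(8) F G w f g by (simp_all add: \<sigma>_def)
    have we: "scl p = d \<otimes>\<^bsub>T\<^esub> (e \<otimes>\<^bsub>T\<^esub> w)" "scl p = e \<otimes>\<^bsub>T\<^esub> (d \<otimes>\<^bsub>T\<^esub> w)" unfolding w(2) using c by (simp_all add: T.m_ac)
    have lj: "lift p j = scaled \<sigma> (e \<otimes>\<^bsub>T\<^esub> w) f"
      using elim(1) S_mult[OF G(4) w(1)] f we(1) unfolding F(1) \<sigma>_def by blast
    have lk: "lift p k = scaled \<sigma> (d \<otimes>\<^bsub>T\<^esub> w) g"
      using elim(2) S_mult[OF F(4) w(1)] g we(2) unfolding G(1) \<sigma>_def by blast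
    define a where "a = f \<otimes>\<^bsub>P\<^esub> emb e \<oplus>\<^bsub>P\<^esub> g \<otimes>\<^bsub>P\<^esub> emb d"
    \<comment> \<open>The product of the numerators contains y^8; \<open>lift\<close> strips off
      y^4, so another y^4 stays in \<open>b\<close>.\<close>
    define b where "b = y [^]\<^bsub>P\<^esub> (4::nat) \<otimes>\<^bsub>P\<^esub> (f \<otimes>\<^bsub>P\<^esub> g)"
    have a: "a \<in> carrier P" "A (pt p) = y [^]\<^bsub>P\<^esub> (4::nat) \<otimes>\<^bsub>P\<^esub> a"
      using f g F(4) G(4) by (simp_all add: a_def A_def P.r_distr P.m_ac)
    have b: "b \<in> carrier P" "B (pt p) = y [^]\<^bsub>P\<^esub> (4::nat) \<otimes>\<^bsub>P\<^esub> b"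
      using f g by (simp_all add: b_def B_def P.m_ac)
    have la: "lift p (j \<oplus>\<^bsub>V\<^esub> k) = scaled \<sigma> w a"
      using elim(3) w a unfolding sum \<sigma>_def by blast
    have lb: "lift p (j \<otimes>\<^bsub>V\<^esub> k) = scaled \<sigma> w b"
      using elim(4) w b unfolding prod \<sigma>_def by blast
    have ea: "ev \<sigma> a = ev \<sigma> f \<otimes>\<^bsub>T\<^esub> e \<oplus>\<^bsub>T\<^esub> ev \<sigma> g \<otimes>\<^bsub>T\<^esub> d"
      using f g F(4) G(4) elim(8) by (simp add: a_def \<sigma>_def ev_emb)
    have eb: "ev \<sigma> b = \<sigma> [^]\<^bsub>T\<^esub> (4::nat) \<otimes>\<^bsub>T\<^esub> (ev \<sigma> f \<otimes>\<^bsub>T\<^esub> ev \<sigma> g)"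
      using f g elim(8) by (simp add: b_def \<sigma>_def ev_y numeral_eq_Suc T.m_ac)
    have "lift p (j \<oplus>\<^bsub>V\<^esub> k) = lift p j \<oplus>\<^bsub>T\<^esub> lift p k"
      unfolding la lj lk scaled_def ea using c by (simp add: T.r_distr T.l_distr T.m_ac)
    moreover have "lift p (j \<otimes>\<^bsub>V\<^esub> k) = lift p j \<otimes>\<^bsub>T\<^esub> lift p k"
    proof -
      \<comment> \<open>One of the additional factors \<sigma> is spent on d e w, because the
        right-hand side carries the cofactors e w and d w where the left-hand side has a single
        w.\<close>
      have p: "\<sigma> [^]\<^bsub>T\<^esub> (4::nat) = \<sigma> [^]\<^bsub>T\<^esub> (3::nat) \<otimes>\<^bsub>T\<^esub> (d \<otimes>\<^bsub>T\<^esub> e \<otimes>\<^bsub>T\<^esub> w)"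
        using c unfolding w(2)[symmetric] \<sigma>_def[symmetric] by (simp add: numeral_eq_Suc)
      show ?thesis unfolding lb lj lk scaled_def eb p using c by (simp add: T.m_ac)
    qed
    ultimately show ?case ..
  qed
  then show "\<forall>\<^sub>F p in dil_at_top. lift p (j \<oplus>\<^bsub>V\<^esub> k) = lift p j \<oplus>\<^bsub>T\<^esub> lift p k"
    and "\<forall>\<^sub>F p in dil_at_top. lift p (j \<otimes>\<^bsub>V\<^esub> k) = lift p j \<otimes>\<^bsub>T\<^esub> lift p k"
    by (rule eventually_mono; blast)+
qed

lemma lift_act:
  assumes b: "b \<in> carrier \<Omega>" and j: "j \<in> J"
  shows "\<forall>\<^sub>F p in dil_at_top. lift p (loc_map \<Omega> M b \<otimes>\<^bsub>V\<^esub> j) = ev (scl p) (b (pt p)) \<otimes>\<^bsub>T\<^esub> lift p j"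
proof -
  obtain F d where F: "j = fr F d" "F \<in> carrier \<Omega>" "vanishing F" "d \<in> S" using J_cases[OF j] by blast
  define B where "B = b \<otimes>\<^bsub>\<Omega>\<^esub> F"
  have B: "B \<in> carrier \<Omega>" "vanishing B" unfolding B_def using Omega.m_closed[OF b F(2)] vanishing_mult(1)[OF b F(3)] by blast+
  have prod: "loc_map \<Omega> M b \<otimes>\<^bsub>V\<^esub> j = fr B d"
    unfolding F(1) B_def loc_map_fr fr_mult[OF b F(2) S_one F(4)] using F(4) by simp
  show ?thesis using lift_eq[OF F(2-4)] lift_eq[OF B F(4)] eventually_factor[OF F(4)] eventually_ydvd[OF F(3), of 4] eventually_scl
  proof eventually_elim
    case (elim p)
    obtain w where w: "w \<in> S" "scl p = d \<otimes>\<^bsub>T\<^esub> w" using elim(3) by blast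
    obtain f where f: "f \<in> carrier P" "F (pt p) = y [^]\<^bsub>P\<^esub> (4::nat) \<otimes>\<^bsub>P\<^esub> f" using elim(4) unfolding ydvd_def by blast
    interpret ev: ring_hom_ring P T "ev (scl p)"
      using ev_hom[OF elim(5)] by (intro ring_hom_ringI2) (auto intro: P.ring_axioms T.ring_axioms)
    have bp: "b (pt p) \<in> carrier P" using b by (simp del: split_paired_All)
    have B': "b (pt p) \<otimes>\<^bsub>P\<^esub> f \<in> carrier P" "B (pt p) = y [^]\<^bsub>P\<^esub> (4::nat) \<otimes>\<^bsub>P\<^esub> (b (pt p) \<otimes>\<^bsub>P\<^esub> f)"
      using f bp by (simp_all add: B_def P.m_ac)
    have "lift p (loc_map \<Omega> M b \<otimes>\<^bsub>V\<^esub> j) = scaled (scl p) w (b (pt p) \<otimes>\<^bsub>P\<^esub> f)" using elim(2) w B' unfolding prod by blast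
    moreover have "lift p j = scaled (scl p) w f" using elim(1) w f unfolding F(1) by blast
    ultimately show ?case using elim(5) w(1) f(1) bp by (simp add: scaled_def T.m_ac del: split_paired_All)
  qed
qed

lemma lift_loc_map:
  assumes "F \<in> carrier \<Omega>" "vanishing F"
  shows "\<forall>\<^sub>F p in dil_at_top. lift p (loc_map \<Omega> M F) = ev (scl p) (F (pt p))"
  unfolding loc_map_fr using lift_eq[OF assms S_one] eventually_ydvd[OF assms(2), of 4] eventually_scl
proof eventually_elim
  case (elim p)
  obtain f where f: "f \<in> carrier P" "F (pt p) = y [^]\<^bsub>P\<^esub> (4::nat) \<otimes>\<^bsub>P\<^esub> f" using elim(2) unfolding ydvd_def by blast
  interpret ev: ring_hom_ring P T "ev (scl p)"
    using ev_hom[OF elim(3)] by (intro ring_hom_ringI2) (auto intro: P.ring_axioms T.ring_axioms)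
  have "scl p = \<one>\<^bsub>T\<^esub> \<otimes>\<^bsub>T\<^esub> scl p" using elim(3) by simp
  then have "lift p (fr F \<one>\<^bsub>T\<^esub>) = scaled (scl p) (scl p) f" using elim(1,3) f by blast
  also have "\<dots> = ev (scl p) (F (pt p))"
    unfolding scaled_def f(2) using f(1) elim(3) by (simp add: ev_y numeral_eq_Suc T.m_ac)
  finally show ?case .
qed

text \<open>A fraction in \<open>V\<close> has in general no value in \<open>T\<close>; an element
  of \<open>J\<close> and a family in \<open>\<Omega>\<close> do. The pairs of a family and a
  fraction congruent to it modulo \<open>J\<close> form a ring in which every element is a family
  plus an element of \<open>J\<close>, the latter embedded as \<open>(\<zero>, j)\<close>.\<close>

definition thick :: "((nat \<times> 'q \<Rightarrow> 'b) \<times> ((nat \<times> 'q \<Rightarrow> 'b) \<times> (nat \<times> 'q \<Rightarrow> 'b)) set) ring" where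
  "thick = (RDirProd \<Omega> V)\<lparr>carrier := {(b, v). b \<in> carrier \<Omega> \<and> v \<in> carrier V \<and> v \<ominus>\<^bsub>V\<^esub> loc_map \<Omega> M b \<in> J}\<rparr>"

sublocale lm: ring_hom_ring \<Omega> V "loc_map \<Omega> M"
  using loc.loc_map_hom by (intro ring_hom_ringI2) (auto intro: Omega.ring_axioms V.ring_axioms)

lemmas J_zero = additive_subgroup.zero_closed[OF ideal.axioms(1)[OF ideal_J]]
  and J_mult_left = ideal.I_l_closed[OF ideal_J]

lemma thick_simps [simp]:
  "(b, v) \<in> carrier thick \<longleftrightarrow> b \<in> carrier \<Omega> \<and> v \<in> carrier V \<and> v \<ominus>\<^bsub>V\<^esub> loc_map \<Omega> M b \<in> J"
  "(b, v) \<oplus>\<^bsub>thick\<^esub> (b', v') = (b \<oplus>\<^bsub>\<Omega>\<^esub> b', v \<oplus>\<^bsub>V\<^esub> v')"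
  "(b, v) \<otimes>\<^bsub>thick\<^esub> (b', v') = (b \<otimes>\<^bsub>\<Omega>\<^esub> b', v \<otimes>\<^bsub>V\<^esub> v')"
  "\<one>\<^bsub>thick\<^esub> = (\<one>\<^bsub>\<Omega>\<^esub>, \<one>\<^bsub>V\<^esub>)"
  by (simp_all add: thick_def del: Omega_simps)

text \<open>Expansion of (c + j)(c' + j') - c c'. The summands are in the form in which
  \<open>lift_add_mult\<close> and \<open>lift_act\<close> evaluate them.\<close>

lemma thick_mult_diff:
  assumes "b \<in> carrier \<Omega>" "b' \<in> carrier \<Omega>" "v \<in> carrier V" "v' \<in> carrier V"
  shows "v \<otimes>\<^bsub>V\<^esub> v' \<ominus>\<^bsub>V\<^esub> loc_map \<Omega> M (b \<otimes>\<^bsub>\<Omega>\<^esub> b') =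
    (v \<ominus>\<^bsub>V\<^esub> loc_map \<Omega> M b) \<otimes>\<^bsub>V\<^esub> (v' \<ominus>\<^bsub>V\<^esub> loc_map \<Omega> M b') \<oplus>\<^bsub>V\<^esub>
    (loc_map \<Omega> M b \<otimes>\<^bsub>V\<^esub> (v' \<ominus>\<^bsub>V\<^esub> loc_map \<Omega> M b') \<oplus>\<^bsub>V\<^esub> loc_map \<Omega> M b' \<otimes>\<^bsub>V\<^esub> (v \<ominus>\<^bsub>V\<^esub> loc_map \<Omega> M b))"
proof -
  define c c' where "c = loc_map \<Omega> M b" and "c' = loc_map \<Omega> M b'"
  have C: "c \<in> carrier V" "c' \<in> carrier V" using assms by (simp_all add: c_def c'_def del: Omega_simps)
  have h: "loc_map \<Omega> M (b \<otimes>\<^bsub>\<Omega>\<^esub> b') = c \<otimes>\<^bsub>V\<^esub> c'" unfolding c_def c'_def using assms by (rule_tac lm.hom_mult)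
  have "v \<otimes>\<^bsub>V\<^esub> v' \<ominus>\<^bsub>V\<^esub> c \<otimes>\<^bsub>V\<^esub> c' = (v \<ominus>\<^bsub>V\<^esub> c) \<otimes>\<^bsub>V\<^esub> (v' \<ominus>\<^bsub>V\<^esub> c') \<oplus>\<^bsub>V\<^esub> (c \<otimes>\<^bsub>V\<^esub> (v' \<ominus>\<^bsub>V\<^esub> c') \<oplus>\<^bsub>V\<^esub> c' \<otimes>\<^bsub>V\<^esub> (v \<ominus>\<^bsub>V\<^esub> c))"
    using C assms(3,4) by algebra
  then show ?thesis unfolding h c_def c'_def .
qed

lemma thick_add_diff:
  assumes "b \<in> carrier \<Omega>" "b' \<in> carrier \<Omega>" "v \<in> carrier V" "v' \<in> carrier V"
  shows "(v \<oplus>\<^bsub>V\<^esub> v') \<ominus>\<^bsub>V\<^esub> loc_map \<Omega> M (b \<oplus>\<^bsub>\<Omega>\<^esub> b') = (v \<ominus>\<^bsub>V\<^esub> loc_map \<Omega> M b) \<oplus>\<^bsub>V\<^esub> (v' \<ominus>\<^bsub>V\<^esub> loc_map \<Omega> M b')"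
proof -
  define c c' where "c = loc_map \<Omega> M b" and "c' = loc_map \<Omega> M b'"
  have C: "c \<in> carrier V" "c' \<in> carrier V" using assms by (simp_all add: c_def c'_def del: Omega_simps)
  have h: "loc_map \<Omega> M (b \<oplus>\<^bsub>\<Omega>\<^esub> b') = c \<oplus>\<^bsub>V\<^esub> c'" unfolding c_def c'_def using assms by (rule_tac lm.hom_add)
  have "(v \<oplus>\<^bsub>V\<^esub> v') \<ominus>\<^bsub>V\<^esub> (c \<oplus>\<^bsub>V\<^esub> c') = (v \<ominus>\<^bsub>V\<^esub> c) \<oplus>\<^bsub>V\<^esub> (v' \<ominus>\<^bsub>V\<^esub> c')"
    using C assms(3,4) by algebra
  then show ?thesis unfolding h c_def c'_def .
qed

lemma cring_thick: "cring thick"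
  and thick_minus: "(b, v) \<in> carrier thick \<Longrightarrow> \<ominus>\<^bsub>thick\<^esub> (b, v) = (\<ominus>\<^bsub>\<Omega>\<^esub> b, \<ominus>\<^bsub>V\<^esub> v)"
proof -
  let ?H = "{(b, v). b \<in> carrier \<Omega> \<and> v \<in> carrier V \<and> v \<ominus>\<^bsub>V\<^esub> loc_map \<Omega> M b \<in> J}"
  have H: "?H \<subseteq> carrier \<Omega> \<times> carrier V" by blast
  have one: "(\<one>\<^bsub>\<Omega>\<^esub>, \<one>\<^bsub>V\<^esub>) \<in> ?H"
    using V.diff_eq_zero_iff[OF V.one_closed V.one_closed] J_zero Omega.one_closed by (simp del: Omega_simps)
  have add: "(b \<oplus>\<^bsub>\<Omega>\<^esub> b', v \<oplus>\<^bsub>V\<^esub> v') \<in> ?H" if "(b, v) \<in> ?H" "(b', v') \<in> ?H" for b v b' v'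
    using that thick_add_diff[of b b' v v'] J_add Omega.a_closed[of b b'] by (simp del: Omega_simps)
  have mult: "(b \<otimes>\<^bsub>\<Omega>\<^esub> b', v \<otimes>\<^bsub>V\<^esub> v') \<in> ?H" if "(b, v) \<in> ?H" "(b', v') \<in> ?H" for b v b' v'
    using that thick_mult_diff[of b b' v v'] J_add J_mult_left J_carr Omega.m_closed[of b b'] lm.hom_closed
    by (simp del: Omega_simps)
  have minus: "(\<ominus>\<^bsub>\<Omega>\<^esub> b, \<ominus>\<^bsub>V\<^esub> v) \<in> ?H" if "(b, v) \<in> ?H" for b v
  proof -
    have "(\<ominus>\<^bsub>\<Omega>\<^esub> \<one>\<^bsub>\<Omega>\<^esub>, \<ominus>\<^bsub>V\<^esub> \<one>\<^bsub>V\<^esub>) \<in> ?H"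
      using V.diff_eq_zero_iff[of "\<ominus>\<^bsub>V\<^esub> \<one>\<^bsub>V\<^esub>" "\<ominus>\<^bsub>V\<^esub> \<one>\<^bsub>V\<^esub>"] J_zero by (simp add: lm.hom_a_inv del: Omega_simps)
    from mult[OF this that] that show ?thesis by (simp add: Omega.l_minus V.l_minus del: Omega_simps)
  qed
  show "cring thick" unfolding thick_def
    by (rule cring_subproduct(1)[OF Omega.is_cring V.is_cring H one minus add mult])
  show "(b, v) \<in> carrier thick \<Longrightarrow> \<ominus>\<^bsub>thick\<^esub> (b, v) = (\<ominus>\<^bsub>\<Omega>\<^esub> b, \<ominus>\<^bsub>V\<^esub> v)"
    using cring_subproduct(2)[OF Omega.is_cring V.is_cring H one minus add mult, of b v] unfolding thick_def by simp
qed

text \<open>Evaluation of the family plus evaluation of the correction in \<open>J\<close>. It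
  respects each sum and product of \<open>thick\<close> eventually, which is all that
  \<open>gword_rel_St_transfer\<close> asks for.\<close>

definition dil :: "nat \<times> 'a \<times> 'q \<Rightarrow> (nat \<times> 'q \<Rightarrow> 'b) \<times> ((nat \<times> 'q \<Rightarrow> 'b) \<times> (nat \<times> 'q \<Rightarrow> 'b)) set \<Rightarrow> 'a" where
  "dil p = (\<lambda>(b, v). ev (scl p) (b (pt p)) \<oplus>\<^bsub>T\<^esub> lift p (v \<ominus>\<^bsub>V\<^esub> loc_map \<Omega> M b))"

lemma dil_closed: "a \<in> carrier thick \<Longrightarrow> \<forall>\<^sub>F p in dil_at_top. dil p a \<in> carrier T"
proof -
  assume a: "a \<in> carrier thick"
  obtain b v where bv: "a = (b, v)" by fastforce
  have c: "b \<in> carrier \<Omega>" "v \<ominus>\<^bsub>V\<^esub> loc_map \<Omega> M b \<in> J" using a bv thick_simps(1) by blast+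
  have "b i \<in> carrier P" for i using c(1) unfolding Omega_simps(1) by (rule spec)
  from lift_closed[OF c(2)] eventually_scl show ?thesis unfolding bv dil_def
    by eventually_elim (use \<open>\<And>i. b i \<in> carrier P\<close> in simp)
qed

lemma dil_add_mult:
  assumes "a \<in> carrier thick" "a' \<in> carrier thick"
  shows "\<forall>\<^sub>F p in dil_at_top. dil p (a \<oplus>\<^bsub>thick\<^esub> a') = dil p a \<oplus>\<^bsub>T\<^esub> dil p a'"
    and "\<forall>\<^sub>F p in dil_at_top. dil p (a \<otimes>\<^bsub>thick\<^esub> a') = dil p a \<otimes>\<^bsub>T\<^esub> dil p a'"
proof -
  obtain b v b' v' where bv: "a = (b, v)" "a' = (b', v')" by fastforce
  define j where "j = v \<ominus>\<^bsub>V\<^esub> loc_map \<Omega> M b"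
  define j' where "j' = v' \<ominus>\<^bsub>V\<^esub> loc_map \<Omega> M b'"
  have c: "b \<in> carrier \<Omega>" "b' \<in> carrier \<Omega>" "v \<in> carrier V" "v' \<in> carrier V" and j: "j \<in> J" "j' \<in> J"
    using assms bv thick_simps(1) unfolding j_def j'_def by blast+
  have bP: "b i \<in> carrier P" "b' i \<in> carrier P" for i using c(1)[unfolded Omega_simps(1), rule_format, of i] c(2)[unfolded Omega_simps(1), rule_format, of i] by blast+
  have jj: "j \<otimes>\<^bsub>V\<^esub> j' \<in> J" "loc_map \<Omega> M b \<otimes>\<^bsub>V\<^esub> j' \<in> J" "loc_map \<Omega> M b' \<otimes>\<^bsub>V\<^esub> j \<in> J"
    using J_mult_left[OF j(2) J_carr[OF j(1)]] J_mult_left[OF j(2) lm.hom_closed[OF c(1)]] J_mult_left[OF j(1) lm.hom_closed[OF c(2)]]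
    by blast+
  note closed = lift_closed[OF j(1)] lift_closed[OF j(2)]
  show "\<forall>\<^sub>F p in dil_at_top. dil p (a \<oplus>\<^bsub>thick\<^esub> a') = dil p a \<oplus>\<^bsub>T\<^esub> dil p a'"
    using closed lift_add_mult(1)[OF j] eventually_scl
  proof eventually_elim
    case (elim p)
    interpret ev: ring_hom_ring P T "ev (scl p)"
      using ev_hom[OF elim(4)] by (intro ring_hom_ringI2) (auto intro: P.ring_axioms T.ring_axioms)
    have "dil p (a \<oplus>\<^bsub>thick\<^esub> a') = ev (scl p) (b (pt p) \<oplus>\<^bsub>P\<^esub> b' (pt p)) \<oplus>\<^bsub>T\<^esub> lift p (j \<oplus>\<^bsub>V\<^esub> j')"
      unfolding bv thick_simps dil_def case_prod_conv thick_add_diff[OF c] j_def[symmetric] j'_def[symmetric] by simp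
    also have "\<dots> = dil p a \<oplus>\<^bsub>T\<^esub> dil p a'"
      unfolding bv dil_def case_prod_conv j_def[symmetric] j'_def[symmetric] elim(3)
      using elim(1,2,4) bP by (simp add: T.a_ac)
    finally show ?case .
  qed
  show "\<forall>\<^sub>F p in dil_at_top. dil p (a \<otimes>\<^bsub>thick\<^esub> a') = dil p a \<otimes>\<^bsub>T\<^esub> dil p a'"
    using closed lift_add_mult(2)[OF j] lift_act[OF c(1) j(2)] lift_act[OF c(2) j(1)] lift_add_mult(1)[OF jj(1) J_add[OF jj(2,3)]]
      lift_add_mult(1)[OF jj(2,3)] eventually_scl
  proof eventually_elim
    case (elim p)
    interpret ev: ring_hom_ring P T "ev (scl p)"
      using ev_hom[OF elim(8)] by (intro ring_hom_ringI2) (auto intro: P.ring_axioms T.ring_axioms)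
    have "dil p (a \<otimes>\<^bsub>thick\<^esub> a') = ev (scl p) (b (pt p) \<otimes>\<^bsub>P\<^esub> b' (pt p)) \<oplus>\<^bsub>T\<^esub>
        lift p (j \<otimes>\<^bsub>V\<^esub> j' \<oplus>\<^bsub>V\<^esub> (loc_map \<Omega> M b \<otimes>\<^bsub>V\<^esub> j' \<oplus>\<^bsub>V\<^esub> loc_map \<Omega> M b' \<otimes>\<^bsub>V\<^esub> j))"
      unfolding bv thick_simps dil_def case_prod_conv thick_mult_diff[OF c] j_def[symmetric] j'_def[symmetric] by simp
    also have "\<dots> = dil p a \<otimes>\<^bsub>T\<^esub> dil p a'"
      unfolding bv dil_def case_prod_conv j_def[symmetric] j'_def[symmetric] elim(3-7)
      using elim(1,2,8) bP by (simp add: T.a_ac T.m_ac T.l_distr T.r_distr)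
    finally show ?case .
  qed
qed

text \<open>\<open>St_lift\<close> turns the relation over \<open>Q\<close> into an equality in the
  Steinberg group of \<open>thick\<close>. Its derivation is finite, so it survives evaluation at
  all indices far enough out.\<close>

theorem St_dilation:
  assumes laced: "simply_laced \<Phi> ip N" and Q: "cring Q" and Q': "cring Q'" and iota: "\<iota> \<in> ring_hom Q' Q"
    and rho: "\<rho>0 \<in> ring_hom Q V" "\<rho>1 \<in> ring_hom Q V" and t: "t0 \<in> ring_hom Q' \<Omega>" "t1 \<in> ring_hom Q' \<Omega>"
    and rho_iota: "\<And>f. f \<in> carrier Q' \<Longrightarrow> \<rho>0 (\<iota> f) = loc_map \<Omega> M (t0 f)"
      "\<And>f. f \<in> carrier Q' \<Longrightarrow> \<rho>1 (\<iota> f) = loc_map \<Omega> M (t1 f)"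
    and rho_diff: "\<And>f. f \<in> carrier Q \<Longrightarrow> \<rho>1 f \<ominus>\<^bsub>V\<^esub> \<rho>0 f \<in> J"
    and t_diff: "\<And>f. f \<in> carrier Q' \<Longrightarrow> vanishing (t1 f \<ominus>\<^bsub>\<Omega>\<^esub> t0 f)"
    and w: "w \<in> St_words \<Phi> Q'" and rel: "(map_coef \<iota> w, []) \<in> St_eq \<Phi> N Q"
  shows "\<forall>\<^sub>F p in dil_at_top. (map_coef (\<lambda>f. ev (scl p) (t1 f (pt p))) w, map_coef (\<lambda>f. ev (scl p) (t0 f (pt p))) w) \<in> St_eq \<Phi> N T"
proof -
  interpret simply_laced \<Phi> ip N by fact
  interpret Q: cring Q by fact
  interpret core_action \<Phi> ip N J V Q \<rho>0 \<rho>1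
    by unfold_locales (fact rho rho_diff)+
  \<comment> \<open>Both have first component \<open>t0 f\<close>, so their difference is
    \<open>\<pi>\<close> of an element of \<open>J\<close>; evaluating the second component of
    \<open>\<tau>1\<close> by \<open>dil\<close> nevertheless gives \<open>t1 f\<close>.\<close>
  define \<tau>0 where "\<tau>0 f = (t0 f, loc_map \<Omega> M (t0 f))" for f
  define \<tau>1 where "\<tau>1 f = (t0 f, loc_map \<Omega> M (t1 f))" for f
  define \<pi> where "\<pi> j = (\<zero>\<^bsub>\<Omega>\<^esub>, j)" for j :: "((nat \<times> 'q \<Rightarrow> 'b) \<times> (nat \<times> 'q \<Rightarrow> 'b)) set"
  interpret t0: ring_hom_ring Q' \<Omega> t0 using t(1) Q' by (intro ring_hom_ringI2) (auto intro: Omega.ring_axioms cring.axioms)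
  interpret t1: ring_hom_ring Q' \<Omega> t1 using t(2) Q' by (intro ring_hom_ringI2) (auto intro: Omega.ring_axioms cring.axioms)
  interpret A: cring thick by (rule cring_thick)
  have tJ: "loc_map \<Omega> M (t1 f) \<ominus>\<^bsub>V\<^esub> loc_map \<Omega> M (t0 f) \<in> J" if "f \<in> carrier Q'" for f
    using rho_diff[OF ring_hom_closed[OF iota that]] rho_iota[OF that] by simp
  have zJ: "v \<ominus>\<^bsub>V\<^esub> v \<in> J" if "v \<in> carrier V" for v
    using V.diff_eq_zero_iff[OF that that] J_zero by simp
  have m0: "v \<ominus>\<^bsub>V\<^esub> loc_map \<Omega> M \<zero>\<^bsub>\<Omega>\<^esub> = v" if "v \<in> carrier V" for v
    using that by (simp add: V.minus_eq del: Omega_simps)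
  have tau: "\<tau>0 \<in> ring_hom Q' thick" "\<tau>1 \<in> ring_hom Q' thick"
    by (rule ring_hom_memI; simp add: \<tau>0_def \<tau>1_def tJ zJ del: Omega_simps)+
  have eq: "(map_coef \<tau>1 w, map_coef \<tau>0 w) \<in> St_eq \<Phi> N thick"
  proof (rule St_lift[where \<pi> = \<pi>, OF cring_thick Q' iota tau _ _ _ _ _ w rel])
    fix j assume j: "j \<in> J"
    then show "\<pi> j \<in> carrier thick" using m0 by (simp add: \<pi>_def J_carr del: Omega_simps)
    fix k assume "k \<in> J"
    then show "\<pi> (j \<oplus>\<^bsub>V\<^esub> k) = \<pi> j \<oplus>\<^bsub>thick\<^esub> \<pi> k" "\<pi> (j \<otimes>\<^bsub>V\<^esub> k) = \<pi> j \<otimes>\<^bsub>thick\<^esub> \<pi> k"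
      by (simp_all add: \<pi>_def del: Omega_simps)
  next
    fix f assume f: "f \<in> carrier Q'"
    have c: "\<tau>1 f \<in> carrier thick" "\<tau>0 f \<in> carrier thick" using ring_hom_closed[OF tau(1) f] ring_hom_closed[OF tau(2) f] by auto
    have "\<tau>1 f \<ominus>\<^bsub>thick\<^esub> \<tau>0 f = \<tau>1 f \<oplus>\<^bsub>thick\<^esub> (\<ominus>\<^bsub>\<Omega>\<^esub> t0 f, \<ominus>\<^bsub>V\<^esub> loc_map \<Omega> M (t0 f))"
      unfolding A.minus_eq using thick_minus c(2) by (simp add: \<tau>0_def del: Omega_simps)
    also have "\<dots> = \<pi> (\<rho>1 (\<iota> f) \<ominus>\<^bsub>V\<^esub> \<rho>0 (\<iota> f))"
      using f by (simp add: \<tau>1_def \<pi>_def rho_iota Omega.r_neg V.minus_eq del: Omega_simps)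
    finally show "\<pi> (\<rho>1 (\<iota> f) \<ominus>\<^bsub>V\<^esub> \<rho>0 (\<iota> f)) = \<tau>1 f \<ominus>\<^bsub>thick\<^esub> \<tau>0 f" ..
    fix j assume "j \<in> J"
    then show "\<pi> (\<rho>0 (\<iota> f) \<otimes>\<^bsub>V\<^esub> j) = \<tau>0 f \<otimes>\<^bsub>thick\<^esub> \<pi> j"
      using f by (simp add: \<pi>_def \<tau>0_def rho_iota del: Omega_simps)
  qed
  have ev: "\<forall>\<^sub>F p in dil_at_top. (map_coef (dil p) (map_coef \<tau>1 w), map_coef (dil p) (map_coef \<tau>0 w)) \<in> St_eq \<Phi> N T"
    by (rule gword_rel_St_transfer[OF A.ring_axioms T.ring_axioms N_unit dil_closed dil_add_mult eq])
  have dt: "\<forall>\<^sub>F p in dil_at_top. dil p (t0 f, loc_map \<Omega> M F) = ev (scl p) (F (pt p))"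
    if F: "F \<in> carrier \<Omega>" "vanishing (F \<ominus>\<^bsub>\<Omega>\<^esub> t0 f)" and f: "f \<in> carrier Q'" for F f
  proof -
    have "F \<ominus>\<^bsub>\<Omega>\<^esub> t0 f \<in> carrier \<Omega>" by (rule Omega.minus_closed) (use F f in \<open>simp_all del: Omega_simps\<close>)
    from lift_loc_map[OF this F(2)] eventually_scl show ?thesis
    proof eventually_elim
      case (elim p)
      interpret ev: ring_hom_ring P T "ev (scl p)"
        using ev_hom[OF elim(2)] by (intro ring_hom_ringI2) (auto intro: P.ring_axioms T.ring_axioms)
      have c: "F (pt p) \<in> carrier P" "t0 f (pt p) \<in> carrier P" using F(1) t0.hom_closed[OF f] by simp_all
      have m: "(F \<ominus>\<^bsub>\<Omega>\<^esub> t0 f) (pt p) = F (pt p) \<ominus>\<^bsub>P\<^esub> t0 f (pt p)"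
        using fun_ring_minus(2)[OF P.is_cring, of F "t0 f"] F(1) t0.hom_closed[OF f] unfolding \<Omega>_def by simp
      have "dil p (t0 f, loc_map \<Omega> M F) = ev (scl p) (t0 f (pt p)) \<oplus>\<^bsub>T\<^esub> lift p (loc_map \<Omega> M (F \<ominus>\<^bsub>\<Omega>\<^esub> t0 f))"
        unfolding dil_def case_prod_conv loc.loc_map_minus[OF F(1) t0.hom_closed[OF f]] ..
      also have "\<dots> = ev (scl p) (t0 f (pt p)) \<oplus>\<^bsub>T\<^esub> (ev (scl p) (F (pt p)) \<ominus>\<^bsub>T\<^esub> ev (scl p) (t0 f (pt p)))"
        unfolding elim(1) m using c by (simp add: P.minus_eq T.minus_eq)
      also have "\<dots> = ev (scl p) (F (pt p))" using c elim(2) by (simp add: T.minus_eq T.a_lcomm T.r_neg)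
      finally show ?case .
    qed
  qed
  have v0: "vanishing (t0 f \<ominus>\<^bsub>\<Omega>\<^esub> t0 f)" if f: "f \<in> carrier Q'" for f
    unfolding Omega.diff_eq_zero_iff[THEN iffD2, OF t0.hom_closed[OF f] t0.hom_closed[OF f] HOL.refl]
    by (auto simp: vanishing_def ydvd_def intro!: bexI[of _ "\<zero>\<^bsub>P\<^esub>"])
  have "\<forall>\<^sub>F p in dil_at_top. map_coef (dil p \<circ> \<tau>1) w = map_coef (\<lambda>f. ev (scl p) (t1 f (pt p))) w"
    "\<forall>\<^sub>F p in dil_at_top. map_coef (dil p \<circ> \<tau>0) w = map_coef (\<lambda>f. ev (scl p) (t0 f (pt p))) w"
    by (intro eventually_map_coef_eq[OF w]; simp add: \<tau>0_def \<tau>1_def dt t_diff v0 del: Omega_simps)+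
  with ev show ?thesis
    unfolding map_coef_comp by eventually_elim simp
qed

end

section \<open>Polynomial rings\<close>

lemma cring_UP: "cring A \<Longrightarrow> cring (UP A)"
  by (rule UP_cring.UP_cring) (rule UP_cring.intro)

lemma UP_const_hom: "cring A \<Longrightarrow> (\<lambda>r. monom (UP A) r 0) \<in> ring_hom A (UP A)"
  using UP_ring.const_ring_hom[OF UP_ring.intro, of A] by (simp add: cring.axioms)

lemma
  assumes A: "cring A" and B: "cring B" and h: "h \<in> ring_hom A B" and s: "s \<in> carrier B"
  shows UP_eval_hom: "eval A B h s \<in> ring_hom (UP A) B"
    and UP_eval_const: "r \<in> carrier A \<Longrightarrow> eval A B h s (monom (UP A) r 0) = h r"
    and UP_eval_X: "eval A B h s (monom (UP A) \<one>\<^bsub>A\<^esub> 1) = s"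
proof -
  have "UP_pre_univ_prop A B h" 
    using ring_hom_cringI[OF A B h] A by (simp add: UP_pre_univ_prop_def UP_cring_def)
  from UP_pre_univ_prop.eval_ring_hom[OF this s] UP_pre_univ_prop.eval_const[OF this s] UP_pre_univ_prop.eval_monom1[OF this s]
  show "eval A B h s \<in> ring_hom (UP A) B" "r \<in> carrier A \<Longrightarrow> eval A B h s (monom (UP A) r 0) = h r"
    "eval A B h s (monom (UP A) \<one>\<^bsub>A\<^esub> 1) = s" by blast+
qed

lemma UP_hom_eqI:
  assumes A: "cring A" and B: "cring B" and h: "h \<in> ring_hom (UP A) B" "k \<in> ring_hom (UP A) B"
    and const: "\<And>r. r \<in> carrier A \<Longrightarrow> h (monom (UP A) r 0) = k (monom (UP A) r 0)"
    and X: "h (monom (UP A) \<one>\<^bsub>A\<^esub> 1) = k (monom (UP A) \<one>\<^bsub>A\<^esub> 1)"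
    and p: "p \<in> carrier (UP A)"
  shows "h p = k p"
proof -
  have c: "(\<lambda>r. h (monom (UP A) r 0)) \<in> ring_hom A B"
    using ring_hom_trans[OF UP_const_hom[OF A] h(1)] by (simp add: comp_def)
  have pre: "UP_pre_univ_prop A B (\<lambda>r. h (monom (UP A) r 0))" 
    using ring_hom_cringI[OF A B c] A by (simp add: UP_pre_univ_prop_def UP_cring_def)
  have s: "h (monom (UP A) \<one>\<^bsub>A\<^esub> 1) \<in> carrier B"
    using ring_hom_closed[OF h(1)] UP_ring.monom_closed[OF UP_ring.intro, of A] A by (simp add: cring.axioms ring.ring_simprules)
  show ?thesis
    by (rule UP_pre_univ_prop.UP_hom_unique[OF pre ring_hom_cringI[OF cring_UP[OF A] B h(1)] HOL.refl _ ring_hom_cringI[OF cring_UP[OF A] B h(2)] _ _ p])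
      (use const X s in simp_all)
qed

text \<open>After composition with the projection modulo \<open>I\<close> this is the uniqueness of
  homomorphisms out of a polynomial ring.\<close>

lemma UP_hom_diff_mem:
  assumes A: "cring A" and B: "cring B" and I: "ideal I B" and h: "h \<in> ring_hom (UP A) B" "k \<in> ring_hom (UP A) B"
    and const: "\<And>r. r \<in> carrier A \<Longrightarrow> h (monom (UP A) r 0) = k (monom (UP A) r 0)"
    and X: "h (monom (UP A) \<one>\<^bsub>A\<^esub> 1) \<ominus>\<^bsub>B\<^esub> k (monom (UP A) \<one>\<^bsub>A\<^esub> 1) \<in> I"
    and p: "p \<in> carrier (UP A)"
  shows "h p \<ominus>\<^bsub>B\<^esub> k p \<in> I"
proof -
  interpret I: ideal I B by fact
  have q: "(\<lambda>b. I +>\<^bsub>B\<^esub> b) \<in> ring_hom B (B Quot I)" by (rule I.rcos_ring_hom)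
  have mX: "monom (UP A) \<one>\<^bsub>A\<^esub> 1 \<in> carrier (UP A)"
    using UP_ring.monom_closed[OF UP_ring.intro, of A] A by (simp add: cring.axioms ring.ring_simprules)
  have eq: "I +>\<^bsub>B\<^esub> a = I +>\<^bsub>B\<^esub> b \<longleftrightarrow> a \<ominus>\<^bsub>B\<^esub> b \<in> I" if "a \<in> carrier B" "b \<in> carrier B" for a b
    using I.quotient_eq_iff_same_a_r_cos[OF I.is_ideal] that by simp
  have "((\<lambda>b. I +>\<^bsub>B\<^esub> b) \<circ> h) p = ((\<lambda>b. I +>\<^bsub>B\<^esub> b) \<circ> k) p"
  proof (rule UP_hom_eqI[OF A I.quotient_is_cring[OF B] ring_hom_trans[OF h(1) q] ring_hom_trans[OF h(2) q] _ _ p])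
    show "((\<lambda>b. I +>\<^bsub>B\<^esub> b) \<circ> h) (monom (UP A) \<one>\<^bsub>A\<^esub> 1) = ((\<lambda>b. I +>\<^bsub>B\<^esub> b) \<circ> k) (monom (UP A) \<one>\<^bsub>A\<^esub> 1)"
      using eq[OF ring_hom_closed[OF h(1) mX] ring_hom_closed[OF h(2) mX]] X by simp
  qed (simp add: const)
  then show ?thesis using eq[OF ring_hom_closed[OF h(1) p] ring_hom_closed[OF h(2) p]] by simp
qed

lemma UP_map_hom:
  assumes A: "cring A" and B: "cring B" and g: "g \<in> ring_hom A B"
  shows "(\<lambda>p n. g (coeff (UP A) p n)) \<in> ring_hom (UP A) (UP B)" (is "?G \<in> _")
    and "r \<in> carrier A \<Longrightarrow> (\<lambda>n. g (coeff (UP A) (monom (UP A) r m) n)) = monom (UP B) (g r) m"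
proof -
  interpret A: cring A by fact
  interpret B: cring B by fact
  interpret g: ring_hom_ring A B g using g by (intro ring_hom_ringI2) (auto intro: A.ring_axioms B.ring_axioms)
  interpret UA: UP_ring A "UP A" by (simp add: UP_ring_def A.ring_axioms)
  interpret UB: UP_ring B "UP B" by (simp add: UP_ring_def B.ring_axioms)
  have closed: "?G p \<in> carrier (UP B)" if p: "p \<in> carrier (UP A)" for p
  proof -
    obtain n where "bound \<zero>\<^bsub>A\<^esub> n (coeff (UP A) p)" using p by (auto simp: UP_def)
    then have "bound \<zero>\<^bsub>B\<^esub> n (?G p)" by (auto simp: bound_def)
    then have "?G p \<in> up B" using UA.coeff_closed[OF p] by (blast intro: g.hom_closed)
    then show ?thesis by (simp add: UP_def)
  qed
  have coeff: "coeff (UP B) (?G p) n = g (coeff (UP A) p n)" if "p \<in> carrier (UP A)" for p n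
    using closed[OF that] by (simp add: UP_def)
  show "?G \<in> ring_hom (UP A) (UP B)"
  proof (rule ring_hom_memI)
    fix p q assume p: "p \<in> carrier (UP A)" and q: "q \<in> carrier (UP A)"
    show "?G (p \<otimes>\<^bsub>UP A\<^esub> q) = ?G p \<otimes>\<^bsub>UP B\<^esub> ?G q"
    proof (rule UB.up_eqI)
      fix n
      have "coeff (UP B) (?G (p \<otimes>\<^bsub>UP A\<^esub> q)) n = g (coeff (UP A) (p \<otimes>\<^bsub>UP A\<^esub> q) n)" by (rule coeff) (use p q in simp)
      also have "\<dots> = (\<Oplus>\<^bsub>B\<^esub>i\<in>{..n}. coeff (UP B) (?G p) i \<otimes>\<^bsub>B\<^esub> coeff (UP B) (?G q) (n - i))"
        unfolding coeff[OF p] coeff[OF q] using p q by (simp add: g.hom_finsum Pi_def comp_def)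
      also have "\<dots> = coeff (UP B) (?G p \<otimes>\<^bsub>UP B\<^esub> ?G q) n" by (rule UB.coeff_mult[OF closed[OF p] closed[OF q], symmetric])
      finally show "coeff (UP B) (?G (p \<otimes>\<^bsub>UP A\<^esub> q)) n = coeff (UP B) (?G p \<otimes>\<^bsub>UP B\<^esub> ?G q) n" .
    qed (rule closed UB.UP_mult_closed UA.UP_mult_closed p q)+
    show "?G (p \<oplus>\<^bsub>UP A\<^esub> q) = ?G p \<oplus>\<^bsub>UP B\<^esub> ?G q"
    proof (rule UB.up_eqI)
      fix n
      have "coeff (UP B) (?G (p \<oplus>\<^bsub>UP A\<^esub> q)) n = g (coeff (UP A) (p \<oplus>\<^bsub>UP A\<^esub> q) n)" by (rule coeff) (use p q in simp)
      also have "\<dots> = coeff (UP B) (?G p) n \<oplus>\<^bsub>B\<^esub> coeff (UP B) (?G q) n"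
        unfolding coeff[OF p] coeff[OF q] using p q by simp
      also have "\<dots> = coeff (UP B) (?G p \<oplus>\<^bsub>UP B\<^esub> ?G q) n" by (rule UB.coeff_add[OF closed[OF p] closed[OF q], symmetric])
      finally show "coeff (UP B) (?G (p \<oplus>\<^bsub>UP A\<^esub> q)) n = coeff (UP B) (?G p \<oplus>\<^bsub>UP B\<^esub> ?G q) n" .
    qed (rule closed UB.UP_a_closed UA.UP_a_closed p q)+
  next
    show "?G \<one>\<^bsub>UP A\<^esub> = \<one>\<^bsub>UP B\<^esub>"
    proof (rule UB.up_eqI)
      show "coeff (UP B) (?G \<one>\<^bsub>UP A\<^esub>) n = coeff (UP B) \<one>\<^bsub>UP B\<^esub> n" for n
        unfolding coeff[OF UA.UP_one_closed] by simp
    qed (rule closed UA.UP_one_closed UB.UP_one_closed)+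
  qed (rule closed)
  show "(\<lambda>n. g (coeff (UP A) (monom (UP A) r m) n)) = monom (UP B) (g r) m" if r: "r \<in> carrier A"
  proof (rule UB.up_eqI)
    show "?G (monom (UP A) r m) \<in> carrier (UP B)" by (rule closed) (use r in simp)
    show "coeff (UP B) (?G (monom (UP A) r m)) n = coeff (UP B) (monom (UP B) (g r) m) n" for n
      using r coeff[of "monom (UP A) r m"] by simp
  qed (use r in simp)
qed

lemma UP_X_regular:
  assumes A: "cring A" and g: "g \<in> carrier (UP A)" and z: "monom (UP A) \<one>\<^bsub>A\<^esub> 1 \<otimes>\<^bsub>UP A\<^esub> g = \<zero>\<^bsub>UP A\<^esub>"
  shows "g = \<zero>\<^bsub>UP A\<^esub>"
proof -
  interpret A: cring A by fact
  interpret UA: UP_ring A "UP A" by (simp add: UP_ring_def A.ring_axioms)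
  have "coeff (UP A) g n = \<zero>\<^bsub>A\<^esub>" for n
  proof -
    have "coeff (UP A) (monom (UP A) \<one>\<^bsub>A\<^esub> 1 \<otimes>\<^bsub>UP A\<^esub> g) (Suc n) = (\<Oplus>\<^bsub>A\<^esub>i\<in>{..Suc n}. if 1 = i then coeff (UP A) g (Suc n - i) else \<zero>\<^bsub>A\<^esub>)"
      unfolding UA.coeff_mult[OF UA.monom_closed[OF A.one_closed] g] by (rule A.finsum_cong) (use g in \<open>auto simp: simp_implies_def\<close>)
    also have "\<dots> = coeff (UP A) g n" using g by (subst A.finsum_singleton) auto
    finally show ?thesis unfolding z by simp
  qed
  then show ?thesis using g by (intro UA.up_eqI) simp_all
qed

definition poly_subst :: "('a, 'm) ring_scheme \<Rightarrow> (nat \<Rightarrow> 'a) \<Rightarrow> (nat \<Rightarrow> 'a) \<Rightarrow> nat \<Rightarrow> 'a" where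
  "poly_subst R c = eval R (UP R) (\<lambda>r. monom (UP R) r 0) c"

lemma
  assumes R: "cring R" and c: "c \<in> carrier (UP R)"
  shows poly_subst_hom: "poly_subst R c \<in> ring_hom (UP R) (UP R)"
    and poly_subst_const: "r \<in> carrier R \<Longrightarrow> poly_subst R c (monom (UP R) r 0) = monom (UP R) r 0"
    and poly_subst_X: "poly_subst R c (monom (UP R) \<one>\<^bsub>R\<^esub> 1) = c"
  unfolding poly_subst_def using assms UP_const_hom[OF R] cring_UP[OF R]
  by (blast intro: UP_eval_hom UP_eval_const UP_eval_X)+

lemma (in dilation) ideal_vanishing: "ideal {F \<in> carrier \<Omega>. vanishing F} \<Omega>"
proof (rule idealI)
  show "ring \<Omega>" by (rule Omega.ring_axioms)
  let ?I = "{F \<in> carrier \<Omega>. vanishing F}"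
  have l: "x \<otimes>\<^bsub>\<Omega>\<^esub> F \<in> ?I" if "F \<in> ?I" "x \<in> carrier \<Omega>" for F x
    using that vanishing_mult(1)[of x F] Omega.m_closed[of x F] by (simp del: Omega_simps)
  then show "\<And>a x. a \<in> ?I \<Longrightarrow> x \<in> carrier \<Omega> \<Longrightarrow> x \<otimes>\<^bsub>\<Omega>\<^esub> a \<in> ?I" .
  show "a \<otimes>\<^bsub>\<Omega>\<^esub> x \<in> ?I" if "a \<in> ?I" "x \<in> carrier \<Omega>" for a x
    using that vanishing_mult(2)[of x a] Omega.m_closed[of a x] by (simp del: Omega_simps)
  have neg: "\<ominus>\<^bsub>\<Omega>\<^esub> F \<in> ?I" if "F \<in> ?I" for F
    using l[OF that, of "\<ominus>\<^bsub>\<Omega>\<^esub> \<one>\<^bsub>\<Omega>\<^esub>"] that by (simp add: Omega.l_minus del: Omega_simps)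
  have "\<zero>\<^bsub>\<Omega>\<^esub> \<in> ?I"
    by (auto simp: vanishing_def ydvd_def intro!: bexI[of _ "\<zero>\<^bsub>P\<^esub>"])
  then show "subgroup ?I (add_monoid \<Omega>)"
    using neg vanishing_add Omega.a_closed by (intro Omega.add.subgroupI) (auto simp: a_inv_def simp del: Omega_simps)
qed

text \<open>The setting in which the dilation takes place: y is a second variable over R[t], and it
  is specialised to constants from \<open>S\<close>.\<close>

lemma (in localization) dilation_UP:
  "dilation (UP R) (UP (UP R)) ((\<lambda>r. monom (UP R) r 0) ` S) (\<lambda>a. monom (UP (UP R)) a 0) (eval (UP R) (UP R) id)
     (monom (UP (UP R)) \<one>\<^bsub>UP R\<^esub> 1)"
proof -
  interpret T: cring "UP R" by (rule cring_UP) (rule is_cring)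
  interpret P: cring "UP (UP R)" by (rule cring_UP) (rule T.is_cring)
  interpret UR: UP_ring R "UP R" by (simp add: UP_ring_def ring_axioms)
  interpret UT: UP_ring "UP R" "UP (UP R)" by (simp add: UP_ring_def T.ring_axioms)
  interpret c: ring_hom_ring R "UP R" "\<lambda>r. monom (UP R) r 0"
    using UP_const_hom[OF is_cring] by (intro ring_hom_ringI2) (auto intro: ring_axioms T.ring_axioms)
  have id: "id \<in> ring_hom (UP R) (UP R)" by (simp add: id_ring_hom)
  have S: "(\<lambda>r. monom (UP R) r 0) ` S \<subseteq> carrier (UP R)" by auto
  show ?thesis
  proof (unfold_locales, goal_cases)
    case 1 show ?case by (rule S)
  next
    case 2 show ?case using c.hom_one one_notin by (intro image_eqI[of _ _ \<one>]) (simp_all del: UR.monom_one)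
  next
    case (3 s t)
    then obtain a b where "s = monom (UP R) a 0" "t = monom (UP R) b 0" "a \<in> S" "b \<in> S" by blast
    moreover from this have "s \<otimes>\<^bsub>UP R\<^esub> t = monom (UP R) (a \<otimes> b) 0" using c.hom_mult by simp
    ultimately show ?case using mult_notin by blast
  next
    case 4 show ?case by (rule UP_const_hom) (rule T.is_cring)
  next
    case (5 \<sigma>) then show ?case using S by (intro UP_eval_hom T.is_cring id) blast
  next
    case (6 \<sigma> a) then show ?case using S UP_eval_const[OF T.is_cring T.is_cring id, of \<sigma> a] by auto
  next
    case (7 \<sigma>) then show ?case using S UP_eval_X[OF T.is_cring T.is_cring id, of \<sigma>] by auto
  next
    case 8 show ?case by simp
  next
    case (9 g) then show ?case by (rule UP_X_regular[OF T.is_cring])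
  qed
qed

text \<open>The parameter \<open>q\<close> runs over all pairs (a, b), and the two evaluation points
  are the families a and a + b y^k. A single use of \<open>St_dilation\<close> thus yields one
  \<open>s\<close> for all \<open>a\<close> and \<open>b\<close>.\<close>

theorem (in localization) St_UP_dilation:
  assumes laced: "simply_laced \<Phi> ip N" and w: "w \<in> St_words \<Phi> (UP R)"
    and rel: "(map_coef (loc_poly_map R M) w, []) \<in> St_eq \<Phi> N (UP L)"
  shows "\<exists>s\<in>S. \<forall>a\<in>carrier (UP R). \<forall>b\<in>carrier (UP R).
    (map_coef (poly_subst R (a \<oplus>\<^bsub>UP R\<^esub> b \<otimes>\<^bsub>UP R\<^esub> monom (UP R) s 0)) w, map_coef (poly_subst R a) w) \<in> St_eq \<Phi> N (UP R)"
proof -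
  let ?S' = "(\<lambda>r. monom (UP R) r 0) ` S"
  let ?emb = "\<lambda>a. monom (UP (UP R)) a 0"
  let ?y = "monom (UP (UP R)) \<one>\<^bsub>UP R\<^esub> 1"
  interpret D: dilation "UP R" "UP (UP R)" ?S' ?emb "eval (UP R) (UP R) id" ?y "TYPE((nat \<Rightarrow> 'a) \<times> (nat \<Rightarrow> 'a))"
    by (rule dilation_UP)
  interpret L: cring L by (rule cring_loc_ring)
  interpret UR: UP_ring R "UP R" by (simp add: UP_ring_def ring_axioms)
  interpret UT: UP_ring "UP R" "UP (UP R)" by (simp add: UP_ring_def D.T.ring_axioms)
  interpret UL: UP_ring L "UP L" by (simp add: UP_ring_def L.ring_axioms)
  interpret c: ring_hom_ring R "UP R" "\<lambda>r. monom (UP R) r 0"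
    using UP_const_hom[OF is_cring] by (intro ring_hom_ringI2) (auto intro: ring_axioms D.T.ring_axioms)
  \<comment> \<open>The index type also contains functions that are not polynomials; they are
    replaced by zero so that \<open>X0\<close> and \<open>D1\<close> are families in the
    ring.\<close>
  define pa pb where "pa q = (if fst q \<in> carrier (UP R) then fst q else \<zero>\<^bsub>UP R\<^esub>)"
    and "pb q = (if snd q \<in> carrier (UP R) then snd q else \<zero>\<^bsub>UP R\<^esub>)" for q :: "(nat \<Rightarrow> 'a) \<times> (nat \<Rightarrow> 'a)"
  have pq [simp]: "pa q \<in> carrier (UP R)" "pb q \<in> carrier (UP R)" for q by (simp_all add: pa_def pb_def)
  define X0 where "X0 i = ?emb (pa (snd i))" for i :: "nat \<times> (nat \<Rightarrow> 'a) \<times> (nat \<Rightarrow> 'a)"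
  define D1 where "D1 i = ?emb (pb (snd i)) \<otimes>\<^bsub>UP (UP R)\<^esub> ?y [^]\<^bsub>UP (UP R)\<^esub> fst i" for i :: "nat \<times> (nat \<Rightarrow> 'a) \<times> (nat \<Rightarrow> 'a)"
  define X1 where "X1 = X0 \<oplus>\<^bsub>D.\<Omega>\<^esub> D1"
  define h where "h r = D.cst (monom (UP R) r 0)" for r
  have X: "X0 \<in> carrier D.\<Omega>" "D1 \<in> carrier D.\<Omega>" by (simp_all add: X0_def D1_def)
  then have X1: "X1 \<in> carrier D.\<Omega>" unfolding X1_def by (rule D.Omega.a_closed)
  have D1v: "D.vanishing D1" unfolding D.vanishing_def
  proof
    fix n
    have "D.ydvd k (D1 (k, q))" for k q
      unfolding D.ydvd_def D1_def by (rule bexI[of _ "?emb (pb q)"]) (simp_all add: D.P.m_comm)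
    then show "\<exists>K. \<forall>k\<ge>K. \<forall>q. D.ydvd n (D1 (k, q))" using D.ydvd_mono by blast
  qed
  have cst: "D.cst \<in> ring_hom (UP R) D.\<Omega>"
    using D.emb_hom by (intro ring_hom_memI) (auto simp: fun_eq_iff ring_hom_def)
  have h: "h \<in> ring_hom R D.\<Omega>"
    using ring_hom_trans[OF UP_const_hom[OF is_cring] cst] by (simp add: h_def[abs_def] comp_def)
  have hS: "h s \<in> carrier D.\<Omega> - D.M" if "s \<in> S" for s
    using D.cst_in[of "monom (UP R) s 0"] that unfolding h_def by blast
  \<comment> \<open>Elements outside \<open>M\<close> become constant denominators in
    \<open>V\<close>, so the map from R to \<open>V\<close> extends to the localization.\<close>
  obtain k where k: "k \<in> ring_hom L D.V" "\<And>r. r \<in> carrier R \<Longrightarrow> k (loc_map R M r) = loc_map D.\<Omega> D.M (h r)"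
    using localization_map[OF localization_axioms D.loc.localization_axioms h hS] by blast
  define t0 where "t0 = eval R D.\<Omega> h X0"
  define t1 where "t1 = eval R D.\<Omega> h X1"
  note R' = is_cring and O = D.Omega.is_cring and V' = D.V.is_cring and L' = L.is_cring
  note t0 = UP_eval_hom[OF R' O h X(1), folded t0_def] UP_eval_const[OF R' O h X(1), folded t0_def] UP_eval_X[OF R' O h X(1), folded t0_def]
  note t1 = UP_eval_hom[OF R' O h X1, folded t1_def] UP_eval_const[OF R' O h X1, folded t1_def] UP_eval_X[OF R' O h X1, folded t1_def]
  define \<rho>0 where "\<rho>0 = eval L D.V k (loc_map D.\<Omega> D.M X0)"
  define \<rho>1 where "\<rho>1 = eval L D.V k (loc_map D.\<Omega> D.M X1)"
  note lX = D.loc.loc_map_closed[OF X(1)] D.loc.loc_map_closed[OF X1]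
  note \<rho>0 = UP_eval_hom[OF L' V' k(1) lX(1), folded \<rho>0_def] UP_eval_const[OF L' V' k(1) lX(1), folded \<rho>0_def] UP_eval_X[OF L' V' k(1) lX(1), folded \<rho>0_def]
  note \<rho>1 = UP_eval_hom[OF L' V' k(1) lX(2), folded \<rho>1_def] UP_eval_const[OF L' V' k(1) lX(2), folded \<rho>1_def] UP_eval_X[OF L' V' k(1) lX(2), folded \<rho>1_def]
  have iota: "loc_poly_map R M \<in> ring_hom (UP R) (UP L)"
    "\<And>r m. r \<in> carrier R \<Longrightarrow> loc_poly_map R M (monom (UP R) r m) = monom (UP L) (loc_map R M r) m"
    using UP_map_hom[OF R' L' loc_map_hom] by (simp_all add: loc_poly_map_def[abs_def])
  have l1: "loc_map R M \<one> = \<one>\<^bsub>L\<^esub>" by (simp add: loc_map_def L_one)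
  have X1X0: "X1 \<ominus>\<^bsub>D.\<Omega>\<^esub> X0 = D1"
    unfolding X1_def using X D.Omega.a_ac D.Omega.r_neg
    by (simp add: D.Omega.minus_eq D.Omega.a_assoc del: D.Omega_simps)
  have "\<forall>\<^sub>F p in D.dil_at_top. (map_coef (\<lambda>f. eval (UP R) (UP R) id (D.scl p) (t1 f (D.pt p))) w,
      map_coef (\<lambda>f. eval (UP R) (UP R) id (D.scl p) (t0 f (D.pt p))) w) \<in> St_eq \<Phi> N (UP R)"
  proof (rule D.St_dilation[OF laced cring_UP[OF L'] D.T.is_cring iota(1) \<rho>0(1) \<rho>1(1) t0(1) t1(1) _ _ _ _ w rel])
    fix f assume f: "f \<in> carrier (UP R)"
    show "\<rho>0 (loc_poly_map R M f) = loc_map D.\<Omega> D.M (t0 f)"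
    proof -
      have "(\<rho>0 \<circ> loc_poly_map R M) f = (loc_map D.\<Omega> D.M \<circ> t0) f"
        by (rule UP_hom_eqI[OF R' V' ring_hom_trans[OF iota(1) \<rho>0(1)] ring_hom_trans[OF t0(1) D.loc.loc_map_hom] _ _ f])
          (use \<rho>0(2,3) t0(2,3) in \<open>simp_all add: iota(2) k(2) l1\<close>)
      then show ?thesis by simp
    qed
    show "\<rho>1 (loc_poly_map R M f) = loc_map D.\<Omega> D.M (t1 f)"
    proof -
      have "(\<rho>1 \<circ> loc_poly_map R M) f = (loc_map D.\<Omega> D.M \<circ> t1) f"
        by (rule UP_hom_eqI[OF R' V' ring_hom_trans[OF iota(1) \<rho>1(1)] ring_hom_trans[OF t1(1) D.loc.loc_map_hom] _ _ f])
          (use \<rho>1(2,3) t1(2,3) in \<open>simp_all add: iota(2) k(2) l1\<close>)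
      then show ?thesis by simp
    qed
    have "ideal {F \<in> carrier D.\<Omega>. D.vanishing F} D.\<Omega>"
      by (rule D.ideal_vanishing)
    from UP_hom_diff_mem[OF R' O this t1(1) t0(1) _ _ f] show "D.vanishing (t1 f \<ominus>\<^bsub>D.\<Omega>\<^esub> t0 f)"
      using t0(2,3) t1(2,3) X1X0 X D1v by (simp del: D.Omega_simps)
  next
    fix f assume f: "f \<in> carrier (UP L)"
    show "\<rho>1 f \<ominus>\<^bsub>D.V\<^esub> \<rho>0 f \<in> D.J"
    proof (rule UP_hom_diff_mem[OF L' V' D.ideal_J \<rho>1(1) \<rho>0(1) _ _ f])
      have "loc_map D.\<Omega> D.M D1 \<in> D.J" unfolding D.loc_map_fr by (rule D.J_I[OF X(2) D1v D.S_one])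
      then show "\<rho>1 (monom (UP L) \<one>\<^bsub>L\<^esub> 1) \<ominus>\<^bsub>D.V\<^esub> \<rho>0 (monom (UP L) \<one>\<^bsub>L\<^esub> 1) \<in> D.J"
        unfolding \<rho>1(3) \<rho>0(3) D.loc.loc_map_minus[OF X1 X(1)] X1X0 .
    qed (simp add: \<rho>1(2) \<rho>0(2))
  qed
  then obtain K u where u: "u \<in> ?S'" and rel': "\<And>s q. s \<in> ?S' \<Longrightarrow>
      (map_coef (\<lambda>f. eval (UP R) (UP R) id (u \<otimes>\<^bsub>UP R\<^esub> s) (t1 f (K, q))) w,
       map_coef (\<lambda>f. eval (UP R) (UP R) id (u \<otimes>\<^bsub>UP R\<^esub> s) (t0 f (K, q))) w) \<in> St_eq \<Phi> N (UP R)"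
    unfolding D.eventually_dil_at_top by fastforce
  obtain r where r: "r \<in> S" "u = monom (UP R) r 0" using u by blast
  \<comment> \<open>The value of y^K at y = r. Of the multiples of \<open>u\<close> that may be
    substituted for y, \<open>u\<close> itself is taken.\<close>
  define s where "s = r [^] K"
  have s: "s \<in> S" unfolding s_def using one_notin mult_notin r(1) by (induction K) auto
  interpret ev: ring_hom_ring "UP (UP R)" "UP R" "eval (UP R) (UP R) id u"
    using D.ev_hom[OF u] by (intro ring_hom_ringI2) (auto intro: D.P.ring_axioms D.T.ring_axioms)
  have uK: "u [^]\<^bsub>UP R\<^esub> K = monom (UP R) s 0"
    unfolding r(2) s_def using r(1) by (induction K) (auto simp: c.hom_mult simp flip: c.hom_one)
  have sub: "eval (UP R) (UP R) id u (t f (K, q)) = poly_subst R (eval (UP R) (UP R) id u (x (K, q))) f"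
    if t: "t \<in> ring_hom (UP R) D.\<Omega>" "\<And>r. r \<in> carrier R \<Longrightarrow> t (monom (UP R) r 0) = h r" "t (monom (UP R) \<one> 1) = x"
      and x: "x \<in> carrier D.\<Omega>" and f: "f \<in> carrier (UP R)" for t x f q
  proof -
    have pr: "(\<lambda>F. F (K, q)) \<in> ring_hom D.\<Omega> (UP (UP R))" by (rule ring_hom_memI) (simp_all del: split_paired_All)
    have xc: "x (K, q) \<in> carrier (UP (UP R))" using x by (simp del: split_paired_All)
    have "(eval (UP R) (UP R) id u \<circ> ((\<lambda>F. F (K, q)) \<circ> t)) f = poly_subst R (eval (UP R) (UP R) id u (x (K, q))) f"
      by (rule UP_hom_eqI[OF R' D.T.is_cring ring_hom_trans[OF ring_hom_trans[OF t(1) pr] D.ev_hom[OF u]] poly_subst_hom[OF R' ev.hom_closed[OF xc]] _ _ f])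
        (use t(2,3) D.ev_emb[OF u] poly_subst_const[OF R' ev.hom_closed[OF xc]] poly_subst_X[OF R' ev.hom_closed[OF xc]] in \<open>simp_all add: h_def\<close>)
    then show ?thesis by simp
  qed
  have cong: "map_coef g w = map_coef g' w" if "\<And>f. f \<in> carrier (UP R) \<Longrightarrow> g f = g' f" for g g' :: "(nat \<Rightarrow> 'a) \<Rightarrow> nat \<Rightarrow> 'a"
    using w that by (induction w) (auto simp: steinberg_gens_iff)
  show ?thesis
  proof (intro bexI[OF _ s] ballI)
    fix a b assume ab: "a \<in> carrier (UP R)" "b \<in> carrier (UP R)"
    have "eval (UP R) (UP R) id u (X0 (K, a, b)) = a"
      using ab D.ev_emb[OF u] by (simp add: X0_def pa_def)
    moreover have "eval (UP R) (UP R) id u (X1 (K, a, b)) = a \<oplus>\<^bsub>UP R\<^esub> b \<otimes>\<^bsub>UP R\<^esub> monom (UP R) s 0"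
      using ab D.ev_emb[OF u] D.ev_y[OF u] uK by (simp add: X1_def X0_def D1_def pa_def pb_def ev.hom_nat_pow)
    moreover have "u \<otimes>\<^bsub>UP R\<^esub> \<one>\<^bsub>UP R\<^esub> = u" using u by auto
    ultimately show "(map_coef (poly_subst R (a \<oplus>\<^bsub>UP R\<^esub> b \<otimes>\<^bsub>UP R\<^esub> monom (UP R) s 0)) w, map_coef (poly_subst R a) w) \<in> St_eq \<Phi> N (UP R)"
      using rel'[OF D.S_one, of "(a, b)"] cong[OF sub[OF t0 X(1), of _ "(a, b)"]] cong[OF sub[OF t1 X1, of _ "(a, b)"]] by simp
  qed
qed

section \<open>Gluing over the maximal ideals\<close>

lemma (in cring) ideal_Union_chain:
  assumes "C \<noteq> {}" and "\<And>I. I \<in> C \<Longrightarrow> ideal I R" and chain: "\<And>I I'. \<lbrakk>I \<in> C; I' \<in> C\<rbrakk> \<Longrightarrow> I \<subseteq> I' \<or> I' \<subseteq> I"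
  shows "ideal (\<Union>C) R"
proof (rule idealI)
  show "ring R" by (rule ring_axioms)
  have zero: "\<zero> \<in> I" and minus: "a \<in> I \<Longrightarrow> \<ominus> a \<in> I" and add: "\<lbrakk>a \<in> I; b \<in> I\<rbrakk> \<Longrightarrow> a \<oplus> b \<in> I"
    and carr: "a \<in> I \<Longrightarrow> a \<in> carrier R"
    and mult: "\<lbrakk>a \<in> I; x \<in> carrier R\<rbrakk> \<Longrightarrow> x \<otimes> a \<in> I" "\<lbrakk>a \<in> I; x \<in> carrier R\<rbrakk> \<Longrightarrow> a \<otimes> x \<in> I"
    if "I \<in> C" for I a b x
  proof -
    interpret I: ideal I R by (rule assms(2)) fact
    show "\<zero> \<in> I" "a \<in> I \<Longrightarrow> \<ominus> a \<in> I" "\<lbrakk>a \<in> I; b \<in> I\<rbrakk> \<Longrightarrow> a \<oplus> b \<in> I" "a \<in> I \<Longrightarrow> a \<in> carrier R"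
      "\<lbrakk>a \<in> I; x \<in> carrier R\<rbrakk> \<Longrightarrow> x \<otimes> a \<in> I" "\<lbrakk>a \<in> I; x \<in> carrier R\<rbrakk> \<Longrightarrow> a \<otimes> x \<in> I"
      by (simp_all add: I.I_l_closed I.I_r_closed I.a_inv_closed)
  qed
  show "subgroup (\<Union>C) (add_monoid R)"
  proof (rule add.subgroupI)
    show "\<Union>C \<subseteq> carrier R" using carr by blast
    show "\<Union>C \<noteq> {}" using assms(1) zero by blast
    show "\<ominus> a \<in> \<Union>C" if "a \<in> \<Union>C" for a using that minus by blast
    show "a \<oplus> b \<in> \<Union>C" if ab: "a \<in> \<Union>C" "b \<in> \<Union>C" for a b
    proof -
      obtain I I' where I: "I \<in> C" "a \<in> I" "I' \<in> C" "b \<in> I'" using ab by blast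
      then consider "I \<subseteq> I'" | "I' \<subseteq> I" using chain by blast
      then show ?thesis using I add[of I] add[of I'] by cases blast+
    qed
  qed
  show "x \<otimes> a \<in> \<Union>C" "a \<otimes> x \<in> \<Union>C" if "a \<in> \<Union>C" "x \<in> carrier R" for a x
    using that mult by blast+
qed

lemma (in cring) ex_maximalideal:
  assumes I: "ideal I R" and "\<one> \<notin> I"
  shows "\<exists>M. maximalideal M R \<and> I \<subseteq> M"
proof -
  let ?A = "{K. ideal K R \<and> I \<subseteq> K \<and> \<one> \<notin> K}"
  have "\<exists>M\<in>?A. \<forall>X\<in>?A. M \<subseteq> X \<longrightarrow> X = M"
  proof (rule subset_Zorn_nonempty)
    show "?A \<noteq> {}" using assms by blast
    fix C assume C: "C \<noteq> {}" "subset.chain ?A C"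
    then have "ideal (\<Union>C) R" by (intro ideal_Union_chain) (auto simp: subset_chain_def)
    then show "\<Union>C \<in> ?A" using C by (auto simp: subset_chain_def)
  qed
  then obtain M where M: "ideal M R" "I \<subseteq> M" "\<one> \<notin> M" "\<And>X. \<lbrakk>ideal X R; M \<subseteq> X; \<one> \<notin> X\<rbrakk> \<Longrightarrow> X = M"
    by (smt (verit, best) mem_Collect_eq subset_trans)
  have "maximalideal M R"
  proof (rule maximalidealI)
    show "carrier R \<noteq> M" using M(3) by blast
    fix X assume "ideal X R" "M \<subseteq> X" "X \<subseteq> carrier R"
    then show "X = M \<or> X = carrier R" using M(4) ideal.one_imp_carrier by blast
  qed (rule M(1))
  then show ?thesis using M(2) by blast
qed

lemma (in cring) localization_maximalideal:
  assumes "maximalideal M R" shows "localization R M"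
proof -
  interpret primeideal M R by (rule maximalideal_prime) fact
  show ?thesis using I_prime I_notcarr one_imp_carrier by unfold_locales auto
qed

lemma map_coef_id: "map_coef id w = w"
  by (induction w) (auto simp: map_coef_def)

lemma map_coef_cong:
  assumes "w \<in> St_words \<Phi> A" "\<And>f. f \<in> carrier A \<Longrightarrow> g f = h f"
  shows "map_coef g w = map_coef h w"
  using assms by (induction w) (auto simp: steinberg_gens_iff)

theorem St_local_global:
  assumes laced: "simply_laced \<Phi> ip N" and R: "cring R" and w: "w \<in> St_words \<Phi> (UP R)"
    and local: "\<And>M. maximalideal M R \<Longrightarrow> (map_coef (loc_poly_map R M) w, []) \<in> St_eq \<Phi> N (UP (loc_ring R M))"
  shows "(w, map_coef (poly_subst R \<zero>\<^bsub>UP R\<^esub>) w) \<in> St_eq \<Phi> N (UP R)"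
proof -
  interpret R: cring R by fact
  interpret T: cring "UP R" by (rule cring_UP) fact
  interpret UR: UP_ring R "UP R" by (simp add: UP_ring_def R.ring_axioms)
  interpret c: ring_hom_ring R "UP R" "\<lambda>r. monom (UP R) r 0"
    using UP_const_hom[OF R] by (intro ring_hom_ringI2) (auto intro: R.ring_axioms T.ring_axioms)
  let ?w = "\<lambda>a. map_coef (poly_subst R a) w"
  let ?c = "\<lambda>r. monom (UP R) r 0"
  \<comment> \<open>The quantification over all \<open>a\<close> and \<open>b\<close> makes this an
    ideal: for a sum, \<open>a + b s\<close> takes the place of \<open>a\<close>; for a multiple r
    s, the factor r is absorbed into \<open>b\<close>.\<close>
  define Q where "Q = {s \<in> carrier R. \<forall>a\<in>carrier (UP R). \<forall>b\<in>carrier (UP R). (?w (a \<oplus>\<^bsub>UP R\<^esub> b \<otimes>\<^bsub>UP R\<^esub> ?c s), ?w a) \<in> St_eq \<Phi> N (UP R)}"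
  have words: "?w a \<in> St_words \<Phi> (UP R)" if "a \<in> carrier (UP R)" for a
    by (rule map_coef_words[OF w]) (use poly_subst_hom[OF R that] in \<open>auto simp: ring_hom_def\<close>)
  have mult: "r \<otimes>\<^bsub>R\<^esub> s \<in> Q" if s: "s \<in> Q" and r: "r \<in> carrier R" for r s
  proof -
    have e: "b \<otimes>\<^bsub>UP R\<^esub> ?c (r \<otimes>\<^bsub>R\<^esub> s) = (b \<otimes>\<^bsub>UP R\<^esub> ?c r) \<otimes>\<^bsub>UP R\<^esub> ?c s" if "b \<in> carrier (UP R)" for b
      using that s r by (simp add: Q_def c.hom_mult T.m_assoc)
    show ?thesis using s r unfolding Q_def by (auto simp: e simp del: c.hom_mult)
  qed
  have Q: "ideal Q R"
  proof (rule idealI)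
    show "ring R" by (rule R.ring_axioms)
    show "r \<otimes>\<^bsub>R\<^esub> s \<in> Q" if "s \<in> Q" "r \<in> carrier R" for r s by (rule mult) fact+
    then show "s \<otimes>\<^bsub>R\<^esub> r \<in> Q" if "s \<in> Q" "r \<in> carrier R" for r s
      using that R.m_comm[of s r] by (simp add: Q_def)
    show "subgroup Q (add_monoid R)"
    proof (rule R.add.subgroupI)
      show "Q \<subseteq> carrier R" by (auto simp: Q_def)
      have "\<zero>\<^bsub>R\<^esub> \<in> Q" using words by (auto simp: Q_def intro: gword_rel.refl)
      then show "Q \<noteq> {}" by blast
      show "\<ominus>\<^bsub>R\<^esub> s \<in> Q" if "s \<in> Q" for s
        using mult[OF that, of "\<ominus>\<^bsub>R\<^esub> \<one>\<^bsub>R\<^esub>"] that by (simp add: R.l_minus Q_def)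
      show "s \<oplus>\<^bsub>R\<^esub> t \<in> Q" if s: "s \<in> Q" and t: "t \<in> Q" for s t
      proof -
        have c: "s \<in> carrier R" "t \<in> carrier R" using s t by (auto simp: Q_def)
        have "(?w (a \<oplus>\<^bsub>UP R\<^esub> b \<otimes>\<^bsub>UP R\<^esub> ?c (s \<oplus>\<^bsub>R\<^esub> t)), ?w a) \<in> St_eq \<Phi> N (UP R)"
          if ab: "a \<in> carrier (UP R)" "b \<in> carrier (UP R)" for a b
        proof -
          have e: "a \<oplus>\<^bsub>UP R\<^esub> b \<otimes>\<^bsub>UP R\<^esub> ?c (s \<oplus>\<^bsub>R\<^esub> t) = (a \<oplus>\<^bsub>UP R\<^esub> b \<otimes>\<^bsub>UP R\<^esub> ?c s) \<oplus>\<^bsub>UP R\<^esub> b \<otimes>\<^bsub>UP R\<^esub> ?c t"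
            using ab c by (simp add: T.r_distr T.a_assoc)
          have "a \<oplus>\<^bsub>UP R\<^esub> b \<otimes>\<^bsub>UP R\<^esub> ?c s \<in> carrier (UP R)" using ab c by simp
          then have "(?w ((a \<oplus>\<^bsub>UP R\<^esub> b \<otimes>\<^bsub>UP R\<^esub> ?c s) \<oplus>\<^bsub>UP R\<^esub> b \<otimes>\<^bsub>UP R\<^esub> ?c t), ?w (a \<oplus>\<^bsub>UP R\<^esub> b \<otimes>\<^bsub>UP R\<^esub> ?c s)) \<in> St_eq \<Phi> N (UP R)"
            using t ab(2) unfolding Q_def by blast
          moreover have "(?w (a \<oplus>\<^bsub>UP R\<^esub> b \<otimes>\<^bsub>UP R\<^esub> ?c s), ?w a) \<in> St_eq \<Phi> N (UP R)" using s ab unfolding Q_def by blast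
          ultimately show ?thesis unfolding e by (rule gword_rel.trans)
        qed
        then show ?thesis using c by (simp add: Q_def del: c.hom_add UR.monom_add)
      qed
    qed
  qed
  have "\<one>\<^bsub>R\<^esub> \<in> Q"
  proof (rule ccontr)
    assume "\<one>\<^bsub>R\<^esub> \<notin> Q"
    then obtain M where M: "maximalideal M R" "Q \<subseteq> M" using R.ex_maximalideal[OF Q] by blast
    interpret localization R M using M(1) by (rule R.localization_maximalideal)
    obtain s where "s \<in> carrier R - M" "s \<in> Q"
      using St_UP_dilation[OF laced w local[OF M(1)]] unfolding Q_def by blast
    then show False using M(2) by blast
  qed
  have X: "monom (UP R) \<one>\<^bsub>R\<^esub> 1 \<in> carrier (UP R)" by simp
  \<comment> \<open>The substitution a = 0, b = t, s = 1 compares the word with its value at t =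
    0.\<close>
  have "(?w (\<zero>\<^bsub>UP R\<^esub> \<oplus>\<^bsub>UP R\<^esub> monom (UP R) \<one>\<^bsub>R\<^esub> 1 \<otimes>\<^bsub>UP R\<^esub> ?c \<one>\<^bsub>R\<^esub>), ?w \<zero>\<^bsub>UP R\<^esub>) \<in> St_eq \<Phi> N (UP R)"
    using \<open>\<one>\<^bsub>R\<^esub> \<in> Q\<close> X unfolding Q_def by blast
  moreover have "\<zero>\<^bsub>UP R\<^esub> \<oplus>\<^bsub>UP R\<^esub> monom (UP R) \<one>\<^bsub>R\<^esub> 1 \<otimes>\<^bsub>UP R\<^esub> ?c \<one>\<^bsub>R\<^esub> = monom (UP R) \<one>\<^bsub>R\<^esub> 1"
    unfolding c.hom_one using X by simp
  moreover have "?w (monom (UP R) \<one>\<^bsub>R\<^esub> 1) = w"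
  proof -
    have "poly_subst R (monom (UP R) \<one>\<^bsub>R\<^esub> 1) f = id f" if "f \<in> carrier (UP R)" for f
      by (rule UP_hom_eqI[OF R T.is_cring poly_subst_hom[OF R X] id_ring_hom _ _ that])
        (simp_all only: poly_subst_const[OF R X] poly_subst_X[OF R X] id_apply)
    then have "?w (monom (UP R) \<one>\<^bsub>R\<^esub> 1) = map_coef id w" by (rule map_coef_cong[OF w])
    then show ?thesis by (simp only: map_coef_id)
  qed
  ultimately show ?thesis by simp
qed

section \<open>Relative Steinberg groups\<close>

lemma (in group) hom_eq_on_generate:
  assumes Q: "group Q" and h: "h \<in> hom G Q" "k \<in> hom G Q" and X: "X \<subseteq> carrier G" "\<And>x. x \<in> X \<Longrightarrow> h x = k x"
    and g: "g \<in> generate G X"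
  shows "h g = k g"
  using g
proof (induction rule: generate.induct)
  case one
  then show ?case using hom_one[OF h(1) group_axioms Q] hom_one[OF h(2) group_axioms Q] by simp
next
  case (incl x)
  then show ?case by (rule X(2))
next
  case (inv x)
  interpret h: group_hom G Q h using h Q group_axioms by (simp add: group_hom_def group_hom_axioms_def)
  interpret k: group_hom G Q k using h Q group_axioms by (simp add: group_hom_def group_hom_axioms_def)
  show ?case using inv X by (simp add: subsetD)
next
  case (eng x y)
  then show ?case using generate_in_carrier[OF X(1)] hom_mult[OF h(1)] hom_mult[OF h(2)] by simp
qed

lemma (in group) r_coset_eq_subgroup_iff:
  assumes "subgroup H G" "x \<in> carrier G" shows "H #> x = H \<longleftrightarrow> x \<in> H"
  using rcos_self[OF assms(2,1)] coset_join2[OF assms(2,1)] by auto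

lemma (in group) mixed_commutator_normal:
  assumes "H \<lhd> G" "K \<lhd> G"
  shows "mixed_commutator G H K \<lhd> G"
  unfolding mixed_commutator_def
proof (rule normal_generateI)
  interpret H: normal H G by fact
  interpret K: normal K G by fact
  show "{h \<otimes> k \<otimes> inv h \<otimes> inv k | h k. h \<in> H \<and> k \<in> K} \<subseteq> carrier G" by auto
  fix c g assume "c \<in> {h \<otimes> k \<otimes> inv h \<otimes> inv k | h k. h \<in> H \<and> k \<in> K}" and g: "g \<in> carrier G"
  then obtain h k where c: "c = h \<otimes> k \<otimes> inv h \<otimes> inv k" "h \<in> H" "k \<in> K" by blast
  define h' k' where "h' = g \<otimes> h \<otimes> inv g" and "k' = g \<otimes> k \<otimes> inv g"
  have hk: "h' \<in> H" "k' \<in> K" unfolding h'_def k'_def using c g H.inv_op_closed2 K.inv_op_closed2 by blast+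
  have cl: "h \<in> carrier G" "k \<in> carrier G" using c by auto
  have cancel: "inv g \<otimes> (g \<otimes> x) = x" if "x \<in> carrier G" for x using that g by (simp flip: m_assoc)
  have "g \<otimes> c \<otimes> inv g = h' \<otimes> k' \<otimes> inv h' \<otimes> inv k'"
    unfolding c(1) h'_def k'_def using cl g by (simp add: m_assoc inv_mult_group cancel)
  then show "g \<otimes> c \<otimes> inv g \<in> {h \<otimes> k \<otimes> inv h \<otimes> inv k | h k. h \<in> H \<and> k \<in> K}" using hk by blast
qed

lemma mixed_commutator_subset:
  assumes G: "group G" and H: "H \<lhd> G" and K: "K \<lhd> G"
  shows "mixed_commutator G H K \<subseteq> H \<inter> K"
proof -
  interpret group G by fact
  interpret H: normal H G by fact
  interpret K: normal K G by fact
  have "{h \<otimes>\<^bsub>G\<^esub> k \<otimes>\<^bsub>G\<^esub> inv\<^bsub>G\<^esub> h \<otimes>\<^bsub>G\<^esub> inv\<^bsub>G\<^esub> k | h k. h \<in> H \<and> k \<in> K} \<subseteq> H \<inter> K"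
  proof safe
    fix h k assume hk: "h \<in> H" "k \<in> K"
    have "h \<otimes>\<^bsub>G\<^esub> (k \<otimes>\<^bsub>G\<^esub> inv\<^bsub>G\<^esub> h \<otimes>\<^bsub>G\<^esub> inv\<^bsub>G\<^esub> k) \<in> H" using hk H.inv_op_closed2[of k "inv\<^bsub>G\<^esub> h"] by simp
    then show "h \<otimes>\<^bsub>G\<^esub> k \<otimes>\<^bsub>G\<^esub> inv\<^bsub>G\<^esub> h \<otimes>\<^bsub>G\<^esub> inv\<^bsub>G\<^esub> k \<in> H" using hk by (simp add: m_assoc)
    show "h \<otimes>\<^bsub>G\<^esub> k \<otimes>\<^bsub>G\<^esub> inv\<^bsub>G\<^esub> h \<otimes>\<^bsub>G\<^esub> inv\<^bsub>G\<^esub> k \<in> K" using hk K.inv_op_closed2[of h k] by simp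
  qed
  moreover have "subgroup (H \<inter> K) G" by (rule subgroups_Inter_pair) (rule H.subgroup_axioms K.subgroup_axioms)+
  ultimately show ?thesis unfolding mixed_commutator_def by (rule generate_subgroup_incl)
qed

text \<open>
  Modulo the commutator subgroup \<open>g \<mapsto> s1 (p2 g) (s0 (p2 g))\<inverse> s2 (p1 g)\<close> is a homomorphism, since
  the kernels commute there.
\<close>

lemma kernels_mixed_commutator:
  assumes G: "group G" and A: "group A" and p: "p1 \<in> hom G A" "p2 \<in> hom G A" and s: "s0 \<in> hom A G" "s1 \<in> hom A G" "s2 \<in> hom A G"
    and ps: "\<And>a. a \<in> carrier A \<Longrightarrow> p1 (s1 a) = p1 (s0 a)" "\<And>a. a \<in> carrier A \<Longrightarrow> p2 (s2 a) = p2 (s0 a)"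
    and X: "X \<subseteq> carrier G" "carrier G = generate G X"
    and sp: "\<And>x. x \<in> X \<Longrightarrow> s0 (p1 x) = s0 (p2 x)"
      "\<And>x. x \<in> X \<Longrightarrow> s1 (p2 x) \<otimes>\<^bsub>G\<^esub> inv\<^bsub>G\<^esub> s0 (p2 x) \<otimes>\<^bsub>G\<^esub> s2 (p1 x) = x"
    and g: "g \<in> carrier G" "p1 g = \<one>\<^bsub>A\<^esub>" "p2 g = \<one>\<^bsub>A\<^esub>"
  shows "g \<in> mixed_commutator G (kernel G A p1) (kernel G A p2)"
proof -
  interpret group G by fact
  interpret p1: group_hom G A p1 using G A p by (simp add: group_hom_def group_hom_axioms_def)
  interpret p2: group_hom G A p2 using G A p by (simp add: group_hom_def group_hom_axioms_def)
  interpret s0: group_hom A G s0 using G A s by (simp add: group_hom_def group_hom_axioms_def)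
  interpret s1: group_hom A G s1 using G A s by (simp add: group_hom_def group_hom_axioms_def)
  interpret s2: group_hom A G s2 using G A s by (simp add: group_hom_def group_hom_axioms_def)
  define C where "C = mixed_commutator G (kernel G A p1) (kernel G A p2)"
  interpret C: normal C G unfolding C_def by (rule mixed_commutator_normal[OF p1.normal_kernel p2.normal_kernel])
  define Q where "Q = G Mod C"
  define \<pi> where "\<pi> x = C #>\<^bsub>G\<^esub> x" for x
  interpret Q: group Q unfolding Q_def by (rule C.factorgroup_is_group)
  have \<pi>: "\<pi> \<in> hom G Q" using C.r_coset_hom_Mod unfolding Q_def \<pi>_def[abs_def] .
  interpret \<pi>: group_hom G Q \<pi> using \<pi> by unfold_locales
  have one: "\<pi> x = \<one>\<^bsub>Q\<^esub> \<longleftrightarrow> x \<in> C" if "x \<in> carrier G" for x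
    unfolding Q_def \<pi>_def one_FactGroup by (rule r_coset_eq_subgroup_iff[OF C.subgroup_axioms that])
  \<comment> \<open>Both sides are homomorphisms, and they agree on the generators
    \<open>X\<close>.\<close>
  have sp0: "s0 (p1 x) = s0 (p2 x)" if "x \<in> carrier G" for x
  proof (rule hom_eq_on_generate[OF G _ _ X(1) sp(1)])
    show "(\<lambda>x. s0 (p1 x)) \<in> hom G G" "(\<lambda>x. s0 (p2 x)) \<in> hom G G" by (rule homI; simp)+
    show "x \<in> generate G X" using that unfolding X(2) .
  qed
  have comm: "\<pi> k \<otimes>\<^bsub>Q\<^esub> \<pi> l = \<pi> l \<otimes>\<^bsub>Q\<^esub> \<pi> k" if k: "k \<in> kernel G A p1" and l: "l \<in> kernel G A p2" for k l
  proof -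
    have c: "k \<in> carrier G" "l \<in> carrier G" using k l by (auto simp: kernel_def)
    have "k \<otimes>\<^bsub>G\<^esub> l \<otimes>\<^bsub>G\<^esub> inv\<^bsub>G\<^esub> k \<otimes>\<^bsub>G\<^esub> inv\<^bsub>G\<^esub> l \<in> C"
      unfolding C_def mixed_commutator_def using k l by (blast intro: generate.incl)
    then have "\<pi> (k \<otimes>\<^bsub>G\<^esub> l \<otimes>\<^bsub>G\<^esub> inv\<^bsub>G\<^esub> k \<otimes>\<^bsub>G\<^esub> inv\<^bsub>G\<^esub> l) = \<one>\<^bsub>Q\<^esub>"
      by (rule one[THEN iffD2, rotated]) (use c in simp)
    then have "(\<pi> k \<otimes>\<^bsub>Q\<^esub> \<pi> l) \<otimes>\<^bsub>Q\<^esub> inv\<^bsub>Q\<^esub> (\<pi> l \<otimes>\<^bsub>Q\<^esub> \<pi> k) = \<one>\<^bsub>Q\<^esub>" using c by (simp add: Q.m_assoc Q.inv_mult_group)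
    then show ?thesis using c by (simp add: Q.inv_solve_right'[of _ _ "\<pi> l \<otimes>\<^bsub>Q\<^esub> \<pi> k"])
  qed
  define \<theta> where "\<theta> x = \<pi> (s1 (p2 x)) \<otimes>\<^bsub>Q\<^esub> inv\<^bsub>Q\<^esub> \<pi> (s0 (p2 x)) \<otimes>\<^bsub>Q\<^esub> \<pi> (s2 (p1 x))" for x
  have "\<theta> \<in> hom G Q"
  proof (rule homI)
    fix x z assume xz: "x \<in> carrier G" "z \<in> carrier G"
    define a b c a' b' c' where d: "a = \<pi> (s1 (p2 x))" "b = \<pi> (s0 (p2 x))" "c = \<pi> (s2 (p1 x))"
      "a' = \<pi> (s1 (p2 z))" "b' = \<pi> (s0 (p2 z))" "c' = \<pi> (s2 (p1 z))"
    have cl: "a \<in> carrier Q" "b \<in> carrier Q" "c \<in> carrier Q" "a' \<in> carrier Q" "b' \<in> carrier Q" "c' \<in> carrier Q"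
      using xz by (simp_all add: d)
    \<comment> \<open>To multiply two values of \<open>\<theta>\<close>, the first two factors of
      the second value must pass the last two factors of the first. They lie in the kernels of
      \<open>p1\<close> and \<open>p2\<close>, so they commute modulo \<open>C\<close>.\<close>
    have "s1 (p2 z) \<otimes>\<^bsub>G\<^esub> inv\<^bsub>G\<^esub> s0 (p2 z) \<in> kernel G A p1" using xz by (simp add: kernel_def ps)
    moreover have "inv\<^bsub>G\<^esub> s0 (p1 x) \<otimes>\<^bsub>G\<^esub> s2 (p1 x) \<in> kernel G A p2" using xz by (simp add: kernel_def ps)
    ultimately have "(a' \<otimes>\<^bsub>Q\<^esub> inv\<^bsub>Q\<^esub> b') \<otimes>\<^bsub>Q\<^esub> (inv\<^bsub>Q\<^esub> b \<otimes>\<^bsub>Q\<^esub> c) = (inv\<^bsub>Q\<^esub> b \<otimes>\<^bsub>Q\<^esub> c) \<otimes>\<^bsub>Q\<^esub> (a' \<otimes>\<^bsub>Q\<^esub> inv\<^bsub>Q\<^esub> b')"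
      using comm[of "s1 (p2 z) \<otimes>\<^bsub>G\<^esub> inv\<^bsub>G\<^esub> s0 (p2 z)" "inv\<^bsub>G\<^esub> s0 (p1 x) \<otimes>\<^bsub>G\<^esub> s2 (p1 x)"] xz by (simp add: d sp0)
    note e = this
    have "\<theta> (x \<otimes>\<^bsub>G\<^esub> z) = a \<otimes>\<^bsub>Q\<^esub> ((a' \<otimes>\<^bsub>Q\<^esub> inv\<^bsub>Q\<^esub> b') \<otimes>\<^bsub>Q\<^esub> (inv\<^bsub>Q\<^esub> b \<otimes>\<^bsub>Q\<^esub> c)) \<otimes>\<^bsub>Q\<^esub> c'"
      using xz by (simp add: \<theta>_def d Q.inv_mult_group Q.m_assoc)
    also have "\<dots> = \<theta> x \<otimes>\<^bsub>Q\<^esub> \<theta> z" unfolding e using cl by (simp add: \<theta>_def Q.m_assoc flip: d)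
    finally show "\<theta> (x \<otimes>\<^bsub>G\<^esub> z) = \<theta> x \<otimes>\<^bsub>Q\<^esub> \<theta> z" .
  qed (simp add: \<theta>_def)
  moreover have "\<theta> x = \<pi> x" if "x \<in> X" for x
  proof -
    have x: "x \<in> carrier G" using that X by blast
    then have "\<theta> x = \<pi> (s1 (p2 x) \<otimes>\<^bsub>G\<^esub> inv\<^bsub>G\<^esub> s0 (p2 x) \<otimes>\<^bsub>G\<^esub> s2 (p1 x))" by (simp add: \<theta>_def)
    then show ?thesis using sp(2)[OF that] by simp
  qed
  ultimately have "\<theta> g = \<pi> g" using hom_eq_on_generate[OF Q.group_axioms _ \<pi> X(1)] g(1) X(2) by blast
  moreover have "\<theta> g = \<one>\<^bsub>Q\<^esub>" using g by (simp add: \<theta>_def)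
  ultimately show ?thesis using one[OF g(1)] by (simp add: C_def)
qed

section \<open>Relative Steinberg groups for an ideal with a complementary subring\<close>

abbreviation St_class :: "'e::euclidean_space set \<Rightarrow> ('e \<Rightarrow> 'e \<Rightarrow> int) \<Rightarrow> ('a, 'm) ring_scheme \<Rightarrow> ('e \<times> 'a) gword \<Rightarrow> ('e \<times> 'a) gword set" where
  "St_class \<Phi> N A w \<equiv> word_class (steinberg_gens \<Phi> A) (steinberg_rels \<Phi> N A) w"

lemma group_St: "group (St \<Phi> N A)"
  unfolding St_def by (rule group_presented_group)

lemma carrier_St: "carrier (St \<Phi> N A) = St_class \<Phi> N A ` St_words \<Phi> A"
  unfolding St_def by (rule presented_group_carrier)

lemma St_class_closed: "w \<in> St_words \<Phi> A \<Longrightarrow> St_class \<Phi> N A w \<in> carrier (St \<Phi> N A)"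
  unfolding carrier_St by (rule imageI)

lemma St_one: "\<one>\<^bsub>St \<Phi> N A\<^esub> = St_class \<Phi> N A []"
  unfolding St_def by (rule presented_group_one)

lemma St_mult: "\<lbrakk>u \<in> St_words \<Phi> A; v \<in> St_words \<Phi> A\<rbrakk> \<Longrightarrow> St_class \<Phi> N A u \<otimes>\<^bsub>St \<Phi> N A\<^esub> St_class \<Phi> N A v = St_class \<Phi> N A (u @ v)"
  unfolding St_def by (rule presented_group_mult)

lemma St_class_eq_one_iff: "w \<in> St_words \<Phi> A \<Longrightarrow> St_class \<Phi> N A w = \<one>\<^bsub>St \<Phi> N A\<^esub> \<longleftrightarrow> (w, []) \<in> St_eq \<Phi> N A"
  unfolding St_one by (rule word_class_eq_iff) auto

lemma St_root_add: "\<lbrakk>\<gamma> \<in> \<Phi>; a \<in> carrier A; b \<in> carrier A; ring A\<rbrakk> \<Longrightarrow>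
   St_class \<Phi> N A (root_elt \<gamma> a) \<otimes>\<^bsub>St \<Phi> N A\<^esub> St_class \<Phi> N A (root_elt \<gamma> b) = St_class \<Phi> N A (root_elt \<gamma> (a \<oplus>\<^bsub>A\<^esub> b))"
proof -
  assume a: "\<gamma> \<in> \<Phi>" "a \<in> carrier A" "b \<in> carrier A" "ring A"
  then have "a \<oplus>\<^bsub>A\<^esub> b \<in> carrier A" by (simp add: ring.ring_simprules)
  with a have w: "root_elt \<gamma> a \<in> St_words \<Phi> A" "root_elt \<gamma> b \<in> St_words \<Phi> A" "root_elt \<gamma> (a \<oplus>\<^bsub>A\<^esub> b) \<in> St_words \<Phi> A"
    by (simp_all add: steinberg_gens_iff)
  have "(root_elt \<gamma> a @ root_elt \<gamma> b, root_elt \<gamma> (a \<oplus>\<^bsub>A\<^esub> b)) \<in> St_eq \<Phi> N A"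
    using gword_rel.relation[OF steinberg_relsI(1)[OF a(1-3)] _ w(3), of "[]" "[]" N] w by simp
  then show ?thesis unfolding St_mult[OF w(1,2)] using w by (subst word_class_eq_iff) auto
qed

lemma generate_St: "generate (St \<Phi> N A) {St_class \<Phi> N A (root_elt \<gamma> a) | \<gamma> a. \<gamma> \<in> \<Phi> \<and> a \<in> carrier A} = carrier (St \<Phi> N A)"
    (is "generate ?G ?X = _")
proof
  interpret group ?G by (rule group_St)
  have X: "?X \<subseteq> carrier ?G" by (auto simp: steinberg_gens_iff intro!: St_class_closed)
  then show "generate ?G ?X \<subseteq> carrier ?G" by (rule generate_incl)
  have "St_class \<Phi> N A w \<in> generate ?G ?X" if "w \<in> St_words \<Phi> A" for w
    using that
  proof (induction w)
    case Nil
    show ?case using generate.one[of ?G ?X] by (simp add: St_one)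
  next
    case (Cons x w)
    obtain \<gamma> a b where x: "x = ((\<gamma>, a), b)" by (metis prod.collapse)
    have g: "\<gamma> \<in> \<Phi>" "a \<in> carrier A" "w \<in> St_words \<Phi> A" using Cons.prems by (auto simp: x steinberg_gens_iff)
    have w: "[((\<gamma>, a), c)] \<in> St_words \<Phi> A" for c using g by (simp add: steinberg_gens_iff)
    have "(root_elt \<gamma> a @ [((\<gamma>, a), False)], []) \<in> St_eq \<Phi> N A"
      using gword_rel.cancel[of "(\<gamma>, a)" "steinberg_gens \<Phi> A" "[]" "[]" True "steinberg_rels \<Phi> N A"] g by (simp add: steinberg_gens_iff)
    then have "St_class \<Phi> N A (root_elt \<gamma> a) \<otimes>\<^bsub>?G\<^esub> St_class \<Phi> N A [((\<gamma>, a), False)] = \<one>\<^bsub>?G\<^esub>"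
      unfolding St_mult[OF w w] using w by (subst St_class_eq_one_iff) (simp_all add: g steinberg_gens_iff)
    then have "St_class \<Phi> N A [((\<gamma>, a), False)] = inv\<^bsub>?G\<^esub> St_class \<Phi> N A (root_elt \<gamma> a)"
      by (rule inv_equality[OF inv_comm, symmetric]) (rule St_class_closed[OF w])+
    moreover have "St_class \<Phi> N A (root_elt \<gamma> a) \<in> ?X" using g by blast
    ultimately have "St_class \<Phi> N A [x] \<in> generate ?G ?X"
      unfolding x by (cases b) (auto intro: generate.incl generate.inv)
    from generate.eng[OF this Cons.IH[OF g(3)]] show ?case
      unfolding x St_mult[OF w[of b] g(3)] by simp
  qed
  then show "carrier ?G \<subseteq> generate ?G ?X" by (auto simp: carrier_St)
qed

text \<open>The transfer lemma for a constant family, with the filter of all points of a one-point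
  index type.\<close>

lemma St_eq_map:
  assumes "ring A" "ring B" "\<And>\<gamma> \<delta>. \<lbrakk>\<gamma> \<in> \<Phi>; \<delta> \<in> \<Phi>; \<gamma> + \<delta> \<in> \<Phi>\<rbrakk> \<Longrightarrow> N \<gamma> \<delta> \<in> {1, -1}" "f \<in> ring_hom A B"
    and "(u, v) \<in> St_eq \<Phi> N A"
  shows "(map_coef f u, map_coef f v) \<in> St_eq \<Phi> N B"
  using gword_rel_St_transfer[of A B \<Phi> N "\<lambda>_. f" "principal UNIV :: unit filter" u v] assms
  by (simp add: eventually_principal ring_hom_def Pi_iff)

locale unit_structure_constants =
  fixes \<Phi> :: "'e::euclidean_space set" and N :: "'e \<Rightarrow> 'e \<Rightarrow> int"
  assumes N_one: "\<And>\<gamma> \<delta>. \<lbrakk>\<gamma> \<in> \<Phi>; \<delta> \<in> \<Phi>; \<gamma> + \<delta> \<in> \<Phi>\<rbrakk> \<Longrightarrow> N \<gamma> \<delta> \<in> {1, -1}"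
begin

lemma map_coef_words_hom: "\<lbrakk>w \<in> St_words \<Phi> A; f \<in> ring_hom A B\<rbrakk> \<Longrightarrow> map_coef f w \<in> St_words \<Phi> B"
  by (rule map_coef_words) (auto simp: ring_hom_def)

lemma St_map_class:
  assumes A: "ring A" and B: "ring B" and f: "f \<in> ring_hom A B" and w: "w \<in> St_words \<Phi> A"
  shows "St_map \<Phi> N B f (St_class \<Phi> N A w) = St_class \<Phi> N B (map_coef f w)"
proof -
  have "St_class \<Phi> N B (map_coef f v) = St_class \<Phi> N B (map_coef f w)" if "v \<in> St_class \<Phi> N A w" for v
  proof -
    have "(w, v) \<in> St_eq \<Phi> N A" using that by (simp add: word_class_def)
    then have "(map_coef f w, map_coef f v) \<in> St_eq \<Phi> N B" by (rule St_eq_map[OF A B _ f, rotated]) (rule N_one)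
    then show ?thesis using gword_rel_gwords by (subst word_class_eq_iff) (blast intro: gword_rel.sym)+
  qed
  moreover have "w \<in> St_class \<Phi> N A w" using w by (auto simp: word_class_def intro: gword_rel.refl)
  ultimately show ?thesis unfolding St_map_def map_coef_def[symmetric] word_class_def[symmetric] by blast
qed

lemma St_map_hom:
  assumes A: "ring A" and B: "ring B" and f: "f \<in> ring_hom A B"
  shows "St_map \<Phi> N B f \<in> hom (St \<Phi> N A) (St \<Phi> N B)"
proof (rule homI)
  fix x y assume "x \<in> carrier (St \<Phi> N A)" "y \<in> carrier (St \<Phi> N A)"
  then obtain u v where uv: "u \<in> St_words \<Phi> A" "v \<in> St_words \<Phi> A" "x = St_class \<Phi> N A u" "y = St_class \<Phi> N A v"
    by (auto simp: carrier_St)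
  show "St_map \<Phi> N B f x \<in> carrier (St \<Phi> N B)"
    using uv map_coef_words_hom[OF uv(1) f] by (simp add: St_map_class[OF A B f] carrier_St)
  show "St_map \<Phi> N B f (x \<otimes>\<^bsub>St \<Phi> N A\<^esub> y) = St_map \<Phi> N B f x \<otimes>\<^bsub>St \<Phi> N B\<^esub> St_map \<Phi> N B f y"
    using uv map_coef_words_hom[OF uv(1) f] map_coef_words_hom[OF uv(2) f]
    by (simp add: St_mult St_map_class[OF A B f])
qed

end

text \<open>The two conditions on \<epsilon> make it an idempotent endomorphism with kernel
  \<open>I\<close>, so that A -> A/I splits. For polynomials it is t \<mapsto> 0.\<close>

locale double = A: cring A + I: ideal I A + unit_structure_constants \<Phi> N
  for A :: "('a, 'm) ring_scheme" and I and \<Phi> :: "'e::euclidean_space set" and N +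
  fixes \<epsilon> :: "'a \<Rightarrow> 'a"
  assumes eps: "\<epsilon> \<in> ring_hom A A" and eps_diff: "a \<in> carrier A \<Longrightarrow> \<epsilon> a \<ominus>\<^bsub>A\<^esub> a \<in> I"
    and eps_I: "a \<in> I \<Longrightarrow> \<epsilon> a = \<zero>\<^bsub>A\<^esub>"
begin

abbreviation D where "D \<equiv> double_ring A I"

lemma cring_D: "cring D"
proof -
  let ?H = "{(a, b). a \<in> carrier A \<and> b \<in> carrier A \<and> a \<ominus>\<^bsub>A\<^esub> b \<in> I}"
  have zero: "\<zero>\<^bsub>A\<^esub> \<in> I" using additive_subgroup.zero_closed[OF I.is_additive_subgroup] .
  have mult: "a \<otimes>\<^bsub>A\<^esub> c \<ominus>\<^bsub>A\<^esub> b \<otimes>\<^bsub>A\<^esub> d \<in> I" if "a \<ominus>\<^bsub>A\<^esub> b \<in> I" "c \<ominus>\<^bsub>A\<^esub> d \<in> I" "a \<in> carrier A" "b \<in> carrier A" "c \<in> carrier A" "d \<in> carrier A" for a b c d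
  proof -
    have "a \<otimes>\<^bsub>A\<^esub> c \<ominus>\<^bsub>A\<^esub> b \<otimes>\<^bsub>A\<^esub> d = c \<otimes>\<^bsub>A\<^esub> (a \<ominus>\<^bsub>A\<^esub> b) \<oplus>\<^bsub>A\<^esub> b \<otimes>\<^bsub>A\<^esub> (c \<ominus>\<^bsub>A\<^esub> d)" using that(3-6) by algebra
    then show ?thesis using that I.I_l_closed additive_subgroup.a_closed[OF I.is_additive_subgroup] by simp
  qed
  have add: "(a \<oplus>\<^bsub>A\<^esub> c) \<ominus>\<^bsub>A\<^esub> (b \<oplus>\<^bsub>A\<^esub> d) \<in> I" if "a \<ominus>\<^bsub>A\<^esub> b \<in> I" "c \<ominus>\<^bsub>A\<^esub> d \<in> I" "a \<in> carrier A" "b \<in> carrier A" "c \<in> carrier A" "d \<in> carrier A" for a b c d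
  proof -
    have "(a \<oplus>\<^bsub>A\<^esub> c) \<ominus>\<^bsub>A\<^esub> (b \<oplus>\<^bsub>A\<^esub> d) = (a \<ominus>\<^bsub>A\<^esub> b) \<oplus>\<^bsub>A\<^esub> (c \<ominus>\<^bsub>A\<^esub> d)" using that(3-6) by algebra
    then show ?thesis using that additive_subgroup.a_closed[OF I.is_additive_subgroup] by simp
  qed
  have minus: "\<ominus>\<^bsub>A\<^esub> a \<ominus>\<^bsub>A\<^esub> \<ominus>\<^bsub>A\<^esub> b \<in> I" if "a \<ominus>\<^bsub>A\<^esub> b \<in> I" "a \<in> carrier A" "b \<in> carrier A" for a b
  proof -
    have "\<ominus>\<^bsub>A\<^esub> a \<ominus>\<^bsub>A\<^esub> \<ominus>\<^bsub>A\<^esub> b = \<ominus>\<^bsub>A\<^esub> (a \<ominus>\<^bsub>A\<^esub> b)" using that(2-3) by algebra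
    then show ?thesis using that additive_subgroup.a_inv_closed[OF I.is_additive_subgroup] by simp
  qed
  show ?thesis unfolding double_ring_def
    by (rule cring_subproduct(1)[OF A.is_cring A.is_cring])
      (auto simp: add mult minus zero A.diff_eq_zero_iff[THEN iffD2])
qed

lemma D_simps [simp]:
  "(a, b) \<in> carrier D \<longleftrightarrow> a \<in> carrier A \<and> b \<in> carrier A \<and> a \<ominus>\<^bsub>A\<^esub> b \<in> I"
  "(a, b) \<oplus>\<^bsub>D\<^esub> (c, d) = (a \<oplus>\<^bsub>A\<^esub> c, b \<oplus>\<^bsub>A\<^esub> d)" "(a, b) \<otimes>\<^bsub>D\<^esub> (c, d) = (a \<otimes>\<^bsub>A\<^esub> c, b \<otimes>\<^bsub>A\<^esub> d)"
  "\<one>\<^bsub>D\<^esub> = (\<one>\<^bsub>A\<^esub>, \<one>\<^bsub>A\<^esub>)"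
  by (simp_all add: double_ring_def)

sublocale D: cring D by (rule cring_D)

sublocale eps: ring_hom_ring A A \<epsilon>
  using eps by (intro ring_hom_ringI2) (auto intro: A.ring_axioms)

lemma eps_D: "(a, b) \<in> carrier D \<Longrightarrow> \<epsilon> a = \<epsilon> b"
  using eps_I[of "a \<ominus>\<^bsub>A\<^esub> b"] by (simp add: A.minus_eq) (metis A.diff_eq_zero_iff A.minus_eq eps.hom_closed)

lemma D_homs: "fst \<in> ring_hom D A" "snd \<in> ring_hom D A"
  "(\<lambda>a. (\<epsilon> a, \<epsilon> a)) \<in> ring_hom A D" "(\<lambda>a. (\<epsilon> a, a)) \<in> ring_hom A D" "(\<lambda>a. (a, \<epsilon> a)) \<in> ring_hom A D"
proof -
  have z: "a \<ominus>\<^bsub>A\<^esub> a \<in> I" if "a \<in> carrier A" for a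
    unfolding A.diff_eq_zero_iff[THEN iffD2, OF that that HOL.refl] by (rule additive_subgroup.zero_closed[OF I.is_additive_subgroup])
  have m: "a \<ominus>\<^bsub>A\<^esub> \<epsilon> a \<in> I" if a: "a \<in> carrier A" for a
  proof -
    have "a \<ominus>\<^bsub>A\<^esub> \<epsilon> a = \<ominus>\<^bsub>A\<^esub> (\<epsilon> a \<ominus>\<^bsub>A\<^esub> a)" using a eps.hom_closed[OF a] by algebra
    then show ?thesis using additive_subgroup.a_inv_closed[OF I.is_additive_subgroup eps_diff[OF a]] by simp
  qed
  have e: "\<epsilon> (\<epsilon> a) = \<epsilon> a" if "a \<in> carrier A" for a using that eps_D[of "\<epsilon> a" a] eps_diff by simp
  show "fst \<in> ring_hom D A" "snd \<in> ring_hom D A" by (rule ring_hom_memI; auto)+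
  show "(\<lambda>a. (\<epsilon> a, \<epsilon> a)) \<in> ring_hom A D" "(\<lambda>a. (\<epsilon> a, a)) \<in> ring_hom A D" "(\<lambda>a. (a, \<epsilon> a)) \<in> ring_hom A D"
    by (rule ring_hom_memI; simp add: z m eps_diff)+
qed

text \<open>The three sections come from the ring homomorphisms sending a to (\<epsilon> a,
  \<epsilon> a), (\<epsilon> a, a) and (a, \<epsilon> a). A coefficient (a, b) satisfies \<epsilon>
  a = \<epsilon> b, hence equals (\<epsilon> b, b) - (\<epsilon> b, \<epsilon> b) + (a, \<epsilon>
  a), which is the factorisation that \<open>kernels_mixed_commutator\<close> requires of the
  generators.\<close>

lemma kernels_St:
  assumes g: "g \<in> carrier (St \<Phi> N D)" "St_map \<Phi> N A fst g = \<one>\<^bsub>St \<Phi> N A\<^esub>" "St_map \<Phi> N A snd g = \<one>\<^bsub>St \<Phi> N A\<^esub>"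
  shows "g \<in> mixed_commutator (St \<Phi> N D) (St_ker \<Phi> N A I fst) (St_ker \<Phi> N A I snd)"
  unfolding St_ker_def
proof (rule kernels_mixed_commutator[where ?s0.0 = "St_map \<Phi> N D (\<lambda>a. (\<epsilon> a, \<epsilon> a))" and ?s1.0 = "St_map \<Phi> N D (\<lambda>a. (\<epsilon> a, a))" and ?s2.0 = "St_map \<Phi> N D (\<lambda>a. (a, \<epsilon> a))"])
  note AD = A.ring_axioms D.ring_axioms and DA = D.ring_axioms A.ring_axioms
  let ?X = "{St_class \<Phi> N D (root_elt \<gamma> a) | \<gamma> a. \<gamma> \<in> \<Phi> \<and> a \<in> carrier D}"
  interpret S: group "St \<Phi> N D" by (rule group_St)
  show "group (St \<Phi> N D)" "group (St \<Phi> N A)" by (rule group_St)+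
  show "St_map \<Phi> N A fst \<in> hom (St \<Phi> N D) (St \<Phi> N A)" "St_map \<Phi> N A snd \<in> hom (St \<Phi> N D) (St \<Phi> N A)"
    by (rule St_map_hom[OF DA] D_homs)+
  show "St_map \<Phi> N D (\<lambda>a. (\<epsilon> a, \<epsilon> a)) \<in> hom (St \<Phi> N A) (St \<Phi> N D)" "St_map \<Phi> N D (\<lambda>a. (\<epsilon> a, a)) \<in> hom (St \<Phi> N A) (St \<Phi> N D)"
    "St_map \<Phi> N D (\<lambda>a. (a, \<epsilon> a)) \<in> hom (St \<Phi> N A) (St \<Phi> N D)"
    by (rule St_map_hom[OF AD] D_homs)+
  show "St_map \<Phi> N A fst (St_map \<Phi> N D (\<lambda>a. (\<epsilon> a, a)) x) = St_map \<Phi> N A fst (St_map \<Phi> N D (\<lambda>a. (\<epsilon> a, \<epsilon> a)) x)"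
    "St_map \<Phi> N A snd (St_map \<Phi> N D (\<lambda>a. (a, \<epsilon> a)) x) = St_map \<Phi> N A snd (St_map \<Phi> N D (\<lambda>a. (\<epsilon> a, \<epsilon> a)) x)"
    if x: "x \<in> carrier (St \<Phi> N A)" for x
  proof -
    obtain w where w: "w \<in> St_words \<Phi> A" "x = St_class \<Phi> N A w" using x by (auto simp: carrier_St)
    have "St_map \<Phi> N A k (St_map \<Phi> N D f x) = St_class \<Phi> N A (map_coef (k \<circ> f) w)"
      if "f \<in> ring_hom A D" "k \<in> ring_hom D A" for f k
      unfolding w(2) St_map_class[OF AD that(1) w(1)] St_map_class[OF DA that(2) map_coef_words_hom[OF w(1) that(1)]] map_coef_comp ..
    note e = this
    show "St_map \<Phi> N A fst (St_map \<Phi> N D (\<lambda>a. (\<epsilon> a, a)) x) = St_map \<Phi> N A fst (St_map \<Phi> N D (\<lambda>a. (\<epsilon> a, \<epsilon> a)) x)"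
      "St_map \<Phi> N A snd (St_map \<Phi> N D (\<lambda>a. (a, \<epsilon> a)) x) = St_map \<Phi> N A snd (St_map \<Phi> N D (\<lambda>a. (\<epsilon> a, \<epsilon> a)) x)"
      unfolding e[OF D_homs(4,1)] e[OF D_homs(3,1)] e[OF D_homs(5,2)] e[OF D_homs(3,2)] by (simp_all add: comp_def)
  qed
  show "?X \<subseteq> carrier (St \<Phi> N D)" "carrier (St \<Phi> N D) = generate (St \<Phi> N D) ?X"
    using generate_St[of \<Phi> N D] by (auto simp: steinberg_gens_iff intro!: St_class_closed)
  fix x assume "x \<in> ?X"
  then obtain \<gamma> a b where x: "x = St_class \<Phi> N D (root_elt \<gamma> (a, b))" and g: "\<gamma> \<in> \<Phi>" and ab: "(a, b) \<in> carrier D" by fastforce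
  have w: "root_elt \<gamma> (a, b) \<in> St_words \<Phi> D" "root_elt \<gamma> a \<in> St_words \<Phi> A" "root_elt \<gamma> b \<in> St_words \<Phi> A"
    using g ab by (simp_all add: steinberg_gens_iff)
  have e: "St_map \<Phi> N A fst x = St_class \<Phi> N A (root_elt \<gamma> a)" "St_map \<Phi> N A snd x = St_class \<Phi> N A (root_elt \<gamma> b)"
    unfolding x using w by (simp_all add: St_map_class[OF DA] D_homs)
  have eab: "\<epsilon> a = \<epsilon> b" by (rule eps_D[OF ab])
  show "St_map \<Phi> N D (\<lambda>a. (\<epsilon> a, \<epsilon> a)) (St_map \<Phi> N A fst x) = St_map \<Phi> N D (\<lambda>a. (\<epsilon> a, \<epsilon> a)) (St_map \<Phi> N A snd x)"
    unfolding e using w by (simp add: St_map_class[OF AD] D_homs eab)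
  let ?x = "St_class \<Phi> N D (root_elt \<gamma> (\<epsilon> b, b))" and ?y = "St_class \<Phi> N D (root_elt \<gamma> (\<epsilon> b, \<epsilon> b))" and ?z = "St_class \<Phi> N D (root_elt \<gamma> (a, \<epsilon> a))"
  have D: "(\<epsilon> b, b) \<in> carrier D" "(\<epsilon> b, \<epsilon> b) \<in> carrier D" "(a, \<epsilon> a) \<in> carrier D"
    using ring_hom_closed[OF D_homs(3)] ring_hom_closed[OF D_homs(4)] ring_hom_closed[OF D_homs(5)] ab by auto
  note add = St_root_add[OF g _ _ D.ring_axioms, of _ _ N]
  have C: "?x \<in> carrier (St \<Phi> N D)" "?y \<in> carrier (St \<Phi> N D)" "?z \<in> carrier (St \<Phi> N D)" "x \<in> carrier (St \<Phi> N D)"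
    unfolding x using D ab g by (auto simp: steinberg_gens_iff intro!: St_class_closed)
  have cA: "\<epsilon> b \<in> carrier A" "a \<in> carrier A" "b \<in> carrier A" using ab by simp_all
  have xy: "?x \<otimes>\<^bsub>St \<Phi> N D\<^esub> ?y = ?y \<otimes>\<^bsub>St \<Phi> N D\<^esub> ?x"
    unfolding add[OF D(1,2)] add[OF D(2,1)] D.a_comm[OF D(1,2)] ..
  \<comment> \<open>In coefficients: (\<epsilon> b, b) + (a, \<epsilon> a) = (\<epsilon> b,
    \<epsilon> b) + (a, b).\<close>
  have xz: "?x \<otimes>\<^bsub>St \<Phi> N D\<^esub> ?z = ?y \<otimes>\<^bsub>St \<Phi> N D\<^esub> x"
    unfolding x add[OF D(1,3)] add[OF D(2) ab] using cA by (simp add: eab A.a_comm)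
  have "?x \<otimes>\<^bsub>St \<Phi> N D\<^esub> inv\<^bsub>St \<Phi> N D\<^esub> ?y = inv\<^bsub>St \<Phi> N D\<^esub> ?y \<otimes>\<^bsub>St \<Phi> N D\<^esub> ?x"
    using C xy S.inv_solve_left S.inv_solve_right by (metis S.inv_closed S.m_assoc S.m_closed)
  then have "?x \<otimes>\<^bsub>St \<Phi> N D\<^esub> inv\<^bsub>St \<Phi> N D\<^esub> ?y \<otimes>\<^bsub>St \<Phi> N D\<^esub> ?z = inv\<^bsub>St \<Phi> N D\<^esub> ?y \<otimes>\<^bsub>St \<Phi> N D\<^esub> (?x \<otimes>\<^bsub>St \<Phi> N D\<^esub> ?z)"
    using C by (simp add: S.m_assoc)
  also have "\<dots> = x" unfolding xz using C by (simp flip: S.m_assoc)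
  finally show "St_map \<Phi> N D (\<lambda>a. (\<epsilon> a, a)) (St_map \<Phi> N A snd x) \<otimes>\<^bsub>St \<Phi> N D\<^esub>
      inv\<^bsub>St \<Phi> N D\<^esub> St_map \<Phi> N D (\<lambda>a. (\<epsilon> a, \<epsilon> a)) (St_map \<Phi> N A snd x) \<otimes>\<^bsub>St \<Phi> N D\<^esub>
      St_map \<Phi> N D (\<lambda>a. (a, \<epsilon> a)) (St_map \<Phi> N A fst x) = x"
    unfolding e using w by (simp add: St_map_class[OF AD] D_homs)
qed (fact g)+

text \<open>A coset representative is killed by the first projection, so by
  \<open>kernels_St\<close> it lies in the commutator subgroup as soon as the second projection
  kills it too. In the split case the map from the relative to the absolute Steinberg group is
  therefore injective.\<close>

theorem St_rel_cases:
  assumes "\<alpha> \<in> carrier (St_rel \<Phi> N A I)"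
  obtains w where "w \<in> St_words \<Phi> D" "(map_coef fst w, []) \<in> St_eq \<Phi> N A"
    "St_rel_map \<Phi> N A \<alpha> = St_class \<Phi> N A (map_coef snd w)"
    "\<alpha> = \<one>\<^bsub>St_rel \<Phi> N A I\<^esub> \<longleftrightarrow> (map_coef snd w, []) \<in> St_eq \<Phi> N A"
proof -
  note DA = D.ring_axioms A.ring_axioms
  let ?G = "St \<Phi> N D" and ?B = "St \<Phi> N A"
  let ?K1 = "St_ker \<Phi> N A I fst" and ?K2 = "St_ker \<Phi> N A I snd"
  interpret G: group ?G by (rule group_St)
  interpret p1: group_hom ?G ?B "St_map \<Phi> N A fst"
    using group_St St_map_hom[OF DA D_homs(1)] by (simp add: group_hom_def group_hom_axioms_def)
  interpret p2: group_hom ?G ?B "St_map \<Phi> N A snd"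
    using group_St St_map_hom[OF DA D_homs(2)] by (simp add: group_hom_def group_hom_axioms_def)
  define C where "C = mixed_commutator ?G ?K1 ?K2"
  have K: "?K1 \<lhd> ?G" "?K2 \<lhd> ?G" unfolding St_ker_def by (rule p1.normal_kernel p2.normal_kernel)+
  interpret C: normal C ?G unfolding C_def by (rule G.mixed_commutator_normal[OF K])
  have CK: "C \<subseteq> ?K1 \<inter> ?K2" unfolding C_def by (rule mixed_commutator_subset[OF group_St K])
  obtain g where g: "g \<in> ?K1" "\<alpha> = C #>\<^bsub>?G\<^esub> g"
    using assms unfolding St_rel_def FactGroup_def RCOSETS_def C_def by (auto simp: r_coset_def)
  have gc: "g \<in> carrier ?G" "St_map \<Phi> N A fst g = \<one>\<^bsub>?B\<^esub>" using g(1) by (auto simp: St_ker_def kernel_def)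
  obtain w where w: "w \<in> St_words \<Phi> D" "g = St_class \<Phi> N D w" using gc(1) by (auto simp: carrier_St)
  have p: "St_map \<Phi> N A fst g = St_class \<Phi> N A (map_coef fst w)" "St_map \<Phi> N A snd g = St_class \<Phi> N A (map_coef snd w)"
    using w D_homs by (simp_all add: St_map_class[OF DA])
  have ww: "map_coef fst w \<in> St_words \<Phi> A" "map_coef snd w \<in> St_words \<Phi> A" using w(1) D_homs map_coef_words_hom by blast+
  have "St_map \<Phi> N A snd ` \<alpha> = {St_map \<Phi> N A snd g}"
  proof -
    have "St_map \<Phi> N A snd (c \<otimes>\<^bsub>?G\<^esub> g) = St_map \<Phi> N A snd g" if "c \<in> C" for c
      using that CK gc by (auto simp: St_ker_def kernel_def)
    moreover have "g \<in> C #>\<^bsub>?G\<^esub> g" by (rule G.rcos_self[OF gc(1) C.subgroup_axioms])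
    ultimately show ?thesis unfolding g(2) by (auto simp: r_coset_def)
  qed
  then have "St_rel_map \<Phi> N A \<alpha> = St_class \<Phi> N A (map_coef snd w)" by (simp add: St_rel_map_def p)
  moreover have "(map_coef fst w, []) \<in> St_eq \<Phi> N A" using gc(2) ww by (simp add: p St_class_eq_one_iff)
  moreover have "\<alpha> = \<one>\<^bsub>St_rel \<Phi> N A I\<^esub> \<longleftrightarrow> (map_coef snd w, []) \<in> St_eq \<Phi> N A"
  proof -
    have "\<one>\<^bsub>St_rel \<Phi> N A I\<^esub> = C" by (simp add: St_rel_def C_def)
    then have "\<alpha> = \<one>\<^bsub>St_rel \<Phi> N A I\<^esub> \<longleftrightarrow> g \<in> C"
      unfolding g(2) using G.r_coset_eq_subgroup_iff[OF C.subgroup_axioms gc(1)] by simp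
    also have "\<dots> \<longleftrightarrow> St_map \<Phi> N A snd g = \<one>\<^bsub>?B\<^esub>"
      using kernels_St[OF gc] CK unfolding C_def by (auto simp: St_ker_def kernel_def)
    finally show ?thesis using ww by (simp add: p St_class_eq_one_iff)
  qed
  ultimately show ?thesis using that w(1) by blast
qed

end

text \<open>By \<open>St_rel_cases\<close> only the second projection v of a representing word
  matters. Local triviality gives v(t) = v(0), and v(0) is trivial because the representative
  belongs to the kernel of the first projection.\<close>

theorem St_rel_UP_eq_one_iff:
  assumes laced: "simply_laced \<Phi> ip N" and R: "cring R" and \<alpha>: "\<alpha> \<in> carrier (St_rel \<Phi> N (UP R) (t_ideal R))"
  shows "\<alpha> = \<one>\<^bsub>St_rel \<Phi> N (UP R) (t_ideal R)\<^esub> \<longleftrightarrow>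
    (\<forall>M. maximalideal M R \<longrightarrow>
       St_map \<Phi> N (UP (loc_ring R M)) (loc_poly_map R M) (St_rel_map \<Phi> N (UP R) \<alpha>) = \<one>\<^bsub>St \<Phi> N (UP (loc_ring R M))\<^esub>)"
    (is "_ \<longleftrightarrow> (\<forall>M. _ \<longrightarrow> ?trivial M)")
proof -
  interpret simply_laced \<Phi> ip N by fact
  interpret R: cring R by fact
  interpret T: cring "UP R" by (rule cring_UP) fact
  interpret UR: UP_ring R "UP R" by (simp add: UP_ring_def R.ring_axioms)
  let ?X = "monom (UP R) \<one>\<^bsub>R\<^esub> 1" and ?e = "poly_subst R \<zero>\<^bsub>UP R\<^esub>"
  have X: "?X \<in> carrier (UP R)" by simp
  note e = poly_subst_hom[OF R T.zero_closed] and e0 = poly_subst_const[OF R T.zero_closed] and e1 = poly_subst_X[OF R T.zero_closed]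
  interpret e: ring_hom_ring "UP R" "UP R" ?e using e by (intro ring_hom_ringI2) (auto intro: T.ring_axioms)
  have I: "ideal (t_ideal R) (UP R)" unfolding t_ideal_def by (rule T.cgenideal_ideal[OF X])
  interpret double "UP R" "t_ideal R" \<Phi> N ?e
  proof (intro double.intro double_axioms.intro unit_structure_constants.intro)
    show "?e a \<ominus>\<^bsub>UP R\<^esub> a \<in> t_ideal R" if a: "a \<in> carrier (UP R)" for a
    proof -
      have "?X \<in> t_ideal R" unfolding t_ideal_def by (rule T.cgenideal_self[OF X])
      then have "\<ominus>\<^bsub>UP R\<^esub> ?X \<in> t_ideal R" by (rule additive_subgroup.a_inv_closed[OF ideal.axioms(1)[OF I]])
      then have "?e ?X \<ominus>\<^bsub>UP R\<^esub> id ?X \<in> t_ideal R" unfolding e1 using X by (simp add: T.minus_eq)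
      from UP_hom_diff_mem[OF R T.is_cring I e id_ring_hom _ this a] show ?thesis by (simp add: e0)
    qed
    show "?e a = \<zero>\<^bsub>UP R\<^esub>" if a: "a \<in> t_ideal R" for a
    proof -
      obtain x where x: "x \<in> carrier (UP R)" "a = x \<otimes>\<^bsub>UP R\<^esub> ?X" using a unfolding t_ideal_def cgenideal_def by blast
      show ?thesis unfolding x(2) e.hom_mult[OF x(1) X] e1 using x(1) by simp
    qed
  qed (fact T.is_cring I e N_unit)+
  note loc = R.localization_maximalideal
  have loc_hom: "ring (UP (loc_ring R M))" "loc_poly_map R M \<in> ring_hom (UP R) (UP (loc_ring R M))" if M: "maximalideal M R" for M
  proof -
    interpret localization R M by (rule loc[OF M])
    show "ring (UP (loc_ring R M))" using cring_UP[OF cring_loc_ring] by (rule cring.axioms)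
    show "loc_poly_map R M \<in> ring_hom (UP R) (UP (loc_ring R M))"
      using UP_map_hom(1)[OF R cring_loc_ring loc_map_hom] by (simp add: loc_poly_map_def[abs_def])
  qed
  obtain w where w: "w \<in> St_words \<Phi> D" "(map_coef fst w, []) \<in> St_eq \<Phi> N (UP R)"
    "St_rel_map \<Phi> N (UP R) \<alpha> = St_class \<Phi> N (UP R) (map_coef snd w)"
    "\<alpha> = \<one>\<^bsub>St_rel \<Phi> N (UP R) (t_ideal R)\<^esub> \<longleftrightarrow> (map_coef snd w, []) \<in> St_eq \<Phi> N (UP R)"
    using St_rel_cases[OF \<alpha>] by blast
  have v: "map_coef snd w \<in> St_words \<Phi> (UP R)" by (rule map_coef_words_hom[OF w(1) D_homs(2)])
  have trivial: "?trivial M \<longleftrightarrow> (map_coef (loc_poly_map R M) (map_coef snd w), []) \<in> St_eq \<Phi> N (UP (loc_ring R M))"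
    if M: "maximalideal M R" for M
    unfolding w(3) St_map_class[OF T.ring_axioms loc_hom[OF M] v] by (rule St_class_eq_one_iff[OF map_coef_words_hom[OF v loc_hom(2)[OF M]]])
  show ?thesis
  proof
    assume "\<alpha> = \<one>\<^bsub>St_rel \<Phi> N (UP R) (t_ideal R)\<^esub>"
    then have "(map_coef snd w, []) \<in> St_eq \<Phi> N (UP R)" using w(4) by blast
    then have "(map_coef (loc_poly_map R M) (map_coef snd w), map_coef (loc_poly_map R M) []) \<in> St_eq \<Phi> N (UP (loc_ring R M))"
      if "maximalideal M R" for M
      by (rule St_eq_map[OF T.ring_axioms loc_hom(1)[OF that] _ loc_hom(2)[OF that], rotated]) (rule N_unit)
    then show "\<forall>M. maximalideal M R \<longrightarrow> ?trivial M" using trivial by simp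
  next
    assume "\<forall>M. maximalideal M R \<longrightarrow> ?trivial M"
    then have "(map_coef snd w, map_coef ?e (map_coef snd w)) \<in> St_eq \<Phi> N (UP R)"
      using trivial by (intro St_local_global[OF laced R v]) blast
    \<comment> \<open>The two components of a coefficient differ by a multiple of t, so they
      coincide at t = 0; this passes to the first component, where the word is trivial.\<close>
    also have "map_coef ?e (map_coef snd w) = map_coef ?e (map_coef fst w)"
      unfolding map_coef_comp by (rule map_coef_cong[OF w(1)]) (use eps_D in auto)
    finally have "(map_coef snd w, map_coef ?e (map_coef fst w)) \<in> St_eq \<Phi> N (UP R)" .
    moreover have "(map_coef ?e (map_coef fst w), map_coef ?e []) \<in> St_eq \<Phi> N (UP R)"
      using w(2) by (rule St_eq_map[OF T.ring_axioms T.ring_axioms _ e, rotated]) (rule N_unit)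
    ultimately have "(map_coef snd w, []) \<in> St_eq \<Phi> N (UP R)" by (simp add: gword_rel.trans)
    then show "\<alpha> = \<one>\<^bsub>St_rel \<Phi> N (UP R) (t_ideal R)\<^esub>" using w(4) by blast
  qed
qed

section \<open>Root systems of type E and Chevalley bases\<close>

lemma root_system_reflect:
  assumes "root_system \<Phi>" "\<alpha> \<in> \<Phi>" "\<beta> \<in> \<Phi>"
  shows "\<beta> - cartan_int \<beta> \<alpha> *\<^sub>R \<alpha> \<in> \<Phi>" "cartan_int \<beta> \<alpha> \<in> \<int>"
  using assms unfolding root_system_def by blast+

lemma root_system_nz: "root_system \<Phi> \<Longrightarrow> \<alpha> \<in> \<Phi> \<Longrightarrow> \<alpha> \<noteq> 0"
  unfolding root_system_def by blast

lemma root_system_uminus: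
  assumes "root_system \<Phi>" "\<alpha> \<in> \<Phi>" shows "- \<alpha> \<in> \<Phi>"
proof -
  have "cartan_int \<alpha> \<alpha> = 2" using root_system_nz[OF assms] by (simp add: cartan_int_def)
  then show ?thesis using root_system_reflect(1)[OF assms(1,2,2)] by (simp add: scaleR_2)
qed

lemma inner_reflect: "\<alpha> \<noteq> 0 \<Longrightarrow> inner (\<beta> - cartan_int \<beta> \<alpha> *\<^sub>R \<alpha>) (\<beta> - cartan_int \<beta> \<alpha> *\<^sub>R \<alpha>) = inner \<beta> \<beta>"
proof -
  assume "\<alpha> \<noteq> 0"
  define c where "c = cartan_int \<beta> \<alpha>"
  have c: "c * inner \<alpha> \<alpha> = 2 * inner \<beta> \<alpha>" using \<open>\<alpha> \<noteq> 0\<close> by (simp add: c_def cartan_int_def)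
  have "inner (\<beta> - c *\<^sub>R \<alpha>) (\<beta> - c *\<^sub>R \<alpha>) = inner \<beta> \<beta> - 2 * c * inner \<beta> \<alpha> + c * (c * inner \<alpha> \<alpha>)"
    by (simp add: inner_diff_left inner_diff_right inner_commute[of \<alpha> \<beta>] algebra_simps)
  then show ?thesis unfolding c by (simp add: c_def)
qed

locale E_roots =
  fixes \<Phi> :: "'e::euclidean_space set" and l :: nat and b :: "nat \<Rightarrow> 'e"
  assumes l: "l \<in> {6, 7, 8}" and root_system: "root_system \<Phi>" and simple_roots: "simple_roots \<Phi> l b"
    and cartan: "\<And>i j. \<lbrakk>i \<in> {1..l}; j \<in> {1..l}\<rbrakk> \<Longrightarrow> cartan_int (b i) (b j) = (if i = j then 2 else if E_edge i j then - 1 else 0)"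
begin

definition L where "L = inner (b 4) (b 4)"

lemmas b_simple = simple_roots[unfolded simple_roots_def]
lemmas b_inj = b_simple[THEN conjunct1]
  and b_subset = b_simple[THEN conjunct2, THEN conjunct1]
  and b_independent = b_simple[THEN conjunct2, THEN conjunct2, THEN conjunct1]
  and b_span = b_simple[THEN conjunct2, THEN conjunct2, THEN conjunct2, THEN conjunct1]
  and b_coeffs = b_simple[THEN conjunct2, THEN conjunct2, THEN conjunct2, THEN conjunct2]

lemma b_root: "i \<in> {1..l} \<Longrightarrow> b i \<in> \<Phi>"
  using b_subset by blast

lemma edges: "E_edge 1 3" "E_edge 3 1" "E_edge 3 4" "E_edge 4 3" "E_edge 2 4" "E_edge 4 2" "E_edge 4 5" "E_edge 5 4"
  "E_edge 5 6" "E_edge 6 5" "E_edge 6 7" "E_edge 7 6" "E_edge 7 8" "E_edge 8 7"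
  by (simp_all add: E_edge_def doubleton_eq_iff)

lemma E_edge_neq: "E_edge i j \<Longrightarrow> i \<noteq> j" by (auto simp: E_edge_def doubleton_eq_iff)

text \<open>Edges are symmetric, so \<open>Q\<close> holds at both ends of an edge or at neither,
  and every node can be compared with the branch node 4.\<close>

lemma connected:
  assumes step: "\<And>i j. \<lbrakk>i \<in> {1..l}; j \<in> {1..l}; E_edge i j; Q i\<rbrakk> \<Longrightarrow> Q j"
    and i: "i \<in> {1..l}" "Q i" and j: "j \<in> {1..l}"
  shows "Q j"
proof -
  have I: "1 \<in> {1..l}" "2 \<in> {1..l}" "3 \<in> {1..l}" "4 \<in> {1..l}" "5 \<in> {1..l}" "6 \<in> {1..l}" using l by auto
  have eq: "Q i = Q j" if "i \<in> {1..l}" "j \<in> {1..l}" "E_edge i j" "E_edge j i" for i j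
    using step[OF that(1,2,3)] step[OF that(2,1,4)] by blast
  have Q3: "Q 3 = Q 4" and Q2: "Q 2 = Q 4" and Q5: "Q 5 = Q 4" by (rule eq; fact I edges)+
  have Q1: "Q 1 = Q 4" unfolding Q3[symmetric] by (rule eq; fact I edges)
  have Q6: "Q 6 = Q 4" unfolding Q5[symmetric] by (rule eq; fact I edges)
  have Q7: "Q 7 = Q 4" if "7 \<in> {1..l}" unfolding Q6[symmetric] by (rule eq[OF that I(6) edges(12,11)])
  have Q8: "Q 8 = Q 4" if k: "8 \<in> {1..l}"
  proof -
    have "7 \<in> {1..l}" using k by simp
    then show ?thesis using Q7 eq[OF k _ edges(14,13)] by blast
  qed
  have Qk: "Q k = Q 4" if k: "k \<in> {1..l}" for k
  proof -
    consider "k = 1" | "k = 2" | "k = 3" | "k = 4" | "k = 5" | "k = 6" | "k = 7" | "k = 8"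
      using k l by (simp, linarith)
    then show ?thesis using k Q1 Q2 Q3 Q5 Q6 Q7 Q8 by cases (simp_all only:)
  qed
  show ?thesis using i(2) unfolding Qk[OF i(1)] Qk[OF j] .
qed

text \<open>Both Cartan integers along an edge are -1, so adjacent simple roots have equal
  length.\<close>

lemma b_length: "i \<in> {1..l} \<Longrightarrow> inner (b i) (b i) = L"
proof (rule connected[where Q = "\<lambda>i. inner (b i) (b i) = L"])
  fix i j assume ij: "i \<in> {1..l}" "j \<in> {1..l}" "E_edge i j" and Q: "inner (b i) (b i) = L"
  have nz: "inner (b i) (b i) \<noteq> 0" "inner (b j) (b j) \<noteq> 0" using root_system_nz[OF root_system b_root[OF ij(1)]] root_system_nz[OF root_system b_root[OF ij(2)]] by simp_all
  have "E_edge j i" using ij(3) unfolding E_edge_def by (subst insert_commute)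
  then have "cartan_int (b i) (b j) = -1" "cartan_int (b j) (b i) = -1" using cartan[OF ij(1,2)] cartan[OF ij(2,1)] ij(3) E_edge_neq[OF ij(3)] by simp_all
  then have "inner (b i) (b i) = inner (b j) (b j)"
    using nz by (simp add: cartan_int_def field_simps inner_commute[of "b j" "b i"])
  then show "inner (b j) (b j) = L" using Q by simp
qed (use l in \<open>auto simp: L_def\<close>)

lemma L_pos: "L > 0"
  using root_system_nz[OF root_system b_root[of 4]] l unfolding L_def by auto

lemma dual_basis:
  obtains d :: "nat \<Rightarrow> 'e \<Rightarrow> real" where "\<And>i. linear (d i)" "\<And>i j. \<lbrakk>i \<in> {1..l}; j \<in> {1..l}\<rbrakk> \<Longrightarrow> d i (b j) = (if i = j then 1 else 0)"
proof -
  have "\<forall>i. \<exists>g. linear g \<and> (\<forall>x\<in>b ` {1..l}. g x = (if x = b i then 1 else 0 :: real))"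
    using linear_independent_extend[OF b_independent] by (rule allI)
  then obtain d where "\<forall>i. linear (d i) \<and> (\<forall>x\<in>b ` {1..l}. d i x = (if x = b i then 1 else 0 :: real))"
    using choice[of "\<lambda>i g. linear g \<and> (\<forall>x\<in>b ` {1..l}. g x = (if x = b i then 1 else 0 :: real))"] by auto
  then have d: "linear (d i)" "\<forall>x\<in>b ` {1..l}. d i x = (if x = b i then 1 else 0 :: real)" for i by blast+
  have "d i (b j) = (if i = j then 1 else 0)" if "i \<in> {1..l}" "j \<in> {1..l}" for i j
    using bspec[OF d(2) imageI[OF that(2)], of i] inj_on_eq_iff[OF b_inj that] by (simp add: eq_commute)
  then show ?thesis using that d(1) by blast
qed

text \<open>Induction on the height: a positive root that is not simple has a reflection of smaller height.\<close>

lemma root_length: "\<alpha> \<in> \<Phi> \<Longrightarrow> inner \<alpha> \<alpha> = L"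
proof -
  let ?I = "{1..l}"
  obtain d :: "nat \<Rightarrow> 'e \<Rightarrow> real" where lin: "\<And>i. linear (d i)" and d: "\<And>i j. \<lbrakk>i \<in> ?I; j \<in> ?I\<rbrakk> \<Longrightarrow> d i (b j) = (if i = j then 1 else 0)"
    by (rule dual_basis) (rule that)
  have coeff: "d i (\<Sum>j\<in>?I. x j *\<^sub>R b j) = x i" if i: "i \<in> ?I" for x i
  proof -
    have "d i (\<Sum>j\<in>?I. x j *\<^sub>R b j) = (\<Sum>j\<in>?I. x j * d i (b j))"
      by (simp add: linear_sum[OF lin] linear_scale[OF lin])
    also have "\<dots> = (\<Sum>j\<in>?I. if i = j then x j else 0)" using i by (intro sum.cong) (auto simp: d)
    also have "\<dots> = x i" using i by simp
    finally show ?thesis .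
  qed
  have root: "(\<alpha> = (\<Sum>i\<in>?I. d i \<alpha> *\<^sub>R b i)) \<and> ((\<forall>i\<in>?I. d i \<alpha> \<ge> 0) \<or> (\<forall>i\<in>?I. d i \<alpha> \<le> 0))" if a: "\<alpha> \<in> \<Phi>" for \<alpha>
  proof -
    obtain c :: "nat \<Rightarrow> nat" where "\<alpha> = (\<Sum>i=1..l. real (c i) *\<^sub>R b i) \<or> \<alpha> = - (\<Sum>i=1..l. real (c i) *\<^sub>R b i)"
      using bspec[OF b_coeffs a] by blast
    then consider "\<alpha> = (\<Sum>i\<in>?I. real (c i) *\<^sub>R b i)" | "\<alpha> = (\<Sum>i\<in>?I. (- real (c i)) *\<^sub>R b i)"
      by (auto simp: sum_negf)
    then show ?thesis
    proof cases
      case 1 then have "d i \<alpha> = real (c i)" if "i \<in> ?I" for i using coeff[OF that, of "\<lambda>i. real (c i)"] by simp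
      then show ?thesis using 1 by (auto intro: sum.cong)
    next
      case 2 then have "d i \<alpha> = - real (c i)" if "i \<in> ?I" for i using coeff[OF that, of "\<lambda>i. - real (c i)"] by simp
      then show ?thesis using 2 by (auto intro: sum.cong)
    qed
  qed
  have pos: "inner \<alpha> \<alpha> = L" if "\<alpha> \<in> \<Phi>" "\<forall>i\<in>?I. d i \<alpha> \<ge> 0" "(\<Sum>i\<in>?I. d i \<alpha>) \<le> real n" for \<alpha> n
    using that
  proof (induction n arbitrary: \<alpha>)
    case 0
    then have "\<forall>i\<in>?I. d i \<alpha> = 0" using sum_nonneg_eq_0_iff[of ?I "\<lambda>i. d i \<alpha>"] sum_nonneg[of ?I "\<lambda>i. d i \<alpha>"] by simp
    then have "\<alpha> = 0" using conjunct1[OF root[OF 0(1)]] by simp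
    then show ?case using root_system_nz[OF root_system 0(1)] by simp
  next
    case (Suc n)
    note a = Suc.prems
    have "inner \<alpha> \<alpha> > 0" using root_system_nz[OF root_system a(1)] by simp
    moreover have "inner \<alpha> \<alpha> = (\<Sum>i\<in>?I. d i \<alpha> * inner (b i) \<alpha>)"
      by (subst conjunct1[OF root[OF a(1)]]) (simp add: inner_sum_left)
    ultimately obtain i where i: "i \<in> ?I" "d i \<alpha> * inner (b i) \<alpha> > 0"
      using sum_nonpos[of ?I "\<lambda>i. d i \<alpha> * inner (b i) \<alpha>"] by force
    then have di: "d i \<alpha> > 0" "inner (b i) \<alpha> > 0" using bspec[OF a(2) i(1)] by (auto simp: zero_less_mult_iff)
    show ?case
    proof (cases "\<exists>j\<in>?I. j \<noteq> i \<and> d j \<alpha> > 0")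
      case True
      then obtain j where j: "j \<in> ?I" "j \<noteq> i" "d j \<alpha> > 0" by blast
      \<comment> \<open>Reflection in \<open>b i\<close> changes only the i-th coefficient. Since
        another coefficient is positive and the coefficients of a root have one sign, the reflected
        root is still positive, and its height has dropped by the positive integer
        \<open>k\<close>.\<close>
      define k where "k = cartan_int \<alpha> (b i)"
      define \<beta> where "\<beta> = \<alpha> - k *\<^sub>R b i"
      have \<beta>: "\<beta> \<in> \<Phi>" unfolding \<beta>_def k_def by (rule root_system_reflect(1)[OF root_system b_root[OF i(1)] a(1)])
      have "k \<in> \<int>" unfolding k_def by (rule root_system_reflect(2)[OF root_system b_root[OF i(1)] a(1)])
      moreover have "k > 0" using di(2) L_pos unfolding k_def cartan_int_def b_length[OF i(1)] by (simp add: inner_commute)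
      ultimately have k: "k \<ge> 1" by (auto elim!: Ints_cases)
      have d\<beta>: "d m \<beta> = d m \<alpha> - (if m = i then k else 0)" if "m \<in> ?I" for m
        using that i(1) by (simp add: \<beta>_def linear_diff[OF lin] linear_scale[OF lin] d)
      have "d j \<beta> > 0" using d\<beta>[OF j(1)] j by simp
      then have "\<forall>m\<in>?I. d m \<beta> \<ge> 0" using root[OF \<beta>] j(1) by force
      moreover have "(\<Sum>m\<in>?I. d m \<beta>) = (\<Sum>m\<in>?I. d m \<alpha>) - k"
        using i(1) by (simp add: d\<beta> sum_subtractf)
      ultimately have "inner \<beta> \<beta> = L" using Suc.IH[OF \<beta>] a(3) k by simp
      then show ?thesis
        using inner_reflect[of "b i" \<alpha>] root_system_nz[OF root_system b_root[OF i(1)]] unfolding \<beta>_def k_def by simp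
    next
      case False
      \<comment> \<open>Here the root is a positive multiple of a simple root, hence equal to
        it.\<close>
      then have "\<forall>j\<in>?I. j \<noteq> i \<longrightarrow> d j \<alpha> = 0" using a(2) by force
      then have "(\<Sum>j\<in>?I. d j \<alpha> *\<^sub>R b j) = (\<Sum>j\<in>?I. if j = i then d i \<alpha> *\<^sub>R b i else 0)" by (intro sum.cong) auto
      then have e: "\<alpha> = d i \<alpha> *\<^sub>R b i" using conjunct1[OF root[OF a(1)]] i(1) by simp
      then have "d i \<alpha> = 1" using root_system b_root[OF i(1)] a(1) di(1) unfolding root_system_def by force
      then show ?thesis using e b_length[OF i(1)] by simp
    qed
  qed
  assume a: "\<alpha> \<in> \<Phi>"
  obtain n where n: "(\<Sum>i\<in>?I. \<bar>d i \<alpha>\<bar>) \<le> real n" using real_arch_simple by blast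
  consider "\<forall>i\<in>?I. d i \<alpha> \<ge> 0" | "\<forall>i\<in>?I. d i \<alpha> \<le> 0" using root[OF a] by blast
  then show ?thesis
  proof cases
    case 1
    then have "(\<Sum>i\<in>?I. d i \<alpha>) \<le> real n" using n by simp
    then show ?thesis using pos[OF a 1] by blast
  next
    case 2
    have "d i (- \<alpha>) = \<bar>d i \<alpha>\<bar>" if "i \<in> ?I" for i using 2 that by (simp add: linear_neg[OF lin])
    then have "\<forall>i\<in>?I. d i (- \<alpha>) \<ge> 0" "(\<Sum>i\<in>?I. d i (- \<alpha>)) \<le> real n" using n by simp_all
    then show ?thesis using pos[OF root_system_uminus[OF root_system a]] by simp
  qed
qed

definition ip :: "'e \<Rightarrow> 'e \<Rightarrow> real" where "ip \<alpha> \<beta> = 2 * inner \<alpha> \<beta> / L"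

lemma ip_cartan: "\<beta> \<in> \<Phi> \<Longrightarrow> ip \<alpha> \<beta> = cartan_int \<alpha> \<beta>"
  by (simp add: ip_def cartan_int_def root_length)

lemma ip_bilinear: "ip (\<alpha> + \<beta>) \<gamma> = ip \<alpha> \<gamma> + ip \<beta> \<gamma>" "ip (\<alpha> - \<beta>) \<gamma> = ip \<alpha> \<gamma> - ip \<beta> \<gamma>" "ip (- \<alpha>) \<gamma> = - ip \<alpha> \<gamma>" "ip \<alpha> (- \<gamma>) = - ip \<alpha> \<gamma>"
  "ip \<gamma> (\<alpha> + \<beta>) = ip \<gamma> \<alpha> + ip \<gamma> \<beta>" "ip \<gamma> (\<alpha> - \<beta>) = ip \<gamma> \<alpha> - ip \<gamma> \<beta>"
  by (simp_all add: ip_def inner_simps add_divide_distrib diff_divide_distrib)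

lemma ip_sym: "ip \<alpha> \<beta> = ip \<beta> \<alpha>" by (simp add: ip_def inner_commute)

lemma ip_self: "\<alpha> \<in> \<Phi> \<Longrightarrow> ip \<alpha> \<alpha> = 2" using L_pos by (simp add: ip_def root_length)

lemma ip_2: "\<lbrakk>\<alpha> \<in> \<Phi>; \<beta> \<in> \<Phi>; ip \<alpha> \<beta> = 2\<rbrakk> \<Longrightarrow> \<alpha> = \<beta>"
proof -
  assume a: "\<alpha> \<in> \<Phi>" "\<beta> \<in> \<Phi>" "ip \<alpha> \<beta> = 2"
  then have "ip (\<alpha> - \<beta>) (\<alpha> - \<beta>) = 0" using ip_sym[of \<beta> \<alpha>] by (simp add: ip_bilinear ip_self)
  then show ?thesis using L_pos by (simp add: ip_def)
qed

lemma ip_vals: "\<lbrakk>\<alpha> \<in> \<Phi>; \<beta> \<in> \<Phi>\<rbrakk> \<Longrightarrow> ip \<alpha> \<beta> \<in> {-2,-1,0,1,2}"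
proof -
  assume a: "\<alpha> \<in> \<Phi>" "\<beta> \<in> \<Phi>"
  have "ip \<alpha> \<beta> \<in> \<int>" using root_system_reflect(2)[OF root_system a(2,1)] ip_cartan[OF a(2)] by simp
  then obtain k where k: "ip \<alpha> \<beta> = of_int k" by (auto elim: Ints_cases)
  have "0 \<le> ip (\<alpha> + \<beta>) (\<alpha> + \<beta>)" "0 \<le> ip (\<alpha> - \<beta>) (\<alpha> - \<beta>)" using L_pos by (simp_all add: ip_def)
  then have "-2 \<le> ip \<alpha> \<beta>" "ip \<alpha> \<beta> \<le> 2" using a ip_sym[of \<beta> \<alpha>] by (simp_all add: ip_bilinear ip_self)
  then have "k \<in> {-2,-1,0,1,2}" unfolding k by auto
  then show ?thesis unfolding k by auto
qed

lemma root_sum: "\<lbrakk>\<alpha> \<in> \<Phi>; \<beta> \<in> \<Phi>\<rbrakk> \<Longrightarrow> \<alpha> + \<beta> \<in> \<Phi> \<longleftrightarrow> ip \<alpha> \<beta> = -1"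
proof
  assume a: "\<alpha> \<in> \<Phi>" "\<beta> \<in> \<Phi>"
  show "ip \<alpha> \<beta> = -1" if "\<alpha> + \<beta> \<in> \<Phi>" using ip_self[OF that] a ip_sym[of \<beta> \<alpha>] by (simp add: ip_bilinear ip_self)
  show "\<alpha> + \<beta> \<in> \<Phi>" if "ip \<alpha> \<beta> = -1"
    using root_system_reflect(1)[OF root_system a(2,1)] that ip_cartan[OF a(2)] by simp
qed

lemma root_neg: "\<alpha> \<in> \<Phi> \<Longrightarrow> - \<alpha> \<in> \<Phi>" by (rule root_system_uminus[OF root_system])

lemma ip_b: "\<lbrakk>i \<in> {1..l}; j \<in> {1..l}\<rbrakk> \<Longrightarrow> ip (b i) (b j) = (if i = j then 2 else if E_edge i j then - 1 else 0)"
  using ip_cartan[OF b_root] cartan by simp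

lemma ex_simple_nonorthogonal: "\<alpha> \<in> \<Phi> \<Longrightarrow> \<exists>i\<in>{1..l}. ip (b i) \<alpha> \<noteq> 0"
proof (rule ccontr)
  assume a: "\<alpha> \<in> \<Phi>" and "\<not> (\<exists>i\<in>{1..l}. ip (b i) \<alpha> \<noteq> 0)"
  then have "\<forall>x\<in>b ` {1..l}. inner \<alpha> x = 0" using L_pos by (auto simp: ip_def inner_commute)
  moreover have "\<alpha> \<in> span (b ` {1..l})" unfolding b_span by (rule UNIV_I)
  ultimately have "inner \<alpha> \<alpha> = 0"
    using linear_eq_0_on_span[OF bounded_linear.linear[OF bounded_linear_inner_right], of "b ` {1..l}" \<alpha> \<alpha>] by blast
  then show False using root_system_nz[OF root_system a] by simp
qed

text \<open>Otherwise every root has product -2, 0 or 2 with \<alpha>. A simple root not orthogonal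
  to \<alpha> is then \<alpha> or -\<alpha>, but its neighbours in the diagram have product -1 with
  it.\<close>

lemma ex_neighbour: "\<alpha> \<in> \<Phi> \<Longrightarrow> \<exists>\<gamma>\<in>\<Phi>. ip \<gamma> \<alpha> = 1"
proof (rule ccontr)
  assume a: "\<alpha> \<in> \<Phi>" and n: "\<not> (\<exists>\<gamma>\<in>\<Phi>. ip \<gamma> \<alpha> = 1)"
  have n': "ip \<gamma> \<alpha> \<in> {-2, 0, 2}" if "\<gamma> \<in> \<Phi>" for \<gamma>
    using ip_vals[OF that a] n that root_neg[OF that] by (force simp: ip_bilinear)
  obtain i where i: "i \<in> {1..l}" "ip (b i) \<alpha> \<noteq> 0" using ex_simple_nonorthogonal[OF a] by blast
  have "ip (b i) \<alpha> = 2 \<or> ip (b i) (- \<alpha>) = 2" using n'[OF b_root[OF i(1)]] i(2) by (auto simp: ip_bilinear)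
  then have bi: "b i = \<alpha> \<or> b i = - \<alpha>" using ip_2[OF b_root[OF i(1)]] a root_neg by blast
  have "\<exists>j\<in>{1..l}. E_edge j i"
  proof -
    have "i \<in> {1, 2, 3, 4, 5, 6, 7, 8}" using i(1) l by auto
    then show ?thesis using edges l i(1) by (elim insertE; force)
  qed
  then obtain j where j: "j \<in> {1..l}" "E_edge j i" by blast
  have "ip (b j) (b i) = -1" using ip_b[OF j(1) i(1)] j(2) E_edge_neq by auto
  then show False using n'[OF b_root[OF j(1)]] bi by (auto simp: ip_bilinear)
qed

text \<open>Otherwise \<alpha> and \<gamma> generate a subsystem \<open>H\<close> of type A2, and
  every root outside \<open>H\<close> is orthogonal to it. By connectedness all simple roots lie in
  \<open>H\<close>, where no two roots are orthogonal, whereas \<open>b 1\<close> and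
  \<open>b 2\<close> are.\<close>

lemma ex_other:
  assumes a: "\<alpha> \<in> \<Phi>" and g: "\<gamma> \<in> \<Phi>" and ag: "ip \<gamma> \<alpha> = 1"
  shows "\<exists>\<gamma>'\<in>\<Phi>. ip \<gamma>' \<alpha> = 1 \<and> \<gamma>' \<noteq> \<gamma> \<and> \<gamma>' \<noteq> \<alpha> - \<gamma>"
proof (rule ccontr)
  assume "\<not> ?thesis"
  then have n: "\<And>\<beta>. \<lbrakk>\<beta> \<in> \<Phi>; ip \<beta> \<alpha> = 1\<rbrakk> \<Longrightarrow> \<beta> = \<gamma> \<or> \<beta> = \<alpha> - \<gamma>" by blast
  define H where "H = {\<alpha>, - \<alpha>, \<gamma>, - \<gamma>, \<alpha> - \<gamma>, \<gamma> - \<alpha>}"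
  have ga: "ip \<alpha> \<gamma> = 1" using ag ip_sym by simp
  note vals = ip_bilinear ip_self[OF a] ip_self[OF g] ag ga
  have HH: "ip \<beta> \<delta> \<noteq> 0" if "\<beta> \<in> H" "\<delta> \<in> H" for \<beta> \<delta>
    using that unfolding H_def by (elim insertE emptyE) (simp_all add: vals)
  have orth: "ip \<beta> \<gamma> = 0" if b: "\<beta> \<in> \<Phi>" "ip \<beta> \<alpha> = 0" for \<beta>
  proof -
    have neg: "ip \<delta> \<gamma> \<noteq> -1" if d: "\<delta> \<in> \<Phi>" "ip \<delta> \<alpha> = 0" for \<delta>
    proof
      assume dg: "ip \<delta> \<gamma> = -1"
      then have "\<delta> + \<gamma> \<in> \<Phi>" using root_sum d g by blast
      then consider "\<delta> + \<gamma> = \<gamma>" | "\<delta> + \<gamma> = \<alpha> - \<gamma>" using n[of "\<delta> + \<gamma>"] d ag by (auto simp: ip_bilinear)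
      then show False
      proof cases
        case 1 then show False using root_system_nz[OF root_system d(1)] by simp
      next
        case 2
        then have "\<delta> = \<alpha> - \<gamma> - \<gamma>" by (simp add: algebra_simps)
        then show False using dg by (simp add: vals)
      qed
    qed
    have "ip \<beta> \<gamma> \<noteq> -1" "ip (- \<beta>) \<gamma> \<noteq> -1" using neg[OF b] neg[OF root_neg[OF b(1)]] b by (simp_all add: ip_bilinear)
    moreover have "ip \<beta> \<gamma> \<noteq> 2" "ip (- \<beta>) \<gamma> \<noteq> 2"
      using ip_2[OF b(1) g] ip_2[OF root_neg[OF b(1)] g] b ag by (auto simp: ip_bilinear)
    ultimately show ?thesis using ip_vals[OF b(1) g] by (auto simp: ip_bilinear)
  qed
  have inH: "\<beta> \<in> H" if b: "\<beta> \<in> \<Phi>" "ip \<beta> \<alpha> \<noteq> 0" for \<beta>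
  proof -
    consider "ip \<beta> \<alpha> = 1" | "ip (- \<beta>) \<alpha> = 1" | "ip \<beta> \<alpha> = 2" | "ip (- \<beta>) \<alpha> = 2"
      using ip_vals[OF b(1) a] b(2) by (auto simp: ip_bilinear)
    then show ?thesis
    proof cases
      case 1 then show ?thesis using n[OF b(1)] by (auto simp: H_def)
    next
      case 2 then show ?thesis using n[OF root_neg[OF b(1)]] by (auto simp: H_def minus_equation_iff[of \<beta>])
    next
      case 3 then show ?thesis using ip_2[OF b(1) a] by (simp add: H_def)
    next
      case 4 then show ?thesis using ip_2[OF root_neg[OF b(1)] a] by (auto simp: H_def minus_equation_iff[of \<beta>])
    qed
  qed
  obtain i where i: "i \<in> {1..l}" "ip (b i) \<alpha> \<noteq> 0" using ex_simple_nonorthogonal[OF a] by blast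
  have all: "b j \<in> H" if j: "j \<in> {1..l}" for j
  proof (rule connected[where Q = "\<lambda>j. b j \<in> H", OF _ i(1) inH[OF b_root[OF i(1)] i(2)] j])
    fix i j assume ij: "i \<in> {1..l}" "j \<in> {1..l}" "E_edge i j" and i: "b i \<in> H"
    show "b j \<in> H"
    proof (rule ccontr)
      assume "b j \<notin> H"
      then have z: "ip (b j) \<alpha> = 0" "ip (b j) \<gamma> = 0" using inH orth b_root[OF ij(2)] by blast+
      then have "ip (b j) (b i) = 0" using i unfolding H_def by (elim insertE emptyE) (simp_all add: ip_bilinear)
      then show False using ip_b[OF ij(1,2)] ij(3) E_edge_neq ip_sym[of "b i" "b j"] by auto
    qed
  qed
  have "\<not> E_edge 1 2" by (auto simp: E_edge_def doubleton_eq_iff)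
  then have "ip (b 1) (b 2) = 0" using ip_b[of 1 2] l by auto
  then show False using HH[OF all all, of 1 2] l by auto
qed

end

section \<open>Structure constants of a Chevalley base\<close>

context complex_lie_algebra begin

lemma bracket_linear:
  "bracket (x + y) z = bracket x z + bracket y z" "bracket z (x + y) = bracket z x + bracket z y"
  "bracket (scale c x) z = scale c (bracket x z)" "bracket z (scale c x) = scale c (bracket z x)"
  "bracket 0 z = 0" "bracket z 0 = 0" "bracket z (- x) = - bracket z x"
proof -
  interpret l: Vector_Spaces.linear scale scale "\<lambda>x. bracket x z" by (rule bracket_linear_left)
  interpret r: Vector_Spaces.linear scale scale "bracket z" by (rule bracket_linear_right)
  show "bracket (x + y) z = bracket x z + bracket y z" "bracket (scale c x) z = scale c (bracket x z)" "bracket 0 z = 0"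
    by (fact l.add l.scale l.zero)+
  show "bracket z (x + y) = bracket z x + bracket z y" "bracket z (scale c x) = scale c (bracket z x)" "bracket z 0 = 0"
    "bracket z (- x) = - bracket z x"
    by (fact r.add r.scale r.zero r.neg)+
qed

lemma bracket_anti: "bracket y x = - bracket x y"
proof -
  have "bracket (x + y) (x + y) = bracket x x + bracket y x + (bracket x y + bracket y y)"
    by (simp only: bracket_linear)
  then have "bracket y x + bracket x y = 0" by (simp add: bracket_self)
  then show ?thesis by (simp only: eq_neg_iff_add_eq_0)
qed

end

locale E_chevalley = E_roots \<Phi> l b + chevalley_base scale bracket \<Phi> H \<psi> e N
  for \<Phi> :: "'e::euclidean_space set" and l b and scale :: "complex \<Rightarrow> 'g::ab_group_add \<Rightarrow> 'g" and bracket H \<psi> e N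
begin

lemma psi_add: "h \<in> H \<Longrightarrow> \<psi> (\<alpha> + \<beta>) h = \<psi> \<alpha> h + \<psi> \<beta> h"
  and psi_diff: "h \<in> H \<Longrightarrow> \<psi> (\<alpha> - \<beta>) h = \<psi> \<alpha> h - \<psi> \<beta> h"
  using linear_add[OF psi_linear] linear_diff[OF psi_linear] by blast+

lemma root_is_root:
  assumes "\<alpha> \<in> \<Phi>"
  shows "\<lbrakk>x \<in> H; y \<in> H\<rbrakk> \<Longrightarrow> \<psi> \<alpha> (x + y) = \<psi> \<alpha> x + \<psi> \<alpha> y" "x \<in> H \<Longrightarrow> \<psi> \<alpha> (scale c x) = c * \<psi> \<alpha> x"
  using psi_root[OF assms] unfolding is_root_def by blast+

lemma bracket_root_vector: "\<lbrakk>\<alpha> \<in> \<Phi>; h \<in> H\<rbrakk> \<Longrightarrow> bracket h (e \<alpha>) = scale (\<psi> \<alpha> h) (e \<alpha>)"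
  using root_vector[of \<alpha>] unfolding root_space_def by blast

text \<open>A zero root vector would make its coroot zero, but \<alpha> takes the value 2
  there.\<close>

lemma root_vector_nz: "\<alpha> \<in> \<Phi> \<Longrightarrow> e \<alpha> \<noteq> 0"
proof
  assume a: "\<alpha> \<in> \<Phi>" and z: "e \<alpha> = 0"
  have h: "bracket (e \<alpha>) (e (- \<alpha>)) = 0" unfolding z by (rule bracket_linear)
  have "\<psi> \<alpha> (scale 0 0) = 0" using root_is_root(2)[OF a, of 0 0] coroot_in_cartan[OF a] by (simp add: h)
  then have "\<psi> \<alpha> 0 = 0" by simp
  moreover have "\<psi> \<alpha> 0 = 2" using coroot[OF a a] ip_self[OF a] ip_cartan[OF a] by (simp add: h)
  ultimately show False by simp
qed

text \<open>A nonzero bracket would make \<open>\<alpha> + \<gamma>\<close> a root.\<close>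

lemma bracket_orthogonal:
  assumes a: "\<alpha> \<in> \<Phi>" "\<gamma> \<in> \<Phi>" and ip: "ip \<alpha> \<gamma> = 0"
  shows "bracket (e \<alpha>) (e \<gamma>) = 0"
proof (rule ccontr)
  assume nz: "bracket (e \<alpha>) (e \<gamma>) \<noteq> 0"
  have "bracket h (bracket (e \<alpha>) (e \<gamma>)) = scale (\<psi> (\<alpha> + \<gamma>) h) (bracket (e \<alpha>) (e \<gamma>))" if h: "h \<in> H" for h
  proof -
    have "bracket h (bracket (e \<alpha>) (e \<gamma>)) = - bracket (e \<alpha>) (bracket (e \<gamma>) h) - bracket (e \<gamma>) (bracket h (e \<alpha>))"
      using jacobi[of h "e \<alpha>" "e \<gamma>"] by (simp add: algebra_simps eq_neg_iff_add_eq_0)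
    also have "bracket (e \<gamma>) h = scale (- \<psi> \<gamma> h) (e \<gamma>)"
      using bracket_anti[of "e \<gamma>" h] bracket_root_vector[OF a(2) h] by simp
    also have "bracket h (e \<alpha>) = scale (\<psi> \<alpha> h) (e \<alpha>)" by (rule bracket_root_vector[OF a(1) h])
    also have "- bracket (e \<alpha>) (scale (- \<psi> \<gamma> h) (e \<gamma>)) - bracket (e \<gamma>) (scale (\<psi> \<alpha> h) (e \<alpha>))
        = scale (\<psi> (\<alpha> + \<gamma>) h) (bracket (e \<alpha>) (e \<gamma>))"
      using bracket_anti[of "e \<gamma>" "e \<alpha>"] by (simp add: bracket_linear psi_add[OF h] scale_left_distrib)
    finally show ?thesis .
  qed
  then have "bracket (e \<alpha>) (e \<gamma>) \<in> root_space H (\<psi> (\<alpha> + \<gamma>))" by (simp add: root_space_def)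
  then have rs: "root_space H (\<psi> (\<alpha> + \<gamma>)) \<noteq> {0}" using nz by blast
  have "\<alpha> + \<gamma> \<noteq> 0" using ip ip_self[OF a(1)] by (auto simp: eq_neg_iff_add_eq_0[symmetric] ip_bilinear)
  then have ex: "\<exists>h\<in>H. \<psi> (\<alpha> + \<gamma>) h \<noteq> 0" using psi_injective by blast
  have sub: "x + y \<in> H" "scale c x \<in> H" if "x \<in> H" "y \<in> H" for x y c
    using cartan that unfolding cartan_subalgebra_def lie_subalgebra_def subspace_def by blast+
  have "is_root H (\<psi> (\<alpha> + \<gamma>))" unfolding is_root_def
    using rs ex by (simp add: psi_add sub root_is_root[OF a(1)] root_is_root[OF a(2)] algebra_simps)
  then obtain \<delta> where d: "\<delta> \<in> \<Phi>" "\<forall>h\<in>H. \<psi> (\<alpha> + \<gamma>) h = \<psi> \<delta> h" using psi_onto_roots by blast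
  then have "\<forall>h\<in>H. \<psi> (\<alpha> + \<gamma> - \<delta>) h = 0" by (simp add: psi_diff)
  then have "\<alpha> + \<gamma> - \<delta> = 0" by (rule psi_injective)
  then have "\<alpha> + \<gamma> = \<delta>" by simp
  then show False using root_sum[OF a] d(1) ip by simp
qed

lemma N_antisym:
  assumes a: "\<alpha> \<in> \<Phi>" "\<beta> \<in> \<Phi>" "\<alpha> + \<beta> \<in> \<Phi>" shows "N \<beta> \<alpha> = - N \<alpha> \<beta>"
proof -
  have "scale (of_int (N \<beta> \<alpha>)) (e (\<alpha> + \<beta>)) = scale (- of_int (N \<alpha> \<beta>)) (e (\<alpha> + \<beta>))"
    using structure_constant[OF a] structure_constant[of \<beta> \<alpha>] a bracket_anti[of "e \<beta>" "e \<alpha>"] by (simp add: add.commute)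
  then have "(of_int (N \<beta> \<alpha>) :: complex) = - of_int (N \<alpha> \<beta>)"
    using root_vector_nz[OF a(3)] by (simp only: scale_cancel_right simp_thms)
  then have "(of_int (N \<beta> \<alpha>) :: complex) = of_int (- N \<alpha> \<beta>)" by simp
  then show ?thesis by (simp only: of_int_eq_iff)
qed

text \<open>The Jacobi identity for \<open>e \<alpha>\<close>, \<open>e \<beta>\<close>,
  \<open>e \<gamma>\<close>. The term containing the bracket of \<open>e \<gamma>\<close> and
  \<open>e \<alpha>\<close> vanishes, and the other two are multiples of the nonzero vector
  \<open>e (\<alpha> + \<beta> + \<gamma>)\<close>.\<close>

lemma N_cocycle:
  assumes a: "\<alpha> \<in> \<Phi>" "\<beta> \<in> \<Phi>" "\<gamma> \<in> \<Phi>" and ip: "ip \<alpha> \<beta> = -1" "ip \<beta> \<gamma> = -1" "ip \<alpha> \<gamma> = 0"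
  shows "N \<alpha> \<beta> * N (\<alpha> + \<beta>) \<gamma> = N \<beta> \<gamma> * N \<alpha> (\<beta> + \<gamma>)"
proof -
  have r: "\<alpha> + \<beta> \<in> \<Phi>" "\<beta> + \<gamma> \<in> \<Phi>" using root_sum a ip by blast+
  have r3: "\<alpha> + \<beta> + \<gamma> \<in> \<Phi>" using root_sum[OF r(1) a(3)] ip by (simp add: ip_bilinear)
  have s: "bracket (e \<alpha>) (bracket (e \<beta>) (e \<gamma>)) = scale (of_int (N \<beta> \<gamma> * N \<alpha> (\<beta> + \<gamma>))) (e (\<alpha> + \<beta> + \<gamma>))"
    using structure_constant[OF a(2,3) r(2)] structure_constant[OF a(1) r(2)] r3 by (simp add: bracket_linear add.assoc)
  have t: "bracket (e \<gamma>) (bracket (e \<alpha>) (e \<beta>)) = - scale (of_int (N \<alpha> \<beta> * N (\<alpha> + \<beta>) \<gamma>)) (e (\<alpha> + \<beta> + \<gamma>))"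
    using structure_constant[OF a(1,2) r(1)] structure_constant[OF r(1) a(3) r3] bracket_anti[of "e \<gamma>" "e (\<alpha> + \<beta>)"]
    by (simp add: bracket_linear)
  have u: "bracket (e \<beta>) (bracket (e \<gamma>) (e \<alpha>)) = 0"
    using bracket_orthogonal[OF a(3,1)] ip(3) ip_sym[of \<alpha> \<gamma>] by (simp add: bracket_linear)
  have "scale (of_int (N \<beta> \<gamma> * N \<alpha> (\<beta> + \<gamma>))) (e (\<alpha> + \<beta> + \<gamma>)) = scale (of_int (N \<alpha> \<beta> * N (\<alpha> + \<beta>) \<gamma>)) (e (\<alpha> + \<beta> + \<gamma>))"
    using jacobi[of "e \<alpha>" "e \<beta>" "e \<gamma>"] unfolding s t u by simp
  then have "(of_int (N \<beta> \<gamma> * N \<alpha> (\<beta> + \<gamma>)) :: complex) = of_int (N \<alpha> \<beta> * N (\<alpha> + \<beta>) \<gamma>)"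
    using root_vector_nz[OF r3] by (simp only: scale_right_imp_eq scale_cancel_right simp_thms)
  then show ?thesis by (simp only: of_int_eq_iff)
qed

lemma simply_laced: "simply_laced \<Phi> ip N"
  by unfold_locales
    (fact ip_bilinear(1) ip_sym ip_vals ip_self ip_2 root_neg root_sum ex_neighbour ex_other N_antisym structure_constant_unit N_cocycle)+

end

theorem theorem2:
  fixes \<Phi> :: "'e::euclidean_space set"
    and N :: "'e \<Rightarrow> 'e \<Rightarrow> int"
    and scale :: "complex \<Rightarrow> 'g::ab_group_add \<Rightarrow> 'g"
    and bracket :: "'g \<Rightarrow> 'g \<Rightarrow> 'g"
    and H :: "'g set"
    and \<psi> :: "'e \<Rightarrow> 'g \<Rightarrow> complex"
    and e :: "'e \<Rightarrow> 'g"
    and R :: "('a, 'm) ring_scheme"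
    and l :: nat
    and \<alpha> :: "('e \<times> (nat \<Rightarrow> 'a) \<times> (nat \<Rightarrow> 'a)) gword set set"
  assumes "l \<in> {6, 7, 8}"
    and "root_system_E l \<Phi>"
    and "chevalley_base scale bracket \<Phi> H \<psi> e N"
    and "cring R"
    and "\<alpha> \<in> carrier (St_rel \<Phi> N (UP R) (t_ideal R))"
  shows "\<alpha> = \<one>\<^bsub>St_rel \<Phi> N (UP R) (t_ideal R)\<^esub> \<longleftrightarrow>
    (\<forall>M. maximalideal M R \<longrightarrow>
       St_map \<Phi> N (UP (loc_ring R M)) (loc_poly_map R M) (St_rel_map \<Phi> N (UP R) \<alpha>)
         = \<one>\<^bsub>St \<Phi> N (UP (loc_ring R M))\<^esub>)"
proof -
  obtain b where "root_system \<Phi>" "simple_roots \<Phi> l b"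
    "\<And>i j. \<lbrakk>i \<in> {1..l}; j \<in> {1..l}\<rbrakk> \<Longrightarrow> cartan_int (b i) (b j) = (if i = j then 2 else if E_edge i j then - 1 else 0)"
    using assms(2) unfolding root_system_E_def by blast
  then interpret E_chevalley \<Phi> l b scale bracket H \<psi> e N
    using assms(1,3) by (intro E_chevalley.intro E_roots.intro)
  show ?thesis by (rule St_rel_UP_eq_one_iff[OF simply_laced assms(4,5)])
qed

end
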